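(* Let $0\neq\lambda=2\alpha$ with $\alpha$ in the Leech lattice $\Lambda$, and let $h\in H$ be associated to the pair $(\xi,a)$, $\xi\in\frac12\Lambda/\Lambda$, $a\in(\mathrm{Aut}\,\Lambda)_\lambda$. Then $$Z(v(\lambda),h,\tau)=e^{2\pi i\langle\xi,\alpha\rangle}\frac{\theta_{\xi,-a}(\tau)}{\eta_{-a}(\tau)}\left(\frac{\Theta_1(\tau)}{2}\right)^{\langle\lambda,\lambda\rangle}+\mathrm{tr}_T(h)\left\{\frac{\eta_a(\tau)}{\eta_a(\tau/2)}\left(\frac{\Theta_2(\tau)}{2}\right)^{\langle\lambda,\lambda\rangle}-\frac{\eta_{-a}(\tau)}{\eta_{-a}(\tau/2)}\left(\frac{\Theta_3(\tau)}{2}\right)^{\langle\lambda,\lambda\rangle}\right\}.$$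
   Context: $\eta$ is the Dedekind eta function, $q=e^{2\pi i\tau}$; $\Theta_1(\tau)=2\frac{\eta(2\tau)^2}{\eta(\tau)}$, $\Theta_2(\tau)=\frac{\eta(\tau/2)^2}{\eta(\tau)}$, $\Theta_3(\tau)=\frac{\eta(\tau)^5}{\eta(\tau/2)^2\eta(2\tau)^2}$. For $b\in\mathrm{Aut}(\Lambda)$ with characteristic polynomial $\prod_k(x^k-1)^{m_k}$ on $\Lambda$, $\eta_b(\tau)=\prod_k\eta(k\tau)^{m_k}$ is the usual eta-product. $-a$ denotes the composite of $a$ with $-1$. The modified theta function is $\theta_{\xi,-a}(\tau)=\sum_{\gamma\in\Lambda,\ a\gamma=-\gamma}e^{2\pi i\langle\xi,\gamma\rangle}q^{\frac12\langle\gamma,\gamma\rangle}$. $\mathfrak h=\mathbb C\otimes_{\mathbb Z}\Lambda$. The lattice vertex operator algebra is $V_\Lambda=M(1)\otimes\mathbb C[\Lambda]$ (Frenkel-Lepowsky-Meurman), $M(1)=S(\hat{\mathfrak h}^-)$ the Heisenberg Fock space, with $Y(e^\alpha,z)=E^-(-\alpha,z)E^+(-\alpha,z)e_\alpha z^\alpha$, $E^{\pm}(\alpha,z)=\exp\big(\sum_{n>0}\frac{\alpha(\pm n)}{\pm n}z^{\mp n}\big)$, $e_\alpha e^\beta=\epsilon(\alpha,\beta)e^{\alpha+\beta}$, with $\epsilon$ a bilinear $\{\pm1\}$-valued 2-cocycle on $\Lambda$ (and $\epsilon(\alpha,\beta)\epsilon(\beta,\alpha)=(-1)^{\langle\alpha,\beta\rangle}$).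 $t$ is the order 2 automorphism with $te^\alpha=e^{-\alpha}$ acting on $M(1)$ by $(-1)^k$ on products $\beta_1(-n_1)\cdots\beta_k(-n_k)$. $V_\Lambda^T=S(\hat{\mathfrak h}[-1]^-)\otimes T$ is the $t$-twisted $V_\Lambda$-module, with $S(\hat{\mathfrak h}[-1]^-)$ generated by $\beta(-n)$, $\beta\in\mathfrak h$, $0<n\in\frac12+\mathbb Z$, and $T$ the $2^{12}$-dimensional projective representation of $\Lambda$ on which $2\Lambda$ acts trivially; the grading is the natural one shifted by $3/2$; $t$ acts as $-1$ on $T$ and by $(-1)^k$ on products of $k$ generators; on $V_\Lambda^T$, $Y(e^\beta,z)=2^{-\langle\beta,\beta\rangle}E^-_{1/2}(-\beta,z)E^+_{1/2}(-\beta,z)e_\beta z^{-\langle\beta,\beta\rangle/2}$, $E^\pm_{1/2}(h,z)=\exp\big(\sum_{n\ge0}\frac{h(\pm(n+1/2))}{\pm(n+1/2)}z^{\mp(n+1/2)}\big)$. The Moonshine module is $V^\natural=V_\Lambda^+\oplus(V_\Lambda^T)^+$ ($+$ denoting $t$-fixed points), and $v(\lambda)=e^\lambda+e^{-\lambda}\in V_\Lambda^+\subset V^\natural$. The centralizer $C$ of a $2B$-involution in the Monster $\mathbb M=\mathrm{Aut}(V^\natural)$ is a quotient of a group $\hat C$ with $1\to Q\to\hat C\to\mathrm{Aut}(\Lambda)\to1$, $Q\cong2^{1+24}_+$ extra-special of order $2^{25}$. $\hat C$ acts on $S(\hat{\mathfrak h}^-)$ and $S(\hat{\mathfrak h}[-1]^-)$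 through the natural action of $\mathrm{Aut}(\Lambda)$ (kernel $Q$), on $\mathbb C[\Lambda]$ with kernel the center $Z(Q)$ of $Q$, and on $T$ with kernel a subgroup of order 2 of the center $Z(\hat C)$ distinct from $Z(Q)$; the quotient $C$ of $\hat C$ by the third subgroup of order 2 of $Z(\hat C)$ acts faithfully on $V^\natural$. $H<\hat C$ is the subgroup defined by $1\to Q\to H\to(\mathrm{Aut}\,\Lambda)_\lambda\to1$, where $(\mathrm{Aut}\,\Lambda)_\lambda$ is the stabilizer of $\lambda$. The action of $h\in H$ on $V_\Lambda$ is described by a pair $(\xi,a)$, $\xi\in\frac12\Lambda/\Lambda$, $a\in(\mathrm{Aut}\,\Lambda)_\lambda$: $a$ acts naturally, $v\otimes e^\beta\mapsto a(v)\otimes e^{a(\beta)}$, followed by $\xi:v\otimes e^\beta\mapsto e^{2\pi i\langle\xi,\beta\rangle}v\otimes e^\beta$. For $v$ homogeneous of weight $\mathrm{wt}\,v$ in $V^\natural=\bigoplus_nV^\natural_n$ with $Y(v,z)=\sum_nv(n)z^{-n-1}$, $o(v)=v(\mathrm{wt}\,v-1)$, and $Z(v,h,\tau)=q^{-1}\sum_n(\mathrm{tr}_{V^\natural_n}o(v)h)q^n$. *)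

theory Defs
  imports
    "HOL-Analysis.Analysis"
    "HOL-Library.Multiset"
    "HOL-Library.Numeral_Type"
    "HOL-Library.Poly_Mapping"
    "HOL-Computational_Algebra.Polynomial"
    "HOL-Algebra.Coset"
begin

section \<open>The Leech lattice and its automorphism group\<close>

type_synonym R24 = "real ^ 24"

text \<open>A full-rank lattice in \<open>R24\<close>, even, unimodular (i.e. self-dual) and without vectors of
  norm 2; by Conway's theorem this determines it up to isometry.\<close>

definition leech_lattice :: "R24 set \<Rightarrow> bool" where
  "leech_lattice \<Lambda> \<longleftrightarrow>
     (\<exists>B. independent B \<and> span B = UNIV \<and>
          \<Lambda> = {\<Sum>b\<in>B. of_int (c b) *\<^sub>R b | c :: R24 \<Rightarrow> int. True}) \<and>
     (\<forall>x\<in>\<Lambda>. \<exists>k :: int. x \<bullet> x = 2 * of_int k) \<and>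
     \<Lambda> = {x. \<forall>y\<in>\<Lambda>. x \<bullet> y \<in> \<int>} \<and>
     (\<forall>x\<in>\<Lambda>. x \<bullet> x \<noteq> 2)"

definition Aut_lattice :: "R24 set \<Rightarrow> (R24 \<Rightarrow> R24) monoid" where
  "Aut_lattice \<Lambda> =
     \<lparr>carrier = {a. orthogonal_transformation a \<and> a ` \<Lambda> = \<Lambda>}, mult = (\<circ>), one = id\<rparr>"

section \<open>Modular functions\<close>

definition qpow :: "complex \<Rightarrow> real \<Rightarrow> complex" where
  "qpow \<tau> x = exp (2 * of_real pi * \<i> * \<tau> * of_real x)"

definition dedekind_eta :: "complex \<Rightarrow> complex" where
  "dedekind_eta \<tau> = qpow \<tau> (1 / 24) * prodinf (\<lambda>n. 1 - qpow \<tau> (real (Suc n)))"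

definition Theta1 :: "complex \<Rightarrow> complex" where
  "Theta1 \<tau> = 2 * dedekind_eta (2 * \<tau>) ^ 2 / dedekind_eta \<tau>"

definition Theta2 :: "complex \<Rightarrow> complex" where
  "Theta2 \<tau> = dedekind_eta (\<tau> / 2) ^ 2 / dedekind_eta \<tau>"

definition Theta3 :: "complex \<Rightarrow> complex" where
  "Theta3 \<tau> = dedekind_eta \<tau> ^ 5 / (dedekind_eta (\<tau> / 2) ^ 2 * dedekind_eta (2 * \<tau>) ^ 2)"

definition char_polynomial :: "(R24 \<Rightarrow> R24) \<Rightarrow> real poly" where
  "char_polynomial b =
     det (\<chi> i j. (if i = j then [:0, 1:] else 0) - [:matrix b $ i $ j:])"

text \<open>\<open>char_polynomial b = (\<Prod>k. (x ^ k - 1) powi m k)\<close> with integer exponents \<open>m k\<close>; the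
  factors with negative exponent are moved to the left-hand side.\<close>

definition is_frame_shape :: "(R24 \<Rightarrow> R24) \<Rightarrow> (nat \<Rightarrow> int) \<Rightarrow> bool" where
  "is_frame_shape b m \<longleftrightarrow>
     finite {k. m k \<noteq> 0} \<and> m 0 = 0 \<and>
     char_polynomial b * (\<Prod>k | m k < 0. (monom 1 k - 1) ^ nat (- m k)) =
       (\<Prod>k | m k > 0. (monom 1 k - 1) ^ nat (m k))"

text \<open>The frame shape of a finite-order lattice automorphism exists and is unique.\<close>

definition frame_shape :: "(R24 \<Rightarrow> R24) \<Rightarrow> nat \<Rightarrow> int" where
  "frame_shape b = (SOME m. is_frame_shape b m)"

definition eta_prod :: "(R24 \<Rightarrow> R24) \<Rightarrow> complex \<Rightarrow> complex" where
  "eta_prod b \<tau> =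
     (\<Prod>k | frame_shape b k \<noteq> 0. dedekind_eta (of_nat k * \<tau>) powi frame_shape b k)"

text \<open>The value of \<open>\<theta>\<^sub>\<xi>\<^sub>,\<^sub>b\<close> with \<open>b = - a\<close>: the sum runs over the fixed vectors of \<open>b\<close>.\<close>

definition theta_mod :: "R24 set \<Rightarrow> R24 \<Rightarrow> (R24 \<Rightarrow> R24) \<Rightarrow> complex \<Rightarrow> complex" where
  "theta_mod \<Lambda> \<xi> b \<tau> =
     infsum (\<lambda>\<gamma>. exp (2 * of_real pi * \<i> * of_real (\<xi> \<bullet> \<gamma>)) * qpow \<tau> (\<gamma> \<bullet> \<gamma> / 2))
       {\<gamma>\<in>\<Lambda>. b \<gamma> = \<gamma>}"

section \<open>Fock spaces\<close>

text \<open>Both Fock spaces are polynomial algebras over the complex numbers. The variable \<open>(i, n)\<close>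
  stands for \<open>e\<^sub>i(-(n + s))\<close>, where \<open>e\<^sub>i\<close> is the standard orthonormal basis of the complexification
  of \<open>R24\<close>, \<open>n \<ge> 0\<close>, and the shift \<open>s\<close> is \<open>1\<close> for the untwisted space \<open>M(1)\<close> and \<open>1/2\<close> for the
  twisted space. A monomial is a multiset of variables.\<close>

type_synonym monomial = "(24 \<times> nat) multiset"
type_synonym fock = "monomial \<Rightarrow>\<^sub>0 complex"

definition mode :: "real \<Rightarrow> nat \<Rightarrow> real" where
  "mode s n = real n + s"

definition fconst :: "complex \<Rightarrow> fock" where
  "fconst c = Poly_Mapping.single {#} c"

definition fscale :: "complex \<Rightarrow> fock \<Rightarrow> fock" where
  "fscale c p = fconst c * p"

text \<open>The generator \<open>\<beta>(-(n + s))\<close>.\<close>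

definition fgen :: "R24 \<Rightarrow> nat \<Rightarrow> fock" where
  "fgen \<beta> n = (\<Sum>i\<in>UNIV. Poly_Mapping.single {#(i, n)#} (of_real (\<beta> $ i)))"

definition pdiff :: "24 \<times> nat \<Rightarrow> fock \<Rightarrow> fock" where
  "pdiff x p = (\<Sum>m\<in>Poly_Mapping.keys p.
     Poly_Mapping.single (m - {#x#}) (of_nat (count m x) * Poly_Mapping.lookup p m))"

text \<open>\<open>\<beta>(-(n + s))\<close> and \<open>\<beta>(n + s)\<close> as operators, with
  \<open>[\<beta>(k), \<gamma>(-l)] = k \<langle>\<beta>, \<gamma>\<rangle> \<delta>\<^sub>k\<^sub>l\<close>.\<close>

definition creation :: "R24 \<Rightarrow> nat \<Rightarrow> fock \<Rightarrow> fock" where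
  "creation \<beta> n p = fgen \<beta> n * p"

definition annihilation :: "real \<Rightarrow> R24 \<Rightarrow> nat \<Rightarrow> fock \<Rightarrow> fock" where
  "annihilation s \<beta> n p =
     (\<Sum>i\<in>UNIV. fscale (of_real (mode s n * \<beta> $ i)) (pdiff (i, n) p))"

text \<open>The algebra automorphism with \<open>\<beta>(-k) \<mapsto> (a \<beta>)(-k)\<close>.\<close>

definition fock_act :: "(R24 \<Rightarrow> R24) \<Rightarrow> fock \<Rightarrow> fock" where
  "fock_act a p = (\<Sum>m\<in>Poly_Mapping.keys p. fscale (Poly_Mapping.lookup p m)
     (prod_mset (image_mset (\<lambda>(i, n). fgen (a (axis i 1)) n) m)))"

text \<open>\<open>(-1) ^ k\<close> on products of \<open>k\<close> generators.\<close>

definition fock_sign :: "fock \<Rightarrow> fock" where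
  "fock_sign p = (\<Sum>m\<in>Poly_Mapping.keys p.
     Poly_Mapping.single m ((-1) ^ size m * Poly_Mapping.lookup p m))"

definition mono_weight :: "real \<Rightarrow> monomial \<Rightarrow> real" where
  "mono_weight s m = (\<Sum>(i, n)\<in>#m. mode s n)"

definition fock_homogeneous :: "real \<Rightarrow> real \<Rightarrow> fock \<Rightarrow> bool" where
  "fock_homogeneous s d p \<longleftrightarrow> (\<forall>m\<in>Poly_Mapping.keys p. mono_weight s m = d)"

text \<open>The coefficient of \<open>x\<^sup>r\<close> in \<open>exp (\<Sum>n\<ge>0. A n x\<^bsup>n + s\<^esup>)\<close>: expanding
  \<open>(\<Sum>n. A n x\<^bsup>n + s\<^esup>) ^ j / j!\<close> gives one summand for every list of length \<open>j\<close>. For \<open>s > 0\<close> the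
  sum over lists is finite.\<close>

definition exp_coeff :: "real \<Rightarrow> (nat \<Rightarrow> fock \<Rightarrow> fock) \<Rightarrow> real \<Rightarrow> fock \<Rightarrow> fock" where
  "exp_coeff s A r p = (\<Sum>ns | sum_list (map (mode s) ns) = r.
     fscale (1 / fact (length ns)) (foldr A ns p))"

text \<open>The coefficient of \<open>z\<^sup>r\<close> in \<open>E\<^sup>-(\<beta>, z)\<close>, and of \<open>z\<^bsup>-r\<^esup>\<close> in \<open>E\<^sup>+(\<beta>, z)\<close>; for \<open>s = 1/2\<close>
  these are the coefficients of \<open>E\<^sup>\<plusminus>\<^bsub>1/2\<^esub>\<close>.\<close>

definition E_minus :: "real \<Rightarrow> R24 \<Rightarrow> real \<Rightarrow> fock \<Rightarrow> fock" where
  "E_minus s \<beta> = exp_coeff s (\<lambda>n p. fscale (of_real (1 / (- mode s n))) (creation \<beta> n p))"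

definition E_plus :: "real \<Rightarrow> R24 \<Rightarrow> real \<Rightarrow> fock \<Rightarrow> fock" where
  "E_plus s \<beta> = exp_coeff s (\<lambda>n p. fscale (of_real (1 / mode s n)) (annihilation s \<beta> n p))"

text \<open>The coefficient of \<open>z\<^sup>r\<close> in \<open>E\<^sup>-(\<beta>, z) E\<^sup>+(\<beta>, z) p\<close>; only finitely many summands are non-zero.\<close>

definition E_coeff :: "real \<Rightarrow> R24 \<Rightarrow> real \<Rightarrow> fock \<Rightarrow> fock" where
  "E_coeff s \<beta> r p = Sum_any (\<lambda>k :: real. E_minus s \<beta> (r + k) (E_plus s \<beta> k p))"

section \<open>The lattice vertex operator algebra and its twisted module\<close>

text \<open>\<open>VL\<close> contains \<open>V\<^sub>\<Lambda> = M(1) \<otimes> \<complex>[\<Lambda>]\<close> as the elements with support in \<open>\<Lambda>\<close>: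
  \<open>Poly_Mapping.single \<beta> p\<close> is \<open>p \<otimes> e\<^sup>\<beta>\<close>. The space \<open>T\<close> is \<open>complex ^ 4096\<close>, and \<open>VT\<close> is
  the tensor product of the twisted Fock space with \<open>T\<close>.\<close>

type_synonym VL = "R24 \<Rightarrow>\<^sub>0 fock"
type_synonym VT = "fock ^ 4096"
type_synonym opT = "complex ^ 4096 ^ 4096"

definition V_lattice :: "R24 set \<Rightarrow> VL set" where
  "V_lattice \<Lambda> = {w. Poly_Mapping.keys w \<subseteq> \<Lambda>}"

text \<open>The additive map with \<open>p \<otimes> e\<^sup>\<beta> \<mapsto> F \<beta> p\<close>.\<close>

definition extend_VL :: "(R24 \<Rightarrow> fock \<Rightarrow> VL) \<Rightarrow> VL \<Rightarrow> VL" where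
  "extend_VL F w = (\<Sum>\<beta>\<in>Poly_Mapping.keys w. F \<beta> (Poly_Mapping.lookup w \<beta>))"

definition scale_VL :: "complex \<Rightarrow> VL \<Rightarrow> VL" where
  "scale_VL c = extend_VL (\<lambda>\<beta> p. Poly_Mapping.single \<beta> (fscale c p))"

definition scale_VT :: "complex \<Rightarrow> VT \<Rightarrow> VT" where
  "scale_VT c x = (\<chi> i. fscale c (x $ i))"

text \<open>The operator \<open>f \<otimes> M\<close> on \<open>VT\<close>.\<close>

definition tensor_VT :: "(fock \<Rightarrow> fock) \<Rightarrow> opT \<Rightarrow> VT \<Rightarrow> VT" where
  "tensor_VT f M x = (\<chi> i. \<Sum>j\<in>UNIV. fscale (M $ i $ j) (f (x $ j)))"

definition t_VL :: "VL \<Rightarrow> VL" where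
  "t_VL = extend_VL (\<lambda>\<beta> p. Poly_Mapping.single (- \<beta>) (fock_sign p))"

definition t_VT :: "VT \<Rightarrow> VT" where
  "t_VT = tensor_VT fock_sign (mat (-1))"

text \<open>The bilinear cocycle \<open>\<epsilon>\<close>, and the operators \<open>e\<^sub>\<beta>\<close> on \<open>T\<close>. A projective representation
  with this cocycle has dimension at least \<open>2 ^ 12\<close>, so \<open>T\<close> is the irreducible one.\<close>

locale leech_data =
  fixes \<Lambda> :: "R24 set" and \<epsilon> :: "R24 \<Rightarrow> R24 \<Rightarrow> complex" and eT :: "R24 \<Rightarrow> opT"
  assumes leech: "leech_lattice \<Lambda>"
    and eps_sign: "\<alpha> \<in> \<Lambda> \<Longrightarrow> \<beta> \<in> \<Lambda> \<Longrightarrow> \<epsilon> \<alpha> \<beta> \<in> {1, -1}"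
    and eps_add_left:
      "\<alpha> \<in> \<Lambda> \<Longrightarrow> \<alpha>' \<in> \<Lambda> \<Longrightarrow> \<beta> \<in> \<Lambda> \<Longrightarrow> \<epsilon> (\<alpha> + \<alpha>') \<beta> = \<epsilon> \<alpha> \<beta> * \<epsilon> \<alpha>' \<beta>"
    and eps_add_right:
      "\<alpha> \<in> \<Lambda> \<Longrightarrow> \<beta> \<in> \<Lambda> \<Longrightarrow> \<beta>' \<in> \<Lambda> \<Longrightarrow> \<epsilon> \<alpha> (\<beta> + \<beta>') = \<epsilon> \<alpha> \<beta> * \<epsilon> \<alpha> \<beta>'"
    and eps_commutator:
      "\<alpha> \<in> \<Lambda> \<Longrightarrow> \<beta> \<in> \<Lambda> \<Longrightarrow> \<epsilon> \<alpha> \<beta> * \<epsilon> \<beta> \<alpha> = (-1) powi \<lfloor>\<alpha> \<bullet> \<beta>\<rfloor>"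
    and eT_mult:
      "\<alpha> \<in> \<Lambda> \<Longrightarrow> \<beta> \<in> \<Lambda> \<Longrightarrow> eT \<alpha> ** eT \<beta> = mat (\<epsilon> \<alpha> \<beta>) ** eT (\<alpha> + \<beta>)"
    and eT_double: "\<alpha> \<in> \<Lambda> \<Longrightarrow> eT (2 *\<^sub>R \<alpha>) = mat 1"

text \<open>The coefficient of \<open>z\<^sup>r\<close> in \<open>Y(e\<^sup>\<beta>, z)\<close>, on \<open>VL\<close> and on \<open>VT\<close>.\<close>

definition Y_VL :: "(R24 \<Rightarrow> R24 \<Rightarrow> complex) \<Rightarrow> R24 \<Rightarrow> real \<Rightarrow> VL \<Rightarrow> VL" where
  "Y_VL \<epsilon> \<beta> r = extend_VL (\<lambda>\<gamma> p.
     Poly_Mapping.single (\<beta> + \<gamma>) (fscale (\<epsilon> \<beta> \<gamma>) (E_coeff 1 (- \<beta>) (r - \<beta> \<bullet> \<gamma>) p)))"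

definition Y_VT :: "(R24 \<Rightarrow> opT) \<Rightarrow> R24 \<Rightarrow> real \<Rightarrow> VT \<Rightarrow> VT" where
  "Y_VT eT \<beta> r x = scale_VT (of_real (2 powr (- (\<beta> \<bullet> \<beta>))))
     (tensor_VT (E_coeff (1/2) (- \<beta>) (r + \<beta> \<bullet> \<beta> / 2)) (eT \<beta>) x)"

section \<open>The Moonshine module\<close>

type_synonym VN = "VL \<times> VT"

definition scale_VN :: "complex \<Rightarrow> VN \<Rightarrow> VN" where
  "scale_VN c = map_prod (scale_VL c) (scale_VT c)"

text \<open>The homogeneous subspace of weight \<open>n\<close> of \<open>V\<^sub>\<Lambda>\<^sup>+ \<oplus> (V\<^sub>\<Lambda>\<^sup>T)\<^sup>+\<close>.\<close>

definition moonshine :: "R24 set \<Rightarrow> nat \<Rightarrow> VN set" where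
  "moonshine \<Lambda> n =
     {w \<in> V_lattice \<Lambda>. t_VL w = w \<and>
        (\<forall>\<beta>. fock_homogeneous 1 (real n - \<beta> \<bullet> \<beta> / 2) (Poly_Mapping.lookup w \<beta>))} \<times>
     {x. t_VT x = x \<and> (\<forall>i. fock_homogeneous (1/2) (real n - 3/2) (x $ i))}"

text \<open>Vertex operators are only needed for \<open>v\<close> in \<open>\<complex>[\<Lambda>] = 1 \<otimes> \<complex>[\<Lambda>]\<close>.\<close>

type_synonym group_alg = "R24 \<Rightarrow>\<^sub>0 complex"

text \<open>The mode \<open>v(n)\<close>, i.e. the coefficient of \<open>z\<^bsup>-n-1\<^esup>\<close> in \<open>Y(v, z)\<close>.\<close>

definition vmode ::
  "(R24 \<Rightarrow> R24 \<Rightarrow> complex) \<Rightarrow> (R24 \<Rightarrow> opT) \<Rightarrow> group_alg \<Rightarrow> int \<Rightarrow> VN \<Rightarrow> VN" where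
  "vmode \<epsilon> eT v n u = (\<Sum>\<beta>\<in>Poly_Mapping.keys v. scale_VN (Poly_Mapping.lookup v \<beta>)
     (map_prod (Y_VL \<epsilon> \<beta> (of_int (- n - 1))) (Y_VT eT \<beta> (of_int (- n - 1))) u))"

definition wt :: "group_alg \<Rightarrow> int" where
  "wt v = (THE d. \<forall>\<beta>\<in>Poly_Mapping.keys v. \<beta> \<bullet> \<beta> / 2 = of_int d)"

definition zero_mode ::
  "(R24 \<Rightarrow> R24 \<Rightarrow> complex) \<Rightarrow> (R24 \<Rightarrow> opT) \<Rightarrow> group_alg \<Rightarrow> VN \<Rightarrow> VN" where
  "zero_mode \<epsilon> eT v = vmode \<epsilon> eT v (wt v - 1)"

definition v_of :: "R24 \<Rightarrow> group_alg" where
  "v_of \<beta> = Poly_Mapping.single \<beta> 1 + Poly_Mapping.single (- \<beta>) 1"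

section \<open>The group acting on the Moonshine module\<close>

text \<open>The extra-special group of order \<open>2 ^ (2 * n + 1)\<close> of plus type, as the Heisenberg group of
  \<open>\<bbbF>\<^sub>2\<^sup>n\<close>: vectors are subsets of \<open>{..<n}\<close>, and \<open>(x, y, z) (x', y', z')\<close> is
  \<open>(x + x', y + y', z + z' + x \<cdot> y')\<close>. For \<open>n = 1\<close> this is the dihedral group of order 8, and in
  general the central product of \<open>n\<close> copies of it.\<close>

definition extraspecial_plus :: "nat \<Rightarrow> (nat set \<times> nat set \<times> bool) monoid" where
  "extraspecial_plus n =
     \<lparr>carrier = Pow {..<n} \<times> Pow {..<n} \<times> UNIV,
      mult = (\<lambda>(x, y, z) (x', y', z').
                (sym_diff x x', sym_diff y y', z \<noteq> (z' \<noteq> odd (card (x \<inter> y'))))),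
      one = ({}, {}, False)\<rparr>"

definition group_center :: "('g, 'm) monoid_scheme \<Rightarrow> 'g set" where
  "group_center G =
     {z \<in> carrier G. \<forall>g\<in>carrier G. z \<otimes>\<^bsub>G\<^esub> g = g \<otimes>\<^bsub>G\<^esub> z}"

text \<open>The group with its projection to \<open>Aut \<Lambda>\<close> and its actions:
  \<open>g e\<^sup>\<beta> = gsign g \<beta> e\<^bsup>gproj g \<beta>\<^esup>\<close> on \<open>\<complex>[\<Lambda>]\<close>, and the matrix \<open>grepT g\<close> on \<open>T\<close>. On the
  Fock spaces it acts through \<open>gproj\<close>.\<close>

record 'g hat_group = "'g monoid" +
  gproj :: "'g \<Rightarrow> R24 \<Rightarrow> R24"
  gsign :: "'g \<Rightarrow> R24 \<Rightarrow> complex"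
  grepT :: "'g \<Rightarrow> opT"

abbreviation extraspecial_kernel :: "R24 set \<Rightarrow> 'g hat_group \<Rightarrow> 'g set" where
  "extraspecial_kernel \<Lambda> G \<equiv> kernel G (Aut_lattice \<Lambda>) (gproj G)"

abbreviation kernel_lattice :: "R24 set \<Rightarrow> 'g hat_group \<Rightarrow> 'g set" where
  "kernel_lattice \<Lambda> G \<equiv>
     {g \<in> carrier G. \<forall>\<beta>\<in>\<Lambda>. gproj G g \<beta> = \<beta> \<and> gsign G g \<beta> = 1}"

abbreviation kernel_T :: "'g hat_group \<Rightarrow> 'g set" where
  "kernel_T G \<equiv> {g \<in> carrier G. grepT G g = mat 1}"

locale hat_C = leech_data \<Lambda> \<epsilon> eT + group G
  for \<Lambda> \<epsilon> eT and G :: "'g hat_group" (structure) +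
  assumes proj_epi: "gproj G \<in> epi G (Aut_lattice \<Lambda>)"
    and Q_extraspecial:
      "G\<lparr>carrier := extraspecial_kernel \<Lambda> G\<rparr> \<cong> extraspecial_plus 12"
    and sign_values: "g \<in> carrier G \<Longrightarrow> \<beta> \<in> \<Lambda> \<Longrightarrow> gsign G g \<beta> \<in> {1, -1}"
    and sign_mult:
      "g \<in> carrier G \<Longrightarrow> h \<in> carrier G \<Longrightarrow> \<beta> \<in> \<Lambda> \<Longrightarrow>
         gsign G (g \<otimes> h) \<beta> = gsign G g (gproj G h \<beta>) * gsign G h \<beta>"
    and kernel_lattice:
      "kernel_lattice \<Lambda> G = group_center (G\<lparr>carrier := extraspecial_kernel \<Lambda> G\<rparr>)"
    and repT_one: "grepT G \<one> = mat 1"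
    and repT_mult:
      "g \<in> carrier G \<Longrightarrow> h \<in> carrier G \<Longrightarrow> grepT G (g \<otimes> h) = grepT G g ** grepT G h"
    and repT_eT:
      "g \<in> carrier G \<Longrightarrow> \<beta> \<in> \<Lambda> \<Longrightarrow>
         \<exists>c\<in>{1, -1}. grepT G g ** eT \<beta> = mat c ** eT (gproj G g \<beta>) ** grepT G g"
    and kernel_T_order: "card (kernel_T G) = 2"
    and kernel_T_central: "kernel_T G \<subseteq> group_center G"
    and kernel_T_neq: "kernel_T G \<noteq> kernel_lattice \<Lambda> G"

definition H_group :: "'g hat_group \<Rightarrow> R24 \<Rightarrow> 'g set" where
  "H_group G l = {h \<in> carrier G. gproj G h l = l}"

definition act_VL :: "'g hat_group \<Rightarrow> 'g \<Rightarrow> VL \<Rightarrow> VL" where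
  "act_VL G g = extend_VL (\<lambda>\<beta> p.
     Poly_Mapping.single (gproj G g \<beta>) (fscale (gsign G g \<beta>) (fock_act (gproj G g) p)))"

definition act_VT :: "'g hat_group \<Rightarrow> 'g \<Rightarrow> VT \<Rightarrow> VT" where
  "act_VT G g = tensor_VT (fock_act (gproj G g)) (grepT G g)"

definition act_VN :: "'g hat_group \<Rightarrow> 'g \<Rightarrow> VN \<Rightarrow> VN" where
  "act_VN G g = map_prod (act_VL G g) (act_VT G g)"

definition act_natural :: "(R24 \<Rightarrow> R24) \<Rightarrow> VL \<Rightarrow> VL" where
  "act_natural a = extend_VL (\<lambda>\<beta> p. Poly_Mapping.single (a \<beta>) (fock_act a p))"

definition act_phase :: "R24 \<Rightarrow> VL \<Rightarrow> VL" where
  "act_phase \<xi> = extend_VL (\<lambda>\<beta> p.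
     Poly_Mapping.single \<beta> (fscale (exp (2 * of_real pi * \<i> * of_real (\<xi> \<bullet> \<beta>))) p))"

definition associated ::
  "R24 set \<Rightarrow> 'g hat_group \<Rightarrow> 'g \<Rightarrow> R24 \<Rightarrow> (R24 \<Rightarrow> R24) \<Rightarrow> bool" where
  "associated \<Lambda> G h \<xi> a \<longleftrightarrow>
     (\<forall>w\<in>V_lattice \<Lambda>. act_VL G h w = act_phase \<xi> (act_natural a w))"

section \<open>Trace functions\<close>

lemma fscale_simps:
  "fscale c (p + p') = fscale c p + fscale c p'"
  "fscale (c + d) p = fscale c p + fscale d p"
  "fscale c (fscale d p) = fscale (c * d) p"
  "fscale 1 p = p"
  "fscale c 0 = 0"
  by (simp_all add: fscale_def fconst_def algebra_simps single_add mult_single flip: mult.assoc)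

lemma lookup_scale_VL:
  "Poly_Mapping.lookup (scale_VL c w) \<beta> = fscale c (Poly_Mapping.lookup w \<beta>)"
  by (auto simp: scale_VL_def extend_VL_def lookup_sum lookup_single when_def
      fscale_simps in_keys_iff sum.delta)

global_interpretation VN: vector_space scale_VN
  by unfold_locales
    (auto simp: scale_VN_def scale_VT_def vec_eq_iff fscale_simps lookup_add lookup_scale_VL
      intro!: poly_mapping_eqI)

text \<open>The trace over a finite-dimensional subspace \<open>W\<close> of a map \<open>f\<close> with \<open>f ` W \<subseteq> W\<close>, computed
  in some basis.\<close>

definition trace_on :: "VN set \<Rightarrow> (VN \<Rightarrow> VN) \<Rightarrow> complex" where
  "trace_on W f = (let B = SOME B. VN.independent B \<and> VN.span B = W
                   in \<Sum>b\<in>B. VN.representation B (f b) b)"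

definition trace_coeff ::
  "R24 set \<Rightarrow> (R24 \<Rightarrow> R24 \<Rightarrow> complex) \<Rightarrow> (R24 \<Rightarrow> opT) \<Rightarrow> 'g hat_group \<Rightarrow>
     group_alg \<Rightarrow> 'g \<Rightarrow> nat \<Rightarrow> complex" where
  "trace_coeff \<Lambda> \<epsilon> eT G v h n =
     trace_on (moonshine \<Lambda> n) (zero_mode \<epsilon> eT v \<circ> act_VN G h)"

definition Z_trace ::
  "R24 set \<Rightarrow> (R24 \<Rightarrow> R24 \<Rightarrow> complex) \<Rightarrow> (R24 \<Rightarrow> opT) \<Rightarrow> 'g hat_group \<Rightarrow>
     group_alg \<Rightarrow> 'g \<Rightarrow> complex \<Rightarrow> complex" where
  "Z_trace \<Lambda> \<epsilon> eT G v h \<tau> =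
     qpow \<tau> (-1) * suminf (\<lambda>n. trace_coeff \<Lambda> \<epsilon> eT G v h n * qpow \<tau> (real n))"

end

theory Submission
  imports Defs "HOL-Complex_Analysis.Complex_Analysis"
    "HOL-Computational_Algebra.Fundamental_Theorem_Algebra" "HOL-Number_Theory.Cong"
begin

text \<open>Decompose the trace over \<open>V\<^sub>\<Lambda>\<^sup>+\<close> and \<open>(V\<^sub>\<Lambda>\<^sup>T)\<^sup>+\<close> by inserting the projection \<open>(1 + t) / 2\<close>.
  On \<open>V\<^sub>\<Lambda>\<close> only the term with \<open>t\<close> survives, and a vector \<open>e\<^sup>\<gamma>\<close> contributes only if
  \<open>\<gamma> = \<plusminus> \<alpha> + \<delta>\<close> with \<open>- a \<delta> = \<delta>\<close>, which gives the theta function; on \<open>V\<^sub>\<Lambda>\<^sup>T\<close>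
  the factor \<open>T\<close> contributes \<open>tr\<^sub>T h\<close>. What remains are traces over Fock spaces of \<open>E\<^sup>-(-\<beta>) E\<^sup>+(-\<beta>) a\<close> with \<open>a \<beta> = \<plusminus> \<beta>\<close>.
  Moving a creation operator cyclically around the trace yields a geometric series, so these traces
  are exponentials of explicit divisor sums: one part depends on \<open>\<langle>\<beta>,\<beta>\<rangle>\<close> and produces the powers of
  \<open>\<Theta>\<^sub>i\<close>, the other depends on the traces of the powers of \<open>a\<close>, hence on its frame shape, and
  produces the eta products.\<close>

section \<open>Linear operators on the Fock space\<close>

text \<open>That \<lambda> is twice a lattice vector enters twice: the bilinear cocycle is 1 against
  \<lambda> and -\<lambda>, and the operator of \<lambda> on T is the identity, so T contributes the
  bare trace of h. On the lattice side the identity half of the projection has no diagonal part,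
  because \<beta> + a \<gamma> = \<gamma> would force \<beta> to have norm 0; the half with t turns
  a into -a on oscillators. On the twisted side t is -1 on T, so only odd degrees in half units
  survive. Passing from a to -a multiplies degree D by (-1)^D, so the odd part is a difference of a
  series for a and one for -a: hence the minus sign and the third theta quotient. The vectors
  \<lambda> and -\<lambda> contribute equally, which cancels the 1/2 of the projection. Fock traces
  are first computed as formal power series, where cyclic moves and infinite operator sums raise no
  question of convergence, and are evaluated only after the exponent has become a combination of
  logarithms of Euler products. The Frame shape is defined by a choice, so its existence has to be
  proved for every automorphism; the proof uses only integrality and finite order.\<close>

definition fock_linear :: "(fock \<Rightarrow> fock) \<Rightarrow> bool" where
  "fock_linear F \<longleftrightarrow>
     (\<forall>p q. F (p + q) = F p + F q) \<and> (\<forall>c p. F (fscale c p) = fscale c (F p))"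

lemma fock_linearI:
  assumes "\<And>p q. F (p + q) = F p + F q" "\<And>c p. F (fscale c p) = fscale c (F p)"
  shows "fock_linear F"
  using assms by (simp add: fock_linear_def)

lemma fock_linear_add: "fock_linear F \<Longrightarrow> F (p + q) = F p + F q"
  and fock_linear_fscale: "fock_linear F \<Longrightarrow> F (fscale c p) = fscale c (F p)"
  by (simp_all add: fock_linear_def)

lemma fscale_zero [simp]: "fscale 0 p = 0"
  by (simp add: fscale_def fconst_def)

lemma fscale_0_right [simp]: "fscale c 0 = 0" and fscale_1 [simp]: "fscale 1 p = p"
  by (simp_all add: fscale_simps)

lemma fock_linear_0: "fock_linear F \<Longrightarrow> F 0 = 0"
  using fock_linear_fscale[of F 0 0] by simp

lemma fock_linear_sum: "fock_linear F \<Longrightarrow> F (\<Sum>x\<in>A. f x) = (\<Sum>x\<in>A. F (f x))"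
  by (induction A rule: infinite_finite_induct) (auto simp: fock_linear_0 fock_linear_add)

lemma fscale_sum: "fscale c (\<Sum>x\<in>A. f x) = (\<Sum>x\<in>A. fscale c (f x))"
  by (simp add: fscale_def sum_distrib_left)

lemma fscale_sum_left: "fscale (\<Sum>x\<in>A. f x) p = (\<Sum>x\<in>A. fscale (f x) p)"
  by (induction A rule: infinite_finite_induct) (auto simp: fscale_simps)

lemma fscale_mult_left: "fscale c p * q = fscale c (p * q)"
  and fscale_mult_right: "p * fscale c q = fscale c (p * q)"
  by (simp_all add: fscale_def ac_simps)

lemma fscale_commute: "fscale c (fscale d p) = fscale d (fscale c p)"
  by (simp add: fscale_simps mult.commute)

lemma fscale_single: "fscale c (Poly_Mapping.single m d) = Poly_Mapping.single m (c * d)"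
  by (simp add: fscale_def fconst_def mult_single)

lemma poly_mapping_sum_monomials:
  "(\<Sum>k\<in>Poly_Mapping.keys p. Poly_Mapping.single k (Poly_Mapping.lookup p k)) = p"
  by (rule poly_mapping_eqI) (auto simp: lookup_sum lookup_single when_def in_keys_iff)

lemma lookup_fscale: "Poly_Mapping.lookup (fscale c p) m = c * Poly_Mapping.lookup p m"
proof -
  have "p = (\<Sum>k\<in>Poly_Mapping.keys p. Poly_Mapping.single k (Poly_Mapping.lookup p k))"
    by (rule poly_mapping_sum_monomials[symmetric])
  then have "fscale c p =
      (\<Sum>k\<in>Poly_Mapping.keys p. Poly_Mapping.single k (c * Poly_Mapping.lookup p k))"
    by (metis (no_types, lifting) fscale_single fscale_sum sum.cong)
  then show ?thesis
    by (auto simp: lookup_sum lookup_single when_def in_keys_iff)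
qed

lemma fock_linear_id [intro]: "fock_linear (\<lambda>p. p)"
  and fock_linear_zero [intro]: "fock_linear (\<lambda>p. 0)"
  and fock_linear_times [intro]: "fock_linear F \<Longrightarrow> fock_linear (\<lambda>p. q * F p)"
  and fock_linear_scale [intro]: "fock_linear F \<Longrightarrow> fock_linear (\<lambda>p. fscale c (F p))"
  and fock_linear_plus [intro]: "fock_linear F \<Longrightarrow> fock_linear F' \<Longrightarrow> fock_linear (\<lambda>p. F p + F' p)"
  and fock_linear_compose: "fock_linear F \<Longrightarrow> fock_linear F' \<Longrightarrow> fock_linear (\<lambda>p. F (F' p))"
  by (auto simp: fock_linear_def fscale_simps algebra_simps fscale_mult_right fscale_commute)

lemma fock_linear_setsum [intro]:
  "(\<And>x. x \<in> A \<Longrightarrow> fock_linear (f x)) \<Longrightarrow> fock_linear (\<lambda>p. \<Sum>x\<in>A. f x p)"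
  by (induction A rule: infinite_finite_induct) auto

lemma fock_expand:
  "p = (\<Sum>m\<in>Poly_Mapping.keys p. fscale (Poly_Mapping.lookup p m) (Poly_Mapping.single m 1))"
  by (simp add: fscale_single poly_mapping_sum_monomials)

lemma fock_linear_eqI:
  assumes "fock_linear F" "fock_linear F'"
    and "\<And>m. F (Poly_Mapping.single m 1) = F' (Poly_Mapping.single m 1)"
  shows "F p = F' p"
  by (subst (1 2) fock_expand)
    (simp add: fock_linear_sum fock_linear_fscale assms)

text \<open>The operators on polynomials are defined by sums over the support, which changes under
  addition and under scaling by 0. Homogeneity in the coefficient gives \<open>g m 0 = 0\<close>, so
  such sums may be extended to a common finite support; linearity and the value on a monomial
  follow.\<close>

lemma fock_linear_extension:
  assumes "\<And>m c. g m c = fscale c (g m 1)"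
  shows "fock_linear (\<lambda>p. \<Sum>m\<in>Poly_Mapping.keys p. g m (Poly_Mapping.lookup p m))"
    and "(\<Sum>m'\<in>Poly_Mapping.keys (Poly_Mapping.single m c).
            g m' (Poly_Mapping.lookup (Poly_Mapping.single m c) m')) = g m c"
proof -
  have g0: "g m 0 = 0" for m
    using assms[of m 0] by simp
  have ext: "(\<Sum>m\<in>Poly_Mapping.keys p. g m (Poly_Mapping.lookup p m)) =
      (\<Sum>m\<in>K. g m (Poly_Mapping.lookup p m))" if "finite K" "Poly_Mapping.keys p \<subseteq> K" for p K
    using that by (intro sum.mono_neutral_left) (auto simp: g0 in_keys_iff)
  show "fock_linear (\<lambda>p. \<Sum>m\<in>Poly_Mapping.keys p. g m (Poly_Mapping.lookup p m))"
  proof (rule fock_linearI)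
    fix p q :: fock
    let ?K = "Poly_Mapping.keys p \<union> Poly_Mapping.keys q"
    have "(\<Sum>m\<in>?K. g m (Poly_Mapping.lookup (p + q) m)) =
        (\<Sum>m\<in>?K. g m (Poly_Mapping.lookup p m)) + (\<Sum>m\<in>?K. g m (Poly_Mapping.lookup q m))"
      unfolding sum.distrib[symmetric]
    proof (intro sum.cong refl)
      fix m
      have "g m (a + b) = g m a + g m b" for a b
        by (subst (1 2 3) assms) (simp add: fscale_simps)
      then show "g m (Poly_Mapping.lookup (p + q) m) =
          g m (Poly_Mapping.lookup p m) + g m (Poly_Mapping.lookup q m)"
        by (simp add: lookup_add)
    qed
    then show "(\<Sum>m\<in>Poly_Mapping.keys (p + q). g m (Poly_Mapping.lookup (p + q) m)) =
        (\<Sum>m\<in>Poly_Mapping.keys p. g m (Poly_Mapping.lookup p m)) +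
        (\<Sum>m\<in>Poly_Mapping.keys q. g m (Poly_Mapping.lookup q m))"
      using ext[of ?K "p + q"] ext[of ?K p] ext[of ?K q]
      by (simp add: Poly_Mapping.keys_add)
  next
    fix c p
    have "(\<Sum>m\<in>Poly_Mapping.keys p. g m (Poly_Mapping.lookup (fscale c p) m)) =
        fscale c (\<Sum>m\<in>Poly_Mapping.keys p. g m (Poly_Mapping.lookup p m))"
      unfolding fscale_sum
    proof (intro sum.cong refl)
      fix m
      show "g m (Poly_Mapping.lookup (fscale c p) m) = fscale c (g m (Poly_Mapping.lookup p m))"
        by (subst (1 2) assms) (simp add: lookup_fscale fscale_simps)
    qed
    then show "(\<Sum>m\<in>Poly_Mapping.keys (fscale c p). g m (Poly_Mapping.lookup (fscale c p) m)) =
        fscale c (\<Sum>m\<in>Poly_Mapping.keys p. g m (Poly_Mapping.lookup p m))"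
      using ext[of "Poly_Mapping.keys p" "fscale c p"]
      by (metis (no_types, lifting) finite_keys in_keys_iff lookup_fscale mult_zero_right subsetI)
  qed
  show "(\<Sum>m'\<in>Poly_Mapping.keys (Poly_Mapping.single m c).
            g m' (Poly_Mapping.lookup (Poly_Mapping.single m c) m')) = g m c"
    by (auto simp: g0)
qed

lemma fock_linear_pdiff: "fock_linear (pdiff x)"
  and pdiff_single: "pdiff x (Poly_Mapping.single m c) =
    Poly_Mapping.single (m - {#x#}) (of_nat (count m x) * c)"
proof -
  have *: "Poly_Mapping.single (m - {#x#}) (of_nat (count m x) * c) =
      fscale c (Poly_Mapping.single (m - {#x#}) (of_nat (count m x) * 1))" for m c
    by (simp add: fscale_single mult.commute)
  show "fock_linear (pdiff x)"
    unfolding pdiff_def[abs_def] by (rule fock_linear_extension(1)[OF *])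
  show "pdiff x (Poly_Mapping.single m c) =
    Poly_Mapping.single (m - {#x#}) (of_nat (count m x) * c)"
    unfolding pdiff_def by (rule fock_linear_extension(2)[OF *])
qed

lemma fock_linear_sign: "fock_linear fock_sign"
  and fock_sign_single: "fock_sign (Poly_Mapping.single m c) =
    Poly_Mapping.single m ((-1) ^ size m * c)"
proof -
  have *: "Poly_Mapping.single m ((-1) ^ size m * c) =
      fscale c (Poly_Mapping.single m ((-1) ^ size m * 1))" for m :: monomial and c
    by (simp add: fscale_single mult.commute)
  show "fock_linear fock_sign"
    unfolding fock_sign_def[abs_def] by (rule fock_linear_extension(1)[OF *])
  show "fock_sign (Poly_Mapping.single m c) = Poly_Mapping.single m ((-1) ^ size m * c)"
    unfolding fock_sign_def by (rule fock_linear_extension(2)[OF *])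
qed

lemma fock_linear_act: "fock_linear (fock_act a)"
  and fock_act_single: "fock_act a (Poly_Mapping.single m c) =
    fscale c (prod_mset (image_mset (\<lambda>(i, n). fgen (a (axis i 1)) n) m))"
proof -
  have *: "fscale c (prod_mset (image_mset (\<lambda>(i, n). fgen (a (axis i 1)) n) m)) =
      fscale c (fscale 1 (prod_mset (image_mset (\<lambda>(i, n). fgen (a (axis i 1)) n) m)))" for m c
    by simp
  show "fock_linear (fock_act a)"
    unfolding fock_act_def[abs_def] by (rule fock_linear_extension(1)[OF *])
  show "fock_act a (Poly_Mapping.single m c) =
      fscale c (prod_mset (image_mset (\<lambda>(i, n). fgen (a (axis i 1)) n) m))"
    unfolding fock_act_def by (rule fock_linear_extension(2)[OF *])
qed

section \<open>Single variables: multiplication, substitution and differentiation\<close>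

definition fvar :: "24 \<times> nat \<Rightarrow> fock" where
  "fvar x = Poly_Mapping.single {#x#} 1"

lemma fvar_times_single: "fvar x * Poly_Mapping.single m c = Poly_Mapping.single (add_mset x m) c"
  by (simp add: fvar_def mult_single)

lemma lookup_fvar_times:
  "Poly_Mapping.lookup (fvar x * p) m =
     (if x \<in># m then Poly_Mapping.lookup p (m - {#x#}) else 0)"
proof -
  have "fvar x * p = (\<Sum>k\<in>Poly_Mapping.keys p.
      Poly_Mapping.single (add_mset x k) (Poly_Mapping.lookup p k))"
    by (subst poly_mapping_sum_monomials[of p, symmetric])
      (simp add: sum_distrib_left fvar_times_single)
  also have "Poly_Mapping.lookup \<dots> m =
      (\<Sum>k\<in>Poly_Mapping.keys p. if k = m - {#x#} \<and> x \<in># m then Poly_Mapping.lookup p k else 0)"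
    unfolding lookup_sum lookup_single when_def by (intro sum.cong) auto
  finally show ?thesis
    by (auto simp: in_keys_iff)
qed

lemma fgen_eq: "fgen \<beta> n = (\<Sum>i\<in>UNIV. fscale (of_real (\<beta> $ i)) (fvar (i, n)))"
  by (simp add: fgen_def fvar_def fscale_single)

lemma fgen_linear:
  "fgen (x + y) n = fgen x n + fgen y n" "fgen (c *\<^sub>R x) n = fscale (of_real c) (fgen x n)"
  by (simp_all add: fgen_eq fscale_simps sum.distrib fscale_sum)

lemma fgen_sum: "fgen (\<Sum>i\<in>A. f i) n = (\<Sum>i\<in>A. fgen (f i) n)"
proof (induction A rule: infinite_finite_induct)
  case empty
  show ?case by (simp add: fgen_def)
next
  case (infinite A)
  then show ?case by (simp add: fgen_def)
qed (simp add: fgen_linear)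

lemma fock_act_1 [simp]: "fock_act a 1 = 1"
  using fock_act_single[of a "{#}" 1] by simp

lemma fock_act_fvar_times: "fock_act a (fvar (i, n) * p) = fgen (a (axis i 1)) n * fock_act a p"
proof (rule fock_linear_eqI[where p = p])
  show "fock_linear (\<lambda>p. fock_act a (fvar (i, n) * p))"
    by (intro fock_linear_compose[OF fock_linear_act] fock_linear_times fock_linear_id)
  show "fock_linear (\<lambda>p. fgen (a (axis i 1)) n * fock_act a p)"
    by (intro fock_linear_times fock_linear_act)
qed (simp add: fvar_times_single fock_act_single)

lemma fock_act_fgen_times:
  assumes "linear a"
  shows "fock_act a (fgen \<beta> n * p) = fgen (a \<beta>) n * fock_act a p"
proof -
  have "a \<beta> = a (\<Sum>i\<in>UNIV. (\<beta> $ i) *\<^sub>R axis i 1)"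
    by (subst basis_expansion[of \<beta>, symmetric]) (simp add: scalar_mult_eq_scaleR)
  also have "\<dots> = (\<Sum>i\<in>UNIV. (\<beta> $ i) *\<^sub>R a (axis i 1))"
    by (simp add: linear_sum[OF assms] linear_cmul[OF assms])
  finally have "a \<beta> = (\<Sum>i\<in>UNIV. (\<beta> $ i) *\<^sub>R a (axis i 1))" .
  then show ?thesis
    by (simp add: fgen_eq[of \<beta>] sum_distrib_right fock_linear_sum[OF fock_linear_act]
      fscale_mult_left fock_linear_fscale[OF fock_linear_act] fock_act_fvar_times fgen_sum fgen_linear)
qed

text \<open>Every generator picks up a factor -1, so a monomial of size k picks up (-1)^k. This is
  how the involution t changes \<open>a\<close> into its negative in all oscillator traces.\<close>

lemma fock_act_uminus:
  assumes "linear a"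
  shows "fock_act (\<lambda>x. - a x) p = fock_act a (fock_sign p)"
proof (rule fock_linear_eqI[where p = p])
  show "fock_linear (\<lambda>p. fock_act a (fock_sign p))"
    by (rule fock_linear_compose[OF fock_linear_act fock_linear_sign])
  fix m :: monomial
  have neg: "fgen (- x) n = fscale (- 1) (fgen x n)" for x n
    using fgen_linear(2)[of "- 1" x n] by simp
  have "prod_mset (image_mset (\<lambda>(i, n). fgen (- a (axis i 1)) n) m) =
      fscale ((-1) ^ size m) (prod_mset (image_mset (\<lambda>(i, n). fgen (a (axis i 1)) n) m))"
    by (induction m) (auto simp: neg fscale_mult_left fscale_mult_right fscale_simps)
  then show "fock_act (\<lambda>x. - a x) (Poly_Mapping.single m 1) =
      fock_act a (fock_sign (Poly_Mapping.single m 1))"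
    by (simp add: fock_act_single fock_sign_single)
qed (rule fock_linear_act)

lemma pdiff_fvar_times: "pdiff x (fvar y * p) = fvar y * pdiff x p + (if x = y then p else 0)"
proof (rule fock_linear_eqI[where p = p])
  show "fock_linear (\<lambda>p. pdiff x (fvar y * p))"
    by (intro fock_linear_compose[OF fock_linear_pdiff] fock_linear_times fock_linear_id)
  show "fock_linear (\<lambda>p. fvar y * pdiff x p + (if x = y then p else 0))"
    by (cases "x = y") (auto intro!: fock_linear_plus fock_linear_times fock_linear_pdiff
      fock_linear_id fock_linear_zero)
  fix m
  show "pdiff x (fvar y * Poly_Mapping.single m 1) =
      fvar y * pdiff x (Poly_Mapping.single m 1) + (if x = y then Poly_Mapping.single m 1 else 0)"
  proof (cases "x \<in># m")
    case True
    then show ?thesis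
      by (auto simp: fvar_times_single pdiff_single single_add[symmetric] algebra_simps
        add_mset_diff_bothsides)
  next
    case False
    then show ?thesis
      by (auto simp: fvar_times_single pdiff_single not_in_iff)
  qed
qed

text \<open>x d/dx is the number operator of the variable x: it is diagonal on monomials, with the
  exponent of x as eigenvalue. It supplies the weights in the Euler relation
  \<open>ftrace_euler\<close>.\<close>

lemma lookup_fvar_pdiff:
  "Poly_Mapping.lookup (fvar x * pdiff x p) m = of_nat (count m x) * Poly_Mapping.lookup p m"
proof -
  define F F' :: "fock \<Rightarrow> fock" where "F p = fvar x * pdiff x p"
    and "F' p = (\<Sum>m\<in>Poly_Mapping.keys p.
      Poly_Mapping.single m (of_nat (count m x) * Poly_Mapping.lookup p m))" for p
  have *: "Poly_Mapping.single m (of_nat (count m x) * c) =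
      fscale c (Poly_Mapping.single m (of_nat (count m x) * 1))" for m c
    by (simp add: fscale_single mult.commute)
  have "F p = F' p"
  proof (rule fock_linear_eqI[where p = p])
    show "fock_linear F" unfolding F_def by (intro fock_linear_times fock_linear_pdiff)
    show "fock_linear F'" unfolding F'_def by (rule fock_linear_extension(1)[OF *])
    fix m
    have "F' (Poly_Mapping.single m 1) = Poly_Mapping.single m (of_nat (count m x) * 1)"
      unfolding F'_def by (rule fock_linear_extension(2)[OF *])
    moreover have "F (Poly_Mapping.single m 1) = Poly_Mapping.single m (of_nat (count m x) * 1)"
      by (cases "x \<in># m") (auto simp: F_def pdiff_single fvar_times_single not_in_iff)
    ultimately show "F (Poly_Mapping.single m 1) = F' (Poly_Mapping.single m 1)" by simp
  qed
  moreover have "Poly_Mapping.lookup (F' p) m = of_nat (count m x) * Poly_Mapping.lookup p m"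
    by (auto simp: F'_def lookup_sum lookup_single when_def in_keys_iff)
  ultimately show ?thesis by (simp add: F_def)
qed

lemma fock_linear_annihilation: "fock_linear (annihilation s \<beta> n)"
  unfolding annihilation_def[abs_def]
  by (intro fock_linear_setsum fock_linear_scale fock_linear_pdiff)

lemma fock_linear_creation: "fock_linear (creation \<beta> n)"
  unfolding creation_def[abs_def] by (intro fock_linear_times fock_linear_id)

text \<open>The Heisenberg relation. Both operators are expanded in orthonormal coordinates; each
  partial derivative acts as a derivation, and the diagonal terms add up to the inner
  product.\<close>

lemma annihilation_creation:
  "annihilation s \<beta> m (creation \<gamma> n p) =
     creation \<gamma> n (annihilation s \<beta> m p) +
     (if m = n then fscale (of_real (mode s n * (\<beta> \<bullet> \<gamma>))) p else 0)"
proof -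
  have pd: "pdiff (i, m) (fgen \<gamma> n * p) = fgen \<gamma> n * pdiff (i, m) p +
      (if m = n then fscale (of_real (\<gamma> $ i)) p else 0)" for i
  proof -
    have "pdiff (i, m) (fgen \<gamma> n * p) =
        (\<Sum>j\<in>UNIV. fscale (of_real (\<gamma> $ j)) (fvar (j, n) * pdiff (i, m) p)) +
        (\<Sum>j\<in>UNIV. if i = j then (if m = n then fscale (of_real (\<gamma> $ j)) p else 0) else 0)"
      unfolding fgen_eq sum_distrib_right fock_linear_sum[OF fock_linear_pdiff] fscale_mult_left
        fock_linear_fscale[OF fock_linear_pdiff] pdiff_fvar_times fscale_simps(1)
        sum.distrib[symmetric]
      by (intro sum.cong refl) auto
    then show ?thesis
      by (simp add: fgen_eq sum_distrib_right fscale_mult_left)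
  qed
  have "annihilation s \<beta> m (creation \<gamma> n p) = creation \<gamma> n (annihilation s \<beta> m p) +
      (\<Sum>i\<in>UNIV. if m = n then fscale (of_real (mode s m * (\<beta> $ i) * (\<gamma> $ i))) p else 0)"
    by (auto simp: annihilation_def creation_def pd fscale_simps sum.distrib sum_distrib_left
      fscale_mult_right intro!: sum.cong)
  also have "(\<Sum>i\<in>UNIV. if m = n then fscale (of_real (mode s m * (\<beta> $ i) * (\<gamma> $ i))) p else 0) =
      (if m = n then fscale (\<Sum>i\<in>UNIV. of_real (mode s m * (\<beta> $ i) * (\<gamma> $ i))) p else 0)"
    by (auto simp: fscale_sum_left)
  also have "(\<Sum>i\<in>UNIV. of_real (mode s m * (\<beta> $ i) * (\<gamma> $ i)) :: complex) =
      of_real (mode s m * (\<beta> \<bullet> \<gamma>))"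
    by (simp add: inner_vec_def sum_distrib_left mult.assoc)
  finally show ?thesis by simp
qed

section \<open>Graded traces on the Fock space\<close>

text \<open>Oscillator modes are indexed by \<open>n = 0, 1, \<dots>\<close>. The integer \<open>u n\<close> is the weight of the \<open>n\<close>-th mode
  in units of \<open>s\<close>: \<open>n + 1\<close> in the untwisted case \<open>s = 1\<close>, and \<open>2 n + 1\<close> in the twisted case \<open>s = 1/2\<close>.\<close>

locale fock_grading =
  fixes s :: real and u :: "nat \<Rightarrow> nat"
  assumes s_pos: "s > 0" and mode_eq: "mode s n = s * real (u n)" and u_gt: "n < u n"
begin

lemma mode_nonzero [simp]: "mode s n \<noteq> 0"
  using s_pos u_gt[of n] by (simp add: mode_eq)

definition degree_of :: "monomial \<Rightarrow> nat" where
  "degree_of m = (\<Sum>(i, n)\<in>#m. u n)"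

lemma degree_of_simps [simp]:
  "degree_of {#} = 0" "degree_of (add_mset (i, n) m) = u n + degree_of m"
  by (simp_all add: degree_of_def)

lemma mono_weight_eq: "mono_weight s m = s * real (degree_of m)"
  by (induction m) (auto simp: mono_weight_def mode_eq algebra_simps)

lemma degree_of_ge: "(i, n) \<in># m \<Longrightarrow> u n \<le> degree_of m"
  by (metis degree_of_simps(2) le_add1 multi_member_split)

lemma size_le_degree_of: "size m \<le> degree_of m"
proof (induction m)
  case (add x m)
  obtain i n where "x = (i, n)" by (cases x)
  then show ?case using add u_gt[of n] by simp
qed simp

lemma degree_of_eq_sum:
  assumes "finite K" "set_mset m \<subseteq> K"
  shows "degree_of m = (\<Sum>x\<in>K. count m x * u (snd x))"
  using assms(2)
proof (induction m)
  case (add y m)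
  have "(\<Sum>x\<in>K. count (add_mset y m) x * u (snd x)) =
      (\<Sum>x\<in>K. count m x * u (snd x)) + (\<Sum>x\<in>K. if x = y then u (snd x) else 0)"
    unfolding sum.distrib[symmetric] by (intro sum.cong) auto
  then show ?case using add assms(1) by (cases y) auto
qed simp

text \<open>A monomial of degree D involves only modes n < D because n < u n, and has at most D
  factors because every weight is positive.\<close>

lemma finite_degree: "finite {m. degree_of m = D}"
proof (rule finite_subset)
  show "{m. degree_of m = D} \<subseteq> mset ` {xs. set xs \<subseteq> UNIV \<times> {..<D} \<and> length xs \<le> D}"
  proof
    fix m assume m: "m \<in> {m. degree_of m = D}"
    obtain xs where xs: "mset xs = m" using ex_mset by blast
    have "set xs \<subseteq> UNIV \<times> {..<D}"
    proof
      fix x assume "x \<in> set xs"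
      then have "(fst x, snd x) \<in># m" using xs by (metis prod.collapse set_mset_mset)
      then have "u (snd x) \<le> D" using degree_of_ge[of "fst x" "snd x" m] m by auto
      then show "x \<in> UNIV \<times> {..<D}" using u_gt[of "snd x"] by (cases x) auto
    qed
    moreover have "length xs \<le> D"
      using size_le_degree_of[of m] m xs by auto
    ultimately show "m \<in> mset ` {xs. set xs \<subseteq> UNIV \<times> {..<D} \<and> length xs \<le> D}"
      using xs by auto
  qed
  show "finite (mset ` {xs. set xs \<subseteq> UNIV \<times> {..<D} \<and> length xs \<le> D} :: monomial set)"
    by (intro finite_imageI finite_lists_length_le) auto
qed

text \<open>Only diagonal coefficients enter, so the series is defined for every operator, and the
  cyclicity below needs no homogeneity.\<close>

definition ftrace :: "(fock \<Rightarrow> fock) \<Rightarrow> complex fps" where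
  "ftrace F = Abs_fps (\<lambda>D. \<Sum>m | degree_of m = D.
     Poly_Mapping.lookup (F (Poly_Mapping.single m 1)) m)"

lemma ftrace_zero [simp]: "ftrace (\<lambda>p. 0) = 0"
  by (simp add: ftrace_def fps_eq_iff)

lemma ftrace_add: "ftrace (\<lambda>p. F p + F' p) = ftrace F + ftrace F'"
  by (simp add: ftrace_def fps_eq_iff lookup_add sum.distrib)

lemma ftrace_fscale: "ftrace (\<lambda>p. fscale c (F p)) = fps_const c * ftrace F"
  by (simp add: ftrace_def fps_eq_iff lookup_fscale sum_distrib_left)

lemma ftrace_sum: "ftrace (\<lambda>p. \<Sum>x\<in>A. f x p) = (\<Sum>x\<in>A. ftrace (f x))"
  by (induction A rule: infinite_finite_induct) (auto simp: ftrace_add)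

text \<open>Cyclicity of the trace. Removing the variable from the monomials that contain it is a
  bijection onto all monomials and lowers the degree by \<open>u n\<close>. The resulting factor
  \<open>fps_X ^ u n\<close> is what makes the recursions below determine the traces.\<close>

lemma ftrace_fvar: "ftrace (\<lambda>p. fvar (i, n) * F p) = fps_X ^ u n * ftrace (\<lambda>p. F (fvar (i, n) * p))"
proof (rule fps_ext)
  fix D
  let ?l = "\<lambda>m. Poly_Mapping.lookup (F (Poly_Mapping.single m 1)) (m - {#(i, n)#})"
  have "fps_nth (ftrace (\<lambda>p. fvar (i, n) * F p)) D =
      (\<Sum>m | degree_of m = D. if (i, n) \<in># m then ?l m else 0)"
    by (simp add: ftrace_def lookup_fvar_times)
  also have "\<dots> = (\<Sum>m | degree_of m = D \<and> (i, n) \<in># m. ?l m)"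
    by (subst sum.inter_filter[symmetric]) (auto simp: finite_degree)
  also have "\<dots> = (if D < u n then 0 else fps_nth (ftrace (\<lambda>p. F (fvar (i, n) * p))) (D - u n))"
  proof (cases "D < u n")
    case True
    then have "{m. degree_of m = D \<and> (i, n) \<in># m} = {}"
      using degree_of_ge by fastforce
    then show ?thesis using True by (simp only: sum.empty) simp
  next
    case False
    have "(\<Sum>m | degree_of m = D \<and> (i, n) \<in># m. ?l m) =
        (\<Sum>m | degree_of m = D - u n. Poly_Mapping.lookup (F (Poly_Mapping.single (add_mset (i, n) m) 1)) m)"
      by (rule sum.reindex_bij_witness[of _ "add_mset (i, n)" "\<lambda>m. m - {#(i, n)#}"])
        (use False in \<open>auto dest!: multi_member_split\<close>)
    then show ?thesis using False by (simp add: ftrace_def fvar_times_single)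
  qed
  also have "\<dots> = fps_nth (fps_X ^ u n * ftrace (\<lambda>p. F (fvar (i, n) * p))) D"
    by (simp add: fps_X_power_mult_nth)
  finally show "fps_nth (ftrace (\<lambda>p. fvar (i, n) * F p)) D =
      fps_nth (fps_X ^ u n * ftrace (\<lambda>p. F (fvar (i, n) * p))) D" .
qed

lemma ftrace_fgen:
  assumes F: "fock_linear F"
  shows "ftrace (\<lambda>p. fgen \<gamma> n * F p) = fps_X ^ u n * ftrace (\<lambda>p. F (fgen \<gamma> n * p))"
  by (simp add: fgen_eq sum_distrib_right fscale_mult_left fock_linear_sum[OF F]
    fock_linear_fscale[OF F] ftrace_sum ftrace_fscale ftrace_fvar sum_distrib_left mult.left_commute)

text \<open>These pairs index the expansion of a sum over the modes n of geometric series in q^(u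
  n), with m the exponent in the series. The constant term m = 0 is left out.\<close>

definition decompositions :: "nat \<Rightarrow> (nat \<times> nat) set" where
  "decompositions e = {(n, m). m \<ge> 1 \<and> m * u n = e}"

lemma decompositions_subset: "decompositions e \<subseteq> {..<e} \<times> {..e}"
proof
  fix x assume "x \<in> decompositions e"
  then obtain n m where x: "x = (n, m)" "m \<ge> 1" "m * u n = e" by (auto simp: decompositions_def)
  have "1 * u n \<le> m * u n" by (intro mult_right_mono x) auto
  moreover have "m * 1 \<le> m * u n" using u_gt[of n] by (intro mult_left_mono) auto
  ultimately show "x \<in> {..<e} \<times> {..e}" using x u_gt[of n] by auto
qed

lemma finite_decompositions [simp]: "finite (decompositions e)"
  by (rule finite_subset[OF decompositions_subset]) auto

lemma decompositions_0 [simp]: "decompositions 0 = {}"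
  using decompositions_subset[of 0] by auto

text \<open>The pairs with product at most D, grouped once by the product and once by the mode; n <
  D is automatic from n < u n.\<close>

lemma sum_decompositions:
  "(\<Sum>e\<in>{1..D}. \<Sum>(n, m)\<in>decompositions e. f n m e) =
     (\<Sum>n<D. \<Sum>m\<in>{1..D div u n}. f n m (m * u n))"
proof -
  have "(\<Sum>e\<in>{1..D}. \<Sum>(n, m)\<in>decompositions e. f n m e) =
      (\<Sum>(e, n, m)\<in>Sigma {1..D} decompositions. f n m e)"
    by (subst sum.Sigma) (auto simp: case_prod_beta)
  also have "\<dots> = (\<Sum>(n, m)\<in>Sigma {..<D} (\<lambda>n. {1..D div u n}). f n m (m * u n))"
  proof (rule sum.reindex_bij_witness[of _ "\<lambda>(n, m). (m * u n, n, m)" "\<lambda>(e, n, m). (n, m)"])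
    fix x assume "x \<in> Sigma {1..D} decompositions"
    moreover obtain e n m where x: "x = (e, n, m)" by (cases x)
    ultimately have *: "e \<in> {1..D}" "(n, m) \<in> decompositions e" by auto
    then have e: "m \<ge> 1" "e = m * u n" by (auto simp: decompositions_def)
    show "(case x of (e, n, m) \<Rightarrow> (n, m)) \<in> Sigma {..<D} (\<lambda>n. {1..D div u n})"
      using * e subsetD[OF decompositions_subset *(2)] u_gt[of n]
      by (auto simp: less_eq_div_iff_mult_less_eq x)
    show "(case case x of (e, n, m) \<Rightarrow> (n, m) of (n, m) \<Rightarrow> (m * u n, n, m)) = x"
      "(case case x of (e, n, m) \<Rightarrow> (n, m) of (n, m) \<Rightarrow> f n m (m * u n)) =
         (case x of (e, n, m) \<Rightarrow> f n m e)"
      using e by (simp_all add: x)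
  next
    fix x assume "x \<in> Sigma {..<D} (\<lambda>n. {1..D div u n})"
    moreover obtain n m where x: "x = (n, m)" by (cases x)
    ultimately have "n < D" "m \<in> {1..D div u n}" by auto
    then show "(case x of (n, m) \<Rightarrow> (m * u n, n, m)) \<in> Sigma {1..D} decompositions"
      using u_gt[of n] by (auto simp: decompositions_def less_eq_div_iff_mult_less_eq Suc_le_eq x)
    show "(case case x of (n, m) \<Rightarrow> (m * u n, n, m) of (e, n, m) \<Rightarrow> (n, m)) = x"
      by (simp add: x)
  qed
  also have "\<dots> = (\<Sum>n<D. \<Sum>m\<in>{1..D div u n}. f n m (m * u n))"
    by (subst sum.Sigma) auto
  finally show ?thesis .
qed

end

section \<open>The graded trace of a linear map on the symmetric algebra\<close>

fun mat_pow :: "'a::semiring_1 ^ 'n ^ 'n \<Rightarrow> nat \<Rightarrow> 'a ^ 'n ^ 'n" where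
  "mat_pow A 0 = mat 1"
| "mat_pow A (Suc m) = mat_pow A m ** A"

context fock_grading
begin

text \<open>The logarithm of the product over all modes n of det (1 - q^(u n) A)^(-1), expanded by
  log det = tr log.\<close>

definition trace_log :: "real ^ 24 ^ 24 \<Rightarrow> complex fps" where
  "trace_log A = Abs_fps (\<lambda>e. \<Sum>(n, m)\<in>decompositions e. of_real (trace (mat_pow A m)) / of_nat m)"

text \<open>With M_i the series on the left and T the trace of \<open>a\<close>, one turn around the
  trace gives M_i = q^(u n) (sum over k of A_ki M_k + A_ji T). Every turn raises the degree, so
  iteration terminates in each degree and produces the powers of A.\<close>

lemma ftrace_fvar_pdiff:
  assumes a: "linear a"
  shows "fps_nth (ftrace (\<lambda>p. fvar (i, n) * pdiff (j, n) (fock_act a p))) D =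
    (\<Sum>m\<in>{1..D div u n}. of_real (mat_pow (matrix a) m $ j $ i) *
       fps_nth (ftrace (fock_act a)) (D - m * u n))"
proof (induction D arbitrary: i rule: less_induct)
  case (less D)
  let ?T = "ftrace (fock_act a)" and ?A = "matrix a"
  let ?M = "\<lambda>i. ftrace (\<lambda>p. fvar (i, n) * pdiff (j, n) (fock_act a p))"
  have Aki: "a (axis i 1) $ k = ?A $ k $ i" for k
    by (simp add: matrix_def)
  have "?M i = fps_X ^ u n * ftrace (\<lambda>p. pdiff (j, n) (fock_act a (fvar (i, n) * p)))"
    by (rule ftrace_fvar)
  also have "(\<lambda>p. pdiff (j, n) (fock_act a (fvar (i, n) * p))) =
      (\<lambda>p. (\<Sum>k\<in>UNIV. fscale (of_real (?A $ k $ i)) (fvar (k, n) * pdiff (j, n) (fock_act a p))) +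
        fscale (of_real (?A $ j $ i)) (fock_act a p))"
  proof
    fix p
    have "pdiff (j, n) (fock_act a (fvar (i, n) * p)) =
        (\<Sum>k\<in>UNIV. fscale (of_real (?A $ k $ i)) (fvar (k, n) * pdiff (j, n) (fock_act a p))) +
        (\<Sum>k\<in>UNIV. if j = k then fscale (of_real (?A $ k $ i)) (fock_act a p) else 0)"
      unfolding sum.distrib[symmetric]
      by (auto simp: fock_act_fvar_times fgen_eq Aki sum_distrib_right fscale_mult_left
        fock_linear_sum[OF fock_linear_pdiff] fock_linear_fscale[OF fock_linear_pdiff]
        pdiff_fvar_times fscale_simps intro!: sum.cong)
    then show "pdiff (j, n) (fock_act a (fvar (i, n) * p)) =
        (\<Sum>k\<in>UNIV. fscale (of_real (?A $ k $ i)) (fvar (k, n) * pdiff (j, n) (fock_act a p))) +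
        fscale (of_real (?A $ j $ i)) (fock_act a p)" by simp
  qed
  also have "ftrace \<dots> = (\<Sum>k\<in>UNIV. fps_const (of_real (?A $ k $ i)) * ?M k) +
      fps_const (of_real (?A $ j $ i)) * ?T"
    by (simp add: ftrace_add ftrace_sum ftrace_fscale)
  finally have M: "fps_nth (?M i) D = (if D < u n then 0 else
      (\<Sum>k\<in>UNIV. of_real (?A $ k $ i) * fps_nth (?M k) (D - u n)) +
      of_real (?A $ j $ i) * fps_nth ?T (D - u n))"
    by (simp add: fps_X_power_mult_nth fps_sum_nth)
  show ?case
  proof (cases "D < u n")
    case True
    then show ?thesis unfolding M by simp
  next
    case False
    let ?E = "D - u n"
    have lt: "?E < D" using False u_gt[of n] by simp
    have dv: "D div u n = Suc (?E div u n)"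
      using False u_gt[of n] by (intro le_div_geq) auto
    have "(\<Sum>k\<in>UNIV. of_real (?A $ k $ i) * fps_nth (?M k) ?E) =
        (\<Sum>k\<in>UNIV. of_real (?A $ k $ i) * (\<Sum>m\<in>{1..?E div u n}.
           of_real (mat_pow ?A m $ j $ k) * fps_nth ?T (?E - m * u n)))"
      by (simp only: less.IH[OF lt])
    also have "\<dots> = (\<Sum>k\<in>UNIV. \<Sum>m\<in>{1..?E div u n}.
        of_real (mat_pow ?A m $ j $ k * ?A $ k $ i) * fps_nth ?T (?E - m * u n))"
      by (simp add: sum_distrib_left mult_ac)
    also have "\<dots> = (\<Sum>m\<in>{1..?E div u n}. \<Sum>k\<in>UNIV.
        of_real (mat_pow ?A m $ j $ k * ?A $ k $ i) * fps_nth ?T (?E - m * u n))"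
      by (rule sum.swap)
    also have "\<dots> = (\<Sum>m\<in>{1..?E div u n}.
        of_real (mat_pow ?A (Suc m) $ j $ i) * fps_nth ?T (D - Suc m * u n))"
      by (simp add: matrix_matrix_mult_def sum_distrib_right)
    also have "\<dots> = (\<Sum>m\<in>{2..D div u n}.
        of_real (mat_pow ?A m $ j $ i) * fps_nth ?T (D - m * u n))"
      unfolding dv
      by (rule sum.reindex_bij_witness[of _ "\<lambda>m. m - 1" Suc]) auto
    finally have "(\<Sum>k\<in>UNIV. of_real (?A $ k $ i) * fps_nth (?M k) ?E) = \<dots>" .
    moreover have "{1..D div u n} = insert 1 {2..D div u n}"
      using dv by auto
    ultimately show ?thesis
      unfolding M using False by (simp add: matrix_mul_lid)
  qed
qed

text \<open>The Euler operator: the degree of a monomial is the sum of \<open>u n\<close> times the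
  exponents of its variables, and these exponents are the eigenvalues of x d/dx. Modes n with n at
  least D cannot occur in degree D.\<close>

lemma ftrace_euler:
  assumes a: "linear a"
  shows "of_nat D * fps_nth (ftrace (fock_act a)) D =
    (\<Sum>n<D. \<Sum>i\<in>UNIV. of_nat (u n) *
      fps_nth (ftrace (\<lambda>p. fvar (i, n) * pdiff (i, n) (fock_act a p))) D)"
proof -
  let ?l = "\<lambda>m. Poly_Mapping.lookup (fock_act a (Poly_Mapping.single m 1)) m"
  have deg: "of_nat (degree_of m) = (\<Sum>n<D. \<Sum>i\<in>UNIV. of_nat (u n * count m (i, n)) :: complex)"
    if "degree_of m = D" for m
  proof -
    have "set_mset m \<subseteq> UNIV \<times> {..<D}"
    proof
      fix x assume "x \<in># m"
      then have "u (snd x) \<le> D" using degree_of_ge[of "fst x" "snd x" m] that by auto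
      then show "x \<in> UNIV \<times> {..<D}" using u_gt[of "snd x"] by (cases x) auto
    qed
    then have "degree_of m = (\<Sum>x\<in>UNIV \<times> {..<D}. count m x * u (snd x))"
      by (intro degree_of_eq_sum) auto
    also have "\<dots> = (\<Sum>i\<in>UNIV. \<Sum>n<D. count m (i, n) * u n)"
      by (subst sum.cartesian_product) (auto simp: case_prod_beta)
    also have "\<dots> = (\<Sum>n<D. \<Sum>i\<in>UNIV. u n * count m (i, n))"
      by (subst sum.swap) (simp add: mult.commute)
    finally show ?thesis by (simp del: of_nat_mult)
  qed
  have "of_nat D * fps_nth (ftrace (fock_act a)) D =
      (\<Sum>m | degree_of m = D. of_nat (degree_of m) * ?l m)"
    by (simp add: ftrace_def sum_distrib_left)
  also have "\<dots> = (\<Sum>m | degree_of m = D. \<Sum>n<D. \<Sum>i\<in>UNIV. of_nat (u n) * (of_nat (count m (i, n)) * ?l m))"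
  proof (intro sum.cong refl)
    fix m assume "m \<in> {m. degree_of m = D}"
    then have m: "degree_of m = D" by simp
    show "of_nat (degree_of m) * ?l m =
        (\<Sum>n<D. \<Sum>i\<in>UNIV. of_nat (u n) * (of_nat (count m (i, n)) * ?l m))"
      unfolding deg[OF m] sum_distrib_right by (simp add: mult.assoc)
  qed
  also have "\<dots> = (\<Sum>n<D. \<Sum>i\<in>UNIV. \<Sum>m | degree_of m = D. of_nat (u n) * (of_nat (count m (i, n)) * ?l m))"
    by (subst sum.swap, intro sum.cong refl) (rule sum.swap)
  finally show ?thesis
    by (simp add: ftrace_def lookup_fvar_pdiff sum_distrib_left)
qed

end

text \<open>Uniqueness for a formal linear differential equation: T and exp G solve it with the same
  initial value, and multiplication by exp (-G) makes both constant.\<close>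

lemma fps_eq_exp_compose:
  fixes T G :: "complex fps"
  assumes "fps_deriv T = fps_deriv G * T" "fps_nth T 0 = 1" "fps_nth G 0 = 0"
  shows "T = fps_exp 1 oo G"
proof -
  define E where "E = (fps_exp 1 oo G :: complex fps)"
  define N where "N = (fps_exp 1 oo (- G) :: complex fps)"
  have dE: "fps_deriv E = fps_deriv G * E"
    using assms(3) by (simp add: E_def fps_compose_deriv mult.commute)
  have dN: "fps_deriv N = - fps_deriv G * N"
    using assms(3) by (simp add: N_def fps_compose_deriv mult.commute)
  have "fps_deriv (N * E) = 0" "fps_deriv (N * T) = 0"
    by (simp_all add: dE dN assms(1) algebra_simps)
  then have "N * E = fps_const (fps_nth (N * E) 0)" "N * T = fps_const (fps_nth (N * T) 0)"
    by (metis fps_deriv_eq_0_iff)+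
  moreover have "fps_nth E 0 = 1" "fps_nth N 0 = 1"
    by (simp_all add: E_def N_def)
  ultimately have "N * E = N * T" using assms(2) by simp
  moreover have "N \<noteq> 0" using \<open>fps_nth N 0 = 1\<close> by auto
  ultimately show ?thesis by (simp add: E_def)
qed

context fock_grading
begin

text \<open>The Euler relation and the iterated cyclic moves combine to q T' = q G' T for the
  logarithm G. The result is the classical trace on a symmetric algebra, the product of all det (1 -
  q^(u n) A)^(-1).\<close>

lemma ftrace_fock_act:
  assumes a: "linear a"
  shows "ftrace (fock_act a) = fps_exp 1 oo trace_log (matrix a)"
proof (rule fps_eq_exp_compose)
  let ?T = "ftrace (fock_act a)" and ?A = "matrix a"
  let ?tr = "\<lambda>m. of_real (trace (mat_pow ?A m)) :: complex"
  have D: "of_nat D * fps_nth ?T D = (\<Sum>e\<in>{1..D}. of_nat e * fps_nth (trace_log ?A) e * fps_nth ?T (D - e))"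
    for D
  proof -
    have "of_nat D * fps_nth ?T D = (\<Sum>n<D. \<Sum>i\<in>UNIV. of_nat (u n) * (\<Sum>m\<in>{1..D div u n}.
        of_real (mat_pow ?A m $ i $ i) * fps_nth ?T (D - m * u n)))"
      by (simp only: ftrace_euler[OF a] ftrace_fvar_pdiff[OF a])
    also have "\<dots> = (\<Sum>n<D. \<Sum>m\<in>{1..D div u n}. of_nat (u n) * ?tr m * fps_nth ?T (D - m * u n))"
      by (intro sum.cong refl, subst sum_distrib_left, subst sum.swap, intro sum.cong refl)
        (simp add: trace_def sum_distrib_left sum_distrib_right mult.assoc)
    also have "\<dots> = (\<Sum>e\<in>{1..D}. \<Sum>(n, m)\<in>decompositions e. of_nat (u n) * ?tr m * fps_nth ?T (D - e))"
      by (rule sum_decompositions[symmetric])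
    also have "\<dots> = (\<Sum>e\<in>{1..D}. of_nat e * fps_nth (trace_log ?A) e * fps_nth ?T (D - e))"
      by (intro sum.cong refl)
        (auto simp: trace_log_def sum_distrib_left sum_distrib_right decompositions_def intro!: sum.cong)
    finally show ?thesis .
  qed
  show "fps_deriv ?T = fps_deriv (trace_log ?A) * ?T"
  proof (rule fps_ext)
    fix k
    have "fps_nth (fps_deriv ?T) k = of_nat (Suc k) * fps_nth ?T (Suc k)" by simp
    also have "\<dots> = (\<Sum>e\<in>{1..Suc k}. of_nat e * fps_nth (trace_log ?A) e * fps_nth ?T (Suc k - e))"
      by (rule D)
    also have "\<dots> = (\<Sum>e\<in>{0..k}. of_nat (Suc e) * fps_nth (trace_log ?A) (Suc e) * fps_nth ?T (k - e))"
      by (rule sum.reindex_bij_witness[of _ Suc "\<lambda>e. e - 1"]) auto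
    also have "\<dots> = fps_nth (fps_deriv (trace_log ?A) * ?T) k"
      by (simp add: fps_mult_nth)
    finally show "fps_nth (fps_deriv ?T) k = fps_nth (fps_deriv (trace_log ?A) * ?T) k" .
  qed
  have "degree_of m = 0 \<longleftrightarrow> m = {#}" for m
    using size_le_degree_of[of m] by auto
  then show "fps_nth ?T 0 = 1"
    by (simp add: ftrace_def fock_act_single)
  show "fps_nth (trace_log ?A) 0 = 0"
    by (simp add: trace_log_def)
qed

end

section \<open>Traces with vertex operators inserted\<close>

context fock_grading
begin

text \<open>The coefficient of x^k in the j-th power of the sum of A n x^(u n), with the operators
  kept in order.\<close>

fun words :: "(nat \<Rightarrow> fock \<Rightarrow> fock) \<Rightarrow> nat \<Rightarrow> nat \<Rightarrow> fock \<Rightarrow> fock" where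
  "words A 0 k p = (if k = 0 then p else 0)"
| "words A (Suc j) k p = (\<Sum>n | u n \<le> k. A n (words A j (k - u n) p))"

lemma finite_u_le [simp]: "finite {n. u n \<le> k}"
proof (rule finite_subset)
  show "{n. u n \<le> k} \<subseteq> {..k}" using u_gt by (metis (no_types, lifting) atMost_iff mem_Collect_eq
    less_imp_le order.trans subsetI)
qed simp

lemma words_Suc_0 [simp]: "words A (Suc j) 0 p = 0"
proof -
  have "{n. u n \<le> 0} = {}" using u_gt by (metis Collect_empty_eq le_0_eq not_less0)
  then show ?thesis by (simp only: words.simps sum.empty)
qed

lemma length_le_sum_u: "length ns \<le> sum_list (map u ns)"
proof (induction ns)
  case (Cons n ns)
  then show ?case using u_gt[of n] by simp
qed simp

lemma finite_u_lists: "finite {ns. sum_list (map u ns) = k}"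
proof (rule finite_subset)
  show "{ns. sum_list (map u ns) = k} \<subseteq> {ns. set ns \<subseteq> {..k} \<and> length ns \<le> k}"
  proof clarify
    fix ns assume "k = sum_list (map u ns)"
    moreover have "n \<le> sum_list (map u ns)" if "n \<in> set ns" for n
      using member_le_sum_list[of "u n" "map u ns"] u_gt[of n] that by auto
    ultimately show "set ns \<subseteq> {..sum_list (map u ns)} \<and> length ns \<le> sum_list (map u ns)"
      using length_le_sum_u[of ns] by auto
  qed
  show "finite {ns. set ns \<subseteq> {..k} \<and> length ns \<le> k}"
    by (rule finite_lists_length_le) auto
qed

lemma words_eq_sum:
  assumes A: "\<And>n. fock_linear (A n)"
  shows "words A j k p = (\<Sum>ns | length ns = j \<and> sum_list (map u ns) = k. foldr A ns p)"
proof (induction j arbitrary: k)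
  case 0
  have "{ns. length ns = 0 \<and> sum_list (map u ns) = k} = (if k = 0 then {[]} else {})" by auto
  then show ?case by simp
next
  case (Suc j)
  let ?L = "\<lambda>k. {ns. length ns = j \<and> sum_list (map u ns) = k}"
  have fin: "finite (?L k)" for k
    by (rule finite_subset[OF _ finite_u_lists[of k]]) auto
  have "words A (Suc j) k p = (\<Sum>n | u n \<le> k. \<Sum>ns\<in>?L (k - u n). foldr A (n # ns) p)"
    by (simp add: Suc.IH fock_linear_sum[OF A])
  also have "\<dots> = (\<Sum>(n, ns)\<in>Sigma {n. u n \<le> k} (\<lambda>n. ?L (k - u n)). foldr A (n # ns) p)"
    by (rule sum.Sigma) (auto simp: fin)
  also have "\<dots> = (\<Sum>ns | length ns = Suc j \<and> sum_list (map u ns) = k. foldr A ns p)"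
    by (rule sum.reindex_bij_witness[of _ "\<lambda>ns. (hd ns, tl ns)" "\<lambda>(n, ns). n # ns"])
      (auto simp: length_Suc_conv)
  finally show ?case .
qed

text \<open>Lists are grouped by length, which never exceeds the total weight since every
  \<open>u n\<close> is at least 1; so the exponential is a finite sum in each weight.\<close>

lemma exp_coeff_eq_words:
  assumes A: "\<And>n. fock_linear (A n)"
  shows "exp_coeff s A (s * real k) p = (\<Sum>j\<le>k. fscale (1 / fact j) (words A j k p))"
proof -
  have *: "sum_list (map (mode s) ns) = s * real (sum_list (map u ns))" for ns
    by (induction ns) (auto simp: mode_eq algebra_simps)
  have "exp_coeff s A (s * real k) p =
      (\<Sum>ns | sum_list (map u ns) = k. fscale (1 / fact (length ns)) (foldr A ns p))"
    using s_pos by (simp add: exp_coeff_def *)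
  also have "\<dots> = (\<Sum>j\<le>k. \<Sum>ns | ns \<in> {ns. sum_list (map u ns) = k} \<and> length ns = j.
      fscale (1 / fact (length ns)) (foldr A ns p))"
    by (rule sum.group[symmetric]) (use length_le_sum_u finite_u_lists in auto)
  also have "\<dots> = (\<Sum>j\<le>k. fscale (1 / fact j) (words A j k p))"
    by (intro sum.cong refl, simp add: words_eq_sum[OF A] fscale_sum) (rule sum.cong, auto)
  finally show ?thesis .
qed

lemma exp_coeff_eq_0:
  assumes "r \<notin> range (\<lambda>k. s * real k)"
  shows "exp_coeff s A r p = 0"
proof -
  have *: "sum_list (map (mode s) ns) = s * real (sum_list (map u ns))" for ns
    by (induction ns) (auto simp: mode_eq algebra_simps)
  then have "{ns. sum_list (map (mode s) ns) = r} = {}" using assms by auto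
  then show ?thesis by (simp only: exp_coeff_def sum.empty)
qed

lemma fock_linear_words: "(\<And>n. fock_linear (A n)) \<Longrightarrow> fock_linear (words A j k)"
proof (induction j arbitrary: k)
  case 0
  then show ?case by (cases "k = 0") auto
next
  case (Suc j)
  have eq: "words A (Suc j) k = (\<lambda>p. \<Sum>n | u n \<le> k. A n (words A j (k - u n) p))"
    by (rule ext) simp
  have "fock_linear (\<lambda>p. A n (words A j (k - u n) p))" for n
    using fock_linear_compose[OF Suc.prems Suc.IH[OF Suc.prems]] .
  then show ?case unfolding eq by (rule fock_linear_setsum)
qed

lemma fock_linear_exp_coeff:
  assumes A: "\<And>n. fock_linear (A n)"
  shows "fock_linear (exp_coeff s A r)"
proof (cases "r \<in> range (\<lambda>k. s * real k)")
  case True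
  then obtain k where "r = s * real k" by auto
  then have "exp_coeff s A r = (\<lambda>p. \<Sum>j\<le>k. fscale (1 / fact j) (words A j k p))"
    by (intro ext) (simp only: exp_coeff_eq_words[OF A])
  then show ?thesis
    by (simp only:) (intro fock_linear_setsum fock_linear_scale fock_linear_words A)
next
  case False
  then have "exp_coeff s A r = (\<lambda>p. 0)" by (intro ext exp_coeff_eq_0)
  then show ?thesis by (simp add: fock_linear_zero)
qed

definition crea :: "R24 \<Rightarrow> nat \<Rightarrow> fock \<Rightarrow> fock" where
  "crea \<beta> n p = fscale (of_real (1 / (- mode s n))) (creation \<beta> n p)"

definition anni :: "R24 \<Rightarrow> nat \<Rightarrow> fock \<Rightarrow> fock" where
  "anni \<beta> n p = fscale (of_real (1 / mode s n)) (annihilation s \<beta> n p)"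

lemma fock_linear_crea: "fock_linear (crea \<beta> n)" and fock_linear_anni: "fock_linear (anni \<beta> n)"
  unfolding crea_def[abs_def] anni_def[abs_def]
  by (intro fock_linear_scale fock_linear_creation fock_linear_annihilation)+

lemma E_minus_eq: "E_minus s \<beta> = exp_coeff s (crea \<beta>)"
  and E_plus_eq: "E_plus s \<beta> = exp_coeff s (anni \<beta>)"
  by (simp_all add: E_minus_def E_plus_def crea_def[abs_def] anni_def[abs_def])

lemma fock_linear_E_minus: "fock_linear (E_minus s \<beta> r)"
  and fock_linear_E_plus: "fock_linear (E_plus s \<beta> r)"
  by (simp_all add: E_minus_eq E_plus_eq fock_linear_exp_coeff fock_linear_crea fock_linear_anni)

text \<open>The scalar in the commutator of the two rescaled modes: (1/k) (-1/k) times k (\<beta>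
  \<bullet> \<beta>), with k = \<open>mode s n\<close>.\<close>

definition contraction :: "R24 \<Rightarrow> nat \<Rightarrow> complex" where
  "contraction \<beta> n = of_real (- (\<beta> \<bullet> \<beta>) / mode s n)"

lemma anni_crea:
  "anni \<beta> m (crea \<beta> n p) = crea \<beta> n (anni \<beta> m p) +
     (if m = n then fscale (contraction \<beta> n) p else 0)"
  by (auto simp: anni_def crea_def contraction_def fock_linear_fscale[OF fock_linear_annihilation]
    fock_linear_fscale[OF fock_linear_creation] annihilation_creation fscale_simps fscale_commute)
    (simp_all add: mult.commute)

lemma crea_crea: "crea \<beta> m (crea \<beta> n p) = crea \<beta> n (crea \<beta> m p)"
  by (simp add: crea_def creation_def fscale_mult_right fscale_simps mult.commute mult.left_commute)

lemma words_crea_crea: "words (crea \<beta>) j k (crea \<beta> n p) = crea \<beta> n (words (crea \<beta>) j k p)"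
  by (induction j arbitrary: k)
    (auto simp: fock_linear_0[OF fock_linear_crea] fock_linear_sum[OF fock_linear_crea] crea_crea)

text \<open>The commutator is a scalar, so the creation operator contracts with any one of the i + 1
  annihilation operators, leaving a word of length i whose weight is smaller by \<open>u n\<close>.
  Only the sum over all words has the uniform factor \<open>Suc i\<close>; a single word may contain
  the mode n any number of times.\<close>

lemma words_anni_crea:
  "words (anni \<beta>) (Suc i) k (crea \<beta> n p) = crea \<beta> n (words (anni \<beta>) (Suc i) k p) +
     (if u n \<le> k then fscale (of_nat (Suc i) * contraction \<beta> n) (words (anni \<beta>) i (k - u n) p) else 0)"
proof (induction i arbitrary: k)
  case 0
  have "words (anni \<beta>) (Suc 0) k (crea \<beta> n p) =
      (\<Sum>m | u m \<le> k. crea \<beta> n (anni \<beta> m (words (anni \<beta>) 0 (k - u m) p))) +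
      (\<Sum>m | u m \<le> k. if m = n then fscale (contraction \<beta> n) (words (anni \<beta>) 0 (k - u m) p) else 0)"
    unfolding sum.distrib[symmetric] words.simps(2)
    by (intro sum.cong refl)
      (auto simp: anni_crea fock_linear_0[OF fock_linear_anni] fock_linear_0[OF fock_linear_crea])
  then show ?case by (auto simp: fock_linear_sum[OF fock_linear_crea])
next
  case (Suc i)
  let ?W = "words (anni \<beta>)"
  let ?c = "\<lambda>j. of_nat j * contraction \<beta> n"
  have "?W (Suc (Suc i)) k (crea \<beta> n p) =
      (\<Sum>m | u m \<le> k. anni \<beta> m (crea \<beta> n (?W (Suc i) (k - u m) p) +
        (if u n \<le> k - u m then fscale (?c (Suc i)) (?W i (k - u m - u n) p) else 0)))"
    by (simp only: words.simps(2)[of _ "Suc i"] Suc.IH)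
  also have "\<dots> = (\<Sum>m | u m \<le> k. crea \<beta> n (anni \<beta> m (?W (Suc i) (k - u m) p)) +
      (if m = n then fscale (contraction \<beta> n) (?W (Suc i) (k - u m) p) else 0) +
      (if u n \<le> k - u m then fscale (?c (Suc i)) (anni \<beta> m (?W i (k - u m - u n) p)) else 0))"
    by (intro sum.cong refl)
      (auto simp: fock_linear_add[OF fock_linear_anni] fock_linear_fscale[OF fock_linear_anni]
        fock_linear_0[OF fock_linear_anni] anni_crea simp del: words.simps of_nat_Suc)
  also have "\<dots> = crea \<beta> n (?W (Suc (Suc i)) k p) +
      (if u n \<le> k then fscale (contraction \<beta> n) (?W (Suc i) (k - u n) p) else 0) +
      (\<Sum>m | u m \<le> k. if u n \<le> k - u m then fscale (?c (Suc i)) (anni \<beta> m (?W i (k - u m - u n) p)) else 0)"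
    by (simp add: sum.distrib words.simps(2)[of _ "Suc i"] fock_linear_sum[OF fock_linear_crea]
      del: words.simps of_nat_Suc)
  also have "(\<Sum>m | u m \<le> k. if u n \<le> k - u m then fscale (?c (Suc i)) (anni \<beta> m (?W i (k - u m - u n) p)) else 0)
      = (\<Sum>m | u m \<le> k \<and> u n \<le> k - u m. fscale (?c (Suc i)) (anni \<beta> m (?W i (k - u m - u n) p)))"
    by (subst sum.inter_filter[symmetric]) (auto simp: conj_commute)
  also have "\<dots> = (if u n \<le> k then fscale (?c (Suc i)) (?W (Suc i) (k - u n) p) else 0)"
  proof (cases "u n \<le> k")
    case True
    then have "{m. u m \<le> k \<and> u n \<le> k - u m} = {m. u m \<le> k - u n}" by auto
    then show ?thesis using True by (simp add: fscale_sum add.commute)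
  next
    case False
    then have "{m. u m \<le> k \<and> u n \<le> k - u m} = {}" by auto
    then show ?thesis using False by (simp only: sum.empty if_False)
  qed
  finally show ?case
    by (auto simp: fscale_simps(2)[symmetric] distrib_right simp del: words.simps)
qed

text \<open>Moving a mode cyclically around a trace multiplies it by \<open>\<kappa> q\<^bsup>u n\<^esup>\<close>, up to a contraction term;
  solving the resulting fixed-point equation sums a geometric series.\<close>

definition geo :: "complex \<Rightarrow> nat \<Rightarrow> complex fps" where
  "geo \<kappa> n = inverse (1 - fps_const \<kappa> * fps_X ^ u n) * (fps_const \<kappa> * fps_X ^ u n)"

lemma geo_eq: "geo \<kappa> n = Abs_fps (\<lambda>e. if u n dvd e \<and> e > 0 then \<kappa> ^ (e div u n) else 0)"
  (is "_ = ?g")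
proof -
  let ?x = "fps_const \<kappa> * fps_X ^ u n :: complex fps"
  have un: "u n > 0" using u_gt[of n] by simp
  have "(1 - ?x) * ?g = ?x"
  proof (rule fps_ext)
    fix e
    have "fps_nth (?x * ?g) e = (if e < u n then 0 else \<kappa> * fps_nth ?g (e - u n))"
      by (simp add: fps_X_power_mult_nth mult.assoc)
    moreover have "fps_nth ?x e = (if e = u n then \<kappa> else 0)"
      by (simp add: fps_X_power_nth)
    moreover have "e div u n = Suc ((e - u n) div u n)" if "\<not> e < u n"
      using that un by (intro le_div_geq) auto
    moreover have "u n dvd e - u n \<longleftrightarrow> u n dvd e" if "\<not> e < u n"
      using that by (simp add: dvd_minus_self)
    moreover have "\<not> (u n dvd e)" if "e < u n" "e > 0"
      using that by (simp add: nat_dvd_not_less)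
    ultimately show "fps_nth ((1 - ?x) * ?g) e = fps_nth ?x e"
      using un by (auto simp: left_diff_distrib)
  qed
  then have "inverse (1 - ?x) * ((1 - ?x) * ?g) = inverse (1 - ?x) * ?x" by simp
  moreover have "inverse (1 - ?x) * (1 - ?x) = 1"
    by (rule inverse_mult_eq_1) (use un in simp)
  ultimately show ?thesis by (simp add: geo_def mult.assoc[symmetric])
qed

lemma geo_fixpoint:
  assumes "r = fps_const \<kappa> * fps_X ^ u n * (r + t)"
  shows "r = geo \<kappa> n * t"
proof -
  let ?x = "fps_const \<kappa> * fps_X ^ u n :: complex fps"
  have un: "u n > 0" using u_gt[of n] by simp
  have "inverse (1 - ?x) * (1 - ?x) = 1"
    by (rule inverse_mult_eq_1) (use un in simp)
  moreover have "(1 - ?x) * r = ?x * t" using assms by (simp add: algebra_simps)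
  ultimately show ?thesis
    by (metis (no_types, lifting) geo_def mult.assoc mult_1)
qed

text \<open>Both words have the same total weight k because the coefficient of z^0 in a vertex
  operator pairs equal weights; their lengths may still differ.\<close>

definition wick :: "R24 \<Rightarrow> (R24 \<Rightarrow> R24) \<Rightarrow> nat \<Rightarrow> nat \<Rightarrow> nat \<Rightarrow> complex fps" where
  "wick \<beta> a j i k =
     ftrace (\<lambda>p. words (crea \<beta>) j k (words (anni \<beta>) i k (fock_act a p)))"

text \<open>One creation operator is split off and carried around the trace: \<open>a\<close>
  multiplies it by the eigenvalue, it commutes with the other creation operators, and it returns to
  its place up to a contraction term. The resulting equation for the trace is solved by
  \<open>geo_fixpoint\<close>.\<close>

lemma wick_Suc:
  assumes a: "linear a" and ab: "a \<beta> = \<kappa> *\<^sub>R \<beta>"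
  shows "wick \<beta> a (Suc j) (Suc i) k = (\<Sum>n | u n \<le> k.
    fps_const (of_nat (Suc i) * contraction \<beta> n) * geo (of_real \<kappa>) n * wick \<beta> a j i (k - u n))"
proof -
  let ?F = "\<lambda>n p. words (crea \<beta>) j (k - u n) (words (anni \<beta>) (Suc i) k (fock_act a p))"
  let ?c = "\<lambda>n. of_nat (Suc i) * contraction \<beta> n"
  have lin: "fock_linear (?F n)" for n
    by (intro fock_linear_compose[OF fock_linear_words[OF fock_linear_crea]]
      fock_linear_compose[OF fock_linear_words[OF fock_linear_anni]] fock_linear_act)
  have "ftrace (\<lambda>p. crea \<beta> n (?F n p)) =
      geo (of_real \<kappa>) n * (fps_const (?c n) * wick \<beta> a j i (k - u n))" if "u n \<le> k" for n
  proof (rule geo_fixpoint)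
    let ?d = "of_real (1 / (- mode s n)) :: complex"
    have "ftrace (\<lambda>p. crea \<beta> n (?F n p)) = fps_const ?d * ftrace (\<lambda>p. fgen \<beta> n * ?F n p)"
      by (simp only: crea_def creation_def ftrace_fscale)
    also have "\<dots> = fps_X ^ u n * (fps_const ?d * ftrace (\<lambda>p. ?F n (fgen \<beta> n * p)))"
      by (simp only: ftrace_fgen[OF lin] mult.left_commute)
    also have "fps_const ?d * ftrace (\<lambda>p. ?F n (fgen \<beta> n * p)) = ftrace (\<lambda>p. ?F n (crea \<beta> n p))"
      by (simp only: crea_def creation_def fock_linear_fscale[OF lin] ftrace_fscale)
    also have "(\<lambda>p. ?F n (crea \<beta> n p)) = (\<lambda>p. fscale (of_real \<kappa>) (crea \<beta> n (?F n p) +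
        fscale (?c n) (words (crea \<beta>) j (k - u n) (words (anni \<beta>) i (k - u n) (fock_act a p)))))"
    proof
      fix p
      have "fock_act a (crea \<beta> n p) = fscale (of_real \<kappa>) (crea \<beta> n (fock_act a p))"
        by (simp add: crea_def creation_def fock_linear_fscale[OF fock_linear_act]
          fock_act_fgen_times[OF a] ab fgen_linear fscale_mult_left fscale_commute)
      then show "?F n (crea \<beta> n p) = fscale (of_real \<kappa>) (crea \<beta> n (?F n p) +
          fscale (?c n) (words (crea \<beta>) j (k - u n) (words (anni \<beta>) i (k - u n) (fock_act a p))))"
        using that
        by (simp add: fock_linear_fscale[OF fock_linear_words[OF fock_linear_anni]]
          fock_linear_fscale[OF fock_linear_words[OF fock_linear_crea]] words_anni_crea
          fock_linear_add[OF fock_linear_words[OF fock_linear_crea]] words_crea_crea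
          del: words.simps of_nat_Suc)
    qed
    also have "ftrace \<dots> = fps_const (of_real \<kappa>) * (ftrace (\<lambda>p. crea \<beta> n (?F n p)) +
        fps_const (?c n) * wick \<beta> a j i (k - u n))"
      by (simp only: ftrace_fscale ftrace_add wick_def)
    finally have "ftrace (\<lambda>p. crea \<beta> n (?F n p)) = fps_X ^ u n * (fps_const (of_real \<kappa>) *
        (ftrace (\<lambda>p. crea \<beta> n (?F n p)) + fps_const (?c n) * wick \<beta> a j i (k - u n)))" .
    then show "ftrace (\<lambda>p. crea \<beta> n (?F n p)) = fps_const (of_real \<kappa>) * fps_X ^ u n *
        (ftrace (\<lambda>p. crea \<beta> n (?F n p)) + fps_const (?c n) * wick \<beta> a j i (k - u n))"
      by (subst mult.commute[of "fps_const (of_real \<kappa>)"], subst mult.assoc)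
  qed
  then show ?thesis
    by (simp add: wick_def ftrace_sum mult_ac del: words.simps(2)[of "anni \<beta>"] of_nat_Suc)
qed

lemma wick_0: "wick \<beta> a 0 0 0 = ftrace (fock_act a)"
  by (simp add: wick_def)

text \<open>Contractions remove one operator of each kind until only one kind is left. The empty
  word then forces k = 0, while the nonempty one has positive weight.\<close>

lemma wick_eq_0: "j \<noteq> i \<Longrightarrow> linear a \<Longrightarrow> a \<beta> = \<kappa> *\<^sub>R \<beta> \<Longrightarrow> wick \<beta> a j i k = 0"
proof (induction j arbitrary: i k)
  case 0
  then obtain i' where "i = Suc i'" by (cases i) auto
  then show ?case by (cases "k = 0") (auto simp: wick_def simp del: words.simps(2))
next
  case (Suc j)
  show ?case
  proof (cases i)
    case 0
    then show ?thesis
      by (cases "k = 0")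
        (auto simp: wick_def fock_linear_0[OF fock_linear_words[OF fock_linear_crea]]
          simp del: words.simps(2))
  next
    case (Suc i')
    then show ?thesis using Suc.prems Suc.IH[of i'] by (simp add: wick_Suc[OF Suc.prems(2,3)])
  qed
qed

text \<open>A contraction in mode n costs at least q^(u n), so total weight k needs degree at least
  k; and j letters have weight at least j. This gives the cutoffs for the sums over k and j in a
  fixed degree.\<close>

lemma wick_nth_eq_0:
  "linear a \<Longrightarrow> a \<beta> = \<kappa> *\<^sub>R \<beta> \<Longrightarrow> D < k \<or> k < j \<Longrightarrow> fps_nth (wick \<beta> a j j k) D = 0"
proof (induction j arbitrary: k D)
  case 0
  then show ?case by (simp add: wick_def)
next
  case (Suc j)
  have "fps_nth (geo (of_real \<kappa>) n * wick \<beta> a j j (k - u n)) D = 0" if "u n \<le> k" for n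
    unfolding fps_mult_nth
  proof (intro sum.neutral ballI)
    fix e assume "e \<in> {0..D}"
    show "fps_nth (geo (of_real \<kappa>) n) e * fps_nth (wick \<beta> a j j (k - u n)) (D - e) = 0"
    proof (cases "u n dvd e \<and> e > 0")
      case True
      then have "u n \<le> e" by (simp add: dvd_imp_le)
      moreover have "D - e < k - u n \<or> k - u n < j"
        using \<open>u n \<le> e\<close> \<open>e \<in> {0..D}\<close> that Suc.prems(3) u_gt[of n] by auto
      ultimately show ?thesis using Suc.IH Suc.prems by simp
    qed (auto simp: geo_eq)
  qed
  then show ?case
    by (simp add: wick_Suc[OF Suc.prems(1,2)] fps_sum_nth mult.assoc del: of_nat_Suc)
qed

text \<open>The contribution of a single contracted pair: the sum over all modes of the contraction
  times the geometric series in the eigenvalue.\<close>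

definition insertion_log :: "R24 \<Rightarrow> complex \<Rightarrow> complex fps" where
  "insertion_log \<beta> \<kappa> = Abs_fps (\<lambda>e. \<Sum>(n, m)\<in>decompositions e. contraction \<beta> n * \<kappa> ^ m)"

lemma insertion_log_nth:
  assumes "e \<le> D"
  shows "fps_nth (insertion_log \<beta> \<kappa>) e = (\<Sum>n<D. contraction \<beta> n * fps_nth (geo \<kappa> n) e)"
proof -
  have "(\<Sum>n<D. contraction \<beta> n * fps_nth (geo \<kappa> n) e) =
      (\<Sum>n | n \<in> {..<D} \<and> u n dvd e \<and> e > 0. contraction \<beta> n * \<kappa> ^ (e div u n))"
    unfolding geo_eq by (subst sum.inter_filter) (auto intro!: sum.cong)
  also have "\<dots> = (\<Sum>(n, m)\<in>decompositions e. contraction \<beta> n * \<kappa> ^ m)"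
  proof (rule sum.reindex_bij_witness[of _ fst "\<lambda>n. (n, e div u n)"])
    fix x assume "x \<in> decompositions e"
    moreover obtain n m where "x = (n, m)" by (cases x)
    ultimately have x: "x = (n, m)" "m \<ge> 1" "m * u n = e" "n < e"
      using decompositions_subset[of e] by (auto simp: decompositions_def)
    then show "(fst x, e div u (fst x)) = x" "fst x \<in> {n. n \<in> {..<D} \<and> u n dvd e \<and> e > 0}"
      using u_gt[of n] assms by auto
  next
    fix n assume "n \<in> {n. n \<in> {..<D} \<and> u n dvd e \<and> e > 0}"
    then show "(n, e div u n) \<in> decompositions e"
      using u_gt[of n] by (auto simp: decompositions_def elim!: dvdE)
  qed auto
  finally show ?thesis by (simp add: insertion_log_def)
qed

text \<open>There are j! ways to contract j creation with j annihilation operators, and all give the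
  same product of series once the weights are summed. Summing over k is what decouples the modes; in
  degree D only k up to D matter.\<close>

lemma sum_wick:
  assumes a: "linear a" and ab: "a \<beta> = \<kappa> *\<^sub>R \<beta>"
  shows "(\<Sum>k\<le>D. fps_nth (wick \<beta> a j j k) D) =
    fact j * fps_nth (insertion_log \<beta> (of_real \<kappa>) ^ j * ftrace (fock_act a)) D"
proof (induction j arbitrary: D)
  case 0
  have "(\<Sum>k\<le>D. fps_nth (wick \<beta> a 0 0 k) D) = fps_nth (wick \<beta> a 0 0 0) D"
  proof (subst sum.mono_neutral_right[of "{..D}" "{0}"])
    show "\<forall>k\<in>{..D} - {0}. fps_nth (wick \<beta> a 0 0 k) D = 0" by (simp add: wick_def)
  qed auto
  then show ?case by (simp add: wick_0)
next
  case (Suc j)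
  let ?S = "insertion_log \<beta> (of_real \<kappa>)" and ?g = "geo (of_real \<kappa>)"
  let ?w = "wick \<beta> a j j" and ?c = "contraction \<beta>"
  have geo0: "fps_nth (?g n) e = 0" if "e < u n" for n e
    using that by (auto simp: geo_eq dest: dvd_imp_le)
  \<comment> \<open>Beyond weight D - e the traces have no coefficient in degree D - e, so every
    larger cutoff gives the same sum.\<close>
  have conv: "(\<Sum>k\<le>K. fps_nth (?w k) (D - e)) =
      fact j * fps_nth (?S ^ j * ftrace (fock_act a)) (D - e)" if "D - e \<le> K" for K e
    unfolding Suc.IH[of "D - e", symmetric]
    by (rule sum.mono_neutral_right) (use that in \<open>auto intro!: wick_nth_eq_0[OF a ab]\<close>)
  have inner: "(\<Sum>k | k \<le> D \<and> u n \<le> k. fps_nth (?g n * ?w (k - u n)) D) =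
      fact j * fps_nth (?g n * (?S ^ j * ftrace (fock_act a))) D" for n
  proof -
    have "(\<Sum>k | k \<le> D \<and> u n \<le> k. fps_nth (?g n * ?w (k - u n)) D) =
        (\<Sum>k | k + u n \<le> D. fps_nth (?g n * ?w k) D)"
      by (rule sum.reindex_bij_witness[of _ "\<lambda>k. k + u n" "\<lambda>k. k - u n"]) auto
    also have "\<dots> = (\<Sum>e\<le>D. fps_nth (?g n) e * (\<Sum>k | k + u n \<le> D. fps_nth (?w k) (D - e)))"
      unfolding fps_mult_nth sum_distrib_left by (subst sum.swap) (simp add: atMost_atLeast0)
    also have "\<dots> = (\<Sum>e\<le>D. fps_nth (?g n) e *
        (fact j * fps_nth (?S ^ j * ftrace (fock_act a)) (D - e)))"
    proof (intro sum.cong refl)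
      fix e assume "e \<in> {..D}"
      show "fps_nth (?g n) e * (\<Sum>k | k + u n \<le> D. fps_nth (?w k) (D - e)) =
          fps_nth (?g n) e * (fact j * fps_nth (?S ^ j * ftrace (fock_act a)) (D - e))"
      proof (cases "e < u n")
        case True
        then show ?thesis by (simp add: geo0)
      next
        case False
        then have "{k. k + u n \<le> D} = {..D - u n}" using \<open>e \<in> {..D}\<close> by auto
        then show ?thesis using conv[of e "D - u n"] False by simp
      qed
    qed
    also have "\<dots> = fact j * fps_nth (?g n * (?S ^ j * ftrace (fock_act a))) D"
      unfolding fps_mult_nth[of "?g n"] sum_distrib_left atMost_atLeast0
      by (intro sum.cong refl) (rule mult.left_commute)
    finally show ?thesis .
  qed
  have "(\<Sum>k\<le>D. fps_nth (wick \<beta> a (Suc j) (Suc j) k) D) =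
      (\<Sum>k\<le>D. \<Sum>n<D. if u n \<le> k then of_nat (Suc j) * ?c n * fps_nth (?g n * ?w (k - u n)) D else 0)"
  proof (intro sum.cong refl)
    fix k assume k: "k \<in> {..D}"
    have "{n. u n \<le> k} = {n \<in> {..<D}. u n \<le> k}" using k u_gt
      by (auto intro: order.strict_trans2)
    then show "fps_nth (wick \<beta> a (Suc j) (Suc j) k) D = (\<Sum>n<D.
        if u n \<le> k then of_nat (Suc j) * ?c n * fps_nth (?g n * ?w (k - u n)) D else 0)"
      by (simp add: wick_Suc[OF a ab] fps_sum_nth mult.assoc sum.inter_filter[symmetric] del: of_nat_Suc)
  qed
  also have "\<dots> = (\<Sum>n<D. of_nat (Suc j) * ?c n *
      (\<Sum>k | k \<le> D \<and> u n \<le> k. fps_nth (?g n * ?w (k - u n)) D))"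
  proof (subst sum.swap, intro sum.cong refl)
    fix n
    have "{k. k \<le> D \<and> u n \<le> k} = {k \<in> {..D}. u n \<le> k}" by auto
    then show "(\<Sum>k\<le>D. if u n \<le> k then of_nat (Suc j) * ?c n * fps_nth (?g n * ?w (k - u n)) D else 0) =
        of_nat (Suc j) * ?c n * (\<Sum>k | k \<le> D \<and> u n \<le> k. fps_nth (?g n * ?w (k - u n)) D)"
      by (simp add: sum.inter_filter[symmetric] sum_distrib_left del: of_nat_Suc)
  qed
  also have "\<dots> = fact (Suc j) * (\<Sum>n<D. ?c n * fps_nth (?g n * (?S ^ j * ftrace (fock_act a))) D)"
    unfolding inner by (simp add: sum_distrib_left mult_ac del: of_nat_Suc)
  also have "(\<Sum>n<D. ?c n * fps_nth (?g n * (?S ^ j * ftrace (fock_act a))) D) =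
      (\<Sum>e\<le>D. (\<Sum>n<D. ?c n * fps_nth (?g n) e) * fps_nth (?S ^ j * ftrace (fock_act a)) (D - e))"
    unfolding fps_mult_nth[of "?g _"] sum_distrib_left sum_distrib_right atMost_atLeast0
    by (subst sum.swap) (simp add: mult_ac)
  also have "\<dots> = fps_nth (?S * (?S ^ j * ftrace (fock_act a))) D"
    by (simp add: fps_mult_nth[of ?S] insertion_log_nth[symmetric] atMost_atLeast0)
  finally show ?case by (simp add: mult_ac)
qed

end

section \<open>Homogeneity and the trace of a vertex operator\<close>

lemma fhom_0 [simp]: "fock_homogeneous s d 0"
  by (simp add: fock_homogeneous_def)

lemma fhom_add: "fock_homogeneous s d p \<Longrightarrow> fock_homogeneous s d q \<Longrightarrow> fock_homogeneous s d (p + q)"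
  using Poly_Mapping.keys_add[of p q] by (auto simp: fock_homogeneous_def)

lemma fhom_fscale: "fock_homogeneous s d p \<Longrightarrow> fock_homogeneous s d (fscale c p)"
  by (auto simp: fock_homogeneous_def in_keys_iff lookup_fscale)

lemma fhom_sum:
  "(\<And>x. x \<in> A \<Longrightarrow> fock_homogeneous s d (f x)) \<Longrightarrow> fock_homogeneous s d (\<Sum>x\<in>A. f x)"
  by (induction A rule: infinite_finite_induct) (auto intro: fhom_add)

lemma fhom_single: "fock_homogeneous s (mono_weight s m) (Poly_Mapping.single m c)"
  by (simp add: fock_homogeneous_def)

lemma fhom_linear:
  assumes "fock_linear F" "fock_homogeneous s d p"
    and "\<And>m. mono_weight s m = d \<Longrightarrow> fock_homogeneous s' d' (F (Poly_Mapping.single m 1))"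
  shows "fock_homogeneous s' d' (F p)"
  by (subst fock_expand) (use assms in \<open>auto simp: fock_linear_sum fock_linear_fscale
    fock_homogeneous_def[of s] intro!: fhom_sum fhom_fscale\<close>)

lemma mono_weight_add_mset: "mono_weight s (add_mset (i, n) m) = mode s n + mono_weight s m"
  by (simp add: mono_weight_def)

lemma fhom_fgen:
  assumes "fock_homogeneous s d p"
  shows "fock_homogeneous s (mode s n + d) (fgen \<beta> n * p)"
proof (rule fhom_linear[OF _ assms])
  fix m assume "mono_weight s m = d"
  then have "fock_homogeneous s (mode s n + d) (Poly_Mapping.single (add_mset (i, n) m) 1)" for i
    by (metis fhom_single mono_weight_add_mset)
  then show "fock_homogeneous s (mode s n + d) (fgen \<beta> n * Poly_Mapping.single m 1)"
    by (auto simp: fgen_eq sum_distrib_right fscale_mult_left fvar_times_single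
      intro!: fhom_sum fhom_fscale)
qed auto

lemma fhom_pdiff:
  assumes "fock_homogeneous s d p"
  shows "fock_homogeneous s (d - mode s n) (pdiff (i, n) p)"
proof (rule fhom_linear[OF fock_linear_pdiff assms])
  fix m assume m: "mono_weight s m = d"
  show "fock_homogeneous s (d - mode s n) (pdiff (i, n) (Poly_Mapping.single m 1))"
  proof (cases "(i, n) \<in># m")
    case True
    then obtain m' where "m = add_mset (i, n) m'" by (metis multi_member_split)
    then show ?thesis using m
      by (auto simp: pdiff_single mono_weight_add_mset fock_homogeneous_def)
  next
    case False
    then show ?thesis by (simp add: pdiff_single not_in_iff)
  qed
qed

lemma fhom_act:
  assumes "fock_homogeneous s d p"
  shows "fock_homogeneous s d (fock_act a p)"
proof (rule fhom_linear[OF fock_linear_act assms])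
  fix m assume m: "mono_weight s m = d"
  have "fock_homogeneous s (mono_weight s m) (fock_act a (Poly_Mapping.single m 1))"
  proof (induction m)
    case empty
    have "fock_homogeneous s (mono_weight s {#}) (Poly_Mapping.single {#} 1)"
      by (rule fhom_single)
    then show ?case by simp
  next
    case (add x m)
    obtain i n where "x = (i, n)" by (cases x)
    then show ?case
      using fhom_fgen[OF add, of n "a (axis i 1)"]
      by (simp add: fvar_times_single[symmetric] fock_act_fvar_times mono_weight_add_mset)
  qed
  then show "fock_homogeneous s d (fock_act a (Poly_Mapping.single m 1))" by (simp add: m)
qed

lemma fhom_sign:
  assumes "fock_homogeneous s d p"
  shows "fock_homogeneous s d (fock_sign p)"
  by (rule fhom_linear[OF fock_linear_sign assms]) (auto simp: fock_sign_single fock_homogeneous_def)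

context fock_grading
begin

lemma mono_weight_nonneg: "mono_weight s m \<ge> 0"
  using s_pos by (simp add: mono_weight_eq)

lemma fhom_negative: "fock_homogeneous s d p \<Longrightarrow> d < 0 \<Longrightarrow> p = 0"
  unfolding fock_homogeneous_def
  by (metis ex_in_conv keys_eq_empty mono_weight_nonneg not_less)

text \<open>The factor \<sigma> is 1 for creation and -1 for annihilation operators, so that both
  kinds are treated at once.\<close>

lemma fhom_words:
  assumes "\<And>n d p. fock_homogeneous s d p \<Longrightarrow> fock_homogeneous s (d + \<sigma> * mode s n) (A n p)"
    and "fock_homogeneous s d p"
  shows "fock_homogeneous s (d + \<sigma> * (s * real k)) (words A j k p)"
proof (induction j arbitrary: k)
  case 0
  then show ?case using assms(2) by simp
next
  case (Suc j)
  have "fock_homogeneous s (d + \<sigma> * (s * real k)) (A n (words A j (k - u n) p))" if "u n \<le> k" for n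
    using assms(1)[OF Suc[of "k - u n"], of n] that
    by (simp add: mode_eq of_nat_diff algebra_simps)
  then show ?case by (auto intro!: fhom_sum)
qed

lemma fhom_exp_coeff:
  assumes "\<And>n d p. fock_homogeneous s d p \<Longrightarrow> fock_homogeneous s (d + \<sigma> * mode s n) (A n p)"
    and A: "\<And>n. fock_linear (A n)" and p: "fock_homogeneous s d p"
  shows "fock_homogeneous s (d + \<sigma> * r) (exp_coeff s A r p)"
proof (cases "r \<in> range (\<lambda>k. s * real k)")
  case True
  then obtain k where "r = s * real k" by auto
  then show ?thesis
    using fhom_words[of \<sigma> A, OF assms(1) p]
    by (auto simp: exp_coeff_eq_words[OF A] intro!: fhom_sum fhom_fscale)
qed (simp add: exp_coeff_eq_0)

lemma fhom_E_minus:
  assumes "fock_homogeneous s d p"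
  shows "fock_homogeneous s (d + r) (E_minus s \<beta> r p)"
proof -
  have "fock_homogeneous s (d + 1 * mode s n) (crea \<beta> n p)" if "fock_homogeneous s d p" for n d p
    using fhom_fscale[OF fhom_fgen[OF that]] by (simp add: crea_def creation_def add.commute)
  then have "fock_homogeneous s (d + 1 * r) (exp_coeff s (crea \<beta>) r p)"
    by (rule fhom_exp_coeff) (use assms fock_linear_crea in auto)
  then show ?thesis by (simp add: E_minus_eq)
qed

lemma fhom_E_plus:
  assumes "fock_homogeneous s d p"
  shows "fock_homogeneous s (d - r) (E_plus s \<beta> r p)"
proof -
  have "fock_homogeneous s (d + - 1 * mode s n) (anni \<beta> n p)" if "fock_homogeneous s d p" for n d p
    using fhom_pdiff[OF that] by (auto simp: anni_def annihilation_def intro!: fhom_fscale fhom_sum)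
  then have "fock_homogeneous s (d + - 1 * r) (exp_coeff s (anni \<beta>) r p)"
    by (rule fhom_exp_coeff) (use assms fock_linear_anni in auto)
  then show ?thesis by (simp add: E_plus_eq)
qed

text \<open>A weight above that of all monomials would lead into negative weight, where 0 is the
  only homogeneous element; exponents that are no multiple of s give an empty sum.\<close>

lemma E_plus_support:
  assumes "E_plus s \<beta> k p \<noteq> 0"
  obtains m j where "m \<in> Poly_Mapping.keys p" "k = s * real j" "j \<le> degree_of m"
proof -
  have "k \<in> range (\<lambda>k. s * real k)"
    using assms exp_coeff_eq_0 by (auto simp: E_plus_eq)
  then obtain j where j: "k = s * real j" by auto
  have "\<exists>m\<in>Poly_Mapping.keys p. E_plus s \<beta> k (Poly_Mapping.single m 1) \<noteq> 0"
  proof (rule ccontr)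
    assume *: "\<not> ?thesis"
    have "E_plus s \<beta> k p = 0"
      by (subst fock_expand) (use * in \<open>simp add: fock_linear_sum[OF fock_linear_E_plus]
        fock_linear_fscale[OF fock_linear_E_plus]\<close>)
    then show False using assms by simp
  qed
  then obtain m where m: "m \<in> Poly_Mapping.keys p" "E_plus s \<beta> k (Poly_Mapping.single m 1) \<noteq> 0"
    by auto
  have "\<not> mono_weight s m - k < 0"
    using fhom_negative[OF fhom_E_plus[OF fhom_single]] m(2) by blast
  then have "j \<le> degree_of m"
    using s_pos by (simp add: mono_weight_eq j)
  then show ?thesis using that m j by blast
qed

text \<open>Turns a sum over all real exponents into a finite one. The bound K stays free, since
  linearity requires one cutoff for several polynomials.\<close>

lemma E_coeff_eq_sum:
  assumes "\<And>m. m \<in> Poly_Mapping.keys p \<Longrightarrow> degree_of m \<le> K"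
  shows "E_coeff s \<beta> r p = (\<Sum>k\<le>K. E_minus s \<beta> (r + s * real k) (E_plus s \<beta> (s * real k) p))"
proof -
  let ?f = "\<lambda>k. E_minus s \<beta> (r + k) (E_plus s \<beta> k p)"
  have "{k. ?f k \<noteq> 0} \<subseteq> (\<lambda>k. s * real k) ` {..K}"
  proof
    fix k assume "k \<in> {k. ?f k \<noteq> 0}"
    then have "E_plus s \<beta> k p \<noteq> 0" using fock_linear_0[OF fock_linear_E_minus] by auto
    then show "k \<in> (\<lambda>k. s * real k) ` {..K}"
      using assms by (elim E_plus_support) (auto intro: order.trans)
  qed
  then have "E_coeff s \<beta> r p = (\<Sum>k\<in>(\<lambda>k. s * real k) ` {..K}. ?f k)"
    unfolding E_coeff_def by (intro Sum_any.expand_superset) auto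
  also have "\<dots> = (\<Sum>k\<le>K. ?f (s * real k))"
    using s_pos by (subst sum.reindex) (auto simp: inj_on_def)
  finally show ?thesis .
qed

lemma fock_linear_E_coeff: "fock_linear (E_coeff s \<beta> r)"
proof (rule fock_linearI)
  let ?F = "\<lambda>K p. \<Sum>k\<le>K. E_minus s \<beta> (r + s * real k) (E_plus s \<beta> (s * real k) p)"
  have F: "fock_linear (?F K)" for K :: nat
    by (intro fock_linear_setsum fock_linear_compose[OF fock_linear_E_minus fock_linear_E_plus])
  have bound: "\<exists>K. \<forall>m\<in>M. degree_of m \<le> K" if "finite M" for M :: "monomial set"
    using finite_nat_set_iff_bounded_le[of "degree_of ` M"] that by auto
  fix p q :: fock
  obtain K where K: "\<forall>m\<in>Poly_Mapping.keys p \<union> Poly_Mapping.keys q. degree_of m \<le> K"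
    using bound[of "Poly_Mapping.keys p \<union> Poly_Mapping.keys q"] by auto
  then have "\<forall>m\<in>Poly_Mapping.keys (p + q). degree_of m \<le> K"
    using Poly_Mapping.keys_add[of p q] by blast
  then show "E_coeff s \<beta> r (p + q) = E_coeff s \<beta> r p + E_coeff s \<beta> r q"
    using K by (simp add: E_coeff_eq_sum[of _ K] fock_linear_add[OF F])
next
  let ?F = "\<lambda>K p. \<Sum>k\<le>K. E_minus s \<beta> (r + s * real k) (E_plus s \<beta> (s * real k) p)"
  have F: "fock_linear (?F K)" for K :: nat
    by (intro fock_linear_setsum fock_linear_compose[OF fock_linear_E_minus fock_linear_E_plus])
  fix c and p :: fock
  obtain K where K: "\<forall>m\<in>Poly_Mapping.keys p. degree_of m \<le> K"
    using finite_nat_set_iff_bounded_le[of "degree_of ` Poly_Mapping.keys p"] by auto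
  then have "\<forall>m\<in>Poly_Mapping.keys (fscale c p). degree_of m \<le> K"
    by (auto simp: in_keys_iff lookup_fscale)
  then show "E_coeff s \<beta> r (fscale c p) = fscale c (E_coeff s \<beta> r p)"
    using K by (simp add: E_coeff_eq_sum[of _ K] fock_linear_fscale[OF F])
qed

lemma fhom_E_coeff:
  assumes "fock_homogeneous s d p"
  shows "fock_homogeneous s (d + r) (E_coeff s \<beta> r p)"
proof -
  obtain K where K: "\<forall>m\<in>Poly_Mapping.keys p. degree_of m \<le> K"
    using finite_nat_set_iff_bounded_le[of "degree_of ` Poly_Mapping.keys p"] by auto
  have "fock_homogeneous s (d + r) (E_minus s \<beta> (r + k) (E_plus s \<beta> k p))" for k
    using fhom_E_minus[OF fhom_E_plus[OF assms, of k], of "r + k"] by (simp add: algebra_simps)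
  then show ?thesis using K by (auto simp: E_coeff_eq_sum[of _ K] intro!: fhom_sum)
qed

text \<open>The two exponentials contribute 1/(j! i!). Only i = j survives, and the j! contractions
  cancel one of the factorials, which leaves the exponential series in
  \<open>insertion_log\<close>.\<close>

theorem ftrace_E_coeff:
  assumes a: "linear a" and ab: "a \<beta> = \<kappa> *\<^sub>R \<beta>"
  shows "ftrace (\<lambda>p. E_coeff s \<beta> 0 (fock_act a p)) =
    fps_exp 1 oo (insertion_log \<beta> (of_real \<kappa>) + trace_log (matrix a))"
proof -
  let ?S = "insertion_log \<beta> (of_real \<kappa>)" and ?T = "ftrace (fock_act a)"
  let ?W = "\<lambda>j i k p. words (crea \<beta>) j k (words (anni \<beta>) i k (fock_act a p))"
  have S0: "fps_nth ?S 0 = 0" by (simp add: insertion_log_def)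
  have "ftrace (\<lambda>p. E_coeff s \<beta> 0 (fock_act a p)) = (fps_exp 1 oo ?S) * ?T"
  proof (rule fps_ext)
    fix D
    have E: "E_coeff s \<beta> 0 (fock_act a (Poly_Mapping.single m 1)) =
        (\<Sum>k\<le>D. \<Sum>j\<le>k. \<Sum>i\<le>k. fscale (1 / (fact j * fact i)) (?W j i k (Poly_Mapping.single m 1)))"
      if m: "degree_of m = D" for m
    proof -
      have "degree_of m' = D" if "m' \<in> Poly_Mapping.keys (fock_act a (Poly_Mapping.single m 1))" for m'
        using fhom_act[OF fhom_single[of s m 1], of a] that m s_pos
        by (auto simp: fock_homogeneous_def mono_weight_eq)
      then have "E_coeff s \<beta> 0 (fock_act a (Poly_Mapping.single m 1)) =
          (\<Sum>k\<le>D. E_minus s \<beta> (s * real k) (E_plus s \<beta> (s * real k) (fock_act a (Poly_Mapping.single m 1))))"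
        by (subst E_coeff_eq_sum[of _ D]) auto
      then show ?thesis
        by (simp add: E_minus_eq E_plus_eq exp_coeff_eq_words[OF fock_linear_anni]
          exp_coeff_eq_words[OF fock_linear_crea] fscale_sum fscale_simps(3)
          fock_linear_sum[OF fock_linear_words[OF fock_linear_crea]]
          fock_linear_fscale[OF fock_linear_words[OF fock_linear_crea]])
    qed
    have "fps_nth (ftrace (\<lambda>p. E_coeff s \<beta> 0 (fock_act a p))) D =
        fps_nth (ftrace (\<lambda>p. \<Sum>k\<le>D. \<Sum>j\<le>k. \<Sum>i\<le>k. fscale (1 / (fact j * fact i)) (?W j i k p))) D"
      unfolding ftrace_def fps_nth_Abs_fps by (intro sum.cong refl) (simp only: mem_Collect_eq E)
    also have "\<dots> = (\<Sum>k\<le>D. \<Sum>j\<le>k. \<Sum>i\<le>k. 1 / (fact j * fact i) * fps_nth (wick \<beta> a j i k) D)"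
      by (simp add: ftrace_sum ftrace_fscale fps_sum_nth wick_def)
    also have "\<dots> = (\<Sum>k\<le>D. \<Sum>j\<le>D. 1 / (fact j * fact j) * fps_nth (wick \<beta> a j j k) D)"
    proof (rule sum.cong[OF refl])
      fix k assume k: "k \<in> {..D}"
      have "(\<Sum>i\<le>k. 1 / (fact j * fact i) * fps_nth (wick \<beta> a j i k) D) =
          1 / (fact j * fact j) * fps_nth (wick \<beta> a j j k) D" if "j \<le> k" for j
        by (subst sum.mono_neutral_right[of _ "{j}"]) (use that in \<open>auto simp: wick_eq_0[OF _ a ab]\<close>)
      then have "(\<Sum>j\<le>k. \<Sum>i\<le>k. 1 / (fact j * fact i) * fps_nth (wick \<beta> a j i k) D) =
          (\<Sum>j\<le>k. 1 / (fact j * fact j) * fps_nth (wick \<beta> a j j k) D)" by simp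
      also have "\<dots> = (\<Sum>j\<le>D. 1 / (fact j * fact j) * fps_nth (wick \<beta> a j j k) D)"
        by (rule sum.mono_neutral_left) (use k in \<open>auto simp: wick_nth_eq_0[OF a ab]\<close>)
      finally show "(\<Sum>j\<le>k. \<Sum>i\<le>k. 1 / (fact j * fact i) * fps_nth (wick \<beta> a j i k) D) =
          (\<Sum>j\<le>D. 1 / (fact j * fact j) * fps_nth (wick \<beta> a j j k) D)" .
    qed
    also have "\<dots> = (\<Sum>j\<le>D. 1 / (fact j * fact j) * (\<Sum>k\<le>D. fps_nth (wick \<beta> a j j k) D))"
      by (subst sum.swap) (simp add: sum_distrib_left)
    also have "\<dots> = (\<Sum>j\<le>D. 1 / fact j * fps_nth (?S ^ j * ?T) D)"
      by (simp add: sum_wick[OF a ab])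
    also have "\<dots> = (\<Sum>e\<le>D. (\<Sum>j\<le>D. 1 / fact j * fps_nth (?S ^ j) e) * fps_nth ?T (D - e))"
      unfolding fps_mult_nth sum_distrib_left sum_distrib_right atMost_atLeast0
      by (subst sum.swap) (simp add: mult_ac)
    also have "\<dots> = (\<Sum>e\<le>D. fps_nth (fps_exp 1 oo ?S) e * fps_nth ?T (D - e))"
    proof (intro sum.cong refl)
      fix e assume "e \<in> {..D}"
      then have "(\<Sum>j\<le>D. 1 / fact j * fps_nth (?S ^ j) e) = (\<Sum>j\<le>e. 1 / fact j * fps_nth (?S ^ j) e)"
        by (intro sum.mono_neutral_right) (auto simp: startsby_zero_power_prefix[OF S0])
      then show "(\<Sum>j\<le>D. 1 / fact j * fps_nth (?S ^ j) e) * fps_nth ?T (D - e) =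
          fps_nth (fps_exp 1 oo ?S) e * fps_nth ?T (D - e)"
        by (simp add: fps_compose_nth atMost_atLeast0)
    qed
    also have "\<dots> = fps_nth ((fps_exp 1 oo ?S) * ?T) D"
      by (simp add: fps_mult_nth atMost_atLeast0)
    finally show "fps_nth (ftrace (\<lambda>p. E_coeff s \<beta> 0 (fock_act a p))) D =
        fps_nth ((fps_exp 1 oo ?S) * ?T) D" .
  qed
  also have "\<dots> = fps_exp 1 oo (?S + trace_log (matrix a))"
  \<comment> \<open>The product of the two exponentials solves the differential equation of the
    exponential of the sum.\<close>
  proof (rule fps_eq_exp_compose)
    have G0: "fps_nth (trace_log (matrix a)) 0 = 0" by (simp add: trace_log_def)
    show "fps_deriv ((fps_exp 1 oo ?S) * ?T) =
        fps_deriv (?S + trace_log (matrix a)) * ((fps_exp 1 oo ?S) * ?T)"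
      by (simp add: ftrace_fock_act[OF a] fps_compose_deriv S0 G0 algebra_simps)
    show "fps_nth ((fps_exp 1 oo ?S) * ?T) 0 = 1"
      by (simp add: ftrace_fock_act[OF a])
    show "fps_nth (?S + trace_log (matrix a)) 0 = 0" by (simp add: S0 G0)
  qed
  finally show ?thesis .
qed

end

section \<open>Eta quotients as exponentials of divisor sums\<close>

text \<open>For e > 0 these are the pairs of complementary divisors; for e = 0 the set is infinite,
  which is why coefficients at 0 are always treated apart.\<close>

definition divisor_pairs :: "nat \<Rightarrow> (nat \<times> nat) set" where
  "divisor_pairs e = {(N, v). N * v = e}"

lemma finite_divisor_pairs: "e > 0 \<Longrightarrow> finite (divisor_pairs e)"
proof -
  assume e: "e > 0"
  have "divisor_pairs e \<subseteq> {..e} \<times> {..e}"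
    using e by (auto simp: divisor_pairs_def dest: dvd_imp_le[OF dvdI] dvd_imp_le[OF dvd_triv_right])
  then show ?thesis by (rule finite_subset) auto
qed

lemma sum_divisor_pairs_swap:
  "(\<Sum>(N, v)\<in>divisor_pairs e. f N v) = (\<Sum>(N, v)\<in>divisor_pairs e. f v N)"
  by (rule sum.reindex_bij_witness[of _ prod.swap prod.swap]) (auto simp: divisor_pairs_def mult.commute)

lemma sum_divisor_pairs_dvd_left:
  assumes "e > 0" "k > 0"
  shows "(\<Sum>(N, v)\<in>divisor_pairs e. if k dvd N then f (N div k) v else 0) =
    (if k dvd e then \<Sum>(N, v)\<in>divisor_pairs (e div k). f N v else 0)"
proof -
  have "(\<Sum>(N, v)\<in>divisor_pairs e. if k dvd N then f (N div k) v else 0) =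
      (\<Sum>(N, v)\<in>{x \<in> divisor_pairs e. k dvd fst x}. f (N div k) v)"
    by (subst sum.inter_filter) (auto simp: finite_divisor_pairs assms case_prod_beta intro!: sum.cong)
  also have "\<dots> = (if k dvd e then \<Sum>(N, v)\<in>divisor_pairs (e div k). f N v else 0)"
  proof (cases "k dvd e")
    case True
    have "(\<Sum>(N, v)\<in>{x \<in> divisor_pairs e. k dvd fst x}. f (N div k) v) =
        (\<Sum>(N, v)\<in>divisor_pairs (e div k). f N v)"
      by (rule sum.reindex_bij_witness[of _ "\<lambda>(N, v). (k * N, v)" "\<lambda>(N, v). (N div k, v)"])
        (use assms True in \<open>auto simp: divisor_pairs_def elim!: dvdE\<close>)
    then show ?thesis using True by simp
  next
    case False
    then have "{x \<in> divisor_pairs e. k dvd fst x} = {}" by (auto simp: divisor_pairs_def)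
    then show ?thesis using False by (simp only: sum.empty if_False)
  qed
  finally show ?thesis .
qed

lemma sum_divisor_pairs_dvd_right:
  assumes "e > 0" "k > 0"
  shows "(\<Sum>(N, v)\<in>divisor_pairs e. if k dvd v then f N (v div k) else 0) =
    (if k dvd e then \<Sum>(N, v)\<in>divisor_pairs (e div k). f N v else 0)"
  using sum_divisor_pairs_dvd_left[OF assms, of "\<lambda>a b. f b a"]
  by (subst (asm) sum_divisor_pairs_swap) (simp add: sum_divisor_pairs_swap[of f])

text \<open>The logarithm \<open>- \<Sum>\<^sub>n ln (1 - z\<^sup>n)\<close> of the inverse Euler product, for \<open>norm z < 1\<close>.\<close>

definition euler_coeff :: "nat \<Rightarrow> complex" where
  "euler_coeff e = (if e = 0 then 0 else \<Sum>(N, v)\<in>divisor_pairs e. 1 / of_nat N)"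

definition euler_fps :: "nat \<Rightarrow> complex fps" where
  "euler_fps k = Abs_fps (\<lambda>e. if k dvd e then euler_coeff (e div k) else 0)"

definition euler_log :: "complex \<Rightarrow> complex" where
  "euler_log z = suminf (\<lambda>e. euler_coeff e * z ^ e)"

lemma euler_fps_0 [simp]: "fps_nth (euler_fps k) 0 = 0"
  by (simp add: euler_fps_def euler_coeff_def)

text \<open>Two forms of the same series as a sum over all divisors of e are used. This one carries
  1/N, as in \<open>trace_log\<close>, where N is the power of the matrix.\<close>

lemma euler_fps_left:
  assumes "e > 0" "k > 0"
  shows "fps_nth (euler_fps k) e = (\<Sum>(N, v)\<in>divisor_pairs e. if k dvd N then of_nat k / of_nat N else 0)"
proof -
  have "fps_nth (euler_fps k) e = (\<Sum>(N, v)\<in>divisor_pairs e. if k dvd N then 1 / of_nat (N div k) else 0)"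
    using assms by (subst sum_divisor_pairs_dvd_left) (auto simp: euler_fps_def euler_coeff_def elim!: dvdE)
  also have "\<dots> = (\<Sum>(N, v)\<in>divisor_pairs e. if k dvd N then of_nat k / of_nat N else 0)"
    using assms by (intro sum.cong refl) (auto elim!: dvdE simp: divisor_pairs_def)
  finally show ?thesis .
qed

text \<open>The substitution N = k N', v = 2 v' turns the two conditions into divisibility of e by 2
  k.\<close>

lemma euler_fps_left_even:
  assumes "e > 0" "k > 0"
  shows "fps_nth (euler_fps (2 * k)) e =
    (\<Sum>(N, v)\<in>divisor_pairs e. if k dvd N \<and> even v then of_nat k / of_nat N else 0)"
proof -
  have "(\<Sum>(N, v)\<in>divisor_pairs e. if k dvd N \<and> even v then of_nat k / of_nat N else 0 :: complex) =
      (\<Sum>(N, v)\<in>divisor_pairs e. if k dvd N then (if even v then 1 / of_nat (N div k) else 0) else 0)"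
    using assms by (intro sum.cong refl) (auto elim!: dvdE simp: divisor_pairs_def)
  also have "\<dots> = (if k dvd e then \<Sum>(N, v)\<in>divisor_pairs (e div k). if even v then 1 / of_nat N else 0 else 0)"
    by (rule sum_divisor_pairs_dvd_left[OF assms])
  also have "\<dots> = (if 2 * k dvd e then euler_coeff (e div (2 * k)) else 0)"
  proof (cases "k dvd e")
    case True
    then have e: "e div k > 0" using assms by (auto elim!: dvdE)
    have "2 * k dvd e \<longleftrightarrow> 2 dvd e div k" using True assms by (auto elim!: dvdE)
    moreover have "e div (2 * k) = e div k div 2"
      by (simp add: div_mult2_eq mult.commute)
    ultimately show ?thesis
      using True e sum_divisor_pairs_dvd_right[OF e, of 2 "\<lambda>N v. 1 / of_nat N :: complex"]
      by (auto simp: euler_coeff_def)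
  next
    case False
    then show ?thesis by (auto dest: dvd_mult_right)
  qed
  finally show ?thesis by (simp add: euler_fps_def)
qed

lemma euler_coeff_alt: "e > 0 \<Longrightarrow> euler_coeff e = (\<Sum>(N, v)\<in>divisor_pairs e. 1 / of_nat v)"
  using sum_divisor_pairs_swap[of "\<lambda>N v. 1 / of_nat N :: complex" e] by (simp add: euler_coeff_def)

text \<open>Here the weight is 1/v, as in \<open>insertion_log\<close>, where v is the mode; the two
  forms agree by exchanging complementary divisors.\<close>

lemma euler_fps_right:
  assumes "e > 0" "k > 0"
  shows "fps_nth (euler_fps k) e = (\<Sum>(N, v)\<in>divisor_pairs e. if k dvd N then 1 / of_nat v else 0)"
  using assms sum_divisor_pairs_dvd_left[OF assms, of "\<lambda>N v. 1 / of_nat v :: complex"]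
  by (auto simp: euler_fps_def euler_coeff_alt elim!: dvdE)

text \<open>An even v = 2 v' contributes 1/(2 v'), hence the factor 2.\<close>

lemma euler_fps_right_even:
  assumes "e > 0" "k > 0"
  shows "fps_nth (euler_fps (2 * k)) e =
    2 * (\<Sum>(N, v)\<in>divisor_pairs e. if k dvd N \<and> even v then 1 / of_nat v else 0)"
proof -
  have "(\<Sum>(N, v)\<in>divisor_pairs e. if k dvd N \<and> even v then 1 / of_nat v else 0 :: complex) =
      (if k dvd e then \<Sum>(N, v)\<in>divisor_pairs (e div k). if even v then 1 / of_nat v else 0 else 0)"
    by (subst sum_divisor_pairs_dvd_left[OF assms, symmetric]) (auto intro!: sum.cong)
  also have "2 * \<dots> = (if 2 * k dvd e then euler_coeff (e div (2 * k)) else 0)"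
  proof (cases "k dvd e")
    case True
    then have e: "e div k > 0" using assms by (auto elim!: dvdE)
    have dv: "2 * k dvd e \<longleftrightarrow> 2 dvd e div k" using True assms by (auto elim!: dvdE)
    have eq: "e div (2 * k) = e div k div 2"
      by (simp add: div_mult2_eq mult.commute)
    have "2 * (\<Sum>(N, v)\<in>divisor_pairs (e div k). if even v then 1 / of_nat v else 0 :: complex) =
        (\<Sum>(N, v)\<in>divisor_pairs (e div k). if even v then 1 / of_nat (v div 2) else 0)"
      unfolding sum_distrib_left by (intro sum.cong refl) (auto elim!: evenE)
    also have "\<dots> = (if 2 dvd e div k then euler_coeff (e div k div 2) else 0)"
      using e sum_divisor_pairs_dvd_right[OF e, of 2 "\<lambda>N v. 1 / of_nat v :: complex"]
      by (auto simp: euler_coeff_alt elim!: evenE)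
    finally show ?thesis using True by (simp add: dv eq)
  next
    case False
    then show ?thesis by (auto dest: dvd_mult_right)
  qed
  finally show ?thesis by (simp add: euler_fps_def)
qed

section \<open>Convergence of divisor series and Euler products\<close>

lemma abs_summable_on_times:
  fixes f :: "'a \<Rightarrow> complex" and g :: "'b \<Rightarrow> complex"
  assumes f: "(\<lambda>x. norm (f x)) summable_on A" and g: "(\<lambda>y. norm (g y)) summable_on B"
  shows "(\<lambda>(x, y). norm (f x * g y)) summable_on A \<times> B"
proof -
  have "(\<lambda>y. norm (f x * g y)) summable_on B" for x
    using summable_on_cmult_right[OF g, of "norm (f x)"] by (simp add: norm_mult)
  moreover have "infsum (\<lambda>y. norm (f x * g y)) B = norm (f x) * infsum (\<lambda>y. norm (g y)) B" for x
    by (simp add: norm_mult infsum_cmult_right[OF g])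
  moreover have "(\<lambda>x. norm (norm (f x) * infsum (\<lambda>y. norm (g y)) B)) summable_on A"
    using summable_on_cmult_left[OF f, of "\<bar>infsum (\<lambda>y. norm (g y)) B\<bar>"] by (simp add: abs_mult)
  ultimately show ?thesis
    using Infinite_Sum.abs_summable_on_Sigma_iff[of "\<lambda>(x, y). f x * g y" A "\<lambda>_. B"]
    by (simp add: case_prod_beta')
qed

lemma has_sum_from_sums:
  fixes f :: "nat \<Rightarrow> complex"
  assumes "f summable_on UNIV" "f sums x"
  shows "(f has_sum x) UNIV"
  using has_sum_infsum[OF assms(1)] sums_unique2[OF has_sum_imp_sums assms(2)] by metis

text \<open>The double series of z^(n m) / m, with n and m at least 1, converges absolutely. Summed
  along n m = e it gives the divisor sums; summed over m first it gives the logarithms of the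
  factors of the Euler product.\<close>

lemma euler_log:
  fixes z :: complex
  assumes z: "norm z < 1"
  shows "(\<lambda>e. euler_coeff e * z ^ e) sums euler_log z" (is ?sums)
    and "exp (- euler_log z) = prodinf (\<lambda>n. 1 - z ^ Suc n)" (is ?prod)
proof -
  let ?f = "\<lambda>(n, m). z ^ (Suc n * Suc m) / of_nat (Suc m)"
  have geo: "(\<lambda>n. norm (z ^ n)) summable_on UNIV"
    using z by (intro norm_summable_imp_summable_on) (simp add: norm_power)
  have abs: "(\<lambda>x. norm (?f x)) summable_on UNIV \<times> UNIV"
  \<comment> \<open>As n + m is at most (n + 1) (m + 1), a product of two geometric series
    dominates.\<close>
  proof (rule Infinite_Sum.abs_summable_on_comparison_test)
    show "(\<lambda>x. norm (case x of (n, m) \<Rightarrow> z ^ n * z ^ m)) summable_on UNIV \<times> UNIV"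
      using abs_summable_on_times[OF geo geo] by (simp add: case_prod_beta')
    fix x :: "nat \<times> nat"
    obtain n m where x: "x = (n, m)" by (cases x)
    have "norm (z ^ (Suc n * Suc m) / of_nat (Suc m)) = norm z ^ (Suc n * Suc m) / real (Suc m)"
      by (simp only: norm_divide norm_power norm_of_nat)
    also have "\<dots> \<le> norm z ^ (Suc n * Suc m) / 1"
      by (intro divide_left_mono) auto
    also have "\<dots> = norm z ^ (Suc n * Suc m)" by simp
    also have "\<dots> \<le> norm z ^ (n + m)"
      using z by (intro power_decreasing) auto
    finally show "norm (?f x) \<le> norm (case x of (n, m) \<Rightarrow> z ^ n * z ^ m)"
      by (simp add: x norm_mult norm_power power_add)
  qed
  then obtain S where S: "(?f has_sum S) (UNIV \<times> UNIV)"
    using Infinite_Sum.abs_summable_summable summable_on_def by blast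
  have "((\<lambda>(e, N, v). z ^ e / of_nat N) has_sum S) (Sigma {1..} divisor_pairs)"
  proof -
    let ?j = "\<lambda>(n, m). (Suc n * Suc m, Suc m, Suc n)"
    have range: "Sigma {1..} divisor_pairs = range ?j"
    proof (intro equalityI subsetI)
      fix x assume "x \<in> Sigma {1..} divisor_pairs"
      moreover obtain e N v where x: "x = (e, N, v)" by (cases x)
      ultimately have "e = N * v" "N > 0" "v > 0" by (auto simp: divisor_pairs_def intro: gr0I)
      then have "x = ?j (v - 1, N - 1)" by (simp add: x mult.commute del: mult_Suc mult_Suc_right)
      then show "x \<in> range ?j" by blast
    qed (auto simp: divisor_pairs_def)
    have inj: "inj ?j" by (auto simp: inj_def)
    have comp: "(\<lambda>(e, N, v). z ^ e / of_nat N) \<circ> ?j = ?f" by (auto simp: fun_eq_iff)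
    show ?thesis
      using S unfolding range has_sum_reindex[OF inj] comp UNIV_Times_UNIV .
  qed
  then have "((\<lambda>e. \<Sum>(N, v)\<in>divisor_pairs e. z ^ e / of_nat N) has_sum S) {1..}"
    by (rule has_sum_SigmaD) (auto intro!: has_sum_finiteI finite_divisor_pairs simp: case_prod_beta)
  then have "((\<lambda>e. euler_coeff e * z ^ e) has_sum S) UNIV"
    by (rule has_sum_cong_neutral[THEN iffD1, rotated -1])
      (auto simp: euler_coeff_def sum_distrib_right case_prod_beta)
  then have sums: "(\<lambda>e. euler_coeff e * z ^ e) sums S"
    by (rule has_sum_imp_sums)
  then have S_eq: "S = euler_log z" by (simp add: euler_log_def sums_iff)
  show ?sums using sums S_eq by simp
  have small: "norm (z ^ Suc n) < 1" for n
    using z by (simp add: norm_power power_less_one_iff del: power_Suc)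
  have "((\<lambda>m. ?f (n, m)) has_sum - Ln (1 - z ^ Suc n)) UNIV" for n
  proof -
    have "(\<lambda>m. ?f (n, m)) summable_on UNIV"
      using summable_on_SigmaD1[of "\<lambda>n m. ?f (n, m)" UNIV "\<lambda>_. UNIV" n] Infinite_Sum.abs_summable_summable[OF abs]
      by (simp add: case_prod_beta')
    moreover have "(\<lambda>m. ?f (n, m)) sums - Ln (1 - z ^ Suc n)"
    proof -
      have "(\<lambda>m. - ((- (- (z ^ Suc n))) ^ m) / of_nat m) sums Ln (1 + (- (z ^ Suc n)))"
        by (rule Ln_series') (use small in simp)
      from sums_minus[OF this] have "(\<lambda>m. (z ^ Suc n) ^ m / of_nat m) sums - Ln (1 - z ^ Suc n)"
        by simp
      then have "(\<lambda>m. (z ^ Suc n) ^ Suc m / of_nat (Suc m)) sums - Ln (1 - z ^ Suc n)"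
        by (subst sums_Suc_iff) simp
      then show ?thesis by (simp add: power_mult[symmetric] del: power_Suc of_nat_Suc mult_Suc)
    qed
    ultimately show ?thesis
      by (rule has_sum_from_sums)
  qed
  then have "((\<lambda>n. - Ln (1 - z ^ Suc n)) has_sum S) UNIV"
    by (rule has_sum_SigmaD[OF S])
  then have "(\<lambda>n. - Ln (1 - z ^ Suc n)) sums S"
    by (rule has_sum_imp_sums)
  then have "(\<lambda>n. Ln (1 - z ^ Suc n)) sums (- S)"
    using sums_minus by fastforce
  then have "prodinf (\<lambda>n. exp (Ln (1 - z ^ Suc n))) = exp (- S)"
    by (metis prodinf_exp sums_iff)
  moreover have "exp (Ln (1 - z ^ Suc n)) = 1 - z ^ Suc n" for n
    using small[of n] by (intro exp_Ln) auto
  ultimately show ?prod by (simp add: S_eq)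
qed

lemma euler_fps_sums:
  assumes "norm z < 1" "k > 0"
  shows "(\<lambda>e. fps_nth (euler_fps k) e * z ^ e) sums euler_log (z ^ k)"
proof -
  have "norm (z ^ k) < 1" using assms by (simp add: norm_power power_less_one_iff)
  then have "(\<lambda>e. euler_coeff e * (z ^ k) ^ e) sums euler_log (z ^ k)" by (rule euler_log)
  also have "(\<lambda>e. euler_coeff e * (z ^ k) ^ e) = (\<lambda>e. fps_nth (euler_fps k) (k * e) * z ^ (k * e))"
    using assms by (simp add: euler_fps_def power_mult)
  finally show ?thesis
    by (subst (asm) sums_mono_reindex[of "\<lambda>e. k * e" "\<lambda>e. fps_nth (euler_fps k) e * z ^ e"])
      (use assms in \<open>auto simp: strict_mono_def euler_fps_def elim!: dvdE\<close>)
qed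

text \<open>Formal composition and composition of functions agree near 0; since exp of g is
  holomorphic on the whole unit disc, its power series converges there.\<close>

lemma exp_compose_sums:
  fixes G :: "complex fps"
  assumes "\<And>z. norm z < 1 \<Longrightarrow> (\<lambda>e. fps_nth G e * z ^ e) sums g z" "fps_nth G 0 = 0" "norm z < 1"
  shows "(\<lambda>e. fps_nth (fps_exp 1 oo G) e * z ^ e) sums exp (g z)"
proof -
  have hol: "g holomorphic_on ball 0 1"
    by (rule power_series_holomorphic[of 0 1 "fps_nth G"]) (use assms(1) in auto)
  have "eventually (\<lambda>z. z \<in> ball 0 1) (nhds (0 :: complex))"
    by (intro eventually_nhds_in_open) auto
  then have "eventually (\<lambda>z. (\<lambda>e. fps_nth G e * z ^ e) sums g z) (nhds 0)"
    by eventually_elim (use assms(1) in auto)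
  then have "g has_fps_expansion G" by (rule has_fps_expansionI)
  then have "(exp \<circ> g) has_fps_expansion (fps_exp 1 oo G)"
    using assms(2) by (intro has_fps_expansion_compose has_fps_expansion_exp1)
  moreover have "(exp \<circ> g) holomorphic_on eball 0 1"
    using hol by (auto simp: one_ereal_def o_def intro!: holomorphic_intros)
  ultimately have "(\<lambda>e. fps_nth (fps_exp 1 oo G) e * z ^ e) sums (exp \<circ> g) z"
    using assms(3) by (intro has_fps_expansion_imp_sums_complex[where r = 1]) (auto simp: one_ereal_def simp del: o_apply)
  then show ?thesis by simp
qed

lemma power_series_abs_summable:
  fixes f :: "nat \<Rightarrow> complex"
  assumes "\<And>z. norm z < 1 \<Longrightarrow> summable (\<lambda>e. f e * z ^ e)" "norm z < 1"
  shows "(\<lambda>e. norm (f e * z ^ e)) summable_on UNIV"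
proof -
  obtain r where r: "norm z < r" "r < 1" using assms(2) dense by blast
  then have "norm (of_real r :: complex) < 1" using norm_ge_zero[of z] by (simp del: norm_ge_zero)
  then have "summable (\<lambda>e. f e * of_real r ^ e)" by (rule assms(1))
  then have "summable (\<lambda>e. norm (f e * z ^ e))"
    by (rule powser_insidea) (use r norm_ge_zero[of z] in simp)
  then show ?thesis by (intro norm_summable_imp_summable_on) simp
qed

section \<open>Traces of vertex operators as eta quotients\<close>

interpretation untwisted: fock_grading 1 Suc
  by unfold_locales (auto simp: mode_def)

interpretation twisted: fock_grading "1/2" "\<lambda>n. Suc (2 * n)"
  by unfold_locales (auto simp: mode_def field_simps)

text \<open>\<open>frame_traces A m\<close> is the Frame shape condition \<open>det (x - A) = \<Prod>\<^sub>k (x\<^sup>k - 1)\<^bsup>m k\<^esup>\<close> in terms of power sums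
  of the eigenvalues.\<close>

definition frame_traces :: "real ^ 24 ^ 24 \<Rightarrow> (nat \<Rightarrow> int) \<Rightarrow> bool" where
  "frame_traces A m \<longleftrightarrow> finite {k. m k \<noteq> 0} \<and> m 0 = 0 \<and>
     (\<forall>j. trace (mat_pow A j) = (\<Sum>k | m k \<noteq> 0 \<and> k dvd j. real_of_int (of_nat k * m k)))"

lemma frame_traces_support:
  "frame_traces A m \<Longrightarrow> finite {k. m k \<noteq> 0}"
  "frame_traces A m \<Longrightarrow> k \<in> {k. m k \<noteq> 0} \<Longrightarrow> k > 0"
  by (auto simp: frame_traces_def intro: gr0I)

lemma frame_traces_pow:
  assumes "frame_traces A m"
  shows "of_real (trace (mat_pow A j)) =
    (\<Sum>k | m k \<noteq> 0. if k dvd j then of_nat k * of_int (m k) else (0 :: complex))"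
proof -
  have "{k. m k \<noteq> 0 \<and> k dvd j} = {k \<in> {k. m k \<noteq> 0}. k dvd j}" by auto
  then show ?thesis
    using assms by (simp add: frame_traces_def sum.inter_filter[symmetric])
qed

text \<open>Here N is the exponent m and v = n + 1 the mode, so every pair of complementary divisors
  occurs. In the twisted case the mode is v = 2 n + 1, and only odd v occur.\<close>

lemma untwisted_decompositions:
  assumes "e > 0"
  shows "(\<Sum>(n, m)\<in>untwisted.decompositions e. f m (Suc n)) = (\<Sum>(N, v)\<in>divisor_pairs e. f N v)"
  by (rule sum.reindex_bij_witness[of _ "\<lambda>(N, v). (v - 1, N)" "\<lambda>(n, m). (m, Suc n)"])
    (use assms in \<open>auto simp: untwisted.decompositions_def divisor_pairs_def Suc_le_eq
      simp del: mult_Suc_right intro: gr0I\<close>)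

lemma twisted_decompositions:
  assumes "e > 0"
  shows "(\<Sum>(n, m)\<in>twisted.decompositions e. f m (Suc (2 * n))) =
    (\<Sum>(N, v)\<in>divisor_pairs e. if odd v then f N v else 0)"
proof -
  have "(\<Sum>(N, v)\<in>divisor_pairs e. if odd v then f N v else 0) =
      (\<Sum>(N, v)\<in>{x \<in> divisor_pairs e. odd (snd x)}. f N v)"
    by (subst sum.inter_filter) (auto simp: finite_divisor_pairs assms case_prod_beta intro!: sum.cong)
  also have "\<dots> = (\<Sum>(n, m)\<in>twisted.decompositions e. f m (Suc (2 * n)))"
    by (rule sum.reindex_bij_witness[of _ "\<lambda>(n, m). (m, Suc (2 * n))" "\<lambda>(N, v). (v div 2, N)"])
      (use assms in \<open>auto simp: twisted.decompositions_def divisor_pairs_def Suc_le_eq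
        simp del: mult_Suc_right intro: gr0I elim!: oddE\<close>)
  finally show ?thesis by simp
qed

text \<open>A factor x^k - 1 of the characteristic polynomial contributes the determinant 1 - q^(k
  v) at mode v, so the trace on the symmetric algebra is the product of all (1 - q^(k v))^(-m
  k).\<close>

lemma untwisted_trace_log:
  assumes "frame_traces A m"
  shows "untwisted.trace_log A = (\<Sum>k | m k \<noteq> 0. fps_const (of_int (m k)) * euler_fps k)"
proof (rule fps_ext)
  fix e
  show "fps_nth (untwisted.trace_log A) e =
      fps_nth (\<Sum>k | m k \<noteq> 0. fps_const (of_int (m k)) * euler_fps k) e"
  proof (cases "e = 0")
    case True
    then show ?thesis by (simp add: untwisted.trace_log_def fps_sum_nth)
  next
    case False
    then have e: "e > 0" by simp
    have "fps_nth (untwisted.trace_log A) e =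
        (\<Sum>(N, v)\<in>divisor_pairs e. of_real (trace (mat_pow A N)) / of_nat N)"
      using untwisted_decompositions[OF e, of "\<lambda>N v. of_real (trace (mat_pow A N)) / of_nat N :: complex"]
      by (simp add: untwisted.trace_log_def)
    also have "\<dots> = (\<Sum>k | m k \<noteq> 0. of_int (m k) *
        (\<Sum>(N, v)\<in>divisor_pairs e. if k dvd N then of_nat k / of_nat N else 0))"
      unfolding frame_traces_pow[OF assms] sum_distrib_left sum_divide_distrib case_prod_beta
      by (subst sum.swap) (auto intro!: sum.cong)
    also have "\<dots> = (\<Sum>k | m k \<noteq> 0. of_int (m k) * fps_nth (euler_fps k) e)"
      using frame_traces_support(2)[OF assms] e by (intro sum.cong refl) (simp add: euler_fps_left)
    finally show ?thesis by (simp add: fps_sum_nth)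
  qed
qed

text \<open>Odd modes are all modes without the even ones, and the even modes give the same Euler
  product with doubled index. This is the source of the quotient of eta products at \<tau> and
  \<tau> / 2.\<close>

lemma twisted_trace_log:
  assumes "frame_traces A m"
  shows "twisted.trace_log A =
    (\<Sum>k | m k \<noteq> 0. fps_const (of_int (m k)) * (euler_fps k - euler_fps (2 * k)))"
proof (rule fps_ext)
  fix e
  show "fps_nth (twisted.trace_log A) e =
      fps_nth (\<Sum>k | m k \<noteq> 0. fps_const (of_int (m k)) * (euler_fps k - euler_fps (2 * k))) e"
  proof (cases "e = 0")
    case True
    then show ?thesis by (simp add: twisted.trace_log_def fps_sum_nth)
  next
    case False
    then have e: "e > 0" by simp
    have "fps_nth (twisted.trace_log A) e =
        (\<Sum>(N, v)\<in>divisor_pairs e. if odd v then of_real (trace (mat_pow A N)) / of_nat N else 0)"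
      using twisted_decompositions[OF e, of "\<lambda>N v. of_real (trace (mat_pow A N)) / of_nat N :: complex"]
      by (simp add: twisted.trace_log_def)
    also have "\<dots> = (\<Sum>k | m k \<noteq> 0. of_int (m k) *
        (\<Sum>(N, v)\<in>divisor_pairs e. (if k dvd N then of_nat k / of_nat N else 0) -
           (if k dvd N \<and> even v then of_nat k / of_nat N else 0)))"
    proof -
      have "(\<Sum>(N, v)\<in>divisor_pairs e. if odd v then of_real (trace (mat_pow A N)) / of_nat N else 0) =
          (\<Sum>(N, v)\<in>divisor_pairs e. \<Sum>k | m k \<noteq> 0. of_int (m k) *
             ((if k dvd N then of_nat k / of_nat N else 0) -
              (if k dvd N \<and> even v then of_nat k / of_nat N else (0 :: complex))))"
        unfolding frame_traces_pow[OF assms]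
        by (intro sum.cong refl) (auto simp: sum_divide_distrib intro!: sum.cong)
      then show ?thesis
        unfolding sum_distrib_left case_prod_beta by (subst (asm) sum.swap) simp
    qed
    also have "\<dots> = (\<Sum>k | m k \<noteq> 0. of_int (m k) *
        (fps_nth (euler_fps k) e - fps_nth (euler_fps (2 * k)) e))"
    proof (intro sum.cong refl)
      fix k assume "k \<in> {k. m k \<noteq> 0}"
      then have k: "k > 0" using frame_traces_support(2)[OF assms] by simp
      show "of_int (m k) * (\<Sum>(N, v)\<in>divisor_pairs e. (if k dvd N then of_nat k / of_nat N else 0) -
          (if k dvd N \<and> even v then of_nat k / of_nat N else 0)) =
          of_int (m k) * (fps_nth (euler_fps k) e - fps_nth (euler_fps (2 * k)) e)"
        unfolding euler_fps_left[OF e k] euler_fps_left_even[OF e k] by (simp add: case_prod_beta sum_subtractf)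
    qed
    finally show ?thesis by (simp add: fps_sum_nth)
  qed
qed

lemma contraction_untwisted: "untwisted.contraction \<beta> n = - of_real (\<beta> \<bullet> \<beta>) / of_nat (Suc n)"
  by (simp add: untwisted.contraction_def mode_def add.commute)

lemma contraction_twisted: "twisted.contraction \<beta> n = - 2 * of_real (\<beta> \<bullet> \<beta>) / of_nat (Suc (2 * n))"
proof -
  have mode: "mode (1/2) n = real (Suc (2 * n)) / 2" by (simp add: mode_def)
  show ?thesis unfolding twisted.contraction_def mode by simp
qed

text \<open>-(-1)^N = 1 - 2 [N even]. As \<open>euler_log\<close> is minus the logarithm of the
  Euler product, the coefficients 1 and -2 belong to eta(2 \<tau>)^2 / eta(\<tau>), that is, to
  \<open>Theta1\<close>.\<close>

lemma untwisted_insertion_log: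
  "untwisted.insertion_log \<beta> (- 1) =
     fps_const (of_real (\<beta> \<bullet> \<beta>)) * (euler_fps 1 - 2 * euler_fps 2)"
proof (rule fps_ext)
  fix e
  let ?b = "of_real (\<beta> \<bullet> \<beta>) :: complex"
  show "fps_nth (untwisted.insertion_log \<beta> (- 1)) e =
     fps_nth (fps_const ?b * (euler_fps 1 - 2 * euler_fps 2)) e"
  proof (cases "e = 0")
    case True
    then show ?thesis by (simp add: untwisted.insertion_log_def numeral_fps_const)
  next
    case False
    then have e: "e > 0" by simp
    have "fps_nth (untwisted.insertion_log \<beta> (- 1)) e =
        (\<Sum>(N, v)\<in>divisor_pairs e. - ?b / of_nat v * (- 1) ^ N)"
      using untwisted_decompositions[OF e, of "\<lambda>N v. - ?b / of_nat v * (- 1) ^ N"]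
      by (simp add: untwisted.insertion_log_def contraction_untwisted del: of_nat_Suc)
    also have "\<dots> = ?b * ((\<Sum>(N, v)\<in>divisor_pairs e. if 1 dvd N then 1 / of_nat v else 0) -
        2 * (\<Sum>(N, v)\<in>divisor_pairs e. if 2 dvd N then 1 / of_nat v else 0))"
      unfolding sum_distrib_left sum_subtractf[symmetric] case_prod_beta
      by (intro sum.cong refl) auto
    finally show ?thesis
      using e by (simp add: euler_fps_right numeral_fps_const)
  qed
qed

text \<open>The contraction carries a factor 2 because twisted modes are half odd integers. The
  restriction to odd v is -2 for all v and +2 for even v, the latter halved by
  \<open>euler_fps_right_even\<close>; with q^(1/2) as variable this is the pattern of
  \<open>Theta2\<close>.\<close>

lemma twisted_insertion_log_pos:
  "twisted.insertion_log \<beta> 1 = fps_const (of_real (\<beta> \<bullet> \<beta>)) * (euler_fps 2 - 2 * euler_fps 1)"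
proof (rule fps_ext)
  fix e
  let ?b = "of_real (\<beta> \<bullet> \<beta>) :: complex"
  show "fps_nth (twisted.insertion_log \<beta> 1) e =
     fps_nth (fps_const ?b * (euler_fps 2 - 2 * euler_fps 1)) e"
  proof (cases "e = 0")
    case True
    then show ?thesis by (simp add: twisted.insertion_log_def numeral_fps_const)
  next
    case False
    then have e: "e > 0" by simp
    have "fps_nth (twisted.insertion_log \<beta> 1) e =
        (\<Sum>(N, v)\<in>divisor_pairs e. if odd v then - 2 * ?b / of_nat v else 0)"
      using twisted_decompositions[OF e, of "\<lambda>N v. - 2 * ?b / of_nat v"]
      by (simp add: twisted.insertion_log_def contraction_twisted del: of_nat_Suc of_nat_add)
    also have "\<dots> = ?b * (2 * (\<Sum>(N, v)\<in>divisor_pairs e. if 1 dvd N \<and> even v then 1 / of_nat v else 0) -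
        2 * (\<Sum>(N, v)\<in>divisor_pairs e. if 1 dvd N then 1 / of_nat v else 0))"
      unfolding sum_distrib_left sum_subtractf[symmetric] case_prod_beta
      by (intro sum.cong refl) auto
    also have "\<dots> = ?b * (fps_nth (euler_fps (2 * 1)) e - 2 * fps_nth (euler_fps 1) e)"
      by (simp only: euler_fps_right_even[OF e zero_less_one, symmetric]
        euler_fps_right[OF e zero_less_one, symmetric])
    finally show ?thesis
      by (simp add: numeral_fps_const)
  qed
qed

text \<open>Multiplying out (1 - 2 [N even]) (1 - [v even]) gives four sums. The two middle ones
  both lead to index 2 and add up to -1 - 4 = -5, which is the pattern of
  \<open>Theta3\<close>.\<close>

lemma twisted_insertion_log_neg:
  "twisted.insertion_log \<beta> (- 1) =
     fps_const (of_real (\<beta> \<bullet> \<beta>)) * (2 * euler_fps 1 - 5 * euler_fps 2 + 2 * euler_fps 4)"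
proof (rule fps_ext)
  fix e
  let ?b = "of_real (\<beta> \<bullet> \<beta>) :: complex"
  show "fps_nth (twisted.insertion_log \<beta> (- 1)) e =
     fps_nth (fps_const ?b * (2 * euler_fps 1 - 5 * euler_fps 2 + 2 * euler_fps 4)) e"
  proof (cases "e = 0")
    case True
    then show ?thesis by (simp add: twisted.insertion_log_def numeral_fps_const)
  next
    case False
    then have e: "e > 0" by simp
    have "fps_nth (twisted.insertion_log \<beta> (- 1)) e =
        (\<Sum>(N, v)\<in>divisor_pairs e. if odd v then - 2 * ?b / of_nat v * (- 1) ^ N else 0)"
      using twisted_decompositions[OF e, of "\<lambda>N v. - 2 * ?b / of_nat v * (- 1) ^ N"]
      by (simp add: twisted.insertion_log_def contraction_twisted del: of_nat_Suc of_nat_add)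
    also have "\<dots> = ?b * (2 * (\<Sum>(N, v)\<in>divisor_pairs e. if 1 dvd N then 1 / of_nat v else 0) -
        2 * (\<Sum>(N, v)\<in>divisor_pairs e. if 1 dvd N \<and> even v then 1 / of_nat v else 0) -
        4 * (\<Sum>(N, v)\<in>divisor_pairs e. if 2 dvd N then 1 / of_nat v else 0) +
        2 * (2 * (\<Sum>(N, v)\<in>divisor_pairs e. if 2 dvd N \<and> even v then 1 / of_nat v else 0)))"
      unfolding sum_distrib_left sum_subtractf[symmetric] sum.distrib[symmetric] case_prod_beta
      by (intro sum.cong refl) auto
    also have "\<dots> = ?b * (2 * fps_nth (euler_fps 1) e - fps_nth (euler_fps (2 * 1)) e -
        4 * fps_nth (euler_fps 2) e + 2 * fps_nth (euler_fps (2 * 2)) e)"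
      by (simp only: euler_fps_right_even[OF e zero_less_one, symmetric]
        euler_fps_right[OF e zero_less_one, symmetric]
        euler_fps_right_even[OF e zero_less_numeral, symmetric]
        euler_fps_right[OF e zero_less_numeral, symmetric])
    finally show ?thesis
      by (simp add: numeral_fps_const)
  qed
qed

lemma euler_combination_sums:
  assumes "norm z < 1" "\<And>k. k \<in> K \<Longrightarrow> k > 0"
  shows "(\<lambda>e. fps_nth (\<Sum>k\<in>K. fps_const (c k) * euler_fps k) e * z ^ e) sums
    (\<Sum>k\<in>K. c k * euler_log (z ^ k))"
proof -
  have "(\<lambda>e. \<Sum>k\<in>K. c k * (fps_nth (euler_fps k) e * z ^ e)) sums (\<Sum>k\<in>K. c k * euler_log (z ^ k))"
    using assms by (intro sums_sum sums_mult euler_fps_sums) auto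
  then show ?thesis
    by (simp add: fps_sum_nth sum_distrib_right mult.assoc)
qed

theorem untwisted_trace:
  assumes a: "linear a" and ab: "a \<beta> = - \<beta>" and m: "frame_traces (matrix a) m" and z: "norm z < 1"
  shows "(\<lambda>D. fps_nth (untwisted.ftrace (\<lambda>p. E_coeff 1 \<beta> 0 (fock_act a p))) D * z ^ D) sums
    exp ((\<Sum>k | m k \<noteq> 0. of_int (m k) * euler_log (z ^ k)) +
      of_real (\<beta> \<bullet> \<beta>) * (euler_log z - 2 * euler_log (z ^ 2)))"
proof -
  let ?S = "fps_const (of_real (\<beta> \<bullet> \<beta>)) * (euler_fps 1 - 2 * euler_fps 2) :: complex fps"
  let ?G = "(\<Sum>k | m k \<noteq> 0. fps_const (of_int (m k)) * euler_fps k) :: complex fps"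
  have eq: "untwisted.ftrace (\<lambda>p. E_coeff 1 \<beta> 0 (fock_act a p)) = fps_exp 1 oo (?S + ?G)"
    using untwisted.ftrace_E_coeff[OF a, of \<beta> "- 1"] ab
    by (simp add: untwisted_insertion_log untwisted_trace_log[OF m])
  show ?thesis unfolding eq
  proof (rule exp_compose_sums[OF _ _ z])
    fix z :: complex assume z: "norm z < 1"
    have "(\<lambda>e. of_real (\<beta> \<bullet> \<beta>) * (fps_nth (euler_fps 1) e * z ^ e - 2 * (fps_nth (euler_fps 2) e * z ^ e)) +
        fps_nth ?G e * z ^ e) sums
        (of_real (\<beta> \<bullet> \<beta>) * (euler_log (z ^ 1) - 2 * euler_log (z ^ 2)) +
          (\<Sum>k | m k \<noteq> 0. of_int (m k) * euler_log (z ^ k)))"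
      using z frame_traces_support[OF m]
      by (intro sums_add sums_mult sums_diff euler_fps_sums euler_combination_sums) auto
    then show "(\<lambda>e. fps_nth (?S + ?G) e * z ^ e) sums
        ((\<Sum>k | m k \<noteq> 0. of_int (m k) * euler_log (z ^ k)) +
          of_real (\<beta> \<bullet> \<beta>) * (euler_log z - 2 * euler_log (z ^ 2)))"
      by (simp add: numeral_fps_const algebra_simps)
  qed (simp add: fps_sum_nth numeral_fps_const)
qed

lemma twisted_combination:
  fixes S :: "complex fps"
  assumes m: "frame_traces A m" and z: "norm z < 1" and S0: "fps_nth S 0 = 0"
    and S: "\<And>z. norm z < 1 \<Longrightarrow> (\<lambda>e. fps_nth S e * z ^ e) sums s z"
  shows "(\<lambda>e. fps_nth (fps_exp 1 oo (S + twisted.trace_log A)) e * z ^ e) sums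
    exp ((\<Sum>k | m k \<noteq> 0. of_int (m k) * (euler_log (z ^ k) - euler_log (z ^ (2 * k)))) + s z)"
proof -
  have "(\<lambda>e. fps_nth (S + twisted.trace_log A) e * z ^ e) sums
      ((\<Sum>k | m k \<noteq> 0. of_int (m k) * (euler_log (z ^ k) - euler_log (z ^ (2 * k)))) + s z)"
    if z: "norm z < 1" for z
  proof -
    have "(\<lambda>e. (\<Sum>k | m k \<noteq> 0. of_int (m k) * (fps_nth (euler_fps k) e * z ^ e -
        fps_nth (euler_fps (2 * k)) e * z ^ e)) + fps_nth S e * z ^ e) sums
        ((\<Sum>k | m k \<noteq> 0. of_int (m k) * (euler_log (z ^ k) - euler_log (z ^ (2 * k)))) + s z)"
      using z frame_traces_support[OF m]
      by (intro sums_add sums_sum sums_mult sums_diff euler_fps_sums S) auto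
    moreover have "fps_nth (S + twisted.trace_log A) e * z ^ e =
        (\<Sum>k | m k \<noteq> 0. of_int (m k) * (fps_nth (euler_fps k) e * z ^ e -
          fps_nth (euler_fps (2 * k)) e * z ^ e)) + fps_nth S e * z ^ e" for e
      unfolding twisted_trace_log[OF m] by (simp add: fps_sum_nth distrib_right sum_distrib_right
        left_diff_distrib right_diff_distrib mult.assoc)
    ultimately show ?thesis by (simp only:)
  qed
  moreover have "fps_nth (S + twisted.trace_log A) 0 = 0"
    by (simp add: S0 twisted_trace_log[OF m] fps_sum_nth)
  ultimately show ?thesis using z by (rule exp_compose_sums)
qed

text \<open>Here z stands for q^(1/2), as twisted degrees are counted in halves; in
  \<open>untwisted_trace\<close> it stands for q.\<close>

theorem twisted_trace_pos:
  assumes a: "linear a" and ab: "a \<beta> = \<beta>" and m: "frame_traces (matrix a) m" and z: "norm z < 1"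
  shows "(\<lambda>D. fps_nth (twisted.ftrace (\<lambda>p. E_coeff (1/2) \<beta> 0 (fock_act a p))) D * z ^ D) sums
    exp ((\<Sum>k | m k \<noteq> 0. of_int (m k) * (euler_log (z ^ k) - euler_log (z ^ (2 * k)))) +
      of_real (\<beta> \<bullet> \<beta>) * (euler_log (z ^ 2) - 2 * euler_log z))"
proof -
  let ?S = "fps_const (of_real (\<beta> \<bullet> \<beta>)) * (euler_fps 2 - 2 * euler_fps 1) :: complex fps"
  have eq: "twisted.ftrace (\<lambda>p. E_coeff (1/2) \<beta> 0 (fock_act a p)) =
      fps_exp 1 oo (?S + twisted.trace_log (matrix a))"
    using twisted.ftrace_E_coeff[OF a, of \<beta> 1] ab by (simp add: twisted_insertion_log_pos)
  show ?thesis unfolding eq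
  proof (rule twisted_combination[OF m z])
    fix z :: complex assume z: "norm z < 1"
    have "(\<lambda>e. of_real (\<beta> \<bullet> \<beta>) * (fps_nth (euler_fps 2) e * z ^ e - 2 * (fps_nth (euler_fps 1) e * z ^ e)))
        sums (of_real (\<beta> \<bullet> \<beta>) * (euler_log (z ^ 2) - 2 * euler_log (z ^ 1)))"
      using z by (intro sums_mult sums_diff euler_fps_sums) auto
    then show "(\<lambda>e. fps_nth ?S e * z ^ e) sums
        (of_real (\<beta> \<bullet> \<beta>) * (euler_log (z ^ 2) - 2 * euler_log z))"
      by (simp add: numeral_fps_const algebra_simps)
  qed (simp add: numeral_fps_const)
qed

theorem twisted_trace_neg:
  assumes a: "linear a" and ab: "a \<beta> = - \<beta>" and m: "frame_traces (matrix a) m" and z: "norm z < 1"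
  shows "(\<lambda>D. fps_nth (twisted.ftrace (\<lambda>p. E_coeff (1/2) \<beta> 0 (fock_act a p))) D * z ^ D) sums
    exp ((\<Sum>k | m k \<noteq> 0. of_int (m k) * (euler_log (z ^ k) - euler_log (z ^ (2 * k)))) +
      of_real (\<beta> \<bullet> \<beta>) * (2 * euler_log z - 5 * euler_log (z ^ 2) + 2 * euler_log (z ^ 4)))"
proof -
  let ?S = "fps_const (of_real (\<beta> \<bullet> \<beta>)) * (2 * euler_fps 1 - 5 * euler_fps 2 + 2 * euler_fps 4) :: complex fps"
  have eq: "twisted.ftrace (\<lambda>p. E_coeff (1/2) \<beta> 0 (fock_act a p)) =
      fps_exp 1 oo (?S + twisted.trace_log (matrix a))"
    using twisted.ftrace_E_coeff[OF a, of \<beta> "- 1"] ab by (simp add: twisted_insertion_log_neg)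
  show ?thesis unfolding eq
  proof (rule twisted_combination[OF m z])
    fix z :: complex assume z: "norm z < 1"
    have "(\<lambda>e. of_real (\<beta> \<bullet> \<beta>) * (2 * (fps_nth (euler_fps 1) e * z ^ e) -
          5 * (fps_nth (euler_fps 2) e * z ^ e) + 2 * (fps_nth (euler_fps 4) e * z ^ e)))
        sums (of_real (\<beta> \<bullet> \<beta>) * (2 * euler_log (z ^ 1) - 5 * euler_log (z ^ 2) + 2 * euler_log (z ^ 4)))"
      using z by (intro sums_mult sums_diff sums_add euler_fps_sums) auto
    then show "(\<lambda>e. fps_nth ?S e * z ^ e) sums
        (of_real (\<beta> \<bullet> \<beta>) * (2 * euler_log z - 5 * euler_log (z ^ 2) + 2 * euler_log (z ^ 4)))"
      by (simp add: numeral_fps_const algebra_simps)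
  qed (simp add: numeral_fps_const)
qed

section \<open>Powers of q, theta quotients and eta products\<close>

lemma qpow_add: "qpow \<tau> (x + y) = qpow \<tau> x * qpow \<tau> y"
  by (simp add: qpow_def exp_add[symmetric] algebra_simps)

lemma qpow_0 [simp]: "qpow \<tau> 0 = 1" by (simp add: qpow_def)

lemma qpow_nonzero [simp]: "qpow \<tau> x \<noteq> 0" by (simp add: qpow_def)

lemma qpow_scale: "qpow (of_real c * \<tau>) x = qpow \<tau> (c * x)"
  by (simp add: qpow_def algebra_simps)

lemma qpow_power: "qpow \<tau> x ^ n = qpow \<tau> (real n * x)"
  by (simp add: qpow_def exp_of_nat_mult[symmetric] algebra_simps)

lemma norm_qpow: "norm (qpow \<tau> x) = exp (- 2 * pi * x * Im \<tau>)"
  by (simp add: qpow_def algebra_simps)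

lemma norm_qpow_less_1: "Im \<tau> > 0 \<Longrightarrow> x > 0 \<Longrightarrow> norm (qpow \<tau> x) < 1"
  by (simp add: norm_qpow)

lemma dedekind_eta_eq:
  assumes "Im \<tau> > 0" "c > 0"
  shows "dedekind_eta (of_real c * \<tau>) = qpow \<tau> (c / 24) * exp (- euler_log (qpow \<tau> c))"
proof -
  have "qpow (of_real c * \<tau>) (real (Suc n)) = qpow \<tau> c ^ Suc n" for n
    by (simp only: qpow_scale qpow_power) (simp only: mult.commute)
  then show ?thesis
    unfolding dedekind_eta_def euler_log(2)[OF norm_qpow_less_1[OF assms]]
    by (simp add: qpow_scale)
qed

lemma eta_eqs:
  assumes "Im \<tau> > 0"
  defines "y \<equiv> qpow \<tau> (1 / 2)"
  shows "dedekind_eta \<tau> = qpow \<tau> (1 / 24) * exp (- euler_log (y ^ 2))"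
    and "dedekind_eta (2 * \<tau>) = qpow \<tau> (1 / 12) * exp (- euler_log (y ^ 4))"
    and "dedekind_eta (\<tau> / 2) = qpow \<tau> (1 / 48) * exp (- euler_log y)"
  using dedekind_eta_eq[OF assms(1), of 1] dedekind_eta_eq[OF assms(1), of 2]
    dedekind_eta_eq[OF assms(1), of "1/2"]
  by (simp_all add: y_def qpow_power)

text \<open>The powers of q in front: 2/12 - 1/24 = 1/8 for \<open>Theta1\<close>, whereas 2/48 -
  1/24 and 5/24 - 2/48 - 2/12 both vanish.\<close>

lemma Theta_eqs:
  assumes "Im \<tau> > 0"
  defines "y \<equiv> qpow \<tau> (1 / 2)"
  shows "Theta1 \<tau> / 2 = qpow \<tau> (1 / 8) * exp (euler_log (y ^ 2) - 2 * euler_log (y ^ 4))"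
    and "Theta2 \<tau> = exp (euler_log (y ^ 2) - 2 * euler_log y)"
    and "Theta3 \<tau> = exp (2 * euler_log y - 5 * euler_log (y ^ 2) + 2 * euler_log (y ^ 4))"
proof -
  have pow: "(qpow \<tau> x * exp w) ^ n = qpow \<tau> (real n * x) * exp (of_nat n * w)" for x w n
    by (simp add: power_mult_distrib qpow_power exp_of_nat_mult)
  have quot: "qpow \<tau> x * exp w / (qpow \<tau> x' * exp w') = qpow \<tau> (x - x') * exp (w - w')" for x x' w w'
    using qpow_add[of \<tau> "x - x'" x'] by (simp add: exp_diff)
  have prod: "qpow \<tau> x * exp w * (qpow \<tau> x' * exp w') = qpow \<tau> (x + x') * exp (w + w')" for x x' w w'
    by (simp add: qpow_add exp_add)
  note eta = eta_eqs[OF assms(1), folded y_def]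
  show "Theta1 \<tau> / 2 = qpow \<tau> (1 / 8) * exp (euler_log (y ^ 2) - 2 * euler_log (y ^ 4))"
  proof -
    have "dedekind_eta (2 * \<tau>) ^ 2 / dedekind_eta \<tau> =
        qpow \<tau> (1 / 8) * exp (euler_log (y ^ 2) - 2 * euler_log (y ^ 4))"
      unfolding eta pow quot by (simp add: algebra_simps)
    then show ?thesis by (simp add: Theta1_def)
  qed
  show "Theta2 \<tau> = exp (euler_log (y ^ 2) - 2 * euler_log y)"
    unfolding Theta2_def eta pow quot by (simp add: algebra_simps)
  show "Theta3 \<tau> = exp (2 * euler_log y - 5 * euler_log (y ^ 2) + 2 * euler_log (y ^ 4))"
    unfolding Theta3_def eta pow prod quot by (simp add: algebra_simps)
qed

lemma qpow_sum: "(\<Prod>x\<in>A. qpow \<tau> (f x)) = qpow \<tau> (\<Sum>x\<in>A. f x)"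
  by (induction A rule: infinite_finite_induct) (auto simp: qpow_add)

text \<open>The leading exponent is c/24 times the sum of all k m_k. That sum is the trace of the
  0-th power of the matrix, i.e. the dimension 24, so the exponent is exactly c.\<close>

lemma eta_prod_eq:
  assumes "Im \<tau> > 0" "c > 0" and m: "frame_traces (matrix a) (frame_shape a)"
  shows "eta_prod a (of_real c * \<tau>) = qpow \<tau> c *
    exp (- (\<Sum>k | frame_shape a k \<noteq> 0. of_int (frame_shape a k) * euler_log (qpow \<tau> c ^ k)))"
proof -
  let ?m = "frame_shape a"
  have "dedekind_eta (of_nat k * (of_real c * \<tau>)) powi ?m k =
      qpow \<tau> (c / 24 * real_of_int (of_nat k * ?m k)) * exp (of_int (?m k) * (- euler_log (qpow \<tau> c ^ k)))"
    if "?m k \<noteq> 0" for k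
  proof -
    have k: "k > 0" using frame_traces_support(2)[OF m] that by auto
    have "dedekind_eta (of_real (real k * c) * \<tau>) =
        qpow \<tau> (real k * c / 24) * exp (- euler_log (qpow \<tau> (real k * c)))"
      by (rule dedekind_eta_eq) (use assms k in auto)
    moreover have "qpow \<tau> x powi n = qpow \<tau> (x * real_of_int n)" for x n
      by (simp add: qpow_def exp_power_int algebra_simps)
    ultimately show ?thesis
      by (simp add: qpow_power power_int_mult_distrib exp_power_int mult_ac)
  qed
  then have "eta_prod a (of_real c * \<tau>) = (\<Prod>k | ?m k \<noteq> 0.
      qpow \<tau> (c / 24 * real_of_int (of_nat k * ?m k)) * exp (of_int (?m k) * (- euler_log (qpow \<tau> c ^ k))))"
    unfolding eta_prod_def by (intro prod.cong) auto
  also have "\<dots> = qpow \<tau> (c / 24 * (\<Sum>k | ?m k \<noteq> 0. real_of_int (of_nat k * ?m k))) *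
      exp (\<Sum>k | ?m k \<noteq> 0. of_int (?m k) * (- euler_log (qpow \<tau> c ^ k)))"
    using frame_traces_support(1)[OF m]
    by (simp add: prod.distrib qpow_sum exp_sum sum_distrib_left)
  also have "(\<Sum>k | ?m k \<noteq> 0. real_of_int (of_nat k * ?m k)) = trace (mat_pow (matrix a) 0)"
  proof -
    have "trace (mat_pow (matrix a) 0) = (\<Sum>k | ?m k \<noteq> 0 \<and> k dvd 0. real_of_int (of_nat k * ?m k))"
      using m unfolding frame_traces_def by blast
    then show ?thesis by simp
  qed
  also have "\<dots> = 24" by (simp add: trace_I)
  finally show ?thesis by (simp add: sum_negf)
qed

section \<open>Power sums of eigenvalues as traces\<close>

lemma det_poly: "poly (det M) x = det (\<chi> i j. poly (M $ i $ j) x)"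
  by (simp add: det_def poly_sum poly_prod)

lemma fps_of_poly_of_int: "fps_of_poly (of_int n) = of_int n"
proof -
  have "fps_of_poly [:of_int n:] = fps_const (of_int n)" by (rule fps_of_poly_const)
  then show ?thesis by (simp add: of_int_poly fps_of_int)
qed

lemma det_fps_of_poly: "fps_of_poly (det M) = det (\<chi> i j. fps_of_poly (M $ i $ j))"
  by (simp add: det_def fps_of_poly_sum fps_of_poly_mult fps_of_poly_prod fps_of_poly_of_int)

lemma det_smult_entries:
  fixes C :: "'a::comm_ring_1 ^ 'n ^ 'n"
  shows "det (\<chi> i j. c * C $ i $ j) = c ^ CARD('n) * det C"
  by (simp add: det_def prod.distrib sum_distrib_left mult.left_commute)

lemma fps_deriv_prod:
  fixes f :: "'i \<Rightarrow> complex fps"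
  assumes "finite S"
  shows "fps_deriv (\<Prod>i\<in>S. f i) = (\<Sum>i\<in>S. fps_deriv (f i) * (\<Prod>j\<in>S - {i}. f j))"
  using assms
proof (induction S)
  case (insert x S)
  have "(\<Sum>i\<in>S. fps_deriv (f i) * (\<Prod>j\<in>insert x S - {i}. f j)) =
      (\<Sum>i\<in>S. f x * (fps_deriv (f i) * (\<Prod>j\<in>S - {i}. f j)))"
  proof (intro sum.cong refl)
    fix i assume "i \<in> S"
    then have "insert x S - {i} = insert x (S - {i})" using insert by auto
    then show "fps_deriv (f i) * (\<Prod>j\<in>insert x S - {i}. f j) =
        f x * (fps_deriv (f i) * (\<Prod>j\<in>S - {i}. f j))"
      using insert by simp
  qed
  moreover have "insert x S - {x} = S" using insert by auto
  ultimately show ?case using insert by (simp add: sum_distrib_left)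
qed simp

lemma fps_deriv_det:
  fixes B :: "complex fps ^ 'n ^ 'n"
  shows "fps_deriv (det B) =
    (\<Sum>i\<in>UNIV. det (\<chi> r. if r = i then (\<chi> c. fps_deriv (B $ i $ c)) else B $ r))"
proof -
  have prod: "(\<Prod>r\<in>UNIV. (\<chi> r. if r = i then (\<chi> c. fps_deriv (B $ i $ c)) else B $ r) $ r $ p r) =
      fps_deriv (B $ i $ p i) * (\<Prod>r\<in>UNIV - {i}. B $ r $ p r)" for i and p :: "'n \<Rightarrow> 'n"
  proof -
    have "(\<Prod>r\<in>UNIV. (\<chi> r. if r = i then (\<chi> c. fps_deriv (B $ i $ c)) else B $ r) $ r $ p r) =
        fps_deriv (B $ i $ p i) *
        (\<Prod>r\<in>UNIV - {i}. (\<chi> r. if r = i then (\<chi> c. fps_deriv (B $ i $ c)) else B $ r) $ r $ p r)"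
      by (subst prod.remove[of _ i]) auto
    also have "(\<Prod>r\<in>UNIV - {i}. (\<chi> r. if r = i then (\<chi> c. fps_deriv (B $ i $ c)) else B $ r) $ r $ p r) =
        (\<Prod>r\<in>UNIV - {i}. B $ r $ p r)"
      by (intro prod.cong) auto
    finally show ?thesis .
  qed
  have "fps_deriv (of_int k * f) = of_int k * fps_deriv f" for k and f :: "complex fps"
    by simp
  then show ?thesis
    unfolding det_def prod fps_deriv_sum
    by (simp add: fps_deriv_prod sum_distrib_left del: fps_deriv_mult) (rule sum.swap)
qed

text \<open>Every row other than the i-th yields a determinant with two equal rows. Together with
  \<open>fps_deriv_det\<close> this evaluates the derivative of a determinant without
  adjugates.\<close>

lemma det_row_combination:
  fixes B :: "'a::comm_ring_1 ^ 'n ^ 'n"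
  shows "det (\<chi> r. if r = i then \<Sum>k\<in>UNIV. c k *s B $ k else B $ r) = c i * det B"
proof -
  have "det (\<chi> r. if r = i then \<Sum>k\<in>UNIV. c k *s B $ k else B $ r) =
      (\<Sum>k\<in>UNIV. c k * det (\<chi> r. if r = i then B $ k else B $ r))"
    by (simp add: det_linear_row_sum[of UNIV _ "\<lambda>_ k. c k *s B $ k"] det_row_mul[of _ _ "\<lambda>_. B $ _"])
  also have "\<dots> = (\<Sum>k\<in>UNIV. if k = i then c k * det B else 0)"
  proof (intro sum.cong refl)
    fix k
    show "c k * det (\<chi> r. if r = i then B $ k else B $ r) = (if k = i then c k * det B else 0)"
    proof (cases "k = i")
      case True
      then have "(\<chi> r. if r = i then B $ k else B $ r) = B" by (simp add: vec_eq_iff)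
      then show ?thesis using True by simp
    next
      case False
      then have "det (\<chi> r. if r = i then B $ k else B $ r) = 0"
        by (intro det_identical_rows[of k i]) (auto simp: row_def)
      then show ?thesis using False by simp
    qed
  qed
  finally show ?thesis by simp
qed

section \<open>Characteristic polynomial, its reversal, and power sums of eigenvalues\<close>

lemma mat_pow_Suc_left: "mat_pow A (Suc m) = A ** mat_pow A m"
  by (induction m) (simp_all add: matrix_mul_assoc[symmetric])

lemma mat_pow_add: "mat_pow A (m + n) = mat_pow A m ** mat_pow A n"
  by (induction n) (simp_all add: matrix_mul_assoc)

lemma mat_pow_mult: "mat_pow A (m * n) = mat_pow (mat_pow A m) n"
  by (induction n) (simp_all add: mat_pow_add add.commute[of m])

definition cpoly :: "complex ^ 'n ^ 'n \<Rightarrow> complex poly" where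
  "cpoly A = det (\<chi> i j. (if i = j then [:0, 1:] else 0) - [:A $ i $ j:])"

lemma poly_cpoly: "poly (cpoly A) x = det (\<chi> i j. (if i = j then x else 0) - A $ i $ j)"
  unfolding cpoly_def det_poly by (rule arg_cong[of _ _ det]) (simp add: vec_eq_iff)

text \<open>The reciprocal \<open>det (1 - y A)\<close> of the characteristic polynomial.\<close>

definition rpoly :: "complex ^ 'n ^ 'n \<Rightarrow> complex poly" where
  "rpoly A = det (\<chi> i j. (if i = j then 1 else 0) - [:0, A $ i $ j:])"

lemma poly_rpoly: "poly (rpoly A) y = det (\<chi> i j. (if i = j then 1 else 0) - y * A $ i $ j)"
  unfolding rpoly_def det_poly by (rule arg_cong[of _ _ det]) (simp add: vec_eq_iff)

lemma poly_rpoly_0: "poly (rpoly A) 0 = 1"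
proof -
  have "(\<chi> i j. (if i = j then 1 else 0) - 0 * A $ i $ j) = mat 1"
    by (simp add: vec_eq_iff mat_def)
  then show ?thesis unfolding poly_rpoly by (simp only: det_I)
qed

lemma rpoly_cpoly:
  fixes A :: "complex ^ 'n ^ 'n"
  assumes "y \<noteq> 0"
  shows "poly (rpoly A) y = y ^ CARD('n) * poly (cpoly A) (1 / y)"
  unfolding poly_rpoly poly_cpoly det_smult_entries[symmetric]
  by (rule arg_cong[of _ _ det]) (use assms in \<open>auto simp: vec_eq_iff right_diff_distrib\<close>)

text \<open>Instead of estimating degrees in the expansion of the determinant, degree and leading
  coefficient are read off from y^r \<open>rpoly\<close> = c y^n Q, with r the number of roots. Both
  \<open>rpoly\<close> and Q are 1 at 0: comparing orders at 0 gives r = n, and comparing values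
  there gives c = 1.\<close>

lemma cpoly_rpoly_roots:
  fixes A :: "complex ^ 'n ^ 'n"
  shows "lead_coeff (cpoly A) = 1" and "size (proots (cpoly A)) = CARD('n)"
    and "rpoly A = (\<Prod>z\<in>#proots (cpoly A). [:1, - z:])"
proof -
  let ?p = "cpoly A" and ?q = "rpoly A" and ?n = "CARD('n)"
  let ?R = "proots ?p" and ?c = "lead_coeff ?p"
  let ?Q = "\<Prod>z\<in>#?R. [:1, - z:]"
  have Qp: "poly (\<Prod>z\<in>#R. [:1, - z:]) y = y ^ size R * poly (\<Prod>z\<in>#R. [:- z, 1:]) (1 / y)"
    if "y \<noteq> 0" for y and R :: "complex multiset"
    using that by (induction R) (auto simp: field_simps)
  have p: "poly ?p x = ?c * poly (\<Prod>z\<in>#?R. [:- z, 1:]) x" for x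
    by (subst (1) complex_poly_decompose_multiset[of ?p, symmetric]) simp
  have eqy: "poly (monom 1 (size ?R) * ?q) y = poly (smult ?c (monom 1 ?n * ?Q)) y" if "y \<noteq> 0" for y
    using that by (simp add: poly_monom rpoly_cpoly p Qp)
  \<comment> \<open>The identity is known only for nonzero y; an extra factor y makes it hold
    everywhere and is cancelled afterwards.\<close>
  have "poly ([:0, 1:] * (monom 1 (size ?R) * ?q)) y = poly ([:0, 1:] * smult ?c (monom 1 ?n * ?Q)) y" for y
    using eqy[of y] by (cases "y = 0") (simp_all only: poly_mult[of "[:0, 1:]"], simp_all)
  then have "[:0, 1:] * (monom 1 (size ?R) * ?q) = [:0, 1:] * smult ?c (monom 1 ?n * ?Q)"
    by (intro iffD1[OF poly_eq_poly_eq_iff] ext)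
  then have eq: "monom 1 (size ?R) * ?q = smult ?c (monom 1 ?n * ?Q)"
    by (simp only: mult_left_cancel mult_smult_right[symmetric] pCons_eq_0_iff one_neq_zero
      zero_neq_one simp_thms)
  have Q0: "poly ?Q 0 = 1"
    by (simp add: poly_prod_mset)
  have "?c \<noteq> 0"
  proof
    assume "?c = 0"
    then have "?q = 0" using eq by (simp add: monom_eq_0_iff)
    then show False using poly_rpoly_0[of A] by simp
  qed
  have order0: "Polynomial.order 0 f = 0" if "poly f 0 = 1" for f :: "complex poly"
    using that by (intro order_0I) simp
  have "Polynomial.order 0 (monom 1 (size ?R) * ?q) = size ?R"
    using poly_rpoly_0[of A] by (subst order_mult) (auto simp: order0 monom_eq_0_iff)
  moreover have "Polynomial.order 0 (smult ?c (monom 1 ?n * ?Q)) = ?n"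
    using Q0 \<open>?c \<noteq> 0\<close> by (subst order_smult, simp, subst order_mult) (auto simp: order0 monom_eq_0_iff)
  ultimately have "size ?R = ?n" using eq by simp
  then have q: "?q = smult ?c ?Q"
    using eq by (metis mult_left_cancel mult_smult_right monom_eq_0_iff one_neq_zero)
  have "?c = 1"
    using poly_rpoly_0[of A] Q0 unfolding q by simp
  then show "?c = 1" "?q = ?Q" "size ?R = ?n" using q \<open>size ?R = ?n\<close> by simp_all
qed

text \<open>Jacobi's formula in disguise: with B = 1 - y A and C = -A (1 - y A)^(-1), expanded as a
  geometric series, the derivative of B is C B. So each differentiated row is a combination of the
  rows of B, and only the diagonal entries of C survive in the determinant.\<close>

lemma fps_deriv_rpoly:
  fixes A :: "complex ^ 'n ^ 'n"
  shows "fps_deriv (fps_of_poly (rpoly A)) =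
    - Abs_fps (\<lambda>m. trace (mat_pow A (Suc m))) * fps_of_poly (rpoly A)"
proof -
  define B :: "complex fps ^ 'n ^ 'n" where
    "B = (\<chi> i j. (if i = j then 1 else 0) - fps_const (A $ i $ j) * fps_X)"
  define C :: "'n \<Rightarrow> 'n \<Rightarrow> complex fps" where
    "C i k = - Abs_fps (\<lambda>m. mat_pow A (Suc m) $ i $ k)" for i k
  have q: "fps_of_poly (rpoly A) = det B"
    unfolding rpoly_def det_fps_of_poly B_def
    by (rule arg_cong[of _ _ det]) (simp add: vec_eq_iff fps_of_poly_diff fps_of_poly_pCons)
  have row: "(\<chi> c. fps_deriv (B $ i $ c)) = (\<Sum>k\<in>UNIV. C i k *s B $ k)" for i
  proof (subst vec_eq_iff, intro allI fps_ext)
    fix j m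
    have "fps_nth ((\<Sum>k\<in>UNIV. C i k *s B $ k) $ j) m =
        (\<Sum>k\<in>UNIV. fps_nth (C i k * (if k = j then 1 else 0)) m - fps_nth (C i k * fps_const (A $ k $ j) * fps_X) m)"
      by (simp add: B_def fps_sum_nth right_diff_distrib mult.assoc)
    also have "\<dots> = fps_nth (C i j) m - (\<Sum>k\<in>UNIV. fps_nth (C i k * fps_const (A $ k $ j) * fps_X) m)"
      by (simp add: sum_subtractf if_distrib[of "\<lambda>x. fps_nth (C i _ * x) m"] cong: if_cong)
    also have "(\<Sum>k\<in>UNIV. fps_nth (C i k * fps_const (A $ k $ j) * fps_X) m) =
        (if m = 0 then 0 else \<Sum>k\<in>UNIV. - (mat_pow A m $ i $ k * A $ k $ j))"
      by (cases m) (simp_all add: C_def)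
    also have "\<dots> = (if m = 0 then 0 else - (mat_pow A (Suc m) $ i $ j))"
      by (simp add: matrix_matrix_mult_def sum_negf)
    finally show "fps_nth ((\<chi> c. fps_deriv (B $ i $ c)) $ j) m =
        fps_nth ((\<Sum>k\<in>UNIV. C i k *s B $ k) $ j) m"
      by (simp add: B_def C_def)
  qed
  have "fps_deriv (det B) = (\<Sum>i\<in>UNIV. C i i * det B)"
    unfolding fps_deriv_det row det_row_combination ..
  also have "\<dots> = (\<Sum>i\<in>UNIV. C i i) * det B"
    by (simp add: sum_distrib_right)
  also have "(\<Sum>i\<in>UNIV. C i i) = - Abs_fps (\<lambda>m. trace (mat_pow A (Suc m)))"
    by (rule fps_ext) (simp add: C_def fps_sum_nth trace_def sum_negf del: mat_pow.simps)
  finally show ?thesis unfolding q .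
qed

text \<open>Both sides are coefficients of the logarithmic derivative of \<open>rpoly\<close>,
  computed once from the matrix and once from its linear factors; this replaces a triangular form.
  Exponent 0 is the number of eigenvalues.\<close>

theorem trace_mat_pow_eq_power_sum:
  fixes A :: "complex ^ 'n ^ 'n"
  shows "trace (mat_pow A j) = (\<Sum>z\<in>#proots (cpoly A). z ^ j)"
proof (cases j)
  case 0
  then show ?thesis using cpoly_rpoly_roots(2)[of A] by (simp add: trace_I)
next
  case (Suc m)
  let ?D = "\<lambda>R :: complex multiset. fps_of_poly (\<Prod>z\<in>#R. [:1, - z:])"
  have D: "fps_deriv (?D R) = - Abs_fps (\<lambda>m. \<Sum>z\<in>#R. z ^ Suc m) * ?D R" for R
  proof (induction R)
    case empty
    have "Abs_fps (\<lambda>m. 0) = (0 :: complex fps)" by (simp add: fps_eq_iff)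
    then show ?case by simp
  next
    case (add z R)
    let ?S = "Abs_fps (\<lambda>m. \<Sum>z\<in>#R. z ^ Suc m)" and ?G = "Abs_fps (\<lambda>m. z ^ Suc m)"
    have ring: "L * (- S * D) + - G * L * D = - (G + S) * (L * D)" for L S D G :: "complex fps"
      by (simp add: algebra_simps)
    define L :: "complex fps" where "L = 1 - fps_const z * fps_X"
    have lin: "fps_of_poly [:1, - z:] = L"
      by (simp add: L_def fps_of_poly_pCons fps_eq_iff)
    have GL: "?G * L = fps_const z" unfolding L_def
    proof (rule fps_ext)
      fix k
      show "fps_nth (?G * (1 - fps_const z * fps_X)) k = fps_nth (fps_const z) k"
        by (cases k) (simp_all add: right_diff_distrib mult.assoc[symmetric] mult.commute[of _ "fps_const z"])
    qed
    have "fps_deriv L = - ?G * L" unfolding mult_minus_left GL by (simp add: L_def)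
    then have "fps_deriv (L * ?D R) = L * (- ?S * ?D R) + - ?G * L * ?D R"
      by (simp only: fps_deriv_mult add)
    also have "\<dots> = - (?G + ?S) * (L * ?D R)"
      by (rule ring)
    finally have "fps_deriv (fps_of_poly [:1, - z:] * ?D R) =
        - (?G + ?S) * (fps_of_poly [:1, - z:] * ?D R)"
      by (simp only: lin)
    moreover have GS: "?G + ?S = Abs_fps (\<lambda>m. \<Sum>z\<in>#add_mset z R. z ^ Suc m)"
      by (simp add: fps_eq_iff)
    ultimately show ?case
      unfolding image_mset_add_mset prod_mset.add_mset fps_of_poly_mult GS[symmetric] by (simp only:)
  qed
  have "Abs_fps (\<lambda>m. trace (mat_pow A (Suc m))) * fps_of_poly (rpoly A) =
      Abs_fps (\<lambda>m. \<Sum>z\<in>#proots (cpoly A). z ^ Suc m) * fps_of_poly (rpoly A)"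
    using fps_deriv_rpoly[of A] D[of "proots (cpoly A)"] by (simp add: cpoly_rpoly_roots(3)[symmetric])
  moreover have "fps_of_poly (rpoly A) \<noteq> 0"
    using poly_rpoly_0[of A] by (metis fps_of_poly_0 fps_of_poly_eq_iff poly_0 zero_neq_one)
  ultimately have "Abs_fps (\<lambda>m. trace (mat_pow A (Suc m))) =
      Abs_fps (\<lambda>m. \<Sum>z\<in>#proots (cpoly A). z ^ Suc m)"
    by simp
  then show ?thesis by (simp only: Suc fps_eq_iff fps_nth_Abs_fps)
qed

lemma cpoly_root_eigenvector:
  fixes A :: "complex ^ 'n ^ 'n"
  assumes "z \<in># proots (cpoly A)"
  obtains v where "v \<noteq> 0" "A *v v = z *s v"
proof -
  have "cpoly A \<noteq> 0" using cpoly_rpoly_roots(1)[of A] by auto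
  then have "poly (cpoly A) z = 0" using assms by simp
  then have det0: "det (mat z - A) = 0"
    unfolding poly_cpoly by (simp add: mat_def minus_vec_def vec_eq_iff cong: if_cong)
  have "\<not> (\<exists>B. B ** (mat z - A) = mat 1)"
    using det0 by (metis det_I det_mul mult_zero_right zero_neq_one)
  then obtain v where v: "(mat z - A) *v v = 0" "v \<noteq> 0"
    by (auto simp: matrix_left_invertible_ker)
  have "mat z *v v = z *s v"
    by (simp add: vec_eq_iff matrix_vector_mult_def mat_def if_distrib[of "\<lambda>x. x * _"] cong: if_cong)
  then have "A *v v = z *s v"
    using v(1) by (simp add: matrix_vector_mult_diff_rdistrib)
  then show ?thesis using that v(2) by blast
qed

lemma cpoly_root_of_unity:
  assumes "z \<in># proots (cpoly A)" "mat_pow A M = mat 1"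
  shows "z ^ M = 1"
proof -
  obtain v where v: "v \<noteq> 0" "A *v v = z *s v" using cpoly_root_eigenvector[OF assms(1)] .
  have "mat_pow A j *v v = z ^ j *s v" for j
  proof (induction j)
    case (Suc j)
    have "mat_pow A (Suc j) *v v = A *v (z ^ j *s v)"
      by (simp only: mat_pow_Suc_left matrix_vector_mul_assoc[symmetric] Suc)
    also have "\<dots> = z ^ j *s (A *v v)" by (rule vector_scalar_commute)
    finally show ?case by (simp add: v(2) vector_smult_assoc mult.commute)
  qed simp
  then have "v = z ^ M *s v" using assms(2) by (metis matrix_vector_mul_lid)
  then have "v $ i = z ^ M * v $ i" for i by (metis vector_smult_component)
  then show ?thesis using v(1) by (auto simp: vec_eq_iff)
qed

section \<open>Frame shapes of integral matrices of finite order\<close>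

text \<open>For an integral matrix \<open>N\<close> and a prime \<open>p\<close>, rotating the closed paths of length \<open>p\<close> shows
  \<open>tr N\<^sup>p \<equiv> tr N (mod p)\<close>. If \<open>N\<close> has order \<open>M\<close>, traces of powers are bounded, so every exponent coprime
  to \<open>M\<close> can be represented by one with only large prime factors, for which the congruence is an
  equality. Hence eigenvalues of equal order have equal multiplicity, with no Galois theory, and
  the Frame shape exists.\<close>

lemma funpow_prime_period:
  assumes p: "prime p" and x: "(f ^^ p) x = x" and ij: "i < j" "j < p" "(f ^^ i) x = (f ^^ j) x"
  shows "f x = x"
proof -
  let ?d = "j - i"
  have period: "(f ^^ (p * k)) x = x" for k
    by (induction k) (simp_all add: x funpow_add)
  have "(f ^^ ?d) x = x"
  proof -
    have "(f ^^ (p - i)) ((f ^^ i) x) = (f ^^ (p - i)) ((f ^^ j) x)" using ij by simp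
    then have "(f ^^ (p - i + i)) x = (f ^^ (p - i + j)) x" by (simp only: funpow_add o_apply)
    moreover have "p - i + i = p" "p - i + j = ?d + p" using ij by auto
    ultimately show ?thesis using x by (metis funpow_add o_apply)
  qed
  then have period': "(f ^^ (?d * k)) x = x" for k
    by (induction k) (simp_all add: funpow_add)
  have "coprime ?d p"
  proof -
    have "\<not> p dvd ?d" using ij by (auto dest!: dvd_imp_le)
    then show ?thesis using prime_imp_coprime[OF p] coprime_commute by blast
  qed
  \<comment> \<open>Both p and j - i are periods, and they are coprime; Bezout makes 1 a
    period.\<close>
  then obtain a b where "?d * a = p * b + 1"
    using ij bezout_nat[of ?d p] by (auto simp: coprime_imp_gcd_eq_1)
  then have "(f ^^ (1 + p * b)) x = x" using period'[of a] by (simp add: add.commute)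
  then show ?thesis using period[of b] by (simp only: funpow_add o_apply) simp
qed

text \<open>The map f generates an action of a cyclic group of prime order, so orbits have 1 or p
  elements. A nontrivial orbit R contributes p times a constant and is removed; induction handles
  the remaining set.\<close>

lemma sum_cong_fixed_points:
  fixes F :: "'a \<Rightarrow> int"
  assumes "finite S" and p: "prime p"
    and "f ` S \<subseteq> S" "\<And>x. x \<in> S \<Longrightarrow> (f ^^ p) x = x" "\<And>x. x \<in> S \<Longrightarrow> F (f x) = F x"
  shows "[(\<Sum>x\<in>S. F x) = (\<Sum>x | x \<in> S \<and> f x = x. F x)] (mod int p)"
  using assms(1,3-)
proof (induction S rule: finite_psubset_induct)
  case (psubset S)
  show ?case
  proof (cases "\<forall>x\<in>S. f x = x")
    case True
    then have "{x. x \<in> S \<and> f x = x} = S" by auto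
    then show ?thesis by simp
  next
    case False
    then obtain x where x: "x \<in> S" "f x \<noteq> x" by auto
    define R where "R = (\<lambda>k. (f ^^ k) x) ` {..<p}"
    have p0: "p > 0" using p by (simp add: prime_gt_0_nat)
    have in_S: "(f ^^ k) x \<in> S" and F_k: "F ((f ^^ k) x) = F x" for k
      using psubset.prems x by (induction k) auto
    have inj: "inj_on (\<lambda>k. (f ^^ k) x) {..<p}"
    proof (rule linorder_inj_onI)
      fix i j assume ij: "i < j" "i \<in> {..<p}" "j \<in> {..<p}"
      show "(f ^^ i) x \<noteq> (f ^^ j) x"
        using funpow_prime_period[OF p psubset.prems(2)[OF x(1)] ij(1)] ij x(2) by auto
    qed auto
    have R_sub: "R \<subseteq> S" using in_S by (auto simp: R_def)
    have fR: "f y \<in> R" if "y \<in> R" for y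
    proof -
      obtain k where k: "k < p" "y = (f ^^ k) x" using \<open>y \<in> R\<close> by (auto simp: R_def)
      show ?thesis
      proof (cases "Suc k < p")
        case True
        then show ?thesis using k by (auto simp: R_def intro!: image_eqI[of _ _ "Suc k"])
      next
        case False
        then have "Suc k = p" using k by simp
        then have "f y = x" using psubset.prems(2)[OF x(1)] k by auto
        then show ?thesis using p0 by (auto simp: R_def intro!: image_eqI[of _ _ 0])
      qed
    qed
    have fp: "f y \<noteq> y" if y: "y \<in> R" for y
    proof
      assume eq: "f y = y"
      obtain k where k: "k < p" "y = (f ^^ k) x" using y by (auto simp: R_def)
      have "(f ^^ i) y = y" for i by (induction i) (auto simp: eq)
      then have "y = (f ^^ (p - k)) y" by simp
      also have "\<dots> = (f ^^ (p - k + k)) x" by (simp only: k funpow_add o_apply)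
      also have "\<dots> = x" using k psubset.prems(2)[OF x(1)] by simp
      finally show False using eq x(2) by simp
    qed
    have inv: "f y \<in> S - R" if y: "y \<in> S - R" for y
    proof -
      have "f y \<notin> R"
      proof
        assume "f y \<in> R"
        then have "(f ^^ k) (f y) \<in> R" for k by (induction k) (auto intro: fR)
        from this[of "p - 1"] have "(f ^^ Suc (p - 1)) y \<in> R" by (simp only: funpow_Suc_right o_apply)
        then show False using y psubset.prems(2)[of y] p0 by simp
      qed
      then show ?thesis using y psubset.prems(1) by auto
    qed
    have "R \<noteq> {}" using p0 by (auto simp: R_def)
    then have "[(\<Sum>x\<in>S - R. F x) = (\<Sum>x | x \<in> S - R \<and> f x = x. F x)] (mod int p)"
      using R_sub inv psubset.prems(2,3) by (intro psubset.IH) auto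
    moreover have "{x. x \<in> S - R \<and> f x = x} = {x. x \<in> S \<and> f x = x}" using fp by auto
    moreover have "(\<Sum>y\<in>R. F y) = int p * F x"
      by (simp add: R_def sum.reindex[OF inj] F_k)
    moreover have "(\<Sum>y\<in>S. F y) = (\<Sum>y\<in>S - R. F y) + (\<Sum>y\<in>R. F y)"
      using R_sub psubset.hyps(1) by (rule sum.subset_diff)
    ultimately show ?thesis by (simp add: cong_def)
  qed
qed

text \<open>The list holds the interior vertices only, so a list of length k describes a path of k +
  1 steps.\<close>

fun path_weight :: "'a::comm_ring_1 ^ 'n ^ 'n \<Rightarrow> 'n \<Rightarrow> 'n list \<Rightarrow> 'n \<Rightarrow> 'a" where
  "path_weight N i [] j = N $ i $ j"
| "path_weight N i (x # xs) j = N $ i $ x * path_weight N x xs j"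

lemma path_weight_append: "path_weight N i (xs @ [x]) j = path_weight N i xs x * N $ x $ j"
  by (induction xs arbitrary: i) (auto simp: mult.assoc)

lemma finite_lists_of_length: "finite {xs :: 'n::finite list. length xs = k}"
  using finite_lists_length_eq[of "UNIV :: 'n set" k] by simp

lemma lists_Suc: "{xs. length xs = Suc k} = (\<lambda>(x, xs). x # xs) ` (UNIV \<times> {xs. length xs = k})"
  by (auto simp: length_Suc_conv image_iff)

lemma sum_lists_Suc:
  "(\<Sum>w | length w = Suc k. f w) = (\<Sum>x\<in>(UNIV :: 'n::finite set). \<Sum>xs | length xs = k. f (x # xs))"
proof -
  have "inj_on (\<lambda>(x, xs). x # xs) (UNIV \<times> {xs :: 'n list. length xs = k})" by (auto simp: inj_on_def)
  from sum.reindex[OF this, of f] show ?thesis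
    unfolding lists_Suc by (simp add: sum.cartesian_product case_prod_beta o_def)
qed

lemma mat_pow_paths: "mat_pow N (Suc k) $ i $ j = (\<Sum>xs | length xs = k. path_weight N i xs j)"
proof (induction k arbitrary: i)
  case 0
  have "{xs :: 'b list. length xs = 0} = {[]}" by auto
  then show ?case by (simp add: matrix_mul_lid)
next
  case (Suc k)
  have "mat_pow N (Suc (Suc k)) $ i $ j = (\<Sum>x\<in>UNIV. N $ i $ x * mat_pow N (Suc k) $ x $ j)"
    by (subst mat_pow_Suc_left) (simp add: matrix_matrix_mult_def)
  then show ?case
    unfolding Suc sum_lists_Suc by (simp add: sum_distrib_left)
qed

text \<open>The closed path through w, based at its first element; meant for nonempty w.\<close>

definition cycle_weight :: "'a::comm_ring_1 ^ 'n ^ 'n \<Rightarrow> 'n list \<Rightarrow> 'a" where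
  "cycle_weight N w = path_weight N (hd w) (tl w) (hd w)"

lemma trace_mat_pow_cycles: "trace (mat_pow N (Suc k)) = (\<Sum>w | length w = Suc k. cycle_weight N w)"
  unfolding sum_lists_Suc trace_def mat_pow_paths by (simp add: cycle_weight_def)

lemma cycle_weight_rotate1: "cycle_weight N (rotate1 w) = cycle_weight N w"
proof (cases w)
  case (Cons x xs)
  then show ?thesis
    by (cases xs) (auto simp: cycle_weight_def path_weight_append mult.commute)
qed simp

lemma rotate1_fixed: "rotate1 w = w \<longleftrightarrow> (\<exists>x. w = replicate (length w) x)"
proof
  assume eq: "rotate1 w = w"
  show "\<exists>x. w = replicate (length w) x"
  proof (cases w)
    case (Cons x xs)
    have "w ! k = x" if "k < length w" for k
      using that
    proof (induction k)
      case (Suc k)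
      have "w ! k = rotate1 w ! k" using eq by simp
      also have "\<dots> = w ! (Suc k mod length w)" using Suc by (intro nth_rotate1) simp
      finally show ?case using Suc by simp
    qed (simp add: Cons)
    then have "w = replicate (length w) x" by (auto simp: list_eq_iff_nth_eq)
    then show ?thesis by blast
  qed simp
next
  assume "\<exists>x. w = replicate (length w) x"
  then obtain x where "w = replicate (length w) x" by blast
  moreover have "rotate1 (replicate k x) = replicate k x" for k
    by (cases k) (simp_all add: replicate_append_same)
  ultimately show "rotate1 w = w" by metis
qed

text \<open>Fermat's little theorem by counting necklaces: among the words of length p over b
  letters, exactly the b constant ones are fixed by rotation. The number a is first replaced by its
  residue b, which can be counted with.\<close>

lemma cong_power_prime:
  fixes a :: int
  assumes p: "prime p"
  shows "[a ^ p = a] (mod int p)"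
proof -
  define b where "b = nat (a mod int p)"
  have p0: "p > 0" using p by (simp add: prime_gt_0_nat)
  let ?S = "{w. set w \<subseteq> {..<b} \<and> length w = p}"
  have "(rotate1 ^^ p) w = w" if "length w = p" for w :: "nat list"
    unfolding rotate_def[symmetric] by (rule rotate_id) (simp add: that)
  then have "[(\<Sum>w\<in>?S. 1) = (\<Sum>w | w \<in> ?S \<and> rotate1 w = w. 1)] (mod int p)"
    by (intro sum_cong_fixed_points[OF _ p]) (auto simp: finite_lists_length_eq)
  moreover have "{w. w \<in> ?S \<and> rotate1 w = w} = (\<lambda>x. replicate p x) ` {..<b}"
  proof (intro equalityI subsetI)
    fix w assume w: "w \<in> {w. w \<in> ?S \<and> rotate1 w = w}"
    then obtain x where x: "w = replicate p x" by (auto simp: rotate1_fixed)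
    then have "x < b" using w p0 by auto
    then show "w \<in> (\<lambda>x. replicate p x) ` {..<b}" using x by blast
  qed (auto simp: rotate1_fixed)
  moreover have "inj (\<lambda>x :: nat. replicate p x)" using p0 by (auto simp: inj_def)
  then have "card ((\<lambda>x. replicate p x) ` {..<b}) = b"
    by (subst card_image) (auto intro: inj_on_subset)
  ultimately have "[int b ^ p = int b] (mod int p)"
    by (simp add: card_lists_length_eq)
  moreover have ab: "[a = int b] (mod int p)" using p0 by (simp add: b_def cong_def)
  ultimately show ?thesis by (metis cong_pow cong_sym cong_trans)
qed

text \<open>Rotation preserves the weight of closed paths of length p; the fixed ones stay at one
  vertex i and contribute N_ii^p, which is N_ii modulo p.\<close>

lemma trace_mat_pow_prime:
  fixes N :: "int ^ 'n ^ 'n"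
  assumes p: "prime p"
  shows "[trace (mat_pow N p) = trace N] (mod int p)"
proof -
  obtain k where k: "p = Suc k" using prime_gt_0_nat[OF p] by (cases p) auto
  let ?S = "{w :: 'n list. length w = Suc k}"
  have rot: "(rotate1 ^^ p) w = w" if "length w = Suc k" for w :: "'n list"
    unfolding rotate_def[symmetric] by (rule rotate_id) (simp add: that k)
  have "[(\<Sum>w\<in>?S. cycle_weight N w) = (\<Sum>w | w \<in> ?S \<and> rotate1 w = w. cycle_weight N w)] (mod int p)"
    by (rule sum_cong_fixed_points[OF finite_lists_of_length p])
      (auto simp: rot cycle_weight_rotate1)
  moreover have "(\<Sum>w | w \<in> ?S \<and> rotate1 w = w. cycle_weight N w) = (\<Sum>i\<in>UNIV. (N $ i $ i) ^ p)"
  proof -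
    have "{w. w \<in> ?S \<and> rotate1 w = w} = range (\<lambda>i. replicate (Suc k) i)"
      by (auto simp: rotate1_fixed simp del: replicate_Suc)
    moreover have "inj (\<lambda>i. replicate (Suc k) i :: 'n list)" by (auto simp: inj_def)
    moreover have "path_weight N i (replicate j i) i = (N $ i $ i) ^ Suc j" for i j
      by (induction j) auto
    ultimately show ?thesis by (simp add: sum.reindex cycle_weight_def k)
  qed
  moreover have "[(\<Sum>i\<in>UNIV. (N $ i $ i) ^ p) = (\<Sum>i\<in>UNIV. N $ i $ i)] (mod int p)"
    by (intro cong_sum cong_power_prime p)
  ultimately have "[(\<Sum>w\<in>?S. cycle_weight N w) = trace N] (mod int p)"
    unfolding trace_def by (simp only:) (rule cong_trans)
  then show ?thesis
    unfolding k trace_mat_pow_cycles .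
qed

text \<open>The witness is the product of those primes in P that do not divide i: then each prime of
  P divides exactly one of i and d s.\<close>

lemma avoid_primes:
  fixes i d :: nat
  assumes "coprime i d" "finite P" "\<And>p. p \<in> P \<Longrightarrow> prime p"
  obtains s where "\<And>p. p \<in> P \<Longrightarrow> \<not> p dvd i + d * s"
proof
  fix p assume p: "p \<in> P"
  let ?s = "\<Prod>p | p \<in> P \<and> \<not> p dvd i. p"
  have fin: "finite {p. p \<in> P \<and> \<not> p dvd i}" using assms(2) by simp
  show "\<not> p dvd i + d * ?s"
  proof (cases "p dvd i")
    case True
    have "\<not> p dvd d" using True assms(1,3) p by (metis coprime_common_divisor not_prime_unit)
    moreover have "\<not> p dvd ?s"
    proof
      assume "p dvd ?s"
      then obtain p' where "p' \<in> P" "\<not> p' dvd i" "p dvd p'"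
        using prime_dvd_prod_iff[OF fin, of p "\<lambda>p. p"] assms(3)[OF p] by auto
      then show False using assms(3) p True by (metis primes_dvd_imp_eq)
    qed
    ultimately show ?thesis
      using True assms(3)[OF p] by (metis dvd_add_right_iff prime_dvd_mult_iff)
  next
    case False
    then have "p dvd ?s" using p fin by (intro dvd_prodI) auto
    then show ?thesis using False by (metis dvd_add_left_iff dvd_mult)
  qed
qed

definition of_mat :: "('a \<Rightarrow> 'b) \<Rightarrow> 'a ^ 'n ^ 'n \<Rightarrow> 'b ^ 'n ^ 'n" where
  "of_mat f M = (\<chi> i j. f (M $ i $ j))"

lemma of_mat_pow:
  assumes "f 0 = 0" "f 1 = 1" "\<And>x y. f (x + y) = f x + f y" "\<And>x y. f (x * y) = f x * f y"
  shows "of_mat f (mat_pow M j) = mat_pow (of_mat f M) j"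
    and "trace (mat_pow (of_mat f M) j) = f (trace (mat_pow M j))"
proof -
  have sum: "f (\<Sum>x\<in>A. g x) = (\<Sum>x\<in>A. f (g x))" for g :: "'n \<Rightarrow> _" and A
    by (induction A rule: infinite_finite_induct) (auto simp: assms)
  show eq: "of_mat f (mat_pow M j) = mat_pow (of_mat f M) j"
  proof (induction j)
    case 0
    show ?case by (simp add: of_mat_def mat_def vec_eq_iff assms)
  next
    case (Suc j)
    show ?case
      unfolding mat_pow.simps Suc[symmetric]
      by (simp add: of_mat_def matrix_matrix_mult_def sum assms)
  qed
  show "trace (mat_pow (of_mat f M) j) = f (trace (mat_pow M j))"
    unfolding eq[symmetric] by (simp add: trace_def sum of_mat_def)
qed

text \<open>With n the size of the matrix, traces of powers have absolute value at most n, the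
  eigenvalues being roots of unity. For a prime above 2 n the congruence therefore forces equality,
  and exponents built from such primes reach every class coprime to M.\<close>

lemma trace_pow_coprime:
  fixes N :: "int ^ 'n ^ 'n"
  assumes M: "M > 0" "mat_pow N M = mat 1" and c: "coprime c M"
  shows "trace (mat_pow N (j * c)) = trace (mat_pow N j)"
proof -
  let ?n = "CARD('n)" and ?A = "of_mat of_int N :: complex ^ 'n ^ 'n"
  let ?t = "\<lambda>j. trace (mat_pow N j)"
  have pow: "of_mat of_int (mat_pow N j) = mat_pow ?A j" "trace (mat_pow ?A j) = of_int (?t j)" for j
    by (rule of_mat_pow; simp)+
  have AM: "mat_pow ?A M = mat 1"
    unfolding pow(1)[symmetric] M(2) by (simp add: of_mat_def mat_def vec_eq_iff)
  have bound: "\<bar>?t j\<bar> \<le> int ?n" for j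
  proof -
    have norm1: "norm z = 1" if "z \<in># proots (cpoly ?A)" for z
    proof -
      have "norm z ^ M = 1" using cpoly_root_of_unity[OF that AM] by (metis norm_one norm_power)
      then show ?thesis using M(1) by (intro power_eq_imp_eq_base[of _ M 1]) auto
    qed
    have "norm (\<Sum>z\<in>#R. z ^ j) \<le> real (size R)" if "\<And>z. z \<in># R \<Longrightarrow> norm z = 1" for R :: "complex multiset"
      using that
    proof (induction R)
      case (add z R)
      have "norm (z ^ j + (\<Sum>z\<in>#R. z ^ j)) \<le> norm (z ^ j) + norm (\<Sum>z\<in>#R. z ^ j)"
        by (rule norm_triangle_ineq)
      then show ?case using add by (simp add: norm_power)
    qed simp
    from this[of "proots (cpoly ?A)", OF norm1] have "norm (of_int (?t j) :: complex) \<le> real ?n"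
      using trace_mat_pow_eq_power_sum[of ?A j] cpoly_rpoly_roots(2)[of ?A] by (simp add: pow)
    then show ?thesis by simp
  qed
  have prime_step: "?t (j * p) = ?t j" if p: "prime p" "p > 2 * ?n" for j p
  proof -
    have "[?t (j * p) = ?t j] (mod int p)"
      using trace_mat_pow_prime[OF p(1), of "mat_pow N j"] by (simp add: mat_pow_mult)
    then have "int p dvd ?t (j * p) - ?t j" by (simp add: cong_iff_dvd_diff)
    moreover have "\<bar>?t (j * p) - ?t j\<bar> < int p"
      using bound[of "j * p"] bound[of j] p(2) by linarith
    ultimately have "?t (j * p) - ?t j = 0"
      using dvd_imp_le_int[of "?t (j * p) - ?t j" "int p"] by fastforce
    then show ?thesis by simp
  qed
  have big: "?t (j * e) = ?t j" if "e > 0" "\<And>p. prime p \<Longrightarrow> p dvd e \<Longrightarrow> p > 2 * ?n" for e j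
    using that
  proof (induction e arbitrary: j rule: less_induct)
    case (less e)
    show ?case
    proof (cases "e = 1")
      case False
      then obtain p where p: "prime p" "p dvd e" by (metis prime_factor_nat)
      then obtain e' where e: "e = p * e'" by blast
      then have "e' < e" "e' > 0" using less.prems(1) prime_gt_1_nat[OF p(1)] by auto
      then have "?t (j * p * e') = ?t (j * p)" using less.prems(2) by (intro less.IH) (auto simp: e)
      then show ?thesis using prime_step[OF p(1)] less.prems(2)[OF p] by (simp add: e mult.assoc)
    qed simp
  qed
  define P where "P = {p. prime p \<and> p \<le> 2 * ?n}"
  have "finite P" "\<And>p. p \<in> P \<Longrightarrow> prime p" by (simp_all add: P_def)
  then obtain s where s: "\<And>p. p \<in> P \<Longrightarrow> \<not> p dvd c + M * s"
    using avoid_primes[OF c, of P] by blast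
  \<comment> \<open>The prime 2 belongs to P, so c + M s is odd and in particular not 0.\<close>
  have "2 \<in> P" by (simp add: P_def Suc_le_eq)
  then have "c + M * s > 0" using s by (metis dvd_0_right gr0I)
  moreover have "p > 2 * ?n" if "prime p" "p dvd c + M * s" for p
    using s[of p] that unfolding P_def by (metis mem_Collect_eq not_le)
  ultimately have "?t (j * (c + M * s)) = ?t j" by (rule big)
  moreover have pM: "mat_pow N (M * k) = mat 1" for k
    unfolding mat_pow_mult M(2) by (induction k) (simp_all add: matrix_mul_lid)
  moreover have "mat_pow N (j * (c + M * s)) = mat_pow N (j * c)"
  proof -
    have "j * (c + M * s) = j * c + M * (j * s)" by (simp add: algebra_simps)
    then show ?thesis by (simp only: mat_pow_add pM matrix_mul_rid)
  qed
  ultimately show ?thesis by simp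
qed

section \<open>Multiplicities of roots of unity from power sums\<close>

lemma bij_betw_mult_mod:
  fixes M c :: nat
  assumes "M > 0" "coprime c M"
  shows "bij_betw (\<lambda>j. j * c mod M) {..<M} {..<M}"
proof -
  have "inj_on (\<lambda>j. j * c mod M) {..<M}"
  proof (rule inj_onI)
    fix i j assume ij: "i \<in> {..<M}" "j \<in> {..<M}" "i * c mod M = j * c mod M"
    then have "[i = j] (mod M)" using assms(2) cong_mult_rcancel_nat[of c M i j] by (simp add: cong_def)
    then show "i = j" using ij by (simp add: cong_def)
  qed
  moreover have "(\<lambda>j. j * c mod M) ` {..<M} \<subseteq> {..<M}" using assms(1) by auto
  ultimately show ?thesis unfolding bij_betw_def using endo_inj_surj[OF finite_lessThan] by blast
qed

lemma power_mod_root: "z ^ M = (1 :: complex) \<Longrightarrow> z ^ (j mod M) = z ^ j"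
proof -
  assume z: "z ^ M = 1"
  have "z ^ j = z ^ (M * (j div M) + j mod M)" by simp
  also have "\<dots> = z ^ (j mod M)" by (simp only: power_add power_mult z power_one mult_1)
  finally show ?thesis by simp
qed

text \<open>Orthogonality of the characters of the cyclic group of order M: an element w of R counts
  M if w = z and cancels in a geometric sum otherwise.\<close>

lemma count_eq_fourier:
  fixes R :: "complex multiset"
  assumes M: "M > 0" and R: "\<And>w. w \<in># R \<Longrightarrow> w ^ M = 1" and z: "z ^ M = 1"
  shows "of_nat M * of_nat (count R z) = (\<Sum>j<M. inverse z ^ j * (\<Sum>w\<in>#R. w ^ j))"
  using R
proof (induction R)
  case (add w R)
  have z0: "z \<noteq> 0" using z M by (auto simp: power_0_left)
  have "(\<Sum>j<M. inverse z ^ j * w ^ j) = (if w = z then of_nat M else 0)"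
  proof (cases "w = z")
    case True
    then show ?thesis using z0 by (simp add: power_mult_distrib[symmetric])
  next
    case False
    then have "w / z \<noteq> 1" using z0 by (simp add: field_simps)
    moreover have "(w / z) ^ M = 1" using add.prems[of w] z by (simp add: power_divide)
    ultimately have "(\<Sum>j<M. (w / z) ^ j) = 0" by (simp add: geometric_sum)
    then show ?thesis using False by (simp add: power_divide field_simps)
  qed
  then show ?case using add by (simp add: distrib_left sum.distrib)
qed simp

text \<open>In the Fourier formula, replacing j by j c permutes the residues modulo M and by
  hypothesis preserves the power sums. This takes the part of the Galois automorphism that sends z
  to z^c.\<close>

lemma count_galois:
  fixes R :: "complex multiset" and t :: "nat \<Rightarrow> complex"
  assumes M: "M > 0" and R: "\<And>w. w \<in># R \<Longrightarrow> w ^ M = 1" and z: "z ^ M = 1"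
    and t: "\<And>j. (\<Sum>w\<in>#R. w ^ (j * c)) = (\<Sum>w\<in>#R. w ^ j)" and c: "coprime c M"
  shows "count R (z ^ c) = count R z"
proof -
  let ?t = "\<lambda>j. \<Sum>w\<in>#R. w ^ j" and ?g = "\<lambda>j. inverse z ^ j * (\<Sum>w\<in>#R. w ^ j)"
  have zc: "(z ^ c) ^ M = 1" using z by (metis mult.commute power_mult power_one)
  have g: "?g (j mod M) = ?g j" for j
  proof -
    have "image_mset (\<lambda>w. w ^ (j mod M)) R = image_mset (\<lambda>w. w ^ j) R"
      by (rule image_mset_cong) (use R in \<open>auto simp: power_mod_root\<close>)
    moreover have "inverse z ^ (j mod M) = inverse z ^ j"
      using z by (intro power_mod_root) (simp add: power_inverse)
    ultimately show ?thesis by simp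
  qed
  have "of_nat M * of_nat (count R (z ^ c)) = (\<Sum>j<M. inverse (z ^ c) ^ j * ?t j)"
    by (rule count_eq_fourier[OF M R zc])
  also have "\<dots> = (\<Sum>j<M. ?g (j * c))"
    by (intro sum.cong refl) (simp add: t power_inverse power_mult[symmetric] mult.commute)
  also have "\<dots> = (\<Sum>j<M. ?g (j * c mod M))" by (simp only: g)
  also have "\<dots> = (\<Sum>j<M. ?g j)"
    by (rule sum.reindex_bij_betw[OF bij_betw_mult_mod[OF M c]])
  also have "\<dots> = of_nat M * of_nat (count R z)"
    by (rule count_eq_fourier[OF M R z, symmetric])
  finally show ?thesis using M by (metis mult_left_cancel of_nat_0_eq_iff of_nat_eq_iff not_gr0)
qed

definition root_order :: "complex \<Rightarrow> nat" where
  "root_order z = (LEAST k. k > 0 \<and> z ^ k = 1)"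

lemma root_order:
  assumes "z ^ M = 1" "M > 0"
  shows "root_order z > 0" "z ^ root_order z = 1" "z ^ k = 1 \<longleftrightarrow> root_order z dvd k"
proof -
  let ?d = "root_order z"
  have d: "?d > 0 \<and> z ^ ?d = 1"
  proof -
    have "\<exists>k. k > 0 \<and> z ^ k = 1" using assms by blast
    from LeastI_ex[OF this] show ?thesis by (simp only: root_order_def)
  qed
  have le: "?d \<le> k" if "k > 0" "z ^ k = 1" for k
    unfolding root_order_def by (rule Least_le) (use that in simp)
  show "?d > 0" "z ^ ?d = 1" using d by auto
  show "z ^ k = 1 \<longleftrightarrow> ?d dvd k"
  proof
    assume "z ^ k = 1"
    then have "z ^ (k mod ?d) = 1" using d power_mod_root[of z ?d k] by simp
    moreover have "k mod ?d < ?d" using d by simp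
    ultimately have "k mod ?d = 0" using le[of "k mod ?d"] by (meson gr0I not_le)
    then show "?d dvd k" by auto
  next
    assume "?d dvd k"
    then show "z ^ k = 1" using d by (auto simp: power_mult elim!: dvdE)
  qed
qed

text \<open>The powers of z are d distinct d-th roots of unity, hence all of them, so w = z^i with i
  coprime to d. A multiple of d is then added to i to make it coprime to M as well.\<close>

lemma same_root_order:
  assumes z: "z ^ M = 1" "M > 0" and w: "w ^ M = 1" and eq: "root_order w = root_order z"
  obtains c where "coprime c M" "w = z ^ c"
proof -
  let ?d = "root_order z"
  note dz = root_order[OF z] and dw = root_order[OF w z(2)]
  have z0: "z \<noteq> 0" using z by (auto simp: power_0_left)
  have "inj_on (\<lambda>i. z ^ i) {..<?d}"
  proof (rule linorder_inj_onI)
    fix i j assume ij: "i < j" "i \<in> {..<?d}" "j \<in> {..<?d}"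
    show "z ^ i \<noteq> z ^ j"
    proof
      assume "z ^ i = z ^ j"
      moreover have "z ^ j = z ^ i * z ^ (j - i)" using ij by (simp flip: power_add)
      ultimately have "z ^ i * z ^ (j - i) = z ^ i * 1" by simp
      then have "z ^ (j - i) = 1" using z0 by simp
      then have "?d dvd j - i" using dz(3) by blast
      then show False using ij by (auto dest: dvd_imp_le)
    qed
  qed auto
  then have "card ((\<lambda>i. z ^ i) ` {..<?d}) = ?d" by (simp add: card_image)
  moreover have "(\<lambda>i. z ^ i) ` {..<?d} \<subseteq> {x. x ^ ?d = 1}"
    using dz(2) by auto (metis mult.commute power_mult power_one)
  moreover have "finite {x :: complex. x ^ ?d = 1}" "card {x :: complex. x ^ ?d = 1} = ?d"
    using dz(1) by (auto simp: finite_roots_unity card_roots_unity_eq)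
  ultimately have "(\<lambda>i. z ^ i) ` {..<?d} = {x. x ^ ?d = 1}" by (intro card_subset_eq) auto
  moreover have "w ^ ?d = 1" using dw(2) eq by simp
  ultimately obtain i where i: "w = z ^ i" by blast
  \<comment> \<open>A common divisor g of i and d would make the order of w a divisor of d /
    g.\<close>
  have "coprime i ?d"
  proof (rule coprimeI)
    fix g assume g: "g dvd i" "g dvd ?d"
    then obtain i' d' where *: "i = g * i'" "?d = g * d'" by (auto elim!: dvdE)
    have "w ^ d' = (z ^ ?d) ^ i'"
      unfolding i power_mult[symmetric] by (simp add: * mult_ac)
    then have "w ^ d' = 1" using dz(2) by simp
    then have "?d dvd d'" using dw(3) eq by simp
    then have "g * d' dvd 1 * d'" using * by simp
    moreover have "d' > 0" using * dz(1) by (auto intro: gr0I)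
    ultimately show "g dvd 1" using dvd_times_right_cancel_iff[of d' g 1] by simp
  qed
  then obtain s where s: "\<And>p. p \<in> prime_factors M \<Longrightarrow> \<not> p dvd i + ?d * s"
    using avoid_primes[of i ?d "prime_factors M"] in_prime_factors_imp_prime finite_set_mset by blast
  have "coprime (i + ?d * s) M"
  proof (rule ccontr)
    assume "\<not> ?thesis"
    then have "gcd (i + ?d * s) M \<noteq> 1" by (simp add: coprime_iff_gcd_eq_1)
    then obtain p where p: "prime p" "p dvd gcd (i + ?d * s) M" using prime_factor_nat by blast
    then have "p dvd i + ?d * s" "p dvd M" by (simp_all only: gcd_greatest_iff)
    then show False using s[of p] z(2) p(1) by (auto simp: in_prime_factors_iff)
  qed
  moreover have "w = z ^ (i + ?d * s)" using i dz(2) by (simp add: power_add power_mult)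
  ultimately show ?thesis using that by blast
qed

text \<open>Moebius inversion over the multiples of d among the divisors of M, by recursion
  downwards from M: after n steps the equation holds for all d > M - n. Changing m at the next d
  leaves these equations intact, since no larger number divides it.\<close>

lemma divisor_sum_inversion:
  fixes c :: "nat \<Rightarrow> int"
  assumes M: "M > 0"
  obtains m where "\<And>k. m k \<noteq> 0 \<Longrightarrow> k dvd M"
    and "\<And>d. d dvd M \<Longrightarrow> c d = (\<Sum>k | k dvd M \<and> d dvd k. m k)"
proof -
  have fin: "finite {k. k dvd M \<and> P k}" for P using M by simp
  have "\<exists>m. (\<forall>k. m k \<noteq> 0 \<longrightarrow> k dvd M) \<and>
      (\<forall>d. d dvd M \<longrightarrow> d + n > M \<longrightarrow> c d = (\<Sum>k | k dvd M \<and> d dvd k. m k))" for n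
  proof (induction n)
    case 0
    show ?case by (intro exI[of _ "\<lambda>_. 0"]) (use M in \<open>auto dest: dvd_imp_le\<close>)
  next
    case (Suc n)
    then obtain m where m: "\<And>k. m k \<noteq> 0 \<Longrightarrow> k dvd M"
      "\<And>d. d dvd M \<Longrightarrow> d + n > M \<Longrightarrow> c d = (\<Sum>k | k dvd M \<and> d dvd k. m k)" by blast
    show ?case
    proof (cases "n \<le> M \<and> M - n dvd M")
      case False
      then show ?thesis using m by (intro exI[of _ m]) (auto simp: less_Suc_eq dvd_imp_le[OF _ M])
    next
      case True
      define d0 where "d0 = M - n"
      \<comment> \<open>The value that makes the equation at d0 true while the other terms of its
        sum stay fixed.\<close>
      define v where "v = c d0 - (\<Sum>k | k dvd M \<and> d0 dvd k. m k) + m d0"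
      have d0: "d0 dvd M" using True by (simp add: d0_def)
      then have "d0 > 0" using M by (auto intro: gr0I)
      let ?m = "m(d0 := v)"
      have "c d = (\<Sum>k | k dvd M \<and> d dvd k. ?m k)" if d: "d dvd M" "d + Suc n > M" for d
      proof (cases "d = d0")
        case True
        have "(\<Sum>k | k dvd M \<and> d0 dvd k. ?m k) = ?m d0 + (\<Sum>k\<in>{k. k dvd M \<and> d0 dvd k} - {d0}. ?m k)"
          using d0 by (intro sum.remove fin) auto
        moreover have "(\<Sum>k | k dvd M \<and> d0 dvd k. m k) = m d0 + (\<Sum>k\<in>{k. k dvd M \<and> d0 dvd k} - {d0}. m k)"
          using d0 by (intro sum.remove fin) auto
        ultimately show ?thesis using True by (simp add: v_def)
      next
        case False
        then have "d + n > M" using d True by (auto simp: d0_def)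
        moreover from this have "\<not> d dvd d0"
          using \<open>d0 > 0\<close> by (auto simp: d0_def dest!: dvd_imp_le)
        then have "(\<Sum>k | k dvd M \<and> d dvd k. ?m k) = (\<Sum>k | k dvd M \<and> d dvd k. m k)"
          by (intro sum.cong) auto
        ultimately show ?thesis using m(2)[OF d(1)] by simp
      qed
      moreover have "k dvd M" if "?m k \<noteq> 0" for k
        using that m(1) d0 by (auto split: if_splits)
      ultimately show ?thesis by blast
    qed
  qed
  from this[of "Suc M"] show ?thesis using that by auto
qed

text \<open>The multiplicity of z depends only on its order d, by \<open>count_galois\<close>. That
  it be the sum of m k over all k with z^k = 1 is a condition on the sum over the multiples k of d,
  which \<open>divisor_sum_inversion\<close> solves.\<close>

lemma exists_multiplicities:
  fixes N :: "int ^ 'n ^ 'n"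
  assumes M: "M > 0" "mat_pow N M = mat 1"
  defines "R \<equiv> proots (cpoly (of_mat of_int N :: complex ^ 'n ^ 'n))"
  obtains m :: "nat \<Rightarrow> int" where "finite {k. m k \<noteq> 0}" "m 0 = 0"
    "\<And>z. int (count R z) = (\<Sum>k | m k \<noteq> 0 \<and> z ^ k = 1. m k)"
proof -
  let ?A = "of_mat of_int N :: complex ^ 'n ^ 'n"
  have pow: "of_mat of_int (mat_pow N j) = mat_pow ?A j" "trace (mat_pow ?A j) = of_int (trace (mat_pow N j))" for j
    by (rule of_mat_pow; simp)+
  have AM: "mat_pow ?A M = mat 1"
    unfolding pow(1)[symmetric] M(2) by (simp add: of_mat_def mat_def vec_eq_iff)
  have R: "w ^ M = 1" if "w \<in># R" for w
    using cpoly_root_of_unity[OF _ AM] that by (simp add: R_def)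
  have t: "(\<Sum>w\<in>#R. w ^ (j * c)) = (\<Sum>w\<in>#R. w ^ j)" if "coprime c M" for j c
    unfolding R_def trace_mat_pow_eq_power_sum[symmetric] pow by (simp only: trace_pow_coprime[OF M that])
  have same: "count R w = count R z" if z: "z ^ M = 1" and w: "w ^ M = 1" and ord: "root_order w = root_order z" for z w
  proof -
    obtain c where c: "coprime c M" "w = z ^ c" using same_root_order[OF z M(1) w ord] .
    then show ?thesis using count_galois[OF M(1) R z t] by simp
  qed
  \<comment> \<open>Any root of order d may represent its class, by \<open>same\<close>.\<close>
  define c where "c d = int (count R (SOME z. z ^ M = 1 \<and> root_order z = d))" for d
  have c: "int (count R z) = c (root_order z)" if z: "z ^ M = 1" for z
  proof -
    let ?w = "SOME w. w ^ M = 1 \<and> root_order w = root_order z"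
    have "?w ^ M = 1 \<and> root_order ?w = root_order z"
      by (rule someI[of _ z]) (use z in simp)
    then show ?thesis unfolding c_def using same[OF z, of ?w] by simp
  qed
  obtain m where m: "\<And>k. m k \<noteq> 0 \<Longrightarrow> k dvd M"
    "\<And>d. d dvd M \<Longrightarrow> c d = (\<Sum>k | k dvd M \<and> d dvd k. m k)"
    using divisor_sum_inversion[OF M(1), of c] by blast
  have supp: "{k. m k \<noteq> 0} \<subseteq> {k. k dvd M}" using m(1) by auto
  have fin: "finite {k. k dvd M}" using M(1) by simp
  show ?thesis
  proof (rule that[of m])
    show "finite {k. m k \<noteq> 0}" using supp fin by (rule finite_subset)
    show "m 0 = 0" using m(1)[of 0] M(1) by auto
    fix z
    show "int (count R z) = (\<Sum>k | m k \<noteq> 0 \<and> z ^ k = 1. m k)"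
    proof (cases "z ^ M = 1")
      case True
      note d = root_order[OF True M(1)]
      have "root_order z dvd M" using d(3) True by blast
      then have "int (count R z) = (\<Sum>k | k dvd M \<and> root_order z dvd k. m k)"
        using c[OF True] m(2) by simp
      also have "\<dots> = (\<Sum>k | m k \<noteq> 0 \<and> z ^ k = 1. m k)"
        by (rule sum.mono_neutral_right) (use fin d(3) m(1) in auto)
      finally show ?thesis .
    next
      case False
      then have "z \<notin># R" using R by auto
      moreover have "z ^ M = 1" if "m k \<noteq> 0" "z ^ k = 1" for k
        using m(1)[OF that(1)] that(2) by (auto simp: power_mult elim!: dvdE)
      then have "{k. m k \<noteq> 0 \<and> z ^ k = 1} = {}" using False by auto
      ultimately show ?thesis by (simp only: sum.empty not_in_iff of_nat_0)
    qed
  qed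
qed

text \<open>The derivative k x^(k-1) vanishes at most at 0, which is no root, so all k-th roots of
  unity are simple roots.\<close>

lemma monom_minus_1:
  assumes k: "k > 0"
  shows "monom 1 k - 1 \<noteq> (0 :: complex poly)" "lead_coeff (monom 1 k - 1 :: complex poly) = 1"
    "proots (monom 1 k - 1 :: complex poly) = mset_set {z. z ^ k = 1}"
proof -
  let ?f = "monom 1 k - 1 :: complex poly"
  have deg: "degree ?f = k"
    using k degree_add_eq_left[of "- 1" "monom 1 k :: complex poly"] by (simp add: degree_monom_eq)
  then show nz: "?f \<noteq> 0" using k by auto
  show "lead_coeff ?f = 1" using k by (simp add: deg)
  have fin: "finite {z :: complex. z ^ k = 1}" using k by (simp add: finite_roots_unity)
  have "rsquarefree ?f"
    unfolding rsquarefree_roots using k by (auto simp: poly_monom pderiv_monom pderiv_diff power_0_left)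
  then have "Polynomial.order z ?f = 0 \<or> Polynomial.order z ?f = 1" for z
    by (simp add: rsquarefree_def)
  then have ord: "Polynomial.order z ?f = (if z ^ k = 1 then 1 else 0)" for z
    using nz order_root[of ?f z] by (metis diff_eq_eq eq_iff_diff_eq_0 mult_1 poly_1 poly_diff poly_monom)
  show "proots ?f = mset_set {z. z ^ k = 1}"
    by (rule multiset_eqI) (use nz fin ord in \<open>auto simp: count_mset_set'\<close>)
qed

text \<open>Multiplication by a primitive root w permutes the k-th roots of unity and multiplies the
  sum by w^j, which is not 1 unless k divides j.\<close>

lemma power_sum_roots_of_unity:
  assumes k: "k > 0"
  shows "(\<Sum>z | z ^ k = 1. z ^ j) = (if k dvd j then of_nat k else (0 :: complex))"
proof (cases "k dvd j")
  case True
  then have "z ^ j = 1" if "z ^ k = 1" for z :: complex using that by (auto simp: power_mult elim!: dvdE)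
  then have "(\<Sum>z :: complex | z ^ k = 1. z ^ j) = (\<Sum>z :: complex | z ^ k = 1. 1)" by (auto intro!: sum.cong)
  also have "\<dots> = of_nat k" using k by (simp add: card_roots_unity_eq)
  finally show ?thesis using True by simp
next
  case False
  define w where "w = exp (2 * of_real pi * \<i> * of_nat 1 / of_nat k)"
  have pw: "w ^ i = exp (2 * of_real pi * \<i> * of_nat i / of_nat k)" for i
    by (simp add: w_def exp_of_nat_mult[symmetric] mult_ac)
  have wk: "w ^ k = 1" and wj: "w ^ j \<noteq> 1"
    using complex_root_unity_eq_1[of k k] complex_root_unity_eq_1[of k j] k False
    by (simp_all add: pw Suc_le_eq)
  have w0: "w \<noteq> 0" by (simp add: w_def)
  let ?S = "\<Sum>z :: complex | z ^ k = 1. z ^ j"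
  have "?S = (\<Sum>z :: complex | z ^ k = 1. (w * z) ^ j)"
    by (rule sum.reindex_bij_witness[of _ "\<lambda>z. w * z" "\<lambda>z. z / w"])
      (use w0 wk in \<open>auto simp: power_mult_distrib power_divide\<close>)
  also have "\<dots> = w ^ j * ?S" by (simp add: power_mult_distrib sum_distrib_left)
  finally have "(1 - w ^ j) * ?S = 0" by (simp add: algebra_simps)
  then show ?thesis using wj False by simp
qed

section \<open>Automorphisms of the lattice\<close>

lemma det_of_mat:
  fixes M :: "real ^ 'n ^ 'n"
  shows "det (of_mat of_real M :: complex ^ 'n ^ 'n) = of_real (det M)"
  by (simp add: det_def of_mat_def)

lemma poly_char_polynomial:
  "poly (cpoly (of_mat of_real (matrix b))) (of_real x) = of_real (poly (char_polynomial b) x)"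
proof -
  have "poly (char_polynomial b) x = det (\<chi> i j. (if i = j then x else 0) - matrix b $ i $ j)"
    unfolding char_polynomial_def det_poly by (rule arg_cong[of _ _ det]) (simp add: vec_eq_iff)
  note char = this
  show ?thesis
    unfolding poly_cpoly char det_of_mat[symmetric]
    by (rule arg_cong[of _ _ det]) (simp add: vec_eq_iff of_mat_def)
qed

text \<open>The difference would have infinitely many roots. This carries equations between real
  polynomials to the complex numbers, where the roots are available.\<close>

lemma poly_eqI_real:
  fixes p q :: "complex poly"
  assumes "\<And>x :: real. poly p (of_real x) = poly q (of_real x)"
  shows "p = q"
proof (rule ccontr)
  assume "p \<noteq> q"
  then have "finite {z. poly (p - q) z = 0}" by (intro poly_roots_finite) simp
  then have "finite (range (of_real :: real \<Rightarrow> complex))"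
    by (rule finite_subset[rotated]) (use assms in auto)
  then have "finite (UNIV :: real set)" by (rule finite_imageD) (simp add: inj_def)
  then show False using infinite_UNIV_char_0 by blast
qed

lemma monic_eqI:
  fixes p q :: "complex poly"
  assumes "proots p = proots q" "lead_coeff p = 1" "lead_coeff q = 1"
  shows "p = q"
  using complex_poly_decompose_multiset[of p] complex_poly_decompose_multiset[of q] assms by simp

lemma is_frame_shape_complex:
  "is_frame_shape b m \<longleftrightarrow> finite {k. m k \<noteq> 0} \<and> m 0 = 0 \<and>
     cpoly (of_mat of_real (matrix b)) * (\<Prod>k | m k < 0. (monom 1 k - 1) ^ nat (- m k)) =
       (\<Prod>k | m k > 0. (monom 1 k - 1) ^ nat (m k))"
proof -
  let ?L = "char_polynomial b * (\<Prod>k | m k < 0. (monom 1 k - 1) ^ nat (- m k))"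
  let ?R = "(\<Prod>k | m k > 0. (monom 1 k - 1) ^ nat (m k)) :: real poly"
  let ?Lc = "cpoly (of_mat of_real (matrix b)) * (\<Prod>k | m k < 0. (monom 1 k - 1) ^ nat (- m k))"
  let ?Rc = "(\<Prod>k | m k > 0. (monom 1 k - 1) ^ nat (m k)) :: complex poly"
  have L: "poly ?Lc (of_real x) = of_real (poly ?L x)" and R: "poly ?Rc (of_real x) = of_real (poly ?R x)" for x
    by (simp_all add: poly_char_polynomial poly_prod poly_monom)
  have "?L = ?R \<longleftrightarrow> (\<forall>x. poly ?L x = poly ?R x)"
    unfolding poly_eq_poly_eq_iff[symmetric] by (rule fun_eq_iff)
  also have "\<dots> \<longleftrightarrow> (\<forall>x :: real. poly ?Lc (of_real x) = poly ?Rc (of_real x))"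
    by (simp only: L R of_real_eq_iff)
  also have "\<dots> \<longleftrightarrow> ?Lc = ?Rc"
  proof
    assume "\<forall>x :: real. poly ?Lc (of_real x) = poly ?Rc (of_real x)"
    then show "?Lc = ?Rc" by (intro poly_eqI_real) (rule spec)
  next
    assume eq: "?Lc = ?Rc"
    show "\<forall>x :: real. poly ?Lc (of_real x) = poly ?Rc (of_real x)" unfolding eq by (intro allI refl)
  qed
  finally show ?thesis by (simp add: is_frame_shape_def)
qed

text \<open>Natural exponents keep both sides of the Frame shape equation polynomial; multiplicities
  and power sums of roots are then additive over the factors.\<close>

definition frame_prod :: "(nat \<Rightarrow> nat) \<Rightarrow> nat set \<Rightarrow> complex poly" where
  "frame_prod e K = (\<Prod>k\<in>K. (monom 1 k - 1) ^ e k)"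

lemma frame_prod:
  assumes "finite K" "0 \<notin> K"
  shows "frame_prod e K \<noteq> 0" "lead_coeff (frame_prod e K) = 1"
    and "count (proots (frame_prod e K)) z = (\<Sum>k | k \<in> K \<and> z ^ k = 1. e k)"
    and "(\<Sum>z\<in>#proots (frame_prod e K). z ^ j) =
      (\<Sum>k\<in>K. of_nat (e k) * (if k dvd j then of_nat k else 0))"
proof -
  have pos: "k > 0" if "k \<in> K" for k using assms(2) that by (metis gr0I)
  have nzk: "(monom 1 k - 1) ^ e k \<noteq> (0 :: complex poly)" if "k \<in> K" for k
    using monom_minus_1(1)[OF pos[OF that]] by (rule power_not_zero)
  show nz: "frame_prod e K \<noteq> 0"
    using nzk unfolding frame_prod_def prod_zero_iff[OF assms(1)] by blast
  show "lead_coeff (frame_prod e K) = 1"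
    unfolding frame_prod_def lead_coeff_prod lead_coeff_power
    by (intro prod.neutral ballI) (simp only: monom_minus_1(2)[OF pos] power_one)
  have pr: "proots (frame_prod e K) = (\<Sum>k\<in>K. repeat_mset (e k) (mset_set {z. z ^ k = 1}))"
  proof -
    have "proots (frame_prod e K) = (\<Sum>k\<in>K. proots ((monom 1 k - 1) ^ e k))"
      unfolding frame_prod_def by (rule proots_prod) (use nzk in blast)
    also have "\<dots> = (\<Sum>k\<in>K. repeat_mset (e k) (mset_set {z. z ^ k = 1}))"
      by (intro sum.cong refl) (simp only: proots_power monom_minus_1(3)[OF pos])
    finally show ?thesis .
  qed
  have fin: "finite {z :: complex. z ^ k = 1}" if "k \<in> K" for k
    using pos[OF that] by (simp add: finite_roots_unity)
  have "count (proots (frame_prod e K)) z = (\<Sum>k\<in>K. if z ^ k = 1 then e k else 0)"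
    unfolding pr count_sum using fin by (intro sum.cong refl) (auto simp: count_mset_set')
  then show "count (proots (frame_prod e K)) z = (\<Sum>k | k \<in> K \<and> z ^ k = 1. e k)"
    using assms(1) by (simp add: sum.inter_filter)
  have rep: "(\<Sum>z\<in>#repeat_mset n R. z ^ j) = of_nat n * (\<Sum>z\<in>#R. z ^ j)" for n and R :: "complex multiset"
    by (induction n) (simp_all add: algebra_simps)
  have "(\<Sum>z\<in>#(\<Sum>k\<in>K. F k). z ^ j) = (\<Sum>k\<in>K. \<Sum>z\<in>#F k. z ^ j)" for F :: "nat \<Rightarrow> complex multiset"
    using assms(1) by induction auto
  then have "(\<Sum>z\<in>#proots (frame_prod e K). z ^ j) = (\<Sum>k\<in>K. of_nat (e k) * (\<Sum>z | z ^ k = 1. z ^ j))"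
    by (simp add: pr rep sum_unfold_sum_mset)
  also have "\<dots> = (\<Sum>k\<in>K. of_nat (e k) * (if k dvd j then of_nat k else 0))"
    by (intro sum.cong refl) (simp only: power_sum_roots_of_unity[OF pos])
  finally show "(\<Sum>z\<in>#proots (frame_prod e K). z ^ j) =
      (\<Sum>k\<in>K. of_nat (e k) * (if k dvd j then of_nat k else 0))" .
qed

lemma is_frame_shape_prod:
  "is_frame_shape b m \<longleftrightarrow> finite {k. m k \<noteq> 0} \<and> m 0 = 0 \<and>
     cpoly (of_mat of_real (matrix b)) * frame_prod (\<lambda>k. nat (- m k)) {k. m k < 0} =
       frame_prod (\<lambda>k. nat (m k)) {k. m k > 0}"
  unfolding is_frame_shape_complex frame_prod_def ..

text \<open>The j-th power sums of the roots are compared on both sides: a factor x^k - 1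
  contributes k if k divides j and 0 otherwise, and the factors with negative exponent return by
  subtraction.\<close>

lemma is_frame_shape_imp_frame_traces:
  assumes "is_frame_shape b m"
  shows "frame_traces (matrix b) m"
proof -
  let ?A = "of_mat of_real (matrix b) :: complex ^ 24 ^ 24"
  have fin: "finite {k. m k \<noteq> 0}" and m0: "m 0 = 0"
    and eq: "cpoly ?A * frame_prod (\<lambda>k. nat (- m k)) {k. m k < 0} = frame_prod (\<lambda>k. nat (m k)) {k. m k > 0}"
    using assms by (auto simp: is_frame_shape_prod)
  have fin': "finite {k. m k < 0}" "finite {k. m k > 0}" and no0: "0 \<notin> {k. m k < 0}" "0 \<notin> {k. m k > 0}"
    using fin m0 by (auto elim: finite_subset[rotated])
  have nz: "cpoly ?A \<noteq> 0" using cpoly_rpoly_roots(1)[of ?A] by auto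
  have "trace (mat_pow (matrix b) j) = (\<Sum>k | m k \<noteq> 0 \<and> k dvd j. real_of_int (of_nat k * m k))" for j
  proof -
    let ?d = "\<lambda>k. (if k dvd j then of_nat k else 0) :: complex"
    have "(\<Sum>z\<in>#proots (cpoly ?A). z ^ j) +
        (\<Sum>z\<in>#proots (frame_prod (\<lambda>k. nat (- m k)) {k. m k < 0}). z ^ j) =
        (\<Sum>z\<in>#proots (frame_prod (\<lambda>k. nat (m k)) {k. m k > 0}). z ^ j)"
      unfolding eq[symmetric] using nz frame_prod(1)[OF fin'(1) no0(1)] by (simp add: proots_mult)
    then have "trace (mat_pow ?A j) =
        (\<Sum>k | m k > 0. of_nat (nat (m k)) * ?d k) - (\<Sum>k | m k < 0. of_nat (nat (- m k)) * ?d k)"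
      unfolding frame_prod(4)[OF fin'(1) no0(1)] frame_prod(4)[OF fin'(2) no0(2)]
        trace_mat_pow_eq_power_sum by (simp only: eq_diff_eq)
    also have "\<dots> = (\<Sum>k | m k > 0. of_int (m k) * ?d k) + (\<Sum>k | m k < 0. of_int (m k) * ?d k)"
      by (simp add: of_nat_nat sum_negf)
    also have "\<dots> = (\<Sum>k\<in>{k. m k > 0} \<union> {k. m k < 0}. of_int (m k) * ?d k)"
      by (rule sum.union_disjoint[symmetric]) (use fin' in auto)
    also have "{k. m k > 0} \<union> {k. m k < 0} = {k. m k \<noteq> 0}" by auto
    also have "(\<Sum>k | m k \<noteq> 0. of_int (m k) * ?d k) = (\<Sum>k | m k \<noteq> 0 \<and> k dvd j. of_int (m k) * of_nat k)"
      using sum.inter_filter[OF fin, of "\<lambda>k. of_int (m k) * of_nat k :: complex" "\<lambda>k. k dvd j"]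
      by (simp add: if_distrib[of "\<lambda>x. _ * x"] cong: if_cong)
    finally have e1: "trace (mat_pow ?A j) =
        of_real (\<Sum>k | m k \<noteq> 0 \<and> k dvd j. real_of_int (of_nat k * m k))"
      by (simp add: mult.commute)
    have e2: "trace (mat_pow ?A j) = of_real (trace (mat_pow (matrix b) j))"
      by (rule of_mat_pow(2)) auto
    have "(of_real (trace (mat_pow (matrix b) j)) :: complex) =
        of_real (\<Sum>k | m k \<noteq> 0 \<and> k dvd j. real_of_int (of_nat k * m k))"
      unfolding e2[symmetric] by (rule e1)
    then show ?thesis by (rule of_real_eq_iff[THEN iffD1])
  qed
  then show ?thesis using fin m0 by (simp add: frame_traces_def)
qed

lemma cpoly_similar:
  fixes A P N :: "real ^ 'n ^ 'n"
  assumes "det P \<noteq> 0" "A ** P = P ** N"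
  shows "cpoly (of_mat of_real A) = cpoly (of_mat of_real N)"
proof (rule poly_eqI_real)
  fix x :: real
  have d: "poly (cpoly (of_mat of_real A)) (of_real x) = of_real (det (mat x - A))" for A :: "real ^ 'n ^ 'n"
    unfolding poly_cpoly det_of_mat[symmetric]
    by (rule arg_cong[of _ _ det]) (simp add: vec_eq_iff of_mat_def mat_def)
  have "(mat x - A) ** P = P ** (mat x - N)"
  proof -
    have "(mat x - A) ** P = x *\<^sub>R P - A ** P"
    proof (simp only: vec_eq_iff, intro allI)
      fix i j
      have "(\<Sum>k\<in>UNIV. mat x $ i $ k * P $ k $ j) = (\<Sum>k\<in>UNIV. if k = i then x * P $ k $ j else 0)"
        by (intro sum.cong) (auto simp: mat_def)
      then show "((mat x - A) ** P) $ i $ j = (x *\<^sub>R P - A ** P) $ i $ j"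
        by (simp add: matrix_matrix_mult_def left_diff_distrib sum_subtractf)
    qed
    moreover have "P ** (mat x - N) = x *\<^sub>R P - P ** N"
    proof (simp only: vec_eq_iff, intro allI)
      fix i j
      have "(\<Sum>k\<in>UNIV. P $ i $ k * mat x $ k $ j) = (\<Sum>k\<in>UNIV. if k = j then x * P $ i $ k else 0)"
        by (intro sum.cong) (auto simp: mat_def)
      then show "(P ** (mat x - N)) $ i $ j = (x *\<^sub>R P - P ** N) $ i $ j"
        by (simp add: matrix_matrix_mult_def right_diff_distrib sum_subtractf)
    qed
    ultimately show ?thesis using assms(2) by simp
  qed
  then have "det (mat x - A) * det P = det P * det (mat x - N)" by (metis det_mul)
  then show "poly (cpoly (of_mat of_real A)) (of_real x) = poly (cpoly (of_mat of_real N)) (of_real x)"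
    using assms(1) by (simp add: d)
qed

text \<open>Both sides of the equation are monic, so they agree once every complex number has the
  same multiplicity as a root. This is \<open>exists_multiplicities\<close> with the negative terms
  moved across.\<close>

lemma is_frame_shape_exists:
  assumes M: "M > 0" "mat_pow N M = mat 1"
    and P: "det P \<noteq> 0" "matrix b ** P = P ** of_mat real_of_int N"
  shows "\<exists>m. is_frame_shape b m"
proof -
  let ?A = "of_mat of_real (matrix b) :: complex ^ 24 ^ 24"
  have A: "cpoly ?A = cpoly (of_mat of_int N)"
    using cpoly_similar[OF P] by (simp add: of_mat_def)
  obtain m where m: "finite {k. m k \<noteq> 0}" "m 0 = 0"
    "\<And>z. int (count (proots (cpoly ?A)) z) = (\<Sum>k | m k \<noteq> 0 \<and> z ^ k = 1. m k)"
    unfolding A using exists_multiplicities[OF M] by blast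
  have fin': "finite {k. m k < 0}" "finite {k. m k > 0}" and no0: "0 \<notin> {k. m k < 0}" "0 \<notin> {k. m k > 0}"
    using m(1,2) by (auto elim: finite_subset[rotated])
  let ?L = "cpoly ?A * frame_prod (\<lambda>k. nat (- m k)) {k. m k < 0}"
  let ?R = "frame_prod (\<lambda>k. nat (m k)) {k. m k > 0}"
  note fp = frame_prod[OF fin'(1) no0(1)] and fp' = frame_prod[OF fin'(2) no0(2)]
  have nz: "cpoly ?A \<noteq> 0" using cpoly_rpoly_roots(1)[of ?A] by auto
  have "proots ?L = proots ?R"
  proof (rule multiset_eqI)
    fix z
    have "int (count (proots ?L) z) = (\<Sum>k | m k \<noteq> 0 \<and> z ^ k = 1. m k) +
        (\<Sum>k | m k < 0 \<and> z ^ k = 1. - m k)"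
      using nz fp(1) by (simp add: proots_mult m(3) fp(3) del: count_proots)
    also have "(\<Sum>k | m k \<noteq> 0 \<and> z ^ k = 1. m k) =
        (\<Sum>k\<in>{k. m k < 0 \<and> z ^ k = 1} \<union> {k. m k > 0 \<and> z ^ k = 1}. m k)"
      by (intro sum.cong) auto
    also have "\<dots> = (\<Sum>k | m k < 0 \<and> z ^ k = 1. m k) + (\<Sum>k | m k > 0 \<and> z ^ k = 1. m k)"
      using fin' by (intro sum.union_disjoint) auto
    also have "(\<Sum>k | m k > 0 \<and> z ^ k = 1. m k) = int (count (proots ?R) z)"
      using fp'(3) by (simp del: count_proots)
    finally show "count (proots ?L) z = count (proots ?R) z" by (simp add: sum_negf)
  qed
  moreover have "lead_coeff ?L = 1" "lead_coeff ?R = 1"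
    using cpoly_rpoly_roots(1)[of ?A] fp(2) fp'(2) by (simp_all only: lead_coeff_mult mult_1)
  ultimately have "?L = ?R" by (rule monic_eqI)
  then have "is_frame_shape b m" unfolding is_frame_shape_prod using m(1,2) by blast
  then show ?thesis by (intro exI[of _ m])
qed

definition int_vec :: "int ^ 24 \<Rightarrow> R24" where
  "int_vec c = (\<chi> i. of_int (c $ i))"

text \<open>The columns of P are a lattice basis. Their independence over the reals gives a trivial
  kernel, hence a nonzero determinant.\<close>

lemma leech_lattice_matrix:
  assumes "leech_lattice \<Lambda>"
  obtains P :: "real ^ 24 ^ 24" where "det P \<noteq> 0" "\<Lambda> = range (\<lambda>c. P *v int_vec c)"
proof -
  obtain B where B: "independent B" "span B = UNIV"
    "\<Lambda> = {\<Sum>b\<in>B. of_int (c b) *\<^sub>R b | c :: R24 \<Rightarrow> int. True}"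
    using assms unfolding leech_lattice_def by blast
  have fin: "finite B" using B(1) by (rule independent_imp_finite)
  have "card B = dim (UNIV :: R24 set)" using dim_eq_card_independent[OF B(1)] B(2) dim_span[of B] by simp
  also have "\<dots> = CARD(24)" by simp
  finally have card: "card B = CARD(24)" .
  then obtain h :: "24 \<Rightarrow> R24" where h: "bij_betw h UNIV B"
    using finite_same_card_bij[of "UNIV :: 24 set" B] fin by auto
  define P :: "real ^ 24 ^ 24" where "P = (\<chi> i j. h j $ i)"
  have col: "column j P = h j" for j by (simp add: P_def column_def vec_eq_iff)
  have Pv: "P *v x = (\<Sum>j\<in>UNIV. (x $ j) *\<^sub>R h j)" for x
    by (simp add: matrix_mult_sum col scalar_mult_eq_scaleR)
  have "x = 0" if "P *v x = 0" for x
  proof -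
    have eq0: "(\<Sum>b\<in>B. (x $ (inv_into UNIV h b)) *\<^sub>R b) = 0"
    proof -
      have "(\<Sum>b\<in>B. (x $ (inv_into UNIV h b)) *\<^sub>R b) =
          (\<Sum>j\<in>UNIV. (x $ (inv_into UNIV h (h j))) *\<^sub>R h j)"
        by (rule sum.reindex_bij_betw[OF h, symmetric])
      then show ?thesis using that bij_betw_imp_inj_on[OF h] by (simp add: Pv)
    qed
    have "x $ (inv_into UNIV h b) = 0" if "b \<in> B" for b
      by (rule independentD[OF B(1) fin subset_refl eq0 that])
    then have "x $ j = 0" for j
      using h by (metis bij_betwE bij_betw_imp_inj_on inv_into_f_f UNIV_I)
    then show ?thesis by (simp add: vec_eq_iff)
  qed
  then have "det P \<noteq> 0"
    using matrix_left_invertible_ker[of P] by (metis det_I det_mul mult_zero_right zero_neq_one)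
  moreover have "\<Lambda> = range (\<lambda>c. P *v int_vec c)"
  proof (intro equalityI subsetI)
    fix x assume "x \<in> \<Lambda>"
    then obtain c where "x = (\<Sum>b\<in>B. of_int (c b) *\<^sub>R b)" using B(3) by auto
    also have "\<dots> = (\<Sum>j\<in>UNIV. of_int (c (h j)) *\<^sub>R h j)"
      by (rule sum.reindex_bij_betw[OF h, symmetric])
    also have "\<dots> = P *v int_vec (\<chi> j. c (h j))" by (simp add: Pv int_vec_def)
    finally show "x \<in> range (\<lambda>c. P *v int_vec c)" by blast
  next
    fix x assume "x \<in> range (\<lambda>c. P *v int_vec c)"
    then obtain c where "x = P *v int_vec c" by auto
    also have "\<dots> = (\<Sum>j\<in>UNIV. of_int (c $ inv_into UNIV h (h j)) *\<^sub>R h j)"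
      using bij_betw_imp_inj_on[OF h] by (simp add: Pv int_vec_def)
    also have "\<dots> = (\<Sum>b\<in>B. of_int (c $ inv_into UNIV h b) *\<^sub>R b)"
      by (rule sum.reindex_bij_betw[OF h])
    finally show "x \<in> \<Lambda>" using B(3) by auto
  qed
  ultimately show ?thesis using that by blast
qed

section \<open>Finite order and Frame shapes of lattice automorphisms\<close>

lemma mat_pow_matrix:
  assumes "linear (b :: R24 \<Rightarrow> R24)"
  shows "mat_pow (matrix b) j *v x = (b ^^ j) x"
proof (induction j arbitrary: x)
  case (Suc j)
  have "matrix b *v x = b x" by (rule matrix_works) (use assms in \<open>simp add: linear_matrix_vector_mul_eq\<close>)
  then show ?case
    by (simp add: matrix_vector_mul_assoc[symmetric] Suc funpow_swap1)
qed simp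

text \<open>In a lattice basis b has an integral matrix N. Its powers are conjugate to powers of an
  orthogonal map, so their entries are bounded; only finitely many integral matrices remain, two
  powers coincide, and N has finite order. Thus a Frame shape exists and the \<open>SOME\<close> in
  \<open>frame_shape\<close> picks one.\<close>

theorem frame_shape_traces:
  assumes "leech_lattice \<Lambda>" and b: "b \<in> carrier (Aut_lattice \<Lambda>)"
  shows "frame_traces (matrix b) (frame_shape b)"
proof -
  have orth: "orthogonal_transformation b" and b\<Lambda>: "b ` \<Lambda> = \<Lambda>"
    using b by (auto simp: Aut_lattice_def)
  have lin: "linear b" using orth by (rule orthogonal_transformation_linear)
  obtain P :: "real ^ 24 ^ 24" where P: "det P \<noteq> 0" "\<Lambda> = range (\<lambda>c. P *v int_vec c)"
    using leech_lattice_matrix[OF assms(1)] .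
  obtain P' where P': "P' ** P = mat 1" "P ** P' = mat 1"
    using P(1) by (metis invertible_def invertible_det_nz)
  have axis_int: "axis j 1 = int_vec (axis j 1)" for j by (simp add: int_vec_def axis_def vec_eq_iff)
  have mb: "matrix b *v x = b x" for x using mat_pow_matrix[OF lin, of 1] by (simp add: matrix_mul_lid)
  have "\<exists>c. b (P *v axis j 1) = P *v int_vec c" for j
  proof -
    have "P *v axis j 1 \<in> \<Lambda>" unfolding P(2) axis_int by (rule rangeI)
    then have "b (P *v axis j 1) \<in> \<Lambda>" using b\<Lambda> by blast
    then show ?thesis unfolding P(2) by auto
  qed
  then obtain c where c: "\<And>j. b (P *v axis j 1) = P *v int_vec (c j)" by metis
  define N :: "int ^ 24 ^ 24" where "N = (\<chi> i j. c j $ i)"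
  have N: "of_mat real_of_int N *v axis j 1 = int_vec (c j)" for j
    by (simp add: matrix_vector_mul_component of_mat_def N_def int_vec_def vec_eq_iff inner_axis)
  have conj: "matrix b ** P = P ** of_mat real_of_int N"
  proof -
    have "(matrix b ** P) *v axis j 1 = (P ** of_mat real_of_int N) *v axis j 1" for j
      by (simp add: matrix_vector_mul_assoc[symmetric] mb c N)
    then show ?thesis
      by (simp add: matrix_vector_mult_basis column_def vec_eq_iff)
  qed
  have conj_pow: "mat_pow (matrix b) j ** P = P ** of_mat real_of_int (mat_pow N j)" for j
  proof -
    have "mat_pow (matrix b) j ** P = P ** mat_pow (of_mat real_of_int N) j"
      by (induction j)
        (simp_all add: matrix_mul_lid matrix_mul_rid matrix_mul_assoc[symmetric] conj,
          simp add: matrix_mul_assoc)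
    then show ?thesis by (simp add: of_mat_pow(1)[of real_of_int])
  qed
  have Nj: "of_mat real_of_int (mat_pow N j) = P' ** mat_pow (matrix b) j ** P" for j
    by (simp add: matrix_mul_assoc[symmetric] conj_pow) (simp add: matrix_mul_assoc P' matrix_mul_lid)
  have iso: "norm ((b ^^ j) x) = norm x" for j x
    by (induction j) (auto simp: orthogonal_transformation_norm[OF orth])
  obtain K where K: "K > 0" "\<And>x. norm (P' *v x) \<le> K * norm x"
    using linear_bounded_pos[OF matrix_vector_mul_linear[of P']] by blast
  obtain K' where K': "K' > 0" "\<And>x. norm (P *v x) \<le> K' * norm x"
    using linear_bounded_pos[OF matrix_vector_mul_linear[of P]] by blast
  \<comment> \<open>An entry is a component of P' b^j P applied to a unit vector; b preserves norms,
    and K and K' bound P' and P.\<close>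
  have bound: "\<bar>mat_pow N j $ i $ k\<bar> \<le> \<lceil>K * K'\<rceil>" for i j k
  proof -
    have "\<bar>of_mat real_of_int (mat_pow N j) $ i $ k\<bar> = \<bar>(of_mat real_of_int (mat_pow N j) *v axis k 1) $ i\<bar>"
      by (simp add: matrix_vector_mult_basis column_def)
    also have "\<dots> \<le> norm (of_mat real_of_int (mat_pow N j) *v axis k 1)" by (rule component_le_norm_cart)
    also have "\<dots> = norm (P' *v ((b ^^ j) (P *v axis k 1)))"
      by (simp add: Nj matrix_vector_mul_assoc[symmetric] mat_pow_matrix[OF lin])
    also have "\<dots> \<le> K * norm (P *v axis k 1)" using K(2) by (metis iso)
    also have "\<dots> \<le> K * (K' * norm (axis k 1 :: R24))" using K(1) K'(2)[of "axis k 1"] by (intro mult_left_mono) auto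
    finally have "\<bar>real_of_int (mat_pow N j $ i $ k)\<bar> \<le> K * K'" by (simp add: of_mat_def)
    then show ?thesis by linarith
  qed
  have bound': "- \<lceil>K * K'\<rceil> \<le> mat_pow N j $ i $ k" "mat_pow N j $ i $ k \<le> \<lceil>K * K'\<rceil>" for i j k
    using bound[of j i k] by linarith+
  let ?F = "(\<lambda>f. \<chi> i k. f (i, k)) ` (PiE UNIV (\<lambda>_ :: 24 \<times> 24. {- \<lceil>K * K'\<rceil>..\<lceil>K * K'\<rceil>}))"
  have "mat_pow N j \<in> ?F" for j
    by (rule image_eqI[of _ _ "\<lambda>(i, k). mat_pow N j $ i $ k"])
      (use bound' in \<open>auto simp: vec_eq_iff\<close>)
  then have "range (mat_pow N) \<subseteq> ?F" by auto
  moreover have "finite ?F" by (intro finite_imageI finite_PiE) auto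
  ultimately have "finite (range (mat_pow N))" by (rule finite_subset)
  then have "\<not> inj (mat_pow N)" using finite_imageD infinite_UNIV_nat by blast
  then obtain i j where ij: "i < j" "mat_pow N i = mat_pow N j" by (metis injI linorder_neqE_nat)
  have inj: "inj (b ^^ i)" by (intro inj_fn orthogonal_transformation_inj orth)
  have M1: "mat_pow N (j - i) = mat 1"
  proof -
    have "(b ^^ i) x = (b ^^ j) x" for x
    proof -
      have "mat_pow (matrix b) i ** P = mat_pow (matrix b) j ** P" by (simp add: conj_pow ij(2))
      moreover have "mat_pow (matrix b) k = mat_pow (matrix b) k ** P ** P'" for k
        by (simp add: matrix_mul_assoc[symmetric] P' matrix_mul_rid)
      ultimately have "mat_pow (matrix b) i = mat_pow (matrix b) j" by metis
      then show ?thesis by (simp add: mat_pow_matrix[OF lin, symmetric])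
    qed
    moreover have "b ^^ j = b ^^ i \<circ> b ^^ (j - i)" using ij(1) by (simp add: funpow_add[symmetric])
    ultimately have "(b ^^ (j - i)) x = x" for x using inj by (metis injD o_apply)
    then have "mat_pow (matrix b) (j - i) = mat 1"
      by (simp add: matrix_eq mat_pow_matrix[OF lin])
    then have "of_mat real_of_int (mat_pow N (j - i)) = mat 1"
      by (simp add: Nj matrix_mul_rid P')
    then have "real_of_int (mat_pow N (j - i) $ k $ l) = mat 1 $ k $ l" for k l
      by (simp add: of_mat_def vec_eq_iff)
    then show ?thesis by (auto simp: vec_eq_iff mat_def split: if_splits) (metis of_int_eq_1_iff of_int_eq_0_iff)+
  qed
  have "\<exists>m. is_frame_shape b m"
    using is_frame_shape_exists[OF _ M1 P(1) conj] ij(1) by simp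
  then have "is_frame_shape b (frame_shape b)" unfolding frame_shape_def by (rule someI_ex)
  then show ?thesis by (rule is_frame_shape_imp_frame_traces)
qed

text \<open>All closure properties come from the description of the lattice as its own dual.\<close>

lemma leech_lattice_closed:
  assumes "leech_lattice \<Lambda>" "x \<in> \<Lambda>" "y \<in> \<Lambda>"
  shows "x + y \<in> \<Lambda>" "- x \<in> \<Lambda>" "x - y \<in> \<Lambda>" "x \<bullet> y \<in> \<int>"
proof -
  have self_dual: "\<Lambda> = {x. \<forall>y\<in>\<Lambda>. x \<bullet> y \<in> \<int>}"
    using assms(1) unfolding leech_lattice_def by (elim conjE)
  then have iff: "x \<in> \<Lambda> \<longleftrightarrow> (\<forall>y\<in>\<Lambda>. x \<bullet> y \<in> \<int>)" for x
    by (rule ssubst[where P = "\<lambda>S. x \<in> S \<longleftrightarrow> (\<forall>y\<in>\<Lambda>. x \<bullet> y \<in> \<int>)"]) simp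
  have int: "x \<bullet> y \<in> \<int>" if "x \<in> \<Lambda>" "y \<in> \<Lambda>" for x y
    using iff[of x] that by blast
  have mem: "x \<in> \<Lambda>" if "\<And>y. y \<in> \<Lambda> \<Longrightarrow> x \<bullet> y \<in> \<int>" for x
    using iff[of x] that by blast
  show "x \<bullet> y \<in> \<int>" using int assms(2,3) .
  show "x + y \<in> \<Lambda>" by (rule mem) (simp add: inner_add_left int assms(2,3))
  show "- x \<in> \<Lambda>" by (rule mem) (simp add: int assms(2))
  show "x - y \<in> \<Lambda>" by (rule mem) (simp add: inner_diff_left int assms(2,3))
qed

lemma leech_lattice_even:
  assumes "leech_lattice \<Lambda>" "x \<in> \<Lambda>"
  obtains n :: nat where "x \<bullet> x = 2 * real n"
proof -
  obtain k :: int where k: "x \<bullet> x = 2 * of_int k"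
    using assms unfolding leech_lattice_def by blast
  then have "k \<ge> 0" using inner_ge_zero[of x] by linarith
  then show ?thesis using that[of "nat k"] k by simp
qed

lemma Aut_lattice_uminus:
  assumes "leech_lattice \<Lambda>" "a \<in> carrier (Aut_lattice \<Lambda>)"
  shows "(\<lambda>x. - a x) \<in> carrier (Aut_lattice \<Lambda>)"
proof -
  have orth: "orthogonal_transformation a" and a: "a ` \<Lambda> = \<Lambda>"
    using assms(2) by (auto simp: Aut_lattice_def)
  have "(\<lambda>x. - a x) ` \<Lambda> = uminus ` a ` \<Lambda>" by (simp add: image_image)
  also have "\<dots> = \<Lambda>"
    unfolding a using leech_lattice_closed(2)[OF assms(1)]
    by (metis (no_types, lifting) add.inverse_inverse equalityI image_eqI image_subsetI subsetI)
  finally show ?thesis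
    using orth by (simp add: Aut_lattice_def orthogonal_transformation_neg)
qed

lemma sum_abs_power_le:
  fixes r :: real
  assumes "0 < r" "r < 1"
  shows "(\<Sum>n\<in>{- int k..int k}. r ^ nat \<bar>n\<bar>) \<le> 2 / (1 - r)"
proof -
  have half: "(\<Sum>n\<in>(\<lambda>i. s * int i) ` {..k}. r ^ nat \<bar>n\<bar>) \<le> 1 / (1 - r)" if "\<bar>s\<bar> = 1" for s
  proof -
    have "(\<Sum>n\<in>(\<lambda>i. s * int i) ` {..k}. r ^ nat \<bar>n\<bar>) = (\<Sum>i\<le>k. r ^ i)"
      using that by (subst sum.reindex) (auto simp: inj_on_def abs_mult)
    also have "\<dots> \<le> suminf (\<lambda>i. r ^ i)"
      using assms by (intro sum_le_suminf summable_geometric) auto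
    also have "\<dots> = 1 / (1 - r)" using assms by (intro suminf_geometric) simp
    finally show ?thesis .
  qed
  have "{- int k..int k} \<subseteq> (\<lambda>i. 1 * int i) ` {..k} \<union> (\<lambda>i. - 1 * int i) ` {..k}"
  proof
    fix n assume "n \<in> {- int k..int k}"
    then have "n = 1 * int (nat n) \<and> nat n \<le> k \<or> n = - 1 * int (nat (- n)) \<and> nat (- n) \<le> k"
      by auto
    then show "n \<in> (\<lambda>i. 1 * int i) ` {..k} \<union> (\<lambda>i. - 1 * int i) ` {..k}" by blast
  qed
  then have "(\<Sum>n\<in>{- int k..int k}. r ^ nat \<bar>n\<bar>) \<le>
      (\<Sum>n\<in>(\<lambda>i. 1 * int i) ` {..k} \<union> (\<lambda>i. - 1 * int i) ` {..k}. r ^ nat \<bar>n\<bar>)"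
    using assms by (intro sum_mono2) auto
  also have "\<dots> \<le> (\<Sum>n\<in>(\<lambda>i. 1 * int i) ` {..k}. r ^ nat \<bar>n\<bar>) + (\<Sum>n\<in>(\<lambda>i. - 1 * int i) ` {..k}. r ^ nat \<bar>n\<bar>)"
    using assms by (subst sum_Un) (auto intro!: sum_nonneg)
  also have "\<dots> \<le> 1 / (1 - r) + 1 / (1 - r)" by (intro add_mono half) auto
  finally show ?thesis by simp
qed

text \<open>In lattice coordinates c the norm is bounded below by a multiple of the sum of the
  c_i^2, and c_i^2 is at least |c_i| for integers. So the Gaussian is dominated by a product of 24
  two-sided geometric series.\<close>

lemma lattice_theta_summable:
  assumes "leech_lattice \<Lambda>" and t: "0 < t"
  shows "(\<lambda>\<gamma>. exp (- t * (\<gamma> \<bullet> \<gamma>))) summable_on \<Lambda>"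
proof -
  obtain P :: "real ^ 24 ^ 24" where P: "det P \<noteq> 0" "\<Lambda> = range (\<lambda>c. P *v int_vec c)"
    using leech_lattice_matrix[OF assms(1)] .
  obtain P' where P': "P' ** P = mat 1"
    using P(1) by (metis invertible_def invertible_det_nz)
  obtain K where K: "K > 0" "\<And>x. norm (P' *v x) \<le> K * norm x"
    using linear_bounded_pos[OF matrix_vector_mul_linear[of P']] by blast
  \<comment> \<open>Each of the 24 coordinates satisfies |c_i| \<le> c_i^2 \<le> K^2 (x \<bullet>
    x), so the sum of the |c_i| is at most 24 K^2 (x \<bullet> x).\<close>
  define r where "r = exp (- t / (24 * K ^ 2))"
  have r: "0 < r" "r < 1" using K(1) t by (auto simp: r_def)
  define F where "F c = (\<Prod>i\<in>UNIV. r ^ nat \<bar>c $ i\<bar>)" for c :: "int ^ 24"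
  have bound: "exp (- t * ((P *v int_vec c) \<bullet> (P *v int_vec c))) \<le> F c" for c
  proof -
    let ?x = "P *v int_vec c"
    have "P' *v ?x = int_vec c" by (simp add: matrix_vector_mul_assoc P')
    then have "\<bar>real_of_int (c $ i)\<bar> \<le> K * norm ?x" for i
      using component_le_norm_cart[of "P' *v ?x" i] K(2)[of ?x] by (simp add: int_vec_def)
    then have "(real_of_int (c $ i))\<^sup>2 \<le> (K * norm ?x)\<^sup>2" for i
      by (metis abs_ge_zero power2_abs power_mono)
    then have sq: "(real_of_int (c $ i))\<^sup>2 \<le> K ^ 2 * (?x \<bullet> ?x)" for i
      by (simp add: power_mult_distrib power2_norm_eq_inner)
    have "real (nat \<bar>c $ i\<bar>) \<le> (real_of_int (c $ i))\<^sup>2" for i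
    proof -
      have "\<bar>c $ i\<bar> \<le> \<bar>c $ i\<bar> * \<bar>c $ i\<bar>"
        using mult_left_mono[of 1 "\<bar>c $ i\<bar>" "\<bar>c $ i\<bar>"] by (cases "c $ i = 0") auto
      then have "real_of_int \<bar>c $ i\<bar> \<le> real_of_int (\<bar>c $ i\<bar> * \<bar>c $ i\<bar>)" by (simp only: of_int_le_iff)
      then show ?thesis by (simp add: power2_eq_square)
    qed
    then have "(\<Sum>i\<in>UNIV. real (nat \<bar>c $ i\<bar>)) \<le> (\<Sum>i\<in>(UNIV :: 24 set). K ^ 2 * (?x \<bullet> ?x))"
      using sq by (intro sum_mono) (rule order.trans)
    also have "\<dots> = 24 * K ^ 2 * (?x \<bullet> ?x)" by simp
    finally have "(\<Sum>i\<in>UNIV. real (nat \<bar>c $ i\<bar>)) * t / (24 * K ^ 2) \<le> t * (?x \<bullet> ?x)"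
      using K(1) t by (simp add: field_simps)
    then have "exp (- t * (?x \<bullet> ?x)) \<le> exp ((\<Sum>i\<in>UNIV. real (nat \<bar>c $ i\<bar>)) * (- t / (24 * K ^ 2)))"
      by (simp add: field_simps)
    also have "\<dots> = F c"
      by (simp only: F_def r_def exp_of_nat_mult[symmetric] exp_sum[OF finite, symmetric] sum_distrib_right)
    finally show ?thesis .
  qed
  have "F summable_on UNIV"
  proof (rule nonneg_bdd_above_summable_on)
    show "F c \<ge> 0" for c using r by (auto simp: F_def intro!: prod_nonneg)
    show "bdd_above (sum F ` {S. S \<subseteq> UNIV \<and> finite S})"
    proof (rule bdd_aboveI2)
      fix S :: "(int ^ 24) set" assume "S \<in> {S. S \<subseteq> UNIV \<and> finite S}"
      then have fin: "finite S" by simp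
      then have "finite ((\<lambda>(c, i). nat \<bar>c $ i\<bar>) ` (S \<times> UNIV))" by simp
      then obtain k where "\<forall>n\<in>(\<lambda>(c, i). nat \<bar>c $ i\<bar>) ` (S \<times> UNIV). n \<le> k"
        unfolding finite_nat_set_iff_bounded_le by blast
      then have k: "nat \<bar>c $ i\<bar> \<le> k" if "c \<in> S" for c :: "int ^ 24" and i
        using that by force
      let ?G = "PiE UNIV (\<lambda>_ :: 24. {- int k..int k})"
      have "inj_on vec_nth S" by (auto simp: inj_on_def vec_eq_iff)
      then have "sum F S = (\<Sum>g\<in>vec_nth ` S. \<Prod>i\<in>UNIV. r ^ nat \<bar>g i\<bar>)"
        by (simp add: sum.reindex F_def)
      also have "\<dots> \<le> (\<Sum>g\<in>?G. \<Prod>i\<in>UNIV. r ^ nat \<bar>g i\<bar>)"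
      proof (rule sum_mono2)
        have "- int k \<le> c $ i \<and> c $ i \<le> int k" if "c \<in> S" for c :: "int ^ 24" and i
          using k[OF that, of i] by linarith
        then show "vec_nth ` S \<subseteq> ?G" by auto
        show "finite ?G" by (intro finite_PiE) auto
      qed (use r in \<open>auto intro!: prod_nonneg\<close>)
      also have "\<dots> = (\<Prod>i\<in>(UNIV :: 24 set). \<Sum>n\<in>{- int k..int k}. r ^ nat \<bar>n\<bar>)"
        by (rule prod_sum_PiE[symmetric]) auto
      also have "\<dots> \<le> (\<Prod>i\<in>(UNIV :: 24 set). 2 / (1 - r))"
        using r by (intro prod_mono conjI sum_abs_power_le sum_nonneg) auto
      finally show "sum F S \<le> (2 / (1 - r)) ^ 24" by simp
    qed
  qed
  then have "(\<lambda>c. exp (- t * ((P *v int_vec c) \<bullet> (P *v int_vec c)))) summable_on UNIV"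
    by (rule summable_on_comparison_test) (use bound in auto)
  moreover have "inj (\<lambda>c. P *v int_vec c)"
  proof (rule injI)
    fix c c' assume "P *v int_vec c = P *v int_vec c'"
    then have "P' *v (P *v int_vec c) = P' *v (P *v int_vec c')" by simp
    then show "c = c'" by (simp add: matrix_vector_mul_assoc P' int_vec_def vec_eq_iff)
  qed
  ultimately show ?thesis
    unfolding P(2) by (subst summable_on_reindex) (simp_all add: o_def)
qed

text \<open>Every point of the ball contributes at least exp (-r) to a convergent series, which
  bounds the number of points.\<close>

lemma finite_lattice_ball:
  assumes "leech_lattice \<Lambda>"
  shows "finite {\<gamma> \<in> \<Lambda>. \<gamma> \<bullet> \<gamma> \<le> r}"
proof -
  let ?f = "\<lambda>\<gamma> :: R24. exp (- 1 * (\<gamma> \<bullet> \<gamma>))" and ?S = "{\<gamma> \<in> \<Lambda>. \<gamma> \<bullet> \<gamma> \<le> r}"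
  have sum: "?f summable_on \<Lambda>" by (rule lattice_theta_summable[OF assms]) simp
  have "card F \<le> nat \<lceil>infsum ?f \<Lambda> / exp (- r)\<rceil>" if F: "F \<subseteq> ?S" "finite F" for F
  proof -
    have "real (card F) * exp (- r) = (\<Sum>\<gamma>\<in>F. exp (- r))" by simp
    also have "\<dots> \<le> (\<Sum>\<gamma>\<in>F. ?f \<gamma>)" by (intro sum_mono) (use F in auto)
    also have "\<dots> \<le> infsum ?f \<Lambda>"
      by (rule finite_sum_le_infsum[OF sum]) (use F in auto)
    finally have "real (card F) \<le> infsum ?f \<Lambda> / exp (- r)" by (simp add: field_simps)
    then show ?thesis by linarith
  qed
  then show ?thesis using finite_if_finite_subsets_card_bdd[of ?S] by blast
qed

section \<open>Traces computed in spanning families\<close>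

text \<open>The scalings are arguments because the spaces involved carry \<open>fscale\<close>,
  \<open>scale_VL\<close>, \<open>scale_VT\<close>, \<open>scale_VN\<close> or multiplication
  instead of a common one.\<close>

definition linear_wrt ::
  "('c \<Rightarrow> 'v::ab_group_add \<Rightarrow> 'v) \<Rightarrow> ('c \<Rightarrow> 'w::ab_group_add \<Rightarrow> 'w) \<Rightarrow> ('v \<Rightarrow> 'w) \<Rightarrow> bool" where
  "linear_wrt sc sc' f \<longleftrightarrow> (\<forall>x y. f (x + y) = f x + f y) \<and> (\<forall>c x. f (sc c x) = sc' c (f x))"

lemma linear_wrtI:
  "(\<And>x y. f (x + y) = f x + f y) \<Longrightarrow> (\<And>c x. f (sc c x) = sc' c (f x)) \<Longrightarrow> linear_wrt sc sc' f"
  by (simp add: linear_wrt_def)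

lemma linear_wrt_add: "linear_wrt sc sc' f \<Longrightarrow> f (x + y) = f x + f y"
  and linear_wrt_scale: "linear_wrt sc sc' f \<Longrightarrow> f (sc c x) = sc' c (f x)"
  by (simp_all add: linear_wrt_def)

lemma linear_wrt_0: "linear_wrt sc sc' f \<Longrightarrow> f 0 = 0"
  using linear_wrt_add[of sc sc' f 0 0] by simp

lemma linear_wrt_sum: "linear_wrt sc sc' f \<Longrightarrow> f (\<Sum>i\<in>I. g i) = (\<Sum>i\<in>I. f (g i))"
  by (induction I rule: infinite_finite_induct) (auto simp: linear_wrt_0 linear_wrt_add)

lemma linear_wrt_compose:
  "linear_wrt sc sc' f \<Longrightarrow> linear_wrt sc' sc'' g \<Longrightarrow> linear_wrt sc sc'' (\<lambda>x. g (f x))"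
  by (simp add: linear_wrt_def)

text \<open>The family need not be linearly independent. This allows one to use the images of a basis of
  a larger space under a projection onto \<open>W\<close>.\<close>

lemma trace_on_spanning_family:
  assumes W: "VN.subspace W" and I: "finite I" "\<And>i. i \<in> I \<Longrightarrow> b i \<in> W"
    and \<phi>: "\<And>i. i \<in> I \<Longrightarrow> linear_wrt scale_VN (*) (\<phi> i)"
    and expand: "\<And>w. w \<in> W \<Longrightarrow> w = (\<Sum>i\<in>I. scale_VN (\<phi> i w) (b i))"
    and f: "linear_wrt scale_VN scale_VN f" "\<And>w. w \<in> W \<Longrightarrow> f w \<in> W"
  shows "trace_on W f = (\<Sum>i\<in>I. \<phi> i (f (b i)))"
proof -
  define B where "B = (SOME B. VN.independent B \<and> VN.span B = W)"
  have ex: "\<exists>B. VN.independent B \<and> VN.span B = W"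
  proof -
    obtain B where B: "B \<subseteq> W" "VN.independent B" "W \<subseteq> VN.span B" "card B = VN.dim W"
      by (rule VN.basis_exists)
    have "VN.span B = W" by (rule equalityI[OF VN.span_minimal[OF B(1) W] B(3)])
    then show ?thesis using B(2) by (intro exI[of _ B]) simp
  qed
  have B': "VN.independent B \<and> VN.span B = W"
    using someI_ex[OF ex] unfolding B_def[symmetric] .
  note B = conjunct1[OF B'] conjunct2[OF B']
  have "W \<subseteq> VN.span (b ` I)"
  proof
    fix w assume "w \<in> W"
    then have "w = (\<Sum>i\<in>I. scale_VN (\<phi> i w) (b i))" by (rule expand)
    also have "\<dots> \<in> VN.span (b ` I)" by (intro VN.span_sum VN.span_scale VN.span_base) auto
    finally show "w \<in> VN.span (b ` I)" .
  qed
  then have fin: "finite B"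
    using VN.independent_span_bound[of "b ` I" B] B VN.span_superset[of B] I(1) by auto
  have BW: "x \<in> W" if "x \<in> B" for x using that B(2) VN.span_base by blast
  let ?r = "VN.representation B"
  \<comment> \<open>The trace in B is rewritten through the family: x is expanded in the vectors b
    i, f is applied, and the diagonal coefficient is taken. Summing over B afterwards reassembles
    each f (b i).\<close>
  have rep: "?r (f x) x = (\<Sum>i\<in>I. \<phi> i x * ?r (f (b i)) x)" if "x \<in> B" for x
  proof -
    have "f x = f (\<Sum>i\<in>I. scale_VN (\<phi> i x) (b i))" using expand[OF BW[OF that]] by simp
    also have "\<dots> = (\<Sum>i\<in>I. scale_VN (\<phi> i x) (f (b i)))"
      by (simp add: linear_wrt_sum[OF f(1)] linear_wrt_scale[OF f(1)])
    finally have fx: "f x = (\<Sum>i\<in>I. scale_VN (\<phi> i x) (f (b i)))" .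
    have "?r (\<Sum>i\<in>I. scale_VN (\<phi> i x) (f (b i))) = (\<lambda>y. \<Sum>i\<in>I. ?r (scale_VN (\<phi> i x) (f (b i))) y)"
    proof (rule VN.representation_sum[OF B(1)])
      fix i assume "i \<in> I"
      then have "f (b i) \<in> VN.span B" using f(2) I(2) B(2) by simp
      then show "scale_VN (\<phi> i x) (f (b i)) \<in> VN.span B" by (rule VN.span_scale)
    qed
    moreover have "?r (scale_VN (\<phi> i x) (f (b i))) = (\<lambda>y. \<phi> i x * ?r (f (b i)) y)" if "i \<in> I" for i
      by (rule VN.representation_scale[OF B(1)]) (use B(2) f(2) I(2) that in auto)
    ultimately show ?thesis unfolding fx by simp
  qed
  have "trace_on W f = (\<Sum>x\<in>B. ?r (f x) x)"
    by (simp add: trace_on_def B_def Let_def)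
  also have "\<dots> = (\<Sum>i\<in>I. \<Sum>x\<in>B. \<phi> i x * ?r (f (b i)) x)"
    by (simp add: rep) (rule sum.swap)
  also have "\<dots> = (\<Sum>i\<in>I. \<phi> i (f (b i)))"
  proof (intro sum.cong refl)
    fix i assume i: "i \<in> I"
    have "f (b i) = (\<Sum>x\<in>B. scale_VN (?r (f (b i)) x) x)"
      by (rule VN.sum_representation_eq[symmetric, OF B(1) _ fin]) (use B(2) f(2) I(2) i in auto)
    then have "\<phi> i (f (b i)) = \<phi> i (\<Sum>x\<in>B. scale_VN (?r (f (b i)) x) x)" by simp
    also have "\<dots> = (\<Sum>x\<in>B. \<phi> i x * ?r (f (b i)) x)"
      by (simp add: linear_wrt_sum[OF \<phi>[OF i]] linear_wrt_scale[OF \<phi>[OF i]] mult.commute)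
    finally show "(\<Sum>x\<in>B. \<phi> i x * ?r (f (b i)) x) = \<phi> i (f (b i))" ..
  qed
  finally show ?thesis .
qed

section \<open>Linear maps on the lattice vertex algebra and its twisted module\<close>

lemma scale_VL_single: "scale_VL c (Poly_Mapping.single \<beta> p) = Poly_Mapping.single \<beta> (fscale c p)"
  by (rule poly_mapping_eqI) (simp add: lookup_scale_VL lookup_single when_def)

lemma scale_VL_add: "scale_VL c (w + w') = scale_VL c w + scale_VL c w'"
  by (rule poly_mapping_eqI) (simp add: lookup_scale_VL lookup_add fscale_simps)

lemma scale_VL_sum: "scale_VL c (\<Sum>i\<in>I. w i) = (\<Sum>i\<in>I. scale_VL c (w i))"
  by (rule poly_mapping_eqI) (simp add: lookup_scale_VL lookup_sum fscale_sum)

lemma scale_VL_0 [simp]: "scale_VL c 0 = 0"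
  by (rule poly_mapping_eqI) (simp add: lookup_scale_VL)

lemma scale_VT_component: "scale_VT c x $ i = fscale c (x $ i)"
  by (simp add: scale_VT_def)

lemma VL_expand: "(\<Sum>\<beta>\<in>Poly_Mapping.keys w. Poly_Mapping.single \<beta> (Poly_Mapping.lookup w \<beta>)) = w"
  for w :: VL
  by (rule poly_mapping_eqI) (auto simp: lookup_sum lookup_single when_def in_keys_iff)

lemma
  assumes F: "\<And>\<beta>. linear_wrt fscale scale_VL (F \<beta>)"
  shows linear_extend_VL: "linear_wrt scale_VL scale_VL (extend_VL F)"
    and extend_VL_single: "extend_VL F (Poly_Mapping.single \<beta> p) = F \<beta> p"
proof -
  have ext: "extend_VL F w = (\<Sum>\<beta>\<in>K. F \<beta> (Poly_Mapping.lookup w \<beta>))"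
    if "finite K" "Poly_Mapping.keys w \<subseteq> K" for w K
    unfolding extend_VL_def
    using that by (intro sum.mono_neutral_left) (auto simp: linear_wrt_0[OF F] in_keys_iff)
  show "linear_wrt scale_VL scale_VL (extend_VL F)"
  proof (rule linear_wrtI)
    fix w w' :: VL
    let ?K = "Poly_Mapping.keys w \<union> Poly_Mapping.keys w'"
    show "extend_VL F (w + w') = extend_VL F w + extend_VL F w'"
      using ext[of ?K "w + w'"] ext[of ?K w] ext[of ?K w'] Poly_Mapping.keys_add[of w w']
      by (simp add: lookup_add linear_wrt_add[OF F] sum.distrib)
  next
    fix c and w :: VL
    have "Poly_Mapping.keys (scale_VL c w) \<subseteq> Poly_Mapping.keys w"
      by (auto simp: in_keys_iff lookup_scale_VL)
    then show "extend_VL F (scale_VL c w) = scale_VL c (extend_VL F w)"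
      using ext[of "Poly_Mapping.keys w" "scale_VL c w"]
      by (simp add: extend_VL_def lookup_scale_VL linear_wrt_scale[OF F] scale_VL_sum)
  qed
  show "extend_VL F (Poly_Mapping.single \<beta> p) = F \<beta> p"
    using linear_wrt_0[OF F] by (auto simp: extend_VL_def)
qed

lemma linear_single:
  assumes "fock_linear F"
  shows "linear_wrt fscale scale_VL (\<lambda>p. Poly_Mapping.single \<beta> (F p))"
  using assms by (intro linear_wrtI) (simp_all add: single_add fock_linear_add fock_linear_fscale scale_VL_single)

lemma VL_linear_eqI:
  assumes "linear_wrt scale_VL sc f" "linear_wrt scale_VL sc g" "w \<in> V_lattice \<Lambda>"
    and "\<And>\<beta> p. \<beta> \<in> \<Lambda> \<Longrightarrow> f (Poly_Mapping.single \<beta> p) = g (Poly_Mapping.single \<beta> p)"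
  shows "f w = g w"
proof -
  have "f (\<Sum>\<beta>\<in>Poly_Mapping.keys w. Poly_Mapping.single \<beta> (Poly_Mapping.lookup w \<beta>)) =
      g (\<Sum>\<beta>\<in>Poly_Mapping.keys w. Poly_Mapping.single \<beta> (Poly_Mapping.lookup w \<beta>))"
    unfolding linear_wrt_sum[OF assms(1)] linear_wrt_sum[OF assms(2)]
    by (intro sum.cong refl assms(4)) (use assms(3) in \<open>auto simp: V_lattice_def\<close>)
  then show ?thesis by (simp only: VL_expand)
qed

lemma linear_t_VL: "linear_wrt scale_VL scale_VL t_VL"
  and t_VL_single: "t_VL (Poly_Mapping.single \<beta> p) = Poly_Mapping.single (- \<beta>) (fock_sign p)"
proof -
  have F: "linear_wrt fscale scale_VL (\<lambda>p. Poly_Mapping.single (- \<beta>) (fock_sign p))" for \<beta> :: R24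
    by (rule linear_single[OF fock_linear_sign])
  show "linear_wrt scale_VL scale_VL t_VL" unfolding t_VL_def by (rule linear_extend_VL[OF F])
  show "t_VL (Poly_Mapping.single \<beta> p) = Poly_Mapping.single (- \<beta>) (fock_sign p)"
    unfolding t_VL_def by (rule extend_VL_single[OF F])
qed

lemma linear_Y_VL: "linear_wrt scale_VL scale_VL (Y_VL \<epsilon> \<beta> r)"
  and Y_VL_single: "Y_VL \<epsilon> \<beta> r (Poly_Mapping.single \<gamma> p) =
    Poly_Mapping.single (\<beta> + \<gamma>) (fscale (\<epsilon> \<beta> \<gamma>) (E_coeff 1 (- \<beta>) (r - \<beta> \<bullet> \<gamma>) p))"
proof -
  have F: "linear_wrt fscale scale_VL (\<lambda>p. Poly_Mapping.single (\<beta> + \<gamma>)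
      (fscale (\<epsilon> \<beta> \<gamma>) (E_coeff 1 (- \<beta>) (r - \<beta> \<bullet> \<gamma>) p)))" for \<gamma>
    by (intro linear_single fock_linear_scale untwisted.fock_linear_E_coeff)
  show "linear_wrt scale_VL scale_VL (Y_VL \<epsilon> \<beta> r)" unfolding Y_VL_def by (rule linear_extend_VL[OF F])
  show "Y_VL \<epsilon> \<beta> r (Poly_Mapping.single \<gamma> p) =
      Poly_Mapping.single (\<beta> + \<gamma>) (fscale (\<epsilon> \<beta> \<gamma>) (E_coeff 1 (- \<beta>) (r - \<beta> \<bullet> \<gamma>) p))"
    unfolding Y_VL_def by (rule extend_VL_single[OF F])
qed

lemma linear_act_VL: "linear_wrt scale_VL scale_VL (act_VL G g)"
  and act_VL_single: "act_VL G g (Poly_Mapping.single \<beta> p) =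
    Poly_Mapping.single (gproj G g \<beta>) (fscale (gsign G g \<beta>) (fock_act (gproj G g) p))"
proof -
  have F: "linear_wrt fscale scale_VL (\<lambda>p. Poly_Mapping.single (gproj G g \<beta>)
      (fscale (gsign G g \<beta>) (fock_act (gproj G g) p)))" for \<beta>
    by (intro linear_single fock_linear_scale fock_linear_act)
  show "linear_wrt scale_VL scale_VL (act_VL G g)" unfolding act_VL_def by (rule linear_extend_VL[OF F])
  show "act_VL G g (Poly_Mapping.single \<beta> p) =
      Poly_Mapping.single (gproj G g \<beta>) (fscale (gsign G g \<beta>) (fock_act (gproj G g) p))"
    unfolding act_VL_def by (rule extend_VL_single[OF F])
qed

lemma act_phase_natural_single:
  "act_phase \<xi> (act_natural a (Poly_Mapping.single \<beta> p)) =
     Poly_Mapping.single (a \<beta>) (fscale (exp (2 * of_real pi * \<i> * of_real (\<xi> \<bullet> a \<beta>))) (fock_act a p))"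
proof -
  have F: "linear_wrt fscale scale_VL (\<lambda>p. Poly_Mapping.single (a \<beta>) (fock_act a p))" for \<beta>
    by (intro linear_single fock_linear_act)
  have F': "linear_wrt fscale scale_VL (\<lambda>p. Poly_Mapping.single \<beta>
      (fscale (exp (2 * of_real pi * \<i> * of_real (\<xi> \<bullet> \<beta>))) p))" for \<beta>
    by (intro linear_single fock_linear_scale fock_linear_id)
  show ?thesis
    unfolding act_phase_def act_natural_def extend_VL_single[OF F] extend_VL_single[OF F'] ..
qed

lemma linear_tensor_VT:
  assumes "fock_linear f"
  shows "linear_wrt scale_VT scale_VT (tensor_VT f M)"
  using assms
  by (intro linear_wrtI)
    (simp_all add: vec_eq_iff tensor_VT_def scale_VT_def fock_linear_add fock_linear_fscale
      fscale_simps sum.distrib fscale_sum mult.commute)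

lemma linear_Y_VT: "linear_wrt scale_VT scale_VT (Y_VT eT \<beta> r)"
proof -
  have "linear_wrt scale_VT scale_VT (scale_VT c)" for c
    by (intro linear_wrtI) (simp_all add: vec_eq_iff scale_VT_def fscale_simps mult.commute)
  then show ?thesis
    unfolding Y_VT_def[abs_def]
    by (intro linear_wrt_compose[OF linear_tensor_VT] twisted.fock_linear_E_coeff)
qed

lemma linear_map_prod:
  assumes "linear_wrt scale_VL scale_VL f" "linear_wrt scale_VT scale_VT g"
  shows "linear_wrt scale_VN scale_VN (map_prod f g)"
  using assms by (auto simp: linear_wrt_def scale_VN_def)

section \<open>The involution on oscillators and vertex operators\<close>

lemma fock_sign_sign [simp]: "fock_sign (fock_sign p) = p"
proof (rule fock_linear_eqI[where p = p])
  show "fock_linear (\<lambda>p. fock_sign (fock_sign p))"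
    by (rule fock_linear_compose[OF fock_linear_sign fock_linear_sign])
qed (auto simp: fock_sign_single power_mult_distrib[symmetric])

lemma fock_sign_fvar: "fock_sign (fvar x * p) = - (fvar x * fock_sign p)"
proof (rule fock_linear_eqI[where p = p])
  show "fock_linear (\<lambda>p. fock_sign (fvar x * p))"
    by (intro fock_linear_compose[OF fock_linear_sign] fock_linear_times fock_linear_id)
  have "fock_linear (\<lambda>p. (- fvar x) * fock_sign p)"
    by (intro fock_linear_times fock_linear_sign)
  then show "fock_linear (\<lambda>p. - (fvar x * fock_sign p))" by simp
qed (simp add: fvar_times_single fock_sign_single single_uminus)

lemma fock_sign_fgen: "fock_sign (fgen \<beta> n * p) = fgen (- \<beta>) n * fock_sign p"
  by (simp add: fgen_eq sum_distrib_right fscale_mult_left fock_linear_sum[OF fock_linear_sign]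
    fock_linear_fscale[OF fock_linear_sign] fock_sign_fvar)
    (simp add: fscale_def fconst_def single_uminus)

lemma fock_sign_pdiff: "fock_sign (pdiff x p) = - pdiff x (fock_sign p)"
proof (rule fock_linear_eqI[where p = p])
  show "fock_linear (\<lambda>p. fock_sign (pdiff x p))"
    by (intro fock_linear_compose[OF fock_linear_sign] fock_linear_pdiff)
  have "fock_linear (\<lambda>p. (- 1) * pdiff x (fock_sign p))"
    by (intro fock_linear_times fock_linear_compose[OF fock_linear_pdiff fock_linear_sign])
  then show "fock_linear (\<lambda>p. - pdiff x (fock_sign p))" by simp
  fix m
  show "fock_sign (pdiff x (Poly_Mapping.single m 1)) = - pdiff x (fock_sign (Poly_Mapping.single m 1))"
  proof (cases "x \<in># m")
    case True
    then obtain m' where "m = add_mset x m'" by (metis multi_member_split)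
    moreover have "pdiff x (- p) = - pdiff x p" for p
      using fock_linear_fscale[OF fock_linear_pdiff, of x "- 1" p]
      by (simp add: fscale_def fconst_def single_uminus)
    ultimately show ?thesis by (simp add: pdiff_single fock_sign_single single_uminus mult.commute)
  next
    case False
    then show ?thesis by (simp add: pdiff_single fock_sign_single not_in_iff fock_linear_0[OF fock_linear_sign])
  qed
qed

lemma fock_sign_annihilation: "fock_sign (annihilation s \<beta> n p) = annihilation s (- \<beta>) n (fock_sign p)"
  by (simp add: annihilation_def fock_linear_sum[OF fock_linear_sign]
    fock_linear_fscale[OF fock_linear_sign] fock_sign_pdiff)
    (simp add: fscale_def fconst_def single_uminus)

lemma fock_sign_act: "linear a \<Longrightarrow> fock_sign (fock_act a p) = fock_act a (fock_sign p)"
proof (rule fock_linear_eqI[where p = p])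
  assume a: "linear a"
  show "fock_linear (\<lambda>p. fock_sign (fock_act a p))"
    by (rule fock_linear_compose[OF fock_linear_sign fock_linear_act])
  show "fock_linear (\<lambda>p. fock_act a (fock_sign p))"
    by (rule fock_linear_compose[OF fock_linear_act fock_linear_sign])
  fix m
  show "fock_sign (fock_act a (Poly_Mapping.single m 1)) = fock_act a (fock_sign (Poly_Mapping.single m 1))"
  proof (induction m)
    case empty
    have "fock_sign 1 = 1" using fock_sign_single[of "{#}" 1] by simp
    then show ?case by simp
  next
    case (add x m)
    obtain i n where x: "x = (i, n)" by (cases x)
    have neg: "fgen (- \<beta>) n = - fgen \<beta> n" for \<beta> n
      by (simp add: fgen_eq fscale_def fconst_def single_uminus sum_negf)
    have "fock_act a (- p) = - fock_act a p" for p
      using fock_linear_fscale[OF fock_linear_act, of a "- 1" p] by (simp add: fscale_def fconst_def single_uminus)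
    then show ?case
      using add by (simp add: x fvar_times_single[symmetric] fock_act_fvar_times fock_sign_fgen fock_sign_fvar neg)
  qed
qed

lemma fock_sign_exp_coeff:
  assumes "\<And>n p. fock_sign (A n p) = A' n (fock_sign p)"
  shows "fock_sign (exp_coeff s A r p) = exp_coeff s A' r (fock_sign p)"
proof -
  have "fock_sign (foldr A ns p) = foldr A' ns (fock_sign p)" for ns
    by (induction ns) (auto simp: assms)
  then show ?thesis
    by (simp add: exp_coeff_def fock_linear_sum[OF fock_linear_sign] fock_linear_fscale[OF fock_linear_sign])
qed

lemma fock_sign_E_minus: "fock_sign (E_minus s \<beta> r p) = E_minus s (- \<beta>) r (fock_sign p)"
  unfolding E_minus_def creation_def
  by (rule fock_sign_exp_coeff) (simp add: fock_linear_fscale[OF fock_linear_sign] fock_sign_fgen)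

lemma fock_sign_E_plus: "fock_sign (E_plus s \<beta> r p) = E_plus s (- \<beta>) r (fock_sign p)"
  unfolding E_plus_def
  by (rule fock_sign_exp_coeff) (simp add: fock_linear_fscale[OF fock_linear_sign] fock_sign_annihilation)

text \<open>The sign involution reverses every creation and annihilation operator, so it carries the
  vertex operator of \<beta> to that of -\<beta>.\<close>

lemma (in fock_grading) fock_sign_E_coeff: "fock_sign (E_coeff s \<beta> r p) = E_coeff s (- \<beta>) r (fock_sign p)"
proof -
  have "finite (degree_of ` (Poly_Mapping.keys p \<union> Poly_Mapping.keys (fock_sign p)))" by simp
  then obtain K where "\<forall>d\<in>degree_of ` (Poly_Mapping.keys p \<union> Poly_Mapping.keys (fock_sign p)). d \<le> K"
    unfolding finite_nat_set_iff_bounded_le by blast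
  then have K: "\<And>m. m \<in> Poly_Mapping.keys p \<Longrightarrow> degree_of m \<le> K"
    "\<And>m. m \<in> Poly_Mapping.keys (fock_sign p) \<Longrightarrow> degree_of m \<le> K" by auto
  show ?thesis
    by (simp add: E_coeff_eq_sum[OF K(1)] E_coeff_eq_sum[OF K(2)] fock_linear_sum[OF fock_linear_sign]
      fock_sign_E_minus fock_sign_E_plus)
qed

section \<open>Graded traces on the Moonshine module\<close>

text \<open>The lattice contains a basis of the real space.\<close>

lemma lattice_linear_eq:
  fixes f g :: "R24 \<Rightarrow> R24"
  assumes "leech_lattice \<Lambda>" "linear f" "linear g" "\<And>x. x \<in> \<Lambda> \<Longrightarrow> f x = g x"
  shows "f = g"
proof
  obtain P :: "real ^ 24 ^ 24" where P: "det P \<noteq> 0" "\<Lambda> = range (\<lambda>c. P *v int_vec c)"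
    using leech_lattice_matrix[OF assms(1)] .
  obtain P' where P': "P ** P' = mat 1"
    using P(1) by (metis invertible_def invertible_det_nz)
  have lin: "linear (\<lambda>x. f (P *v x))" "linear (\<lambda>x. g (P *v x))"
    using linear_compose[OF matrix_vector_mul_linear assms(2)] linear_compose[OF matrix_vector_mul_linear assms(3)]
    by (simp_all add: o_def)
  have "(\<lambda>x. f (P *v x)) = (\<lambda>x. g (P *v x))"
  proof (rule linear_eq_stdbasis[OF lin])
    fix b :: R24 assume "b \<in> Basis"
    then obtain j where "b = axis j 1" by (auto simp: Basis_vec_def)
    then have "b = int_vec (axis j 1)" by (simp add: int_vec_def axis_def vec_eq_iff)
    then show "f (P *v b) = g (P *v b)" using assms(4) P(2) by auto
  qed
  then have "f (P *v (P' *v x)) = g (P *v (P' *v x))" for x by metis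
  then show "f x = g x" for x by (simp add: matrix_vector_mul_assoc P')
qed

lemma phase_uminus:
  assumes "2 * x \<in> \<int>"
  shows "exp (2 * of_real pi * \<i> * of_real (- x)) = exp (2 * of_real pi * \<i> * of_real x)"
proof -
  obtain k :: int where k: "2 * x = of_int k" using assms by (elim Ints_cases)
  have "exp (2 * of_real pi * \<i> * of_real x) =
      exp (2 * of_real pi * \<i> * of_real (- x)) * exp (2 * of_real pi * \<i> * of_real (2 * x))"
    by (simp add: exp_add[symmetric] algebra_simps)
  also have "exp (2 * of_real pi * \<i> * of_real (2 * x)) = 1"
    unfolding k using exp_integer_2pi[of "of_int k"] by (simp add: mult_ac)
  finally show ?thesis by simp
qed

lemma t_VT_component: "t_VT x $ i = - fock_sign (x $ i)"
proof -
  have "t_VT x $ i = (\<Sum>j\<in>UNIV. fscale (mat (- 1) $ i $ j) (fock_sign (x $ j)))"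
    by (simp add: t_VT_def tensor_VT_def)
  also have "\<dots> = (\<Sum>j\<in>UNIV. if j = i then - fock_sign (x $ j) else 0)"
    by (intro sum.cong refl) (auto simp: mat_def fscale_def fconst_def single_uminus)
  finally show ?thesis by simp
qed

lemma linear_t_VT: "linear_wrt scale_VT scale_VT t_VT"
  unfolding t_VT_def by (rule linear_tensor_VT[OF fock_linear_sign])

lemma t_VL_t_VL: "t_VL (t_VL w) = w"
proof (rule VL_linear_eqI[where \<Lambda> = UNIV])
  show "linear_wrt scale_VL scale_VL (\<lambda>w. t_VL (t_VL w))"
    by (rule linear_wrt_compose[OF linear_t_VL linear_t_VL])
  show "linear_wrt scale_VL scale_VL (\<lambda>w. w)" by (simp add: linear_wrt_def)
qed (simp_all add: V_lattice_def t_VL_single)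

section \<open>Weight spaces and their monomial bases\<close>

definition VL_weight :: "R24 set \<Rightarrow> real \<Rightarrow> VL set" where
  "VL_weight \<Lambda> n =
     {w \<in> V_lattice \<Lambda>. \<forall>\<beta>. fock_homogeneous 1 (n - \<beta> \<bullet> \<beta> / 2) (Poly_Mapping.lookup w \<beta>)}"

lemma VL_weight_add: "w \<in> VL_weight \<Lambda> n \<Longrightarrow> w' \<in> VL_weight \<Lambda> n \<Longrightarrow> w + w' \<in> VL_weight \<Lambda> n"
  using Poly_Mapping.keys_add[of w w']
  by (auto simp: VL_weight_def V_lattice_def lookup_add intro!: fhom_add)

lemma VL_weight_0: "0 \<in> VL_weight \<Lambda> n"
  by (simp add: VL_weight_def V_lattice_def)

lemma VL_weight_scale: "w \<in> VL_weight \<Lambda> n \<Longrightarrow> scale_VL c w \<in> VL_weight \<Lambda> n"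
proof -
  assume w: "w \<in> VL_weight \<Lambda> n"
  have "Poly_Mapping.keys (scale_VL c w) \<subseteq> Poly_Mapping.keys w"
    by (auto simp: in_keys_iff lookup_scale_VL)
  then show ?thesis using w by (auto simp: VL_weight_def V_lattice_def lookup_scale_VL intro!: fhom_fscale)
qed

lemma VL_weight_sum: "(\<And>i. i \<in> I \<Longrightarrow> w i \<in> VL_weight \<Lambda> n) \<Longrightarrow> (\<Sum>i\<in>I. w i) \<in> VL_weight \<Lambda> n"
  by (induction I rule: infinite_finite_induct) (auto intro: VL_weight_0 VL_weight_add)

lemma VL_weight_single:
  "\<beta> \<in> \<Lambda> \<Longrightarrow> fock_homogeneous 1 (n - \<beta> \<bullet> \<beta> / 2) p \<Longrightarrow> Poly_Mapping.single \<beta> p \<in> VL_weight \<Lambda> n"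
  by (auto simp: VL_weight_def V_lattice_def lookup_single when_def)

lemma VL_weight_linear:
  assumes "linear_wrt scale_VL scale_VL f" "w \<in> VL_weight \<Lambda> n"
    and "\<And>\<beta> p. \<beta> \<in> \<Lambda> \<Longrightarrow> fock_homogeneous 1 (n - \<beta> \<bullet> \<beta> / 2) p \<Longrightarrow>
      f (Poly_Mapping.single \<beta> p) \<in> VL_weight \<Lambda> n"
  shows "f w \<in> VL_weight \<Lambda> n"
proof -
  have "f w = (\<Sum>\<beta>\<in>Poly_Mapping.keys w. f (Poly_Mapping.single \<beta> (Poly_Mapping.lookup w \<beta>)))"
    by (subst linear_wrt_sum[OF assms(1), symmetric]) (simp only: VL_expand)
  also have "\<dots> \<in> VL_weight \<Lambda> n"
    by (intro VL_weight_sum assms(3)) (use assms(2) in \<open>auto simp: VL_weight_def V_lattice_def\<close>)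
  finally show ?thesis .
qed

definition VT_weight :: "real \<Rightarrow> VT set" where
  "VT_weight n = {x. \<forall>i. fock_homogeneous (1/2) (n - 3/2) (x $ i)}"

lemma moonshine_eq:
  "moonshine \<Lambda> n = {w \<in> VL_weight \<Lambda> n. t_VL w = w} \<times> {x \<in> VT_weight n. t_VT x = x}"
  by (auto simp: moonshine_def VL_weight_def VT_weight_def)

lemma subspace_moonshine: "VN.subspace (moonshine \<Lambda> n)"
proof (rule VN.subspaceI)
  show "0 \<in> moonshine \<Lambda> n"
    by (simp add: moonshine_eq zero_prod_def VL_weight_0 VT_weight_def linear_wrt_0[OF linear_t_VL]
      linear_wrt_0[OF linear_t_VT])
  fix x y assume "x \<in> moonshine \<Lambda> n" "y \<in> moonshine \<Lambda> n"
  then show "x + y \<in> moonshine \<Lambda> n"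
    by (auto simp: moonshine_eq VL_weight_add VT_weight_def fhom_add linear_wrt_add[OF linear_t_VL]
      linear_wrt_add[OF linear_t_VT])
next
  fix c x assume "x \<in> moonshine \<Lambda> n"
  then show "scale_VN c x \<in> moonshine \<Lambda> n"
    by (auto simp: moonshine_eq scale_VN_def VL_weight_scale VT_weight_def scale_VT_component fhom_fscale
      linear_wrt_scale[OF linear_t_VL] linear_wrt_scale[OF linear_t_VT])
qed

definition VL_index :: "R24 set \<Rightarrow> nat \<Rightarrow> (R24 \<times> monomial) set" where
  "VL_index \<Lambda> n = {(\<gamma>, m). \<gamma> \<in> \<Lambda> \<and> mono_weight 1 m + \<gamma> \<bullet> \<gamma> / 2 = real n}"

definition VT_index :: "nat \<Rightarrow> (4096 \<times> monomial) set" where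
  "VT_index n = {(i, m). mono_weight (1/2) m + 3/2 = real n}"

lemma finite_VL_index:
  assumes "leech_lattice \<Lambda>"
  shows "finite (VL_index \<Lambda> n)"
proof (rule finite_subset)
  show "VL_index \<Lambda> n \<subseteq> {\<gamma> \<in> \<Lambda>. \<gamma> \<bullet> \<gamma> \<le> 2 * real n} \<times> (\<Union>D\<le>n. {m. untwisted.degree_of m = D})"
  proof
    fix z assume "z \<in> VL_index \<Lambda> n"
    then obtain \<gamma> m where z: "z = (\<gamma>, m)" "\<gamma> \<in> \<Lambda>" "mono_weight 1 m + \<gamma> \<bullet> \<gamma> / 2 = real n"
      by (auto simp: VL_index_def)
    moreover have "mono_weight 1 m = real (untwisted.degree_of m)" by (simp add: untwisted.mono_weight_eq)
    moreover from calculation have "\<gamma> \<bullet> \<gamma> \<le> 2 * real n" "real (untwisted.degree_of m) \<le> real n"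
      using inner_ge_zero[of \<gamma>] by linarith+
    ultimately show "z \<in> {\<gamma> \<in> \<Lambda>. \<gamma> \<bullet> \<gamma> \<le> 2 * real n} \<times> (\<Union>D\<le>n. {m. untwisted.degree_of m = D})"
      by auto
  qed
  show "finite ({\<gamma> \<in> \<Lambda>. \<gamma> \<bullet> \<gamma> \<le> 2 * real n} \<times> (\<Union>D\<le>n. {m. untwisted.degree_of m = D}))"
    using finite_lattice_ball[OF assms] untwisted.finite_degree by auto
qed

text \<open>In units of 1/2 the shift 3/2 becomes 3, so the degree is 2 n - 3 and in particular odd.
  The equation is written as a sum because truncated subtraction would admit degree 0 for n <
  2.\<close>

lemma VT_index_eq: "VT_index n = UNIV \<times> {m. twisted.degree_of m + 3 = 2 * n}"
proof -
  have "mono_weight (1/2) m = real (twisted.degree_of m) / 2" for m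
    by (simp add: twisted.mono_weight_eq)
  then have "mono_weight (1/2) m + 3/2 = real n \<longleftrightarrow>
      real (twisted.degree_of m + 3) = real (2 * n)" for m
    by (simp add: field_simps)
  then have "mono_weight (1/2) m + 3/2 = real n \<longleftrightarrow> twisted.degree_of m + 3 = 2 * n" for m
    by (simp only: of_nat_eq_iff)
  then show ?thesis by (auto simp: VT_index_def)
qed

lemma finite_VT_index: "finite (VT_index n)"
proof -
  have "finite {m. twisted.degree_of m + 3 = 2 * n}"
    by (rule finite_subset[OF _ twisted.finite_degree[of "2 * n - 3"]]) auto
  then show ?thesis
    unfolding VT_index_eq by (intro finite_cartesian_product) simp
qed

definition VL_unit :: "R24 \<Rightarrow> monomial \<Rightarrow> VL" where
  "VL_unit \<gamma> m = Poly_Mapping.single \<gamma> (Poly_Mapping.single m 1)"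

definition VT_unit :: "4096 \<Rightarrow> monomial \<Rightarrow> VT" where
  "VT_unit i m = axis i (Poly_Mapping.single m 1)"

lemma VL_unit_expand:
  assumes "leech_lattice \<Lambda>" "w \<in> VL_weight \<Lambda> (real n)"
  shows "w = (\<Sum>(\<gamma>, m)\<in>VL_index \<Lambda> n. scale_VL (Poly_Mapping.lookup (Poly_Mapping.lookup w \<gamma>) m) (VL_unit \<gamma> m))"
proof (rule poly_mapping_eqI, rule poly_mapping_eqI)
  fix \<gamma> m
  let ?c = "\<lambda>z. Poly_Mapping.lookup (Poly_Mapping.lookup w (fst z)) (snd z)"
  have "Poly_Mapping.lookup (Poly_Mapping.lookup (\<Sum>(\<gamma>, m)\<in>VL_index \<Lambda> n.
      scale_VL (Poly_Mapping.lookup (Poly_Mapping.lookup w \<gamma>) m) (VL_unit \<gamma> m)) \<gamma>) m =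
      (\<Sum>z\<in>VL_index \<Lambda> n. if z = (\<gamma>, m) then ?c z else 0)"
    unfolding lookup_sum
    by (intro sum.cong refl)
      (auto simp: VL_unit_def lookup_scale_VL lookup_fscale lookup_single when_def split: prod.splits)
  also have "\<dots> = (if (\<gamma>, m) \<in> VL_index \<Lambda> n then ?c (\<gamma>, m) else 0)"
    using finite_VL_index[OF assms(1), of n] by simp
  also have "\<dots> = Poly_Mapping.lookup (Poly_Mapping.lookup w \<gamma>) m"
  proof (cases "(\<gamma>, m) \<in> VL_index \<Lambda> n")
    case False
    have "Poly_Mapping.lookup (Poly_Mapping.lookup w \<gamma>) m = 0"
    proof (rule ccontr)
      assume *: "\<not> ?thesis"
      then have "m \<in> Poly_Mapping.keys (Poly_Mapping.lookup w \<gamma>)" by (simp add: in_keys_iff)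
      moreover from this have "\<gamma> \<in> Poly_Mapping.keys w" by (auto simp: in_keys_iff)
      ultimately show False
        using assms(2) False by (auto simp: VL_weight_def V_lattice_def VL_index_def fock_homogeneous_def)
    qed
    then show ?thesis using False by simp
  qed simp
  finally show "Poly_Mapping.lookup (Poly_Mapping.lookup w \<gamma>) m =
      Poly_Mapping.lookup (Poly_Mapping.lookup (\<Sum>(\<gamma>, m)\<in>VL_index \<Lambda> n.
      scale_VL (Poly_Mapping.lookup (Poly_Mapping.lookup w \<gamma>) m) (VL_unit \<gamma> m)) \<gamma>) m" by simp
qed

lemma VT_unit_expand:
  assumes "x \<in> VT_weight (real n)"
  shows "x = (\<Sum>(i, m)\<in>VT_index n. scale_VT (Poly_Mapping.lookup (x $ i) m) (VT_unit i m))"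
proof (subst vec_eq_iff, intro allI, rule poly_mapping_eqI)
  fix i m
  let ?c = "\<lambda>z. Poly_Mapping.lookup (x $ fst z) (snd z)"
  have "Poly_Mapping.lookup ((\<Sum>(i, m)\<in>VT_index n. scale_VT (Poly_Mapping.lookup (x $ i) m) (VT_unit i m)) $ i) m =
      (\<Sum>z\<in>VT_index n. if z = (i, m) then ?c z else 0)"
    unfolding lookup_sum sum_component
    by (intro sum.cong refl)
      (auto simp: VT_unit_def axis_def scale_VT_component lookup_fscale lookup_single when_def split: prod.splits)
  also have "\<dots> = (if (i, m) \<in> VT_index n then ?c (i, m) else 0)"
    using finite_VT_index[of n] by simp
  also have "\<dots> = Poly_Mapping.lookup (x $ i) m"
  proof (cases "m \<in> Poly_Mapping.keys (x $ i)")
    case True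
    then have "mono_weight (1/2) m = real n - 3/2"
      using assms unfolding VT_weight_def fock_homogeneous_def by blast
    then show ?thesis by (simp add: VT_index_def)
  next
    case False
    then show ?thesis by (simp add: in_keys_iff)
  qed
  finally show "Poly_Mapping.lookup (x $ i) m = Poly_Mapping.lookup
      ((\<Sum>(i, m)\<in>VT_index n. scale_VT (Poly_Mapping.lookup (x $ i) m) (VT_unit i m)) $ i) m" by simp
qed

lemma VL_unit_weight: "(\<gamma>, m) \<in> VL_index \<Lambda> n \<Longrightarrow> VL_unit \<gamma> m \<in> VL_weight \<Lambda> n"
  unfolding VL_unit_def by (rule VL_weight_single) (auto simp: VL_index_def fock_homogeneous_def)

lemma VT_unit_weight: "(i, m) \<in> VT_index n \<Longrightarrow> VT_unit i m \<in> VT_weight n"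
  by (auto simp: VT_unit_def VT_weight_def axis_def VT_index_def fock_homogeneous_def)

lemma scale_VT_add: "scale_VT c (x + y) = scale_VT c x + scale_VT c y"
  by (simp add: scale_VT_def vec_eq_iff fscale_simps)

lemma scale_VT_0 [simp]: "scale_VT c 0 = 0" by (simp add: scale_VT_def vec_eq_iff)

lemma fscale_half: "fscale (1/2) (p + p) = p"
proof -
  have "fscale (1/2) (p + p) = fscale (1/2 + 1/2) p" by (simp only: fscale_simps(1,2))
  then show ?thesis by simp
qed

lemma scale_VL_half: "scale_VL (1/2) (w + w) = w"
  by (rule poly_mapping_eqI) (simp only: lookup_scale_VL lookup_add fscale_half)

lemma scale_VT_half: "scale_VT (1/2) (x + x) = x"
  by (simp only: scale_VT_component vec_eq_iff vector_add_component fscale_half simp_thms)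

lemma scale_VL_scale_VL: "scale_VL c (scale_VL d w) = scale_VL d (scale_VL c w)"
  by (rule poly_mapping_eqI) (simp add: lookup_scale_VL fscale_commute)

lemma scale_VT_scale_VT: "scale_VT c (scale_VT d x) = scale_VT d (scale_VT c x)"
  by (simp add: scale_VT_def vec_eq_iff fscale_commute)

text \<open>The images of the standard basis of \<open>V\<^sub>\<Lambda> \<oplus> V\<^sub>\<Lambda>\<^sup>T\<close> under the projection \<open>(1 + t) / 2\<close> span the
  Moonshine module.\<close>

lemma trace_on_moonshine:
  assumes leech: "leech_lattice \<Lambda>"
    and f1: "linear_wrt scale_VL scale_VL f1" "\<And>w. w \<in> VL_weight \<Lambda> n \<Longrightarrow> f1 w \<in> VL_weight \<Lambda> n"
      "\<And>w. w \<in> VL_weight \<Lambda> n \<Longrightarrow> t_VL (f1 w) = f1 (t_VL w)"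
    and f2: "linear_wrt scale_VT scale_VT f2" "\<And>x. x \<in> VT_weight n \<Longrightarrow> f2 x \<in> VT_weight n"
      "\<And>x. t_VT (f2 x) = f2 (t_VT x)"
  shows "trace_on (moonshine \<Lambda> n) (map_prod f1 f2) =
    (\<Sum>(\<gamma>, m)\<in>VL_index \<Lambda> n. Poly_Mapping.lookup (Poly_Mapping.lookup
       (f1 (scale_VL (1/2) (VL_unit \<gamma> m + t_VL (VL_unit \<gamma> m)))) \<gamma>) m) +
    (\<Sum>(i, m)\<in>VT_index n. Poly_Mapping.lookup
       (f2 (scale_VT (1/2) (VT_unit i m + t_VT (VT_unit i m))) $ i) m)"
proof -
  let ?I = "VL_index \<Lambda> n <+> VT_index n"
  define bL where "bL z = scale_VL (1/2) (VL_unit (fst z) (snd z) + t_VL (VL_unit (fst z) (snd z)))" for z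
  define bT where "bT z = scale_VT (1/2) (VT_unit (fst z) (snd z) + t_VT (VT_unit (fst z) (snd z)))" for z
  define b :: "(R24 \<times> monomial) + (4096 \<times> monomial) \<Rightarrow> VN" where
    "b = case_sum (\<lambda>z. (bL z, 0)) (\<lambda>z. (0, bT z))"
  \<comment> \<open>These are the coordinates of the full space. They need not be dual to the
    projected vectors, but for a t-invariant vector they are the coefficients of an expansion in
    them.\<close>
  define \<phi> :: "(R24 \<times> monomial) + (4096 \<times> monomial) \<Rightarrow> VN \<Rightarrow> complex" where
    "\<phi> = case_sum (\<lambda>z u. Poly_Mapping.lookup (Poly_Mapping.lookup (fst u) (fst z)) (snd z))
       (\<lambda>z u. Poly_Mapping.lookup (snd u $ fst z) (snd z))"
  have t_weight: "t_VL w \<in> VL_weight \<Lambda> n" if "w \<in> VL_weight \<Lambda> n" for w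
    by (rule VL_weight_linear[OF linear_t_VL that])
      (auto simp: t_VL_single leech_lattice_closed(2)[OF leech] intro!: VL_weight_single fhom_sign)
  have tT_weight: "t_VT x \<in> VT_weight n" if "x \<in> VT_weight n" for x
  proof -
    have neg: "fock_homogeneous s d (- p)" if "fock_homogeneous s d p" for s d p
      using that by (simp add: fock_homogeneous_def)
    show ?thesis using that by (auto simp: VT_weight_def t_VT_component intro!: neg fhom_sign)
  qed
  have tT2: "t_VT (t_VT x) = x" for x
  proof -
    have "fock_sign (- p) = - fock_sign p" for p
      using fock_linear_fscale[OF fock_linear_sign, of "- 1" p] by (simp add: fscale_def fconst_def single_uminus)
    then show ?thesis by (simp add: vec_eq_iff t_VT_component)
  qed
  have fin: "finite ?I" using finite_VL_index[OF leech] finite_VT_index by simp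
  have bI: "b i \<in> moonshine \<Lambda> n" if "i \<in> ?I" for i
    using that
  proof (rule PlusE)
    fix z assume z: "z \<in> VL_index \<Lambda> n" "i = Inl z"
    have "VL_unit (fst z) (snd z) \<in> VL_weight \<Lambda> n" using z(1) by (intro VL_unit_weight) simp
    then have "bL z \<in> VL_weight \<Lambda> n" unfolding bL_def by (intro VL_weight_scale VL_weight_add t_weight)
    moreover have "t_VL (bL z) = bL z"
      by (simp add: bL_def linear_wrt_scale[OF linear_t_VL] linear_wrt_add[OF linear_t_VL] t_VL_t_VL add.commute)
    ultimately show ?thesis
      by (simp add: z b_def moonshine_eq VT_weight_def linear_wrt_0[OF linear_t_VT])
  next
    fix z assume z: "z \<in> VT_index n" "i = Inr z"
    have "VT_unit (fst z) (snd z) \<in> VT_weight n" using z(1) by (intro VT_unit_weight) simp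
    then have "bT z \<in> VT_weight n"
      using tT_weight[of "VT_unit (fst z) (snd z)"]
      by (simp add: bT_def VT_weight_def scale_VT_component fhom_add fhom_fscale)
    moreover have "t_VT (bT z) = bT z"
      by (simp add: bT_def linear_wrt_scale[OF linear_t_VT] linear_wrt_add[OF linear_t_VT] tT2 add.commute)
    ultimately show ?thesis
      by (simp add: z b_def moonshine_eq VL_weight_0 linear_wrt_0[OF linear_t_VL])
  qed
  have phi: "linear_wrt scale_VN (*) (\<phi> i)" for i
    by (cases i) (auto simp: linear_wrt_def \<phi>_def lookup_add scale_VN_def lookup_scale_VL lookup_fscale
      scale_VT_component)
  have expand: "u = (\<Sum>i\<in>?I. scale_VN (\<phi> i u) (b i))" if "u \<in> moonshine \<Lambda> n" for u
  proof -
    obtain w x where u: "u = (w, x)" by (cases u)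
    have w: "w \<in> VL_weight \<Lambda> n" "t_VL w = w" and x: "x \<in> VT_weight n" "t_VT x = x"
      using that by (auto simp: u moonshine_eq)
    let ?c = "\<lambda>z. Poly_Mapping.lookup (Poly_Mapping.lookup w (fst z)) (snd z)"
    let ?d = "\<lambda>z. Poly_Mapping.lookup (x $ fst z) (snd z)"
    have "w = scale_VL (1/2) (w + t_VL w)" by (simp only: w(2) scale_VL_half)
    also have "\<dots> = (\<Sum>z\<in>VL_index \<Lambda> n. scale_VL (?c z) (bL z))"
    proof -
      have ex: "w = (\<Sum>z\<in>VL_index \<Lambda> n. scale_VL (?c z) (VL_unit (fst z) (snd z)))"
        using VL_unit_expand[OF leech w(1)] by (simp add: case_prod_beta)
      have "t_VL w = (\<Sum>z\<in>VL_index \<Lambda> n. scale_VL (?c z) (t_VL (VL_unit (fst z) (snd z))))"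
        by (subst ex) (simp add: linear_wrt_sum[OF linear_t_VL] linear_wrt_scale[OF linear_t_VL])
      then have "w + t_VL w = (\<Sum>z\<in>VL_index \<Lambda> n. scale_VL (?c z) (VL_unit (fst z) (snd z) + t_VL (VL_unit (fst z) (snd z))))"
        using ex by (simp add: scale_VL_add sum.distrib)
      then show ?thesis by (simp add: bL_def scale_VL_sum scale_VL_scale_VL)
    qed
    finally have w': "w = (\<Sum>z\<in>VL_index \<Lambda> n. scale_VL (?c z) (bL z))" .
    have "x = scale_VT (1/2) (x + t_VT x)" by (simp only: x(2) scale_VT_half)
    also have "\<dots> = (\<Sum>z\<in>VT_index n. scale_VT (?d z) (bT z))"
    proof -
      have ex: "x = (\<Sum>z\<in>VT_index n. scale_VT (?d z) (VT_unit (fst z) (snd z)))"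
        using VT_unit_expand[OF x(1)] by (simp add: case_prod_beta)
      have "t_VT x = (\<Sum>z\<in>VT_index n. scale_VT (?d z) (t_VT (VT_unit (fst z) (snd z))))"
        by (subst ex) (simp add: linear_wrt_sum[OF linear_t_VT] linear_wrt_scale[OF linear_t_VT])
      then have "x + t_VT x = (\<Sum>z\<in>VT_index n. scale_VT (?d z) (VT_unit (fst z) (snd z) + t_VT (VT_unit (fst z) (snd z))))"
        using ex by (simp add: scale_VT_add sum.distrib)
      moreover have "scale_VT c (\<Sum>i\<in>I. g i) = (\<Sum>i\<in>I. scale_VT c (g i))" for c I and g :: "_ \<Rightarrow> VT"
        by (induction I rule: infinite_finite_induct) (auto simp: scale_VT_add)
      ultimately show ?thesis by (simp add: bT_def scale_VT_scale_VT)
    qed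
    finally have x': "x = (\<Sum>z\<in>VT_index n. scale_VT (?d z) (bT z))" .
    have pairL: "(\<Sum>z\<in>A. (g z, 0 :: VT)) = (\<Sum>z\<in>A. g z, 0)" for A :: "(R24 \<times> monomial) set" and g :: "_ \<Rightarrow> VL"
      by (induction A rule: infinite_finite_induct) (auto simp: zero_prod_def)
    have pairT: "(\<Sum>z\<in>A. (0 :: VL, g z)) = (0, \<Sum>z\<in>A. g z)" for A :: "(4096 \<times> monomial) set" and g :: "_ \<Rightarrow> VT"
      by (induction A rule: infinite_finite_induct) (auto simp: zero_prod_def)
    have "(\<Sum>i\<in>?I. scale_VN (\<phi> i u) (b i)) =
        (\<Sum>z\<in>VL_index \<Lambda> n. (scale_VL (?c z) (bL z), 0)) + (\<Sum>z\<in>VT_index n. (0, scale_VT (?d z) (bT z)))"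
      by (subst sum.Plus) (simp_all add: finite_VL_index[OF leech] finite_VT_index b_def \<phi>_def u scale_VN_def)
    also have "\<dots> = (w, x)" unfolding pairL pairT using w' x' by simp
    finally show ?thesis by (simp add: u)
  qed
  have stable: "map_prod f1 f2 u \<in> moonshine \<Lambda> n" if "u \<in> moonshine \<Lambda> n" for u
    using that f1(2,3) f2(2,3) by (cases u) (auto simp: moonshine_eq)
  have "trace_on (moonshine \<Lambda> n) (map_prod f1 f2) = (\<Sum>i\<in>?I. \<phi> i (map_prod f1 f2 (b i)))"
    by (rule trace_on_spanning_family[OF subspace_moonshine fin bI phi expand linear_map_prod[OF f1(1) f2(1)] stable])
  also have "\<dots> = (\<Sum>z\<in>VL_index \<Lambda> n. Poly_Mapping.lookup (Poly_Mapping.lookup (f1 (bL z)) (fst z)) (snd z)) +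
      (\<Sum>z\<in>VT_index n. Poly_Mapping.lookup (f2 (bT z) $ fst z) (snd z))"
    by (subst sum.Plus) (simp_all add: finite_VL_index[OF leech] finite_VT_index b_def \<phi>_def)
  finally show ?thesis by (simp add: bL_def bT_def case_prod_beta)
qed

section \<open>The zero mode of \<open>v(\<lambda>)\<close>\<close>

locale moonshine_element =
  fixes \<Lambda> :: "R24 set" and \<epsilon> :: "R24 \<Rightarrow> R24 \<Rightarrow> complex" and eT :: "R24 \<Rightarrow> opT"
    and G :: "'g hat_group" and h :: 'g and a :: "R24 \<Rightarrow> R24" and \<xi> \<alpha> l :: R24
  assumes hat: "hat_C \<Lambda> \<epsilon> eT G"
    and l_nonzero: "l \<noteq> 0" and \<alpha>: "\<alpha> \<in> \<Lambda>" and l: "l = 2 *\<^sub>R \<alpha>"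
    and h: "h \<in> H_group G l" and \<xi>: "2 *\<^sub>R \<xi> \<in> \<Lambda>"
    and a: "a \<in> carrier (Aut_lattice \<Lambda>)" and a_l: "a l = l"
    and assoc: "associated \<Lambda> G h \<xi> a"
begin

lemma data: "leech_data \<Lambda> \<epsilon> eT"
  using hat by (rule hat_C.axioms(1))

lemma leech: "leech_lattice \<Lambda>"
  using data by (rule leech_data.leech)

lemma a_orthogonal: "orthogonal_transformation a" and a_image: "a ` \<Lambda> = \<Lambda>"
  using a by (auto simp: Aut_lattice_def)

lemma a_linear: "linear a"
  by (rule orthogonal_transformation_linear[OF a_orthogonal])

lemma a_inner: "a x \<bullet> a y = x \<bullet> y"
  using a_orthogonal by (simp add: orthogonal_transformation_def)

lemma a_mem: "\<beta> \<in> \<Lambda> \<Longrightarrow> a \<beta> \<in> \<Lambda>"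
  using a_image by blast

lemma a_minus: "a (- x) = - a x" and a_add: "a (x + y) = a x + a y" and a_diff: "a (x - y) = a x - a y"
  using linear_neg[OF a_linear] linear_add[OF a_linear] linear_diff[OF a_linear] by blast+

lemma l_neq_minus_l: "l \<noteq> - l"
  using l_nonzero by (metis add.inverse_inverse eq_neg_iff_add_eq_0 scaleR_2 scaleR_eq_0_iff zero_neq_numeral)

lemma a_\<alpha>: "a \<alpha> = \<alpha>"
  using a_l linear_cmul[OF a_linear, of 2 \<alpha>] by (simp add: l)

lemma l_mem: "l \<in> \<Lambda>"
  using leech_lattice_closed(1)[OF leech \<alpha> \<alpha>] by (simp add: l scaleR_2)

lemma h_carrier: "h \<in> carrier G"
  using h by (simp add: H_group_def)

text \<open>The pair (\<xi>, a) is given only through its action on the lattice algebra; testing it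
  on 1 tensor e^\<beta> recovers projection and sign. The phase is taken at a \<beta> since
  \<open>a\<close> acts first.\<close>

lemma gproj_gsign:
  assumes "\<beta> \<in> \<Lambda>"
  shows "gproj G h \<beta> = a \<beta>" "gsign G h \<beta> = exp (2 * of_real pi * \<i> * of_real (\<xi> \<bullet> a \<beta>))"
proof -
  let ?s = "Poly_Mapping.single \<beta> (1 :: fock)" and ?c = "exp (2 * of_real pi * \<i> * of_real (\<xi> \<bullet> a \<beta>))"
  have "?s \<in> V_lattice \<Lambda>" using assms by (simp add: V_lattice_def)
  then have "act_VL G h ?s = act_phase \<xi> (act_natural a ?s)"
    using assoc unfolding associated_def by blast
  then have eq: "Poly_Mapping.single (gproj G h \<beta>) (fscale (gsign G h \<beta>) 1) =
      Poly_Mapping.single (a \<beta>) (fscale ?c 1)"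
    by (simp add: act_VL_single act_phase_natural_single)
  have one: "fscale c 1 = fconst c" for c by (simp add: fscale_def)
  have inj: "fconst c = fconst d \<longleftrightarrow> c = d" for c d
    unfolding fconst_def by (metis lookup_single_eq)
  have "fconst ?c \<noteq> fconst 0" unfolding inj by simp
  then have nz: "fscale ?c 1 \<noteq> 0" unfolding one by (simp add: fconst_def)
  have "Poly_Mapping.lookup (Poly_Mapping.single (gproj G h \<beta>) (fscale (gsign G h \<beta>) 1)) (a \<beta>) = fscale ?c 1"
    unfolding eq by simp
  then show g: "gproj G h \<beta> = a \<beta>" using nz by (auto simp: lookup_single when_def split: if_splits)
  then have "fscale (gsign G h \<beta>) 1 = fscale ?c 1"
    using eq by (metis lookup_single_eq)
  then show "gsign G h \<beta> = ?c" unfolding one inj .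
qed

lemma gproj_eq: "gproj G h = a"
proof (rule lattice_linear_eq[OF leech _ a_linear])
  have "gproj G h \<in> carrier (Aut_lattice \<Lambda>)"
    using hat_C.proj_epi[OF hat] h_carrier by (auto simp: epi_def hom_def)
  then show "linear (gproj G h)"
    by (auto simp: Aut_lattice_def intro: orthogonal_transformation_linear)
qed (rule gproj_gsign)

definition L :: real where "L = l \<bullet> l / 2"

lemma wt_v_of: "of_int (wt (v_of l)) = L"
proof -
  obtain k where k: "l \<bullet> l = 2 * real k" using leech_lattice_even[OF leech l_mem] .
  note ne = l_neq_minus_l
  have "Poly_Mapping.keys (v_of l) = {l, - l}"
    using ne by (auto simp: v_of_def in_keys_iff lookup_add lookup_single when_def split: if_splits)
  then have "wt (v_of l) = (THE d. real k = of_int d)" by (simp add: wt_def k)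
  also have "\<dots> = int k" by (rule the_equality) auto
  finally show ?thesis by (simp add: L_def k)
qed

text \<open>The zero mode v (wt v - 1) is the coefficient of z^(-wt v), and the weight of
  \<open>v_of l\<close> is L.\<close>

definition zmode_VL :: "VL \<Rightarrow> VL" where
  "zmode_VL w = Y_VL \<epsilon> l (- L) (act_VL G h w) + Y_VL \<epsilon> (- l) (- L) (act_VL G h w)"

definition zmode_VT :: "VT \<Rightarrow> VT" where
  "zmode_VT x = Y_VT eT l (- L) (act_VT G h x) + Y_VT eT (- l) (- L) (act_VT G h x)"

lemma zero_mode_act: "zero_mode \<epsilon> eT (v_of l) \<circ> act_VN G h = map_prod zmode_VL zmode_VT"
proof
  fix u :: VN
  note ne = l_neq_minus_l
  have keys: "Poly_Mapping.keys (v_of l) = {l, - l}"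
    using ne by (auto simp: v_of_def in_keys_iff lookup_add lookup_single when_def split: if_splits)
  have look: "Poly_Mapping.lookup (v_of l) l = 1" "Poly_Mapping.lookup (v_of l) (- l) = 1"
    using ne by (auto simp: v_of_def lookup_add lookup_single when_def)
  have exponent: "of_int (- (wt (v_of l) - 1) - 1) = - L" using wt_v_of by simp
  show "(zero_mode \<epsilon> eT (v_of l) \<circ> act_VN G h) u = map_prod zmode_VL zmode_VT u"
    unfolding o_apply zero_mode_def vmode_def keys exponent act_VN_def
    using ne by (cases u) (simp add: look zmode_VL_def zmode_VT_def)
qed

lemma linear_zmode_VL: "linear_wrt scale_VL scale_VL zmode_VL"
proof (rule linear_wrtI)
  note lin = linear_wrt_compose[OF linear_act_VL linear_Y_VL]
  show "zmode_VL (x + y) = zmode_VL x + zmode_VL y" for x y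
    by (simp add: zmode_VL_def linear_wrt_add[OF lin])
  show "zmode_VL (scale_VL c x) = scale_VL c (zmode_VL x)" for c x
    by (simp add: zmode_VL_def linear_wrt_scale[OF lin] scale_VL_add)
qed

lemma linear_zmode_VT: "linear_wrt scale_VT scale_VT zmode_VT"
proof (rule linear_wrtI)
  note lin = linear_wrt_compose[OF linear_tensor_VT[OF fock_linear_act] linear_Y_VT]
  show "zmode_VT (x + y) = zmode_VT x + zmode_VT y" for x y
    by (simp add: zmode_VT_def act_VT_def linear_wrt_add[OF lin])
  show "zmode_VT (scale_VT c x) = scale_VT c (zmode_VT x)" for c x
    by (simp add: zmode_VT_def act_VT_def linear_wrt_scale[OF lin] scale_VT_add)
qed

definition phase :: "R24 \<Rightarrow> complex" where
  "phase \<gamma> = exp (2 * of_real pi * \<i> * of_real (\<xi> \<bullet> \<gamma>))"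

lemma phase_minus: "\<gamma> \<in> \<Lambda> \<Longrightarrow> phase (- \<gamma>) = phase \<gamma>"
  using phase_uminus[of "\<xi> \<bullet> \<gamma>"] leech_lattice_closed(4)[OF leech \<xi>] by (simp add: phase_def)

lemma phase_add: "phase (x + y) = phase x * phase y"
  by (simp add: phase_def inner_add_right exp_add[symmetric] algebra_simps)

text \<open>The cocycle is bilinear with values 1 and -1, so on twice a vector it is a square. This
  is one of the places where l = 2 \<alpha> enters; \<open>eT_l\<close> is the other.\<close>

lemma \<epsilon>_double:
  assumes "x \<in> \<Lambda>" "y \<in> \<Lambda>"
  shows "\<epsilon> (2 *\<^sub>R x) y = 1"
proof -
  have "\<epsilon> (2 *\<^sub>R x) y = \<epsilon> x y * \<epsilon> x y"
    unfolding scaleR_2 using assms by (intro leech_data.eps_add_left[OF data])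
  moreover have "\<epsilon> x y = 1 \<or> \<epsilon> x y = - 1" using leech_data.eps_sign[OF data assms] by auto
  ultimately show ?thesis by auto
qed

lemma \<epsilon>_l: "y \<in> \<Lambda> \<Longrightarrow> \<epsilon> l y = 1" "y \<in> \<Lambda> \<Longrightarrow> \<epsilon> (- l) y = 1"
  using \<epsilon>_double[OF \<alpha>] \<epsilon>_double[OF leech_lattice_closed(2)[OF leech \<alpha> \<alpha>]] by (simp_all add: l)

lemma eT_l: "eT l = mat 1" "eT (- l) = mat 1"
  using leech_data.eT_double[OF data \<alpha>]
    leech_data.eT_double[OF data leech_lattice_closed(2)[OF leech \<alpha> \<alpha>]] by (simp_all add: l)

definition zterm :: "R24 \<Rightarrow> R24 \<Rightarrow> fock \<Rightarrow> VL" where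
  "zterm \<beta> \<gamma> p = Poly_Mapping.single (\<beta> + a \<gamma>)
     (fscale (phase (a \<gamma>)) (E_coeff 1 (- \<beta>) (- L - \<beta> \<bullet> a \<gamma>) (fock_act a p)))"

lemma zmode_VL_single:
  assumes "\<gamma> \<in> \<Lambda>"
  shows "zmode_VL (Poly_Mapping.single \<gamma> p) = zterm l \<gamma> p + zterm (- l) \<gamma> p"
  using assms
  by (simp add: zmode_VL_def act_VL_single Y_VL_single gproj_eq gproj_gsign \<epsilon>_l a_mem zterm_def phase_def
    fock_linear_fscale[OF untwisted.fock_linear_E_coeff])

text \<open>Half the norm of \<beta> + a \<gamma> is L + \<beta> \<bullet> a \<gamma> plus half the
  norm of \<gamma>; the exponent of z compensates exactly this change.\<close>

lemma zterm_weight: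
  assumes "\<gamma> \<in> \<Lambda>" "\<beta> \<in> \<Lambda>" "\<beta> \<bullet> \<beta> / 2 = L" "fock_homogeneous 1 (n - \<gamma> \<bullet> \<gamma> / 2) p"
  shows "zterm \<beta> \<gamma> p \<in> VL_weight \<Lambda> n"
  unfolding zterm_def
proof (rule VL_weight_single)
  show "\<beta> + a \<gamma> \<in> \<Lambda>" using assms a_mem leech_lattice_closed(1)[OF leech] by blast
  have "n - \<gamma> \<bullet> \<gamma> / 2 + (- L - \<beta> \<bullet> a \<gamma>) = n - (\<beta> + a \<gamma>) \<bullet> (\<beta> + a \<gamma>) / 2"
    using assms(3) by (simp add: inner_add_left inner_add_right a_inner inner_commute[of "a \<gamma>" \<beta>] field_simps)
  then show "fock_homogeneous 1 (n - (\<beta> + a \<gamma>) \<bullet> (\<beta> + a \<gamma>) / 2)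
      (fscale (phase (a \<gamma>)) (E_coeff 1 (- \<beta>) (- L - \<beta> \<bullet> a \<gamma>) (fock_act a p)))"
    using fhom_fscale[OF untwisted.fhom_E_coeff[OF fhom_act[OF assms(4)], of "- L - \<beta> \<bullet> a \<gamma>" "- \<beta>" a], where c = "phase (a \<gamma>)"]
    by (simp only:)
qed

text \<open>The sign involution maps \<beta> to -\<beta>, and the phase is even because 2 \<xi> lies
  in the integral lattice.\<close>

lemma t_zterm:
  assumes "\<gamma> \<in> \<Lambda>"
  shows "t_VL (zterm \<beta> \<gamma> p) = zterm (- \<beta>) (- \<gamma>) (fock_sign p)"
  using phase_minus[OF a_mem[OF assms]]
  by (simp add: zterm_def t_VL_single fock_linear_fscale[OF fock_linear_sign] untwisted.fock_sign_E_coeff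
    fock_sign_act[OF a_linear] a_minus)

lemma zmode_VL_weight:
  assumes "w \<in> VL_weight \<Lambda> n"
  shows "zmode_VL w \<in> VL_weight \<Lambda> n"
proof (rule VL_weight_linear[OF linear_zmode_VL assms])
  fix \<gamma> p assume \<gamma>: "\<gamma> \<in> \<Lambda>" "fock_homogeneous 1 (n - \<gamma> \<bullet> \<gamma> / 2) p"
  have "- l \<in> \<Lambda>" by (rule leech_lattice_closed(2)[OF leech l_mem l_mem])
  then show "zmode_VL (Poly_Mapping.single \<gamma> p) \<in> VL_weight \<Lambda> n"
    unfolding zmode_VL_single[OF \<gamma>(1)]
    using \<gamma> l_mem by (intro VL_weight_add zterm_weight) (auto simp: L_def)
qed

lemma t_zmode_VL:
  assumes "w \<in> VL_weight \<Lambda> n"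
  shows "t_VL (zmode_VL w) = zmode_VL (t_VL w)"
proof (rule VL_linear_eqI[where \<Lambda> = \<Lambda> and f = "\<lambda>w. t_VL (zmode_VL w)" and g = "\<lambda>w. zmode_VL (t_VL w)"])
  show "linear_wrt scale_VL scale_VL (\<lambda>w. t_VL (zmode_VL w))"
    by (rule linear_wrt_compose[OF linear_zmode_VL linear_t_VL])
  show "linear_wrt scale_VL scale_VL (\<lambda>w. zmode_VL (t_VL w))"
    by (rule linear_wrt_compose[OF linear_t_VL linear_zmode_VL])
  show "w \<in> V_lattice \<Lambda>" using assms by (simp add: VL_weight_def)
  fix \<gamma> p assume \<gamma>: "\<gamma> \<in> \<Lambda>"
  then show "t_VL (zmode_VL (Poly_Mapping.single \<gamma> p)) = zmode_VL (t_VL (Poly_Mapping.single \<gamma> p))"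
    by (simp add: t_VL_single zmode_VL_single leech_lattice_closed(2)[OF leech] linear_wrt_add[OF linear_t_VL]
      t_zterm add.commute)
qed

text \<open>The normalizing factor of twisted vertex operators. In the end it turns the theta
  quotients into their halves, raised to the power l \<bullet> l.\<close>

definition twist_const :: complex where
  "twist_const = of_real (2 powr (- (l \<bullet> l)))"

text \<open>The exponent 0 arises as -L + (l \<bullet> l) / 2: the power of z in the twisted vertex
  operator already accounts for the whole weight. As \<open>eT\<close> is the identity at l and -l,
  the factor T separates.\<close>

definition zfock :: "fock \<Rightarrow> fock" where
  "zfock p = E_coeff (1/2) l 0 (fock_act a p) + E_coeff (1/2) (- l) 0 (fock_act a p)"

lemma fock_linear_zfock: "fock_linear zfock"
  unfolding zfock_def[abs_def]
  by (intro fock_linear_plus fock_linear_compose[OF twisted.fock_linear_E_coeff fock_linear_act])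

lemma zmode_VT_component:
  "zmode_VT x $ i = fscale twist_const (\<Sum>j\<in>UNIV. fscale (grepT G h $ i $ j) (zfock (x $ j)))"
proof -
  have Y: "Y_VT eT \<beta> (- L) y $ i = fscale twist_const (E_coeff (1/2) (- \<beta>) 0 (y $ i))"
    if "eT \<beta> = mat 1" "\<beta> \<bullet> \<beta> / 2 = L" for \<beta> y
  proof -
    have "(\<Sum>j\<in>UNIV. fscale (mat 1 $ i $ j) (E_coeff (1/2) (- \<beta>) 0 (y $ j))) =
        (\<Sum>j\<in>UNIV. if j = i then E_coeff (1/2) (- \<beta>) 0 (y $ j) else 0)"
      by (intro sum.cong refl) (auto simp: mat_def)
    moreover have "\<beta> \<bullet> \<beta> = l \<bullet> l" using that(2) by (simp add: L_def)
    ultimately show ?thesis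
      using that by (simp add: Y_VT_def scale_VT_def tensor_VT_def twist_const_def)
  qed
  let ?y = "act_VT G h x"
  have y: "?y $ i = (\<Sum>j\<in>UNIV. fscale (grepT G h $ i $ j) (fock_act a (x $ j)))"
    by (simp add: act_VT_def tensor_VT_def gproj_eq)
  have "zmode_VT x $ i = fscale twist_const (E_coeff (1/2) (- l) 0 (?y $ i)) +
      fscale twist_const (E_coeff (1/2) l 0 (?y $ i))"
    using Y[OF eT_l(1)] Y[OF eT_l(2)] by (simp add: zmode_VT_def L_def)
  also have "\<dots> = fscale twist_const (E_coeff (1/2) l 0 (?y $ i) + E_coeff (1/2) (- l) 0 (?y $ i))"
    by (simp add: fscale_simps add.commute)
  also have "E_coeff (1/2) l 0 (?y $ i) + E_coeff (1/2) (- l) 0 (?y $ i) =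
      (\<Sum>j\<in>UNIV. fscale (grepT G h $ i $ j) (zfock (x $ j)))"
    unfolding y zfock_def
    by (simp add: fock_linear_sum[OF twisted.fock_linear_E_coeff]
      fock_linear_fscale[OF twisted.fock_linear_E_coeff] fscale_simps sum.distrib)
  finally show ?thesis .
qed

lemma fock_sign_zfock: "fock_sign (zfock p) = zfock (fock_sign p)"
  by (simp add: zfock_def fock_linear_add[OF fock_linear_sign] twisted.fock_sign_E_coeff
    fock_sign_act[OF a_linear] add.commute)

lemma zmode_VT_weight:
  assumes "x \<in> VT_weight n"
  shows "zmode_VT x \<in> VT_weight n"
proof -
  have "fock_homogeneous (1/2) (n - 3/2) (zfock (x $ j))" for j
    using twisted.fhom_E_coeff[OF fhom_act, of "n - 3/2" "x $ j" 0 _ a] assms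
    by (auto simp: zfock_def VT_weight_def intro!: fhom_add)
  then show ?thesis
    by (auto simp: VT_weight_def zmode_VT_component intro!: fhom_fscale fhom_sum)
qed

lemma t_zmode_VT: "t_VT (zmode_VT x) = zmode_VT (t_VT x)"
proof -
  have neg: "F (- p) = - F p" if "fock_linear F" for F p
    using fock_linear_fscale[OF that, of "- 1" p] by (simp add: fscale_def fconst_def single_uminus)
  have fneg: "fscale c (- p) = - fscale c p" for c p by (simp add: fscale_def)
  show ?thesis
    by (simp add: vec_eq_iff t_VT_component zmode_VT_component fock_linear_fscale[OF fock_linear_sign]
      fock_linear_sum[OF fock_linear_sign] fock_sign_zfock neg[OF fock_linear_zfock] fneg sum_negf)
qed

section \<open>The three oscillator series and the lattice sum\<close>

definition untwisted_series :: "complex fps" where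
  "untwisted_series = untwisted.ftrace (\<lambda>p. E_coeff 1 l 0 (fock_act (\<lambda>x. - a x) p))"

definition twisted_series :: "complex fps" where
  "twisted_series = twisted.ftrace (\<lambda>p. E_coeff (1/2) l 0 (fock_act a p))"

definition twisted_series_neg :: "complex fps" where
  "twisted_series_neg = twisted.ftrace (\<lambda>p. E_coeff (1/2) l 0 (fock_act (\<lambda>x. - a x) p))"

lemma neg_a_linear: "linear (\<lambda>x. - a x)"
  using a_linear by (rule linear_compose_neg)

text \<open>Contractions involve only the norm of l, and l and -l have the same eigenvalue.\<close>

lemma neg_series:
  "untwisted.ftrace (\<lambda>p. E_coeff 1 (- l) 0 (fock_act (\<lambda>x. - a x) p)) = untwisted_series"
  "twisted.ftrace (\<lambda>p. E_coeff (1/2) (- l) 0 (fock_act a p)) = twisted_series"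
proof -
  have "untwisted.insertion_log (- l) c = untwisted.insertion_log l c"
    "twisted.insertion_log (- l) c = twisted.insertion_log l c" for c
    by (simp_all add: untwisted.insertion_log_def untwisted.contraction_def
      twisted.insertion_log_def twisted.contraction_def)
  then show "untwisted.ftrace (\<lambda>p. E_coeff 1 (- l) 0 (fock_act (\<lambda>x. - a x) p)) = untwisted_series"
    "twisted.ftrace (\<lambda>p. E_coeff (1/2) (- l) 0 (fock_act a p)) = twisted_series"
    using untwisted.ftrace_E_coeff[OF neg_a_linear, of "- l" "- 1"]
      untwisted.ftrace_E_coeff[OF neg_a_linear, of l "- 1"]
      twisted.ftrace_E_coeff[OF a_linear, of "- l" 1] twisted.ftrace_E_coeff[OF a_linear, of l 1]
    by (simp_all add: untwisted_series_def twisted_series_def a_l a_minus)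
qed

definition neg_fixed :: "R24 set" where
  "neg_fixed = {\<delta> \<in> \<Lambda>. - a \<delta> = \<delta>}"

text \<open>The weight of e^(\<alpha> + \<delta>) when the two vectors are orthogonal; an integer
  for lattice vectors because the lattice is even.\<close>

definition level :: "R24 \<Rightarrow> nat" where
  "level \<delta> = nat \<lfloor>(\<alpha> \<bullet> \<alpha> + \<delta> \<bullet> \<delta>) / 2\<rfloor>"

lemma level: "\<delta> \<in> \<Lambda> \<Longrightarrow> real (level \<delta>) = (\<alpha> \<bullet> \<alpha> + \<delta> \<bullet> \<delta>) / 2"
proof -
  assume \<delta>: "\<delta> \<in> \<Lambda>"
  obtain i where i: "\<alpha> \<bullet> \<alpha> = 2 * real i" using leech_lattice_even[OF leech \<alpha>] .
  obtain j where j: "\<delta> \<bullet> \<delta> = 2 * real j" using leech_lattice_even[OF leech \<delta>] .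
  have "(\<alpha> \<bullet> \<alpha> + \<delta> \<bullet> \<delta>) / 2 = real (i + j)" by (simp add: i j)
  then show ?thesis unfolding level_def by (simp only: floor_of_nat nat_int)
qed

text \<open>As \<open>a\<close> is orthogonal, fixes \<alpha> and negates \<delta>, the inner
  product equals its negative.\<close>

lemma neg_fixed_orthogonal: "\<delta> \<in> neg_fixed \<Longrightarrow> \<alpha> \<bullet> \<delta> = 0"
  using a_inner[of \<alpha> \<delta>] by (simp add: neg_fixed_def a_\<alpha>) (metis add.inverse_inverse inner_minus_right neg_equal_zero)

lemma finite_levels: "finite {\<delta> \<in> neg_fixed. level \<delta> \<le> n}"
proof (rule finite_subset[OF _ finite_lattice_ball[OF leech, of "2 * real n"]])
  show "{\<delta> \<in> neg_fixed. level \<delta> \<le> n} \<subseteq> {\<gamma> \<in> \<Lambda>. \<gamma> \<bullet> \<gamma> \<le> 2 * real n}"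
  proof
    fix \<delta> assume *: "\<delta> \<in> {\<delta> \<in> neg_fixed. level \<delta> \<le> n}"
    then have mem: "\<delta> \<in> \<Lambda>" by (simp add: neg_fixed_def)
    have le: "real (level \<delta>) \<le> real n" using * by simp
    have "\<delta> \<bullet> \<delta> = 2 * real (level \<delta>) - \<alpha> \<bullet> \<alpha>" using level[OF mem] by simp
    also have "\<dots> \<le> 2 * real (level \<delta>)" by simp
    also have "\<dots> \<le> 2 * real n" using le by simp
    finally have "\<delta> \<bullet> \<delta> \<le> 2 * real n" .
    with mem show "\<delta> \<in> {\<gamma> \<in> \<Lambda>. \<gamma> \<bullet> \<gamma> \<le> 2 * real n}" by blast
  qed
qed

text \<open>A vector \<open>\<gamma>\<close> contributes to the trace of \<open>e\<^sup>\<beta> h t\<close>, \<open>\<beta> = 2 \<alpha>'\<close>, only if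
  \<open>\<beta> - a \<gamma> = \<gamma>\<close>, that is, if \<open>\<gamma> = \<alpha>' + \<delta>\<close> with \<open>a \<delta> = - \<delta>\<close>.\<close>

lemma VL_part:
  assumes \<beta>: "\<beta> = 2 *\<^sub>R \<alpha>'" "\<alpha>' \<in> {\<alpha>, - \<alpha>}"
  shows "(\<Sum>(\<gamma>, m)\<in>VL_index \<Lambda> n. if \<beta> - a \<gamma> = \<gamma> then phase (a \<gamma>) *
      Poly_Mapping.lookup (E_coeff 1 (- \<beta>) 0 (fock_act (\<lambda>x. - a x) (Poly_Mapping.single m 1))) m else 0) =
    (\<Sum>\<delta> | \<delta> \<in> neg_fixed \<and> level \<delta> \<le> n. phase \<alpha> * phase \<delta> * fps_nth untwisted_series (n - level \<delta>))"
proof -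
  let ?c = "\<lambda>m. Poly_Mapping.lookup (E_coeff 1 (- \<beta>) 0 (fock_act (\<lambda>x. - a x) (Poly_Mapping.single m 1))) m"
  let ?deg = untwisted.degree_of
  have \<alpha>'\<Lambda>: "\<alpha>' \<in> \<Lambda>" and a\<alpha>': "a \<alpha>' = \<alpha>'" and sq: "\<alpha>' \<bullet> \<alpha>' = \<alpha> \<bullet> \<alpha>"
    using \<beta>(2) \<alpha> leech_lattice_closed(2)[OF leech \<alpha> \<alpha>] by (auto simp: a_\<alpha> a_minus)
  have index: "(\<alpha>' + \<delta>, m) \<in> VL_index \<Lambda> n \<longleftrightarrow> level \<delta> + ?deg m = n" if "\<delta> \<in> neg_fixed" for \<delta> m
  proof -
    have \<delta>: "\<delta> \<in> \<Lambda>" using that by (simp add: neg_fixed_def)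
    have "\<alpha>' \<bullet> \<delta> = 0" using neg_fixed_orthogonal[OF that] \<beta>(2) by auto
    then have "(\<alpha>' + \<delta>) \<bullet> (\<alpha>' + \<delta>) / 2 = real (level \<delta>)"
      by (simp add: level[OF \<delta>] inner_add_left inner_add_right inner_commute[of \<delta> \<alpha>'] sq)
    moreover have "\<alpha>' + \<delta> \<in> \<Lambda>" by (rule leech_lattice_closed(1)[OF leech \<alpha>'\<Lambda> \<delta>])
    moreover have "mono_weight 1 m = real (?deg m)" by (simp add: untwisted.mono_weight_eq)
    ultimately show ?thesis by (auto simp: VL_index_def)
  qed
  have "(\<Sum>(\<gamma>, m)\<in>VL_index \<Lambda> n. if \<beta> - a \<gamma> = \<gamma> then phase (a \<gamma>) * ?c m else 0) =
      (\<Sum>(\<gamma>, m)\<in>{z \<in> VL_index \<Lambda> n. \<beta> - a (fst z) = fst z}. phase (a \<gamma>) * ?c m)"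
    unfolding sum.inter_filter[OF finite_VL_index[OF leech]] by (rule sum.cong) (simp_all add: case_prod_beta)
  also have "\<dots> = (\<Sum>(\<delta>, m)\<in>Sigma {\<delta> \<in> neg_fixed. level \<delta> \<le> n} (\<lambda>\<delta>. {m. ?deg m = n - level \<delta>}).
      phase \<alpha> * phase \<delta> * ?c m)"
  proof (rule sum.reindex_bij_witness[of _ "\<lambda>(\<delta>, m). (\<alpha>' + \<delta>, m)" "\<lambda>(\<gamma>, m). (\<gamma> - \<alpha>', m)"])
    fix z assume z: "z \<in> {z \<in> VL_index \<Lambda> n. \<beta> - a (fst z) = fst z}"
    obtain \<gamma> m where gm: "z = (\<gamma>, m)" by (cases z)
    let ?\<delta> = "\<gamma> - \<alpha>'"
    have \<gamma>: "\<gamma> \<in> \<Lambda>" and eq: "\<beta> - a \<gamma> = \<gamma>" using z by (auto simp: gm VL_index_def)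
    have "a ?\<delta> = - ?\<delta>" using eq by (simp add: a_diff a\<alpha>' \<beta>(1) scaleR_2 algebra_simps)
    moreover have \<delta>\<Lambda>: "?\<delta> \<in> \<Lambda>" by (rule leech_lattice_closed(3)[OF leech \<gamma> \<alpha>'\<Lambda>])
    ultimately have \<delta>: "?\<delta> \<in> neg_fixed" by (simp add: neg_fixed_def)
    have "level ?\<delta> + ?deg m = n" using index[OF \<delta>, of m] z by (simp add: gm)
    then show "(case z of (\<gamma>, m) \<Rightarrow> (\<gamma> - \<alpha>', m)) \<in> Sigma {\<delta> \<in> neg_fixed. level \<delta> \<le> n} (\<lambda>\<delta>. {m. ?deg m = n - level \<delta>})"
      using \<delta> by (auto simp: gm)
    show "(case case z of (\<gamma>, m) \<Rightarrow> (\<gamma> - \<alpha>', m) of (\<delta>, m) \<Rightarrow> (\<alpha>' + \<delta>, m)) = z" by (simp add: gm)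
    \<comment> \<open>The phase is multiplicative and even on the lattice, so the signs of \<alpha>'
      and \<delta> drop out.\<close>
    have "a \<gamma> = \<alpha>' + - ?\<delta>" using eq by (simp add: \<beta>(1) scaleR_2 algebra_simps)
    then have "phase (a \<gamma>) = phase \<alpha>' * phase (- ?\<delta>)" by (simp only: phase_add)
    also have "\<dots> = phase \<alpha> * phase ?\<delta>" using \<beta>(2) phase_minus[OF \<alpha>] phase_minus[OF \<delta>\<Lambda>] by auto
    finally show "(case case z of (\<gamma>, m) \<Rightarrow> (\<gamma> - \<alpha>', m) of (\<delta>, m) \<Rightarrow> phase \<alpha> * phase \<delta> * ?c m) =
        (case z of (\<gamma>, m) \<Rightarrow> phase (a \<gamma>) * ?c m)" by (simp add: gm)
  next
    fix z assume z: "z \<in> Sigma {\<delta> \<in> neg_fixed. level \<delta> \<le> n} (\<lambda>\<delta>. {m. ?deg m = n - level \<delta>})"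
    obtain \<delta> m where dm: "z = (\<delta>, m)" by (cases z)
    have \<delta>: "\<delta> \<in> neg_fixed" and n: "level \<delta> + ?deg m = n" using z by (auto simp: dm)
    have "a \<delta> = - \<delta>" using \<delta> by (simp add: neg_fixed_def) (metis add.inverse_inverse)
    then have "\<beta> - a (\<alpha>' + \<delta>) = \<alpha>' + \<delta>" by (simp add: a_add a\<alpha>' \<beta>(1) scaleR_2)
    then show "(case z of (\<delta>, m) \<Rightarrow> (\<alpha>' + \<delta>, m)) \<in> {z \<in> VL_index \<Lambda> n. \<beta> - a (fst z) = fst z}"
      using index[OF \<delta>, of m] n by (simp add: dm)
    show "(case case z of (\<delta>, m) \<Rightarrow> (\<alpha>' + \<delta>, m) of (\<gamma>, m) \<Rightarrow> (\<gamma> - \<alpha>', m)) = z" by (simp add: dm)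
  qed
  also have "\<dots> = (\<Sum>\<delta> | \<delta> \<in> neg_fixed \<and> level \<delta> \<le> n. \<Sum>m | ?deg m = n - level \<delta>. phase \<alpha> * phase \<delta> * ?c m)"
    by (rule sum.Sigma[symmetric]) (use finite_levels untwisted.finite_degree in auto)
  also have "\<dots> = (\<Sum>\<delta> | \<delta> \<in> neg_fixed \<and> level \<delta> \<le> n. phase \<alpha> * phase \<delta> * fps_nth untwisted_series (n - level \<delta>))"
  proof (intro sum.cong refl)
    fix \<delta>
    have "untwisted_series = untwisted.ftrace (\<lambda>p. E_coeff 1 (- \<beta>) 0 (fock_act (\<lambda>x. - a x) p))"
    proof -
      have "\<beta> = l \<or> \<beta> = - l" using \<beta> by (auto simp: l)
      then show ?thesis using neg_series(1) by (auto simp: untwisted_series_def)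
    qed
    then show "(\<Sum>m | ?deg m = n - level \<delta>. phase \<alpha> * phase \<delta> * ?c m) =
        phase \<alpha> * phase \<delta> * fps_nth untwisted_series (n - level \<delta>)"
      by (simp add: untwisted.ftrace_def sum_distrib_left)
  qed
  finally show ?thesis .
qed

text \<open>Of the projection (1 + t) / 2 only t contributes on the diagonal. Its term sends
  e^\<gamma> to e^(\<beta> - a \<gamma>), and on oscillators the composition with t replaces
  \<open>a\<close> by its negative.\<close>

lemma VL_diagonal:
  assumes "\<gamma> \<in> \<Lambda>"
  shows "Poly_Mapping.lookup (Poly_Mapping.lookup
      (zmode_VL (scale_VL (1/2) (VL_unit \<gamma> m + t_VL (VL_unit \<gamma> m)))) \<gamma>) m =
    1/2 * (\<Sum>\<beta>\<in>{l, - l}. if \<beta> - a \<gamma> = \<gamma> then phase (a \<gamma>) *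
      Poly_Mapping.lookup (E_coeff 1 (- \<beta>) 0 (fock_act (\<lambda>x. - a x) (Poly_Mapping.single m 1))) m else 0)"
proof -
  have neg\<gamma>: "- \<gamma> \<in> \<Lambda>" by (rule leech_lattice_closed(2)[OF leech assms assms])
  note ne = l_neq_minus_l
  have inv: "a \<beta> = \<beta>" if "\<beta> \<in> {l, - l}" for \<beta> using that by (auto simp: a_l a_minus)
  \<comment> \<open>Pairing with the \<open>a\<close>-invariant vector \<beta> would give it norm
    0.\<close>
  have off: "\<beta> + a \<gamma> \<noteq> \<gamma>" if "\<beta> \<in> {l, - l}" for \<beta>
  proof
    assume eq: "\<beta> + a \<gamma> = \<gamma>"
    have "\<beta> \<bullet> \<gamma> = \<beta> \<bullet> (\<beta> + a \<gamma>)" by (simp only: eq)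
    also have "\<dots> = \<beta> \<bullet> \<beta> + \<beta> \<bullet> \<gamma>" using a_inner[of \<beta> \<gamma>] by (simp add: inner_add_right inv[OF that])
    finally show False using that l_nonzero by auto
  qed
  have diag: "Poly_Mapping.lookup (Poly_Mapping.lookup (zterm \<beta> (- \<gamma>) (fock_sign p)) \<gamma>) m =
      (if \<beta> - a \<gamma> = \<gamma> then phase (a \<gamma>) * Poly_Mapping.lookup (E_coeff 1 (- \<beta>) 0 (fock_act (\<lambda>x. - a x) p)) m else 0)"
    if "\<beta> \<in> {l, - l}" for \<beta> p
  proof (cases "\<beta> - a \<gamma> = \<gamma>")
    case True
    \<comment> \<open>The condition \<beta> - a \<gamma> = \<gamma> forces \<beta> \<bullet> a
      \<gamma> = L, so the exponent -L + \<beta> \<bullet> a \<gamma> vanishes.\<close>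
    have "\<beta> \<bullet> \<beta> = \<beta> \<bullet> (\<gamma> + a \<gamma>)" using True by (metis diff_add_cancel)
    also have "\<dots> = 2 * (\<beta> \<bullet> a \<gamma>)" using a_inner[of \<beta> \<gamma>] by (simp add: inner_add_right inv[OF that])
    finally have "\<beta> \<bullet> a \<gamma> = L" using that by (auto simp: L_def)
    then show ?thesis
      using True by (simp add: zterm_def a_minus lookup_fscale phase_minus[OF a_mem[OF assms]]
        fock_act_uminus[OF a_linear])
  next
    case False
    then show ?thesis by (simp add: zterm_def a_minus lookup_single)
  qed
  have first: "Poly_Mapping.lookup (zmode_VL (VL_unit \<gamma> m)) \<gamma> = 0"
    using off[of l] off[of "- l"] by (simp add: VL_unit_def zmode_VL_single[OF assms] zterm_def lookup_add lookup_single)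
  have "Poly_Mapping.lookup (Poly_Mapping.lookup (zmode_VL (t_VL (VL_unit \<gamma> m))) \<gamma>) m =
      (\<Sum>\<beta>\<in>{l, - l}. if \<beta> - a \<gamma> = \<gamma> then phase (a \<gamma>) *
        Poly_Mapping.lookup (E_coeff 1 (- \<beta>) 0 (fock_act (\<lambda>x. - a x) (Poly_Mapping.single m 1))) m else 0)"
    using ne diag[of l "Poly_Mapping.single m 1"] diag[of "- l" "Poly_Mapping.single m 1"]
    by (simp add: VL_unit_def t_VL_single zmode_VL_single[OF neg\<gamma>] lookup_add)
  then show ?thesis
    by (simp add: linear_wrt_scale[OF linear_zmode_VL] linear_wrt_add[OF linear_zmode_VL] lookup_scale_VL
      lookup_fscale lookup_add first del: sum.insert)
qed

text \<open>Since t is -1 on T, the projection keeps exactly the monomials of odd size.\<close>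

lemma VT_diagonal:
  "Poly_Mapping.lookup (zmode_VT (scale_VT (1/2) (VT_unit i m + t_VT (VT_unit i m))) $ i) m =
    (1 - (-1) ^ size m) / 2 * twist_const * grepT G h $ i $ i *
      Poly_Mapping.lookup (zfock (Poly_Mapping.single m 1)) m"
proof -
  let ?s = "Poly_Mapping.single m 1 :: fock" and ?c = "(1 - (-1) ^ size m) / 2 :: complex"
  have "scale_VT (1/2) (VT_unit i m + t_VT (VT_unit i m)) $ j = (if j = i then fscale ?c ?s else 0)" for j
    by (auto simp: scale_VT_component t_VT_component VT_unit_def axis_def fock_sign_single
      fock_linear_0[OF fock_linear_sign] fscale_single single_diff[symmetric] diff_divide_distrib)
  then have "zmode_VT (scale_VT (1/2) (VT_unit i m + t_VT (VT_unit i m))) $ i =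
      fscale twist_const (\<Sum>j\<in>UNIV. if j = i then fscale (grepT G h $ i $ j) (zfock (fscale ?c ?s)) else 0)"
    unfolding zmode_VT_component
    by (intro arg_cong[of _ _ "fscale twist_const"] sum.cong refl) (simp add: fock_linear_0[OF fock_linear_zfock])
  then show ?thesis
    by (simp add: lookup_fscale fock_linear_fscale[OF fock_linear_zfock])
qed

text \<open>Every twisted mode has the odd weight 2 n + 1 in half units.\<close>

lemma twisted_size_parity: "(-1 :: complex) ^ size m = (-1) ^ twisted.degree_of m"
  by (induction m) (auto simp: power_add)

text \<open>Size and degree have the same parity, so passing from \<open>a\<close> to its negative
  multiplies degree D by (-1)^D. The difference of the two series is therefore twice the odd
  part.\<close>

lemma twisted_series_neg_nth: "fps_nth twisted_series_neg D = (-1) ^ D * fps_nth twisted_series D"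
proof -
  have "E_coeff (1/2) l 0 (fock_act (\<lambda>x. - a x) (Poly_Mapping.single m 1)) =
      fscale ((-1) ^ twisted.degree_of m) (E_coeff (1/2) l 0 (fock_act a (Poly_Mapping.single m 1)))" for m
  proof -
    have "fock_sign (Poly_Mapping.single m 1) = fscale ((-1) ^ twisted.degree_of m) (Poly_Mapping.single m 1)"
      by (simp add: fock_sign_single fscale_single twisted_size_parity)
    then show ?thesis
      by (simp only: fock_act_uminus[OF a_linear] fock_linear_fscale[OF fock_linear_act]
        fock_linear_fscale[OF twisted.fock_linear_E_coeff])
  qed
  then show ?thesis
    by (simp add: twisted_series_neg_def twisted_series_def twisted.ftrace_def lookup_fscale sum_distrib_left)
qed

text \<open>On the lattice side the 1/2 of the projection cancels against the equal contributions of
  l and -l. On the twisted side all degrees are odd, and twice an odd coefficient is the difference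
  of the two series. The guard n \<ge> 2 keeps 2 n - 3 a true subtraction.\<close>

theorem trace_coeff_eq:
  "trace_coeff \<Lambda> \<epsilon> eT G (v_of l) h n =
    (\<Sum>\<delta> | \<delta> \<in> neg_fixed \<and> level \<delta> \<le> n. phase \<alpha> * phase \<delta> * fps_nth untwisted_series (n - level \<delta>)) +
    (if n \<ge> 2 then trace (grepT G h) * twist_const *
       (fps_nth twisted_series (2 * n - 3) - fps_nth twisted_series_neg (2 * n - 3)) else 0)"
proof -
  let ?S = "\<Sum>\<delta> | \<delta> \<in> neg_fixed \<and> level \<delta> \<le> n. phase \<alpha> * phase \<delta> * fps_nth untwisted_series (n - level \<delta>)"
  let ?e = "\<lambda>\<beta> \<gamma> m. if \<beta> - a \<gamma> = \<gamma> then phase (a \<gamma>) *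
      Poly_Mapping.lookup (E_coeff 1 (- \<beta>) 0 (fock_act (\<lambda>x. - a x) (Poly_Mapping.single m 1))) m else 0"
  note ne = l_neq_minus_l
  have "trace_coeff \<Lambda> \<epsilon> eT G (v_of l) h n =
    (\<Sum>(\<gamma>, m)\<in>VL_index \<Lambda> n. Poly_Mapping.lookup (Poly_Mapping.lookup
       (zmode_VL (scale_VL (1/2) (VL_unit \<gamma> m + t_VL (VL_unit \<gamma> m)))) \<gamma>) m) +
    (\<Sum>(i, m)\<in>VT_index n. Poly_Mapping.lookup
       (zmode_VT (scale_VT (1/2) (VT_unit i m + t_VT (VT_unit i m))) $ i) m)"
    unfolding trace_coeff_def zero_mode_act
    by (rule trace_on_moonshine[OF leech linear_zmode_VL zmode_VL_weight t_zmode_VL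
      linear_zmode_VT zmode_VT_weight t_zmode_VT])
  also have "(\<Sum>(\<gamma>, m)\<in>VL_index \<Lambda> n. Poly_Mapping.lookup (Poly_Mapping.lookup
       (zmode_VL (scale_VL (1/2) (VL_unit \<gamma> m + t_VL (VL_unit \<gamma> m)))) \<gamma>) m) =
      (\<Sum>(\<gamma>, m)\<in>VL_index \<Lambda> n. 1/2 * (?e l \<gamma> m + ?e (- l) \<gamma> m))"
    using ne by (intro sum.cong refl) (auto simp: VL_diagonal VL_index_def simp del: minus_diff_eq)
  also have "\<dots> = 1/2 * ((\<Sum>(\<gamma>, m)\<in>VL_index \<Lambda> n. ?e l \<gamma> m) + (\<Sum>(\<gamma>, m)\<in>VL_index \<Lambda> n. ?e (- l) \<gamma> m))"
    by (simp only: sum.distrib[symmetric] sum_distrib_left case_prod_unfold)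
  also have "(\<Sum>(\<gamma>, m)\<in>VL_index \<Lambda> n. ?e l \<gamma> m) = ?S"
    by (rule VL_part[of _ \<alpha>]) (simp_all add: l)
  also have "(\<Sum>(\<gamma>, m)\<in>VL_index \<Lambda> n. ?e (- l) \<gamma> m) = ?S"
    by (rule VL_part[of _ "- \<alpha>"]) (simp_all add: l)
  also have "1/2 * (?S + ?S) = ?S" by simp
  also have "(\<Sum>(i, m)\<in>VT_index n. Poly_Mapping.lookup
       (zmode_VT (scale_VT (1/2) (VT_unit i m + t_VT (VT_unit i m))) $ i) m) =
      (if n \<ge> 2 then trace (grepT G h) * twist_const *
       (fps_nth twisted_series (2 * n - 3) - fps_nth twisted_series_neg (2 * n - 3)) else 0)"
  proof (cases "n \<ge> 2")
    case True
    let ?D = "2 * n - 3"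
    let ?M = "{m. twisted.degree_of m = ?D}"
    let ?z = "\<lambda>m. Poly_Mapping.lookup (zfock (Poly_Mapping.single m 1)) m"
    have index: "VT_index n = UNIV \<times> ?M" using True by (auto simp: VT_index_eq)
    have odd: "odd ?D" using True by simp
    have "(\<Sum>(i, m)\<in>VT_index n. Poly_Mapping.lookup
       (zmode_VT (scale_VT (1/2) (VT_unit i m + t_VT (VT_unit i m))) $ i) m) =
        (\<Sum>(i, m)\<in>UNIV \<times> ?M. grepT G h $ i $ i * (twist_const * ?z m))"
      unfolding index using odd
      by (intro sum.cong refl) (auto simp: VT_diagonal twisted_size_parity)
    also have "\<dots> = trace (grepT G h) * (twist_const * (\<Sum>m\<in>?M. ?z m))"
      by (simp only: trace_def sum_distrib_left[where r = twist_const] sum_product sum.cartesian_product)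
    also have "(\<Sum>m\<in>?M. ?z m) = fps_nth (twisted.ftrace (\<lambda>p. E_coeff (1/2) l 0 (fock_act a p)) +
        twisted.ftrace (\<lambda>p. E_coeff (1/2) (- l) 0 (fock_act a p))) ?D"
      by (simp add: twisted.ftrace_def zfock_def lookup_add sum.distrib)
    also have "\<dots> = fps_nth twisted_series ?D - fps_nth twisted_series_neg ?D"
      using odd by (simp add: neg_series twisted_series_neg_nth twisted_series_def[symmetric])
    finally show ?thesis using True by (simp add: mult.assoc)
  next
    case False
    then have "VT_index n = {}" by (auto simp: VT_index_eq)
    then show ?thesis using False by simp
  qed
  finally show ?thesis .
qed

end

section \<open>Generating functions\<close>

text \<open>A Cauchy product in which one factor is a sum over a set graded by \<open>lev\<close>:
  the pairs (x, d) are regrouped by n = d + lev x, which absolute convergence permits.\<close>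

lemma sums_level_convolution:
  fixes c :: "'a \<Rightarrow> complex" and f :: "nat \<Rightarrow> complex" and lev :: "'a \<Rightarrow> nat"
  assumes c: "(\<lambda>x. norm (c x * z ^ lev x)) summable_on A"
    and f: "(\<lambda>d. norm (f d * z ^ d)) summable_on UNIV" "(\<lambda>d. f d * z ^ d) sums s"
    and fin: "\<And>n. finite {x \<in> A. lev x \<le> n}"
  shows "(\<lambda>n. (\<Sum>x | x \<in> A \<and> lev x \<le> n. c x * f (n - lev x)) * z ^ n) sums
    (infsum (\<lambda>x. c x * z ^ lev x) A * s)"
proof -
  let ?c = "\<lambda>x. c x * z ^ lev x" and ?f = "\<lambda>d. f d * z ^ d"
  let ?g = "\<lambda>(x, d). ?c x * ?f d"
  let ?B = "Sigma UNIV (\<lambda>n. {x \<in> A. lev x \<le> n})"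
  let ?h = "\<lambda>(n, x). c x * f (n - lev x) * z ^ n"
  have g_abs: "(\<lambda>p. norm (?g p)) summable_on A \<times> UNIV"
    using abs_summable_on_times[OF c f(1)] by (simp only: case_prod_unfold)
  have s: "(?f has_sum s) UNIV"
    by (rule has_sum_from_sums[OF abs_summable_summable[OF f(1)] f(2)])
  have C: "(?c has_sum infsum ?c A) A"
    by (rule has_sum_infsum[OF abs_summable_summable[OF c]])
  have "(?g has_sum (infsum ?c A * s)) (A \<times> UNIV)"
  proof (rule has_sum_SigmaI)
    show "((\<lambda>d. ?g (x, d)) has_sum (?c x * s)) UNIV" for x
      unfolding case_prod_conv by (rule has_sum_cmult_right[OF s])
    show "((\<lambda>x. ?c x * s) has_sum (infsum ?c A * s)) A"
      by (rule has_sum_cmult_left[OF C])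
    show "?g summable_on A \<times> UNIV" by (rule abs_summable_summable[OF g_abs])
  qed
  moreover have "(?g has_sum (infsum ?c A * s)) (A \<times> UNIV) \<longleftrightarrow> (?h has_sum (infsum ?c A * s)) ?B"
    by (rule has_sum_reindex_bij_witness[of _ "\<lambda>(n, x). (x, n - lev x)" "\<lambda>(x, d). (d + lev x, x)"])
      (auto simp: power_add)
  ultimately have h: "(?h has_sum (infsum ?c A * s)) ?B" by blast
  have "((\<lambda>n. \<Sum>x | x \<in> A \<and> lev x \<le> n. ?h (n, x)) has_sum (infsum ?c A * s)) UNIV"
    by (rule has_sum_SigmaD[OF h]) (rule has_sum_finite[OF fin])
  then show ?thesis
    by (intro has_sum_imp_sums) (simp add: sum_distrib_right)
qed

lemma eta_prod_ratio:
  assumes "Im \<tau> > 0" and m: "frame_traces (matrix a) (frame_shape a)"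
  defines "y \<equiv> qpow \<tau> (1 / 2)"
  shows "eta_prod a \<tau> / eta_prod a (\<tau> / 2) = qpow \<tau> (1 / 2) *
    exp (\<Sum>k | frame_shape a k \<noteq> 0. of_int (frame_shape a k) * (euler_log (y ^ k) - euler_log (y ^ (2 * k))))"
proof -
  let ?m = "frame_shape a"
  have qy: "qpow \<tau> 1 = y ^ 2" by (simp add: y_def qpow_power)
  have 1: "eta_prod a \<tau> = qpow \<tau> (1 / 2) * qpow \<tau> (1 / 2) *
      exp (- (\<Sum>k | ?m k \<noteq> 0. of_int (?m k) * euler_log (y ^ (2 * k))))"
    using eta_prod_eq[OF assms(1) zero_less_one m] qpow_add[of \<tau> "1/2" "1/2"] by (simp add: qy power_mult)
  have 2: "eta_prod a (\<tau> / 2) = qpow \<tau> (1 / 2) *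
      exp (- (\<Sum>k | ?m k \<noteq> 0. of_int (?m k) * euler_log (y ^ k)))"
    using eta_prod_eq[OF assms(1) _ m, of "1/2"] by (simp add: y_def)
  show ?thesis
    unfolding 1 2 by (simp add: exp_minus exp_diff field_simps sum_subtractf right_diff_distrib)
qed

context moonshine_element
begin

lemma frame_traces_a:
  "frame_traces (matrix a) (frame_shape a)"
  "frame_traces (matrix (\<lambda>x. - a x)) (frame_shape (\<lambda>x. - a x))"
  using frame_shape_traces[OF leech a] frame_shape_traces[OF leech Aut_lattice_uminus[OF leech a]] .

text \<open>The weight of e^(\<alpha> + \<delta>) is (\<alpha> \<bullet> \<alpha>) / 2 + (\<delta>
  \<bullet> \<delta>) / 2. The first part leaves the sum and later becomes the leading power of
  \<open>Theta1\<close>; the second builds the theta function. Phases have norm 1, so absolute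
  convergence is that of a lattice theta series.\<close>

lemma untwisted_sums:
  assumes \<tau>: "Im \<tau> > 0"
  defines "m \<equiv> frame_shape (\<lambda>x. - a x)" and "q \<equiv> qpow \<tau> 1"
  shows "(\<lambda>n. (\<Sum>\<delta> | \<delta> \<in> neg_fixed \<and> level \<delta> \<le> n. phase \<alpha> * phase \<delta> * fps_nth untwisted_series (n - level \<delta>)) *
      qpow \<tau> (real n)) sums
    (phase \<alpha> * qpow \<tau> (\<alpha> \<bullet> \<alpha> / 2) * theta_mod \<Lambda> \<xi> (\<lambda>x. - a x) \<tau> *
      exp ((\<Sum>k | m k \<noteq> 0. of_int (m k) * euler_log (q ^ k)) +
        of_real (l \<bullet> l) * (euler_log q - 2 * euler_log (q ^ 2))))"
proof -
  have q: "norm q < 1" unfolding q_def by (rule norm_qpow_less_1[OF \<tau>]) simp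
  have qn: "qpow \<tau> (real n) = q ^ n" for n by (simp add: q_def qpow_power)
  have neg_l: "- a l = - l" by (simp add: a_l)
  note tr = untwisted_trace[OF neg_a_linear neg_l frame_traces_a(2), folded untwisted_series_def m_def]
  let ?c = "\<lambda>\<delta>. phase \<alpha> * phase \<delta> * q ^ level \<delta>"
  have c: "?c \<delta> = (phase \<alpha> * qpow \<tau> (\<alpha> \<bullet> \<alpha> / 2)) * (phase \<delta> * qpow \<tau> (\<delta> \<bullet> \<delta> / 2))"
    if "\<delta> \<in> neg_fixed" for \<delta>
  proof -
    have "\<delta> \<in> \<Lambda>" using that by (simp add: neg_fixed_def)
    then have "real (level \<delta>) = \<alpha> \<bullet> \<alpha> / 2 + \<delta> \<bullet> \<delta> / 2" by (simp add: level add_divide_distrib)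
    then show ?thesis by (simp add: qn[symmetric] qpow_add)
  qed
  have norm_phase: "norm (phase \<gamma>) = 1" for \<gamma> by (simp add: phase_def)
  have norm_c: "norm (phase \<alpha> * qpow \<tau> (\<alpha> \<bullet> \<alpha> / 2)) * exp (- (pi * Im \<tau>) * (\<delta> \<bullet> \<delta>)) = norm (?c \<delta>)"
    if "\<delta> \<in> neg_fixed" for \<delta>
    unfolding c[OF that] norm_mult norm_phase norm_qpow[of \<tau> "\<delta> \<bullet> \<delta> / 2"] by simp
  have "(\<lambda>\<delta>. exp (- (pi * Im \<tau>) * (\<delta> \<bullet> \<delta>))) summable_on neg_fixed"
    by (rule summable_on_subset[OF lattice_theta_summable[OF leech]]) (use \<tau> in \<open>auto simp: neg_fixed_def\<close>)
  then have "(\<lambda>\<delta>. norm (phase \<alpha> * qpow \<tau> (\<alpha> \<bullet> \<alpha> / 2)) * exp (- (pi * Im \<tau>) * (\<delta> \<bullet> \<delta>))) summable_on neg_fixed"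
    by (rule summable_on_cmult_right)
  then have abs: "(\<lambda>\<delta>. norm (?c \<delta>)) summable_on neg_fixed"
    by (rule summable_on_cong[THEN iffD1, rotated]) (rule norm_c)
  have "infsum ?c neg_fixed = infsum (\<lambda>\<delta>. (phase \<alpha> * qpow \<tau> (\<alpha> \<bullet> \<alpha> / 2)) * (phase \<delta> * qpow \<tau> (\<delta> \<bullet> \<delta> / 2))) neg_fixed"
    by (rule infsum_cong) (rule c)
  also have "\<dots> = phase \<alpha> * qpow \<tau> (\<alpha> \<bullet> \<alpha> / 2) * theta_mod \<Lambda> \<xi> (\<lambda>x. - a x) \<tau>"
    unfolding infsum_cmult_right' theta_mod_def neg_fixed_def phase_def ..
  finally have theta: "infsum ?c neg_fixed = phase \<alpha> * qpow \<tau> (\<alpha> \<bullet> \<alpha> / 2) * theta_mod \<Lambda> \<xi> (\<lambda>x. - a x) \<tau>" .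
  show ?thesis
    unfolding qn theta[symmetric]
    by (rule sums_level_convolution[OF abs power_series_abs_summable[OF sums_summable[OF tr] q] tr[OF q] finite_levels])
qed

text \<open>Only odd D survive; for D = 2 k + 1 and n = k + 2 one has q^n = q^(3/2) (q^(1/2))^D,
  whence the constant.\<close>

lemma twisted_sums:
  assumes "(\<lambda>D. fps_nth twisted_series D * qpow \<tau> (1 / 2) ^ D) sums s"
    and "(\<lambda>D. fps_nth twisted_series_neg D * qpow \<tau> (1 / 2) ^ D) sums t"
  shows "(\<lambda>n. (if n \<ge> 2 then c * (fps_nth twisted_series (2 * n - 3) - fps_nth twisted_series_neg (2 * n - 3))
      else 0) * qpow \<tau> (real n)) sums (c * qpow \<tau> (3 / 2) * (s - t))"
proof -
  let ?F = "\<lambda>D. (fps_nth twisted_series D - fps_nth twisted_series_neg D) * qpow \<tau> (1 / 2) ^ D"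
  let ?G = "\<lambda>n. (if n \<ge> 2 then c * (fps_nth twisted_series (2 * n - 3) - fps_nth twisted_series_neg (2 * n - 3))
      else 0) * qpow \<tau> (real n)"
  have "?F sums (s - t)" using sums_diff[OF assms] by (simp only: left_diff_distrib)
  moreover have "(\<lambda>k. ?F (2 * k + 1)) sums (s - t) \<longleftrightarrow> ?F sums (s - t)"
  proof (rule sums_mono_reindex)
    show "strict_mono (\<lambda>k :: nat. 2 * k + 1)" by (simp add: strict_mono_def)
    fix D :: nat assume D: "D \<notin> range (\<lambda>k. 2 * k + 1)"
    have "even D"
    proof (rule ccontr)
      assume "odd D"
      then obtain k where "D = 2 * k + 1" by (rule oddE)
      then show False using D by blast
    qed
    then show "?F D = 0" by (simp add: twisted_series_neg_nth)
  qed
  ultimately have "(\<lambda>k. ?F (2 * k + 1)) sums (s - t)" by blast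
  from sums_mult[OF this, of "c * qpow \<tau> (3 / 2)"]
  have *: "(\<lambda>k. c * qpow \<tau> (3 / 2) * ?F (2 * k + 1)) sums (c * qpow \<tau> (3 / 2) * (s - t))" .
  have "?G (k + 2) = c * qpow \<tau> (3 / 2) * ?F (2 * k + 1)" for k
  proof -
    have "2 * (k + 2) - 3 = 2 * k + 1" by simp
    moreover have "real (k + 2) = 3 / 2 + real (2 * k + 1) * (1 / 2)" by (simp add: field_simps)
    then have "qpow \<tau> (real (k + 2)) = qpow \<tau> (3 / 2) * qpow \<tau> (1 / 2) ^ (2 * k + 1)"
      by (simp only: qpow_add qpow_power)
    ultimately show ?thesis by (simp only: if_True le_add2 mult_ac)
  qed
  then have "(\<lambda>k. ?G (k + 2)) sums (c * qpow \<tau> (3 / 2) * (s - t))" using * by (simp only:)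
  then have "?G sums (c * qpow \<tau> (3 / 2) * (s - t) + (\<Sum>k<2. ?G k))" by (rule iffD1[OF sums_iff_shift])
  moreover have "(\<Sum>k<2. ?G k) = 0" by (intro sum.neutral ballI) simp
  ultimately show ?thesis by (simp only: add_0_right)
qed

lemma norm_l: "real (nat \<lfloor>l \<bullet> l\<rfloor>) = l \<bullet> l"
proof -
  obtain k where "l \<bullet> l = 2 * real k" using leech_lattice_even[OF leech l_mem] .
  then have "l \<bullet> l = real (2 * k)" by simp
  then show ?thesis by (simp only: floor_of_nat nat_int)
qed

lemma twist_const_eq: "twist_const = (1 / 2) ^ nat \<lfloor>l \<bullet> l\<rfloor>"
proof -
  define N where "N = nat \<lfloor>l \<bullet> l\<rfloor>"
  have "2 powr (- real N) = (1 / 2 :: real) ^ N"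
    by (simp add: powr_minus powr_realpow power_one_over inverse_eq_divide)
  then have "2 powr (- (l \<bullet> l)) = (1 / 2 :: real) ^ N" unfolding N_def norm_l .
  then show ?thesis by (simp add: twist_const_def N_def)
qed

text \<open>The leading powers match: the eta product of the negative of \<open>a\<close> starts
  with q and absorbs q^(-1), while q^(-1) q^(3/2) = q^(1/2) is the leading power of the quotients of
  eta products at \<tau> and \<tau> / 2.\<close>

theorem trace_sums:
  assumes \<tau>: "Im \<tau> > 0"
  defines "N \<equiv> nat \<lfloor>l \<bullet> l\<rfloor>"
  shows "(\<lambda>n. qpow \<tau> (-1) * (trace_coeff \<Lambda> \<epsilon> eT G (v_of l) h n * qpow \<tau> (real n))) sums
    (phase \<alpha> * (theta_mod \<Lambda> \<xi> (\<lambda>x. - a x) \<tau> / eta_prod (\<lambda>x. - a x) \<tau>) * (Theta1 \<tau> / 2) ^ N +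
      trace (grepT G h) *
        (eta_prod a \<tau> / eta_prod a (\<tau> / 2) * (Theta2 \<tau> / 2) ^ N -
         eta_prod (\<lambda>x. - a x) \<tau> / eta_prod (\<lambda>x. - a x) (\<tau> / 2) * (Theta3 \<tau> / 2) ^ N))"
proof -
  define y q where "y = qpow \<tau> (1 / 2)" and "q = qpow \<tau> 1"
  let ?neg = "\<lambda>x. - a x"
  have y: "norm y < 1" unfolding y_def by (rule norm_qpow_less_1[OF \<tau>]) simp
  have qy: "y ^ 2 = q" "y ^ 4 = q ^ 2" by (simp_all add: y_def q_def qpow_power)
  have N: "of_real (l \<bullet> l) = (of_nat N :: complex)"
    using of_real_of_nat_eq[of N, where ?'a = complex] unfolding N_def norm_l .
  have neg_l: "?neg l = - l" by (simp add: a_l)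
  define M where "M = (\<Sum>k | frame_shape ?neg k \<noteq> 0. of_int (frame_shape ?neg k) * euler_log (q ^ k))"
  define R where "R b = (\<Sum>k | frame_shape b k \<noteq> 0. of_int (frame_shape b k) * (euler_log (y ^ k) - euler_log (y ^ (2 * k))))"
    for b :: "R24 \<Rightarrow> R24"
  define E1 E2 E3 where "E1 = euler_log q - 2 * euler_log (q ^ 2)" and "E2 = euler_log q - 2 * euler_log y"
    and "E3 = 2 * euler_log y - 5 * euler_log q + 2 * euler_log (q ^ 2)"
  let ?U = "phase \<alpha> * qpow \<tau> (\<alpha> \<bullet> \<alpha> / 2) * theta_mod \<Lambda> \<xi> ?neg \<tau> * exp (M + of_nat N * E1)"
  let ?S = "exp (R a + of_nat N * E2)" and ?T = "exp (R ?neg + of_nat N * E3)"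
  let ?t = "trace (grepT G h)"
  have "(\<lambda>D. fps_nth twisted_series D * y ^ D) sums ?S"
    using twisted_trace_pos[OF a_linear a_l frame_traces_a(1) y]
    unfolding twisted_series_def[symmetric] qy N R_def E2_def .
  moreover have "(\<lambda>D. fps_nth twisted_series_neg D * y ^ D) sums ?T"
    using twisted_trace_neg[OF neg_a_linear neg_l frame_traces_a(2) y]
    unfolding twisted_series_neg_def[symmetric] qy N R_def E3_def .
  ultimately have tw: "(\<lambda>n. (if n \<ge> 2 then ?t * twist_const *
      (fps_nth twisted_series (2 * n - 3) - fps_nth twisted_series_neg (2 * n - 3)) else 0) * qpow \<tau> (real n)) sums
      (?t * twist_const * qpow \<tau> (3 / 2) * (?S - ?T))"
    unfolding y_def by (rule twisted_sums)
  have untw: "(\<lambda>n. (\<Sum>\<delta> | \<delta> \<in> neg_fixed \<and> level \<delta> \<le> n. phase \<alpha> * phase \<delta> *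
      fps_nth untwisted_series (n - level \<delta>)) * qpow \<tau> (real n)) sums ?U"
    using untwisted_sums[OF \<tau>] unfolding q_def[symmetric] N M_def E1_def .
  have "(\<lambda>n. trace_coeff \<Lambda> \<epsilon> eT G (v_of l) h n * qpow \<tau> (real n)) sums
      (?U + ?t * twist_const * qpow \<tau> (3 / 2) * (?S - ?T))"
    using sums_add[OF untw tw] unfolding trace_coeff_eq distrib_right .
  from sums_mult[OF this, of "qpow \<tau> (-1)"]
  have sums: "(\<lambda>n. qpow \<tau> (-1) * (trace_coeff \<Lambda> \<epsilon> eT G (v_of l) h n * qpow \<tau> (real n))) sums
      (qpow \<tau> (-1) * (?U + ?t * twist_const * qpow \<tau> (3 / 2) * (?S - ?T)))" .
  have inv: "qpow \<tau> (-1) = inverse (qpow \<tau> 1)"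
    using inverse_unique[of "qpow \<tau> 1" "qpow \<tau> (-1)"] qpow_add[of \<tau> 1 "-1"] by simp
  have half: "qpow \<tau> (-1) * qpow \<tau> (3 / 2) = qpow \<tau> (1 / 2)"
    by (simp add: qpow_add[symmetric])
  \<comment> \<open>\<open>Theta1\<close> contributes q^(1/8) for each of N = 4 (\<alpha> \<bullet>
    \<alpha>) factors.\<close>
  have level: "real N * (1 / 8) = \<alpha> \<bullet> \<alpha> / 2" unfolding N_def norm_l by (simp add: l)
  have T1: "(Theta1 \<tau> / 2) ^ N = qpow \<tau> (\<alpha> \<bullet> \<alpha> / 2) * exp (of_nat N * E1)"
    by (simp only: Theta_eqs(1)[OF \<tau>] y_def[symmetric] qy E1_def power_mult_distrib qpow_power exp_of_nat_mult level)
  have T2: "(Theta2 \<tau> / 2) ^ N = twist_const * exp (of_nat N * E2)"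
    unfolding Theta_eqs(2)[OF \<tau>] y_def[symmetric] qy E2_def[symmetric] exp_of_nat_mult twist_const_eq N_def[symmetric]
    by (simp add: power_divide)
  have T3: "(Theta3 \<tau> / 2) ^ N = twist_const * exp (of_nat N * E3)"
    unfolding Theta_eqs(3)[OF \<tau>] y_def[symmetric] qy E3_def[symmetric] exp_of_nat_mult twist_const_eq N_def[symmetric]
    by (simp add: power_divide)
  have eta: "eta_prod ?neg \<tau> = qpow \<tau> 1 * exp (- M)"
    using eta_prod_eq[OF \<tau> zero_less_one frame_traces_a(2)] by (simp add: M_def q_def)
  have A: "qpow \<tau> (-1) * ?U = phase \<alpha> * (theta_mod \<Lambda> \<xi> ?neg \<tau> / eta_prod ?neg \<tau>) * (Theta1 \<tau> / 2) ^ N"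
    unfolding inv T1 eta exp_add by (simp add: exp_minus field_simps)
  have B: "eta_prod a \<tau> / eta_prod a (\<tau> / 2) * (Theta2 \<tau> / 2) ^ N = qpow \<tau> (1 / 2) * twist_const * ?S"
    unfolding eta_prod_ratio[OF \<tau> frame_traces_a(1)] y_def[symmetric] R_def[symmetric] T2 exp_add
    by (simp only: mult_ac)
  have C: "eta_prod ?neg \<tau> / eta_prod ?neg (\<tau> / 2) * (Theta3 \<tau> / 2) ^ N = qpow \<tau> (1 / 2) * twist_const * ?T"
    unfolding eta_prod_ratio[OF \<tau> frame_traces_a(2)] y_def[symmetric] R_def[symmetric] T3 exp_add
    by (simp only: mult_ac)
  have "qpow \<tau> (-1) * (?U + ?t * twist_const * qpow \<tau> (3 / 2) * (?S - ?T)) =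
      qpow \<tau> (-1) * ?U + ?t * twist_const * (qpow \<tau> (-1) * qpow \<tau> (3 / 2)) * (?S - ?T)"
    by (simp only: distrib_left mult_ac)
  also have "\<dots> = phase \<alpha> * (theta_mod \<Lambda> \<xi> ?neg \<tau> / eta_prod ?neg \<tau>) * (Theta1 \<tau> / 2) ^ N +
      ?t * (qpow \<tau> (1 / 2) * twist_const * ?S - qpow \<tau> (1 / 2) * twist_const * ?T)"
    unfolding A half by (simp only: right_diff_distrib mult_ac)
  finally show ?thesis using sums by (simp only: B C)
qed

end

text \<open>The exponent l \<bullet> l is a nonnegative even integer, written as a natural number.
  Summability is part of the claim because \<open>suminf\<close> has a value even for a divergent
  series. The vector \<xi> represents a class modulo the lattice; by integrality the phases do not
  depend on the representative.\<close>

theorem theorem5p1: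
  fixes \<Lambda> :: "R24 set" and \<epsilon> :: "R24 \<Rightarrow> R24 \<Rightarrow> complex" and eT :: "R24 \<Rightarrow> opT"
    and G :: "'g hat_group" and h :: 'g and a :: "R24 \<Rightarrow> R24"
    and \<xi> \<alpha> l :: R24 and \<tau> :: complex
  assumes "hat_C \<Lambda> \<epsilon> eT G"
    and "l \<noteq> 0" and "\<alpha> \<in> \<Lambda>" and "l = 2 *\<^sub>R \<alpha>"
    and "h \<in> H_group G l"
    and "2 *\<^sub>R \<xi> \<in> \<Lambda>"
    and "a \<in> carrier (Aut_lattice \<Lambda>)" and "a l = l"
    and "associated \<Lambda> G h \<xi> a"
    and "Im \<tau> > 0"
  shows "summable (\<lambda>n. trace_coeff \<Lambda> \<epsilon> eT G (v_of l) h n * qpow \<tau> (real n)) \<and>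
    Z_trace \<Lambda> \<epsilon> eT G (v_of l) h \<tau> =
      exp (2 * of_real pi * \<i> * of_real (\<xi> \<bullet> \<alpha>)) *
        (theta_mod \<Lambda> \<xi> (\<lambda>x. - a x) \<tau> / eta_prod (\<lambda>x. - a x) \<tau>) *
        (Theta1 \<tau> / 2) ^ nat \<lfloor>l \<bullet> l\<rfloor> +
      trace (grepT G h) *
        (eta_prod a \<tau> / eta_prod a (\<tau> / 2) * (Theta2 \<tau> / 2) ^ nat \<lfloor>l \<bullet> l\<rfloor> -
         eta_prod (\<lambda>x. - a x) \<tau> / eta_prod (\<lambda>x. - a x) (\<tau> / 2) *
           (Theta3 \<tau> / 2) ^ nat \<lfloor>l \<bullet> l\<rfloor>)"
proof -
  interpret moonshine_element \<Lambda> \<epsilon> eT G h a \<xi> \<alpha> l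
    by (rule moonshine_element.intro) (fact assms)+
  note sums = trace_sums[OF assms(10)]
  have summable: "summable (\<lambda>n. trace_coeff \<Lambda> \<epsilon> eT G (v_of l) h n * qpow \<tau> (real n))"
    using sums_summable[OF sums] by (simp only: summable_cmult_iff qpow_nonzero simp_thms)
  then show ?thesis
    using sums_unique[OF sums] unfolding suminf_mult[OF summable] phase_def Z_trace_def by simp
qed

end
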